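(* (i) Suppose there exists a $\mathbb{Q}$-algebra isomorphism $\varphi:\mathcal{Z}_{\mathcal{A}}\to\overline{\mathcal{Z}}$ with $\varphi(\zeta_{\mathcal{A}}({\boldsymbol{k}}))=\zeta_{\mathcal{S}}({\boldsymbol{k}})$ for every positive index ${\boldsymbol{k}}$. Then for every index ${\boldsymbol{k}}\in\mathbb{Z}^r$ ($r\ge0$, entries arbitrary integers), $\zeta_{\mathcal{A}}({\boldsymbol{k}})\in\mathcal{Z}_{\mathcal{A}}$ and $\varphi(\zeta_{\mathcal{A}}({\boldsymbol{k}}))=\zeta_{\mathcal{S}}({\boldsymbol{k}})$. In particular, $\mathcal{A}$-MZVs and $\mathcal{S}$-MZVs of general indices satisfy the same $\mathbb{Q}$-linear relations. (ii) Suppose there exists a topological $\mathbb{Q}$-algebra isomorphism $\psi:\mathcal{Z}_{\widehat{\mathcal{A}}}\to\overline{\mathcal{Z}}[[t]]$ with $\psi({\boldsymbol{p}})=t$ and $\psi(\zeta_{\widehat{\mathcal{A}}}({\boldsymbol{k}}))=\zeta_{\widehat{\mathcal{S}}}({\boldsymbol{k}})$ for every positive index ${\boldsymbol{k}}$. Then for every index ${\boldsymbol{k}}\in\mathbb{Z}^r$, $\zeta_{\widehat{\mathcal{A}}}({\boldsymbol{k}})\in\mathcal{Z}_{\widehat{\mathcal{A}}}$ and $\psi(\zeta_{\widehat{\mathcal{A}}}({\boldsymbol{k}}))=\zeta_{\widehat{\mathcal{S}}}({\boldsymbol{k}})$. In particular, $\widehat{\mathcal{A}}$-MZVs and $\widehat{\mathcal{S}}$-MZVs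 of general indices satisfy the same $\mathbb{Q}$-linear relations.
   Context: An index is a tuple of integers ${\boldsymbol{k}}=(k_1,\dots,k_r)$, $r\ge0$; it is positive if all $k_i>0$ (the empty index is positive). For primes $p$, $\zeta_p({\boldsymbol{k}})=\sum_{0<n_1<\cdots<n_r<p}n_1^{-k_1}\cdots n_r^{-k_r}\in\mathbb{Z}_{(p)}$ (equal to $1$ for the empty index). $\mathcal{A}=(\prod_p\mathbb{Z}/p\mathbb{Z})/(\bigoplus_p\mathbb{Z}/p\mathbb{Z})$ and $\zeta_{\mathcal{A}}({\boldsymbol{k}})=(\zeta_p({\boldsymbol{k}})\bmod p)_p$; $\mathcal{Z}_{\mathcal{A}}$ is the $\mathbb{Q}$-subalgebra of $\mathcal{A}$ generated by $\zeta_{\mathcal{A}}({\boldsymbol{k}})$ for positive ${\boldsymbol{k}}$. $\widehat{\mathcal{A}}=\varprojlim_n[(\prod_p\mathbb{Z}/p^n\mathbb{Z})/(\bigoplus_p\mathbb{Z}/p^n\mathbb{Z})]$, $\zeta_{\widehat{\mathcal{A}}}({\boldsymbol{k}})=((\zeta_p({\boldsymbol{k}})\bmod p^n)_p)_n$, ${\boldsymbol{p}}=((p\bmod p^n)_p)_n$; $\widehat{\mathcal{A}}$ carries the ${\boldsymbol{p}}$-adic topology, and $\mathcal{Z}_{\widehat{\mathcal{A}}}$ is the closed $\mathbb{Q}$-subalgebra generated by ${\boldsymbol{p}}$ and $\zeta_{\widehat{\mathcal{A}}}({\boldsymbol{k}})$ for positive ${\boldsymbol{k}}$ (elements $\sum_{i\ge1}a_i\zeta_{\widehat{\mathcal{A}}}({\boldsymbol{k}}_i){\boldsymbol{p}}^{n_i}$,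 $a_i\in\mathbb{Q}$, ${\boldsymbol{k}}_i$ positive, $n_i\ge0$, $n_i\to\infty$). $\mathcal{Z}\subset\mathbb{R}$ is the $\mathbb{Q}$-algebra generated by multiple zeta values $\zeta(k_1,\dots,k_r)=\sum_{0<n_1<\cdots<n_r}n_1^{-k_1}\cdots n_r^{-k_r}$ ($k_i\ge1$, $k_r\ge2$); $\overline{\mathcal{Z}}=\mathcal{Z}/\pi^2\mathcal{Z}\cong\mathcal{Z}[\pi i]/\pi i\mathcal{Z}[\pi i]$; $\overline{\mathcal{Z}}[[t]]$ carries the $t$-adic topology. For $t\in\mathbb{C}\setminus[1,\infty)$, $\zeta(s_1,\dots,s_r;t)=\sum_{0<n_1<\cdots<n_r}\prod_j(n_j-t)^{-s_j}$ (principal branch), meromorphically continued from its region of absolute convergence to $\mathbb{C}^r$, $\zeta(\varnothing;t)=1$; for $t_+\in\mathbb{C}\setminus(-\infty,-1]$, $t_-\in\mathbb{C}\setminus[1,\infty)$, $\zeta_{\widehat{\mathcal{U}}}(s_1,\dots,s_r;t_+,t_-)=\sum_{i=0}^r e^{\pi i(s_{i+1}+\cdots+s_r)}\zeta(s_1,\dots,s_i;-t_+)\zeta(s_r,\dots,s_{i+1};t_-)$, known (Komori) to extend holomorphically, entire in ${\boldsymbol{s}}$. For an integer index ${\boldsymbol{k}}$: $\zeta_{\mathcal{S}}({\boldsymbol{k}})=\zeta_{\widehat{\mathcal{U}}}({\boldsymbol{k}};0,0)\bmod\pi i\mathcal{Z}[\pi i]\in\overline{\mathcal{Z}}$, and $\zeta_{\widehat{\mathcal{S}}}({\boldsymbol{k}})$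 is the Taylor expansion at $t=0$ of $\zeta_{\widehat{\mathcal{U}}}({\boldsymbol{k}};0,t)$ modulo $\pi i\mathcal{Z}[\pi i][[t]]$, an element of $\overline{\mathcal{Z}}[[t]]$ (these values lie in $\mathcal{Z}[\pi i]$, resp.\ $\mathcal{Z}[\pi i][[t]]$). *)

theory Defs
  imports "HOL-Complex_Analysis.Complex_Analysis"
    "HOL-Computational_Algebra.Formal_Power_Series"
    "HOL-Number_Theory.Cong"
begin

text \<open>Given the structure map ofr : Q -> R of a Q-algebra R, the Q-subalgebra
  generated by G is the smallest set containing G and the image of Q and closed
  under addition and multiplication (scalar multiplication by q is
  multiplication by ofr q).\<close>

inductive_set Qalg :: "(rat \<Rightarrow> 'a::{plus,times}) \<Rightarrow> 'a set \<Rightarrow> 'a set"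
  for ofr :: "rat \<Rightarrow> 'a" and G :: "'a set" where
  gen: "g \<in> G \<Longrightarrow> g \<in> Qalg ofr G"
| rat: "ofr q \<in> Qalg ofr G"
| add: "x \<in> Qalg ofr G \<Longrightarrow> y \<in> Qalg ofr G \<Longrightarrow> x + y \<in> Qalg ofr G"
| mult: "x \<in> Qalg ofr G \<Longrightarrow> y \<in> Qalg ofr G \<Longrightarrow> x * y \<in> Qalg ofr G"

definition incr_tuples :: "nat \<Rightarrow> nat \<Rightarrow> nat list set" where
  "incr_tuples r p = {ns. length ns = r \<and> sorted_wrt (<) ns \<and> (\<forall>n\<in>set ns. 0 < n \<and> n < p)}"

definition zeta_p :: "nat \<Rightarrow> int list \<Rightarrow> rat" where
  "zeta_p p k = (\<Sum>ns\<in>incr_tuples (length k) p.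
      \<Prod>j<length k. (of_nat (ns ! j)) powi (- (k ! j)))"

text \<open>Reduction of a rational number modulo m: a residue r with b*r = a (mod m)
  where a/b is the reduced fraction (well defined mod m when gcd(b,m)=1).\<close>
definition ratmod :: "rat \<Rightarrow> int \<Rightarrow> int" where
  "ratmod x m = (SOME r. [snd (quotient_of x) * r = fst (quotient_of x)] (mod m))"

definition positive_index :: "int list \<Rightarrow> bool" where
  "positive_index k \<longleftrightarrow> (\<forall>i\<in>set k. i > 0)"

section \<open>The ring A = (prod_p Z/pZ) / (sum_p Z/pZ)\<close>

definition eqA :: "(nat \<Rightarrow> int) \<Rightarrow> (nat \<Rightarrow> int) \<Rightarrow> bool" where
  "eqA f g \<longleftrightarrow> (\<forall>\<^sub>F p in sequentially. prime p \<longrightarrow> [f p = g p] (mod int p))"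

lemma equivp_eqA: "equivp eqA"
proof (rule equivpI)
  show "reflp eqA" unfolding reflp_def eqA_def by simp
  show "symp eqA" unfolding symp_def eqA_def
    by (auto elim!: eventually_mono simp: cong_sym_eq)
  show "transp eqA" unfolding transp_def
  proof (intro allI impI)
    fix x y z assume "eqA x y" "eqA y z"
    then have a: "\<forall>\<^sub>F p in sequentially. prime p \<longrightarrow> [x p = y p] (mod int p)"
      and b: "\<forall>\<^sub>F p in sequentially. prime p \<longrightarrow> [y p = z p] (mod int p)"
      unfolding eqA_def by auto
    show "eqA x z" unfolding eqA_def
      using eventually_conj[OF a b] by (rule eventually_mono) (auto intro: cong_trans)
  qed
qed

quotient_type ringA = "nat \<Rightarrow> int" / eqA
  by (rule equivp_eqA)

lemma eqA_pointwise: "(\<And>p. f p = g p) \<Longrightarrow> eqA f g"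
  unfolding eqA_def by simp

instantiation ringA :: comm_ring_1
begin
lift_definition zero_ringA :: ringA is "\<lambda>_. 0" .
lift_definition one_ringA :: ringA is "\<lambda>_. 1" .
lift_definition plus_ringA :: "ringA \<Rightarrow> ringA \<Rightarrow> ringA" is "\<lambda>f g p. f p + g p"
proof -
  fix f g h k assume a: "eqA f g" and b: "eqA h k"
  show "eqA (\<lambda>p. f p + h p) (\<lambda>p. g p + k p)" using a b unfolding eqA_def
    by - (rule eventually_elim2, assumption, assumption, auto intro: cong_add)
qed
lift_definition minus_ringA :: "ringA \<Rightarrow> ringA \<Rightarrow> ringA" is "\<lambda>f g p. f p - g p"
proof -
  fix f g h k assume a: "eqA f g" and b: "eqA h k"
  show "eqA (\<lambda>p. f p - h p) (\<lambda>p. g p - k p)" using a b unfolding eqA_def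
    by - (rule eventually_elim2, assumption, assumption, auto intro: cong_diff)
qed
lift_definition uminus_ringA :: "ringA \<Rightarrow> ringA" is "\<lambda>f p. - f p"
  unfolding eqA_def by (auto elim!: eventually_mono intro: cong_minus_minus_iff[THEN iffD2])
lift_definition times_ringA :: "ringA \<Rightarrow> ringA \<Rightarrow> ringA" is "\<lambda>f g p. f p * g p"
proof -
  fix f g h k assume a: "eqA f g" and b: "eqA h k"
  show "eqA (\<lambda>p. f p * h p) (\<lambda>p. g p * k p)" using a b unfolding eqA_def
    by - (rule eventually_elim2, assumption, assumption, auto intro: cong_mult)
qed
instance
proof
  show "(0::ringA) \<noteq> 1"
  proof transfer
    show "\<not> eqA (\<lambda>_. 0) (\<lambda>_. 1)"
    proof
      assume "eqA (\<lambda>_. 0) (\<lambda>_. 1)"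
      then have "\<exists>N. \<forall>p\<ge>N. prime p \<longrightarrow> [0 = 1] (mod int p)"
        unfolding eqA_def eventually_sequentially .
      then obtain N where N: "\<forall>p\<ge>N. prime p \<longrightarrow> [0 = 1] (mod int p)" by blast
      obtain p where p: "prime p" "N < p" using bigger_prime[of N] by blast
      then have "[0 = 1] (mod int p)" using N by simp
      moreover have "int p > 1" using prime_gt_1_nat[OF p(1)] by simp
      ultimately show False by (simp add: cong_def)
    qed
  qed
qed (transfer; auto intro!: eqA_pointwise simp: algebra_simps)+
end

definition ratA :: "rat \<Rightarrow> ringA" where
  "ratA q = abs_ringA (\<lambda>p. ratmod q (int p))"

definition zetaA :: "int list \<Rightarrow> ringA" where
  "zetaA k = abs_ringA (\<lambda>p. ratmod (zeta_p p k) (int p))"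

definition ZA :: "ringA set" where
  "ZA = Qalg ratA {zetaA k | k. positive_index k}"

section \<open>The ring A-hat = lim_n (prod_p Z/p^nZ)/(sum_p Z/p^nZ)\<close>

text \<open>Representatives are families x n p (level n, prime p) with x n p read modulo p^n.
  Two families are identified when, at every level n, they agree modulo p^n for all
  but finitely many primes p.  The inverse limit consists of the classes of
  compatible families (see \<open>Ahat\<close> below).\<close>

definition eqAh :: "(nat \<Rightarrow> nat \<Rightarrow> int) \<Rightarrow> (nat \<Rightarrow> nat \<Rightarrow> int) \<Rightarrow> bool" where
  "eqAh x y \<longleftrightarrow> (\<forall>n. \<forall>\<^sub>F p in sequentially. prime p \<longrightarrow> [x n p = y n p] (mod int p ^ n))"

lemma equivp_eqAh: "equivp eqAh"
proof (rule equivpI)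
  show "reflp eqAh" unfolding reflp_def eqAh_def by simp
  show "symp eqAh" unfolding symp_def eqAh_def
    by (auto elim!: eventually_mono simp: cong_sym_eq)
  show "transp eqAh" unfolding transp_def eqAh_def
  proof (intro allI impI)
    fix x y z n
    assume "(\<forall>n. \<forall>\<^sub>F p in sequentially. prime p \<longrightarrow> [x n p = y n p] (mod int p ^ n))"
            "(\<forall>n. \<forall>\<^sub>F p in sequentially. prime p \<longrightarrow> [y n p = z n p] (mod int p ^ n))"
    then have "\<forall>\<^sub>F p in sequentially. prime p \<longrightarrow> [x n p = y n p] (mod int p ^ n)"
      "\<forall>\<^sub>F p in sequentially. prime p \<longrightarrow> [y n p = z n p] (mod int p ^ n)" by auto
    then have "\<forall>\<^sub>F p in sequentially. (prime p \<longrightarrow> [x n p = y n p] (mod int p ^ n)) \<and>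
      (prime p \<longrightarrow> [y n p = z n p] (mod int p ^ n))" by (rule eventually_conj)
    then show "\<forall>\<^sub>F p in sequentially. prime p \<longrightarrow> [x n p = z n p] (mod int p ^ n)"
      by (rule eventually_mono) (auto intro: cong_trans)
  qed
qed

quotient_type ringAh = "nat \<Rightarrow> nat \<Rightarrow> int" / eqAh
  by (rule equivp_eqAh)

lemma eqAh_pointwise: "(\<And>n p. x n p = y n p) \<Longrightarrow> eqAh x y"
  unfolding eqAh_def by simp

instantiation ringAh :: comm_ring
begin
lift_definition zero_ringAh :: ringAh is "\<lambda>_ _. 0" .
lift_definition plus_ringAh :: "ringAh \<Rightarrow> ringAh \<Rightarrow> ringAh" is "\<lambda>x y n p. x n p + y n p"
proof -
  fix f g h k assume a: "eqAh f g" and b: "eqAh h k"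
  show "eqAh (\<lambda>n p. f n p + h n p) (\<lambda>n p. g n p + k n p)" unfolding eqAh_def
  proof
    fix n
    from a b have "\<forall>\<^sub>F p in sequentially. prime p \<longrightarrow> [f n p = g n p] (mod int p ^ n)"
      "\<forall>\<^sub>F p in sequentially. prime p \<longrightarrow> [h n p = k n p] (mod int p ^ n)"
      unfolding eqAh_def by auto
    then show "\<forall>\<^sub>F p in sequentially. prime p \<longrightarrow> [f n p + h n p = g n p + k n p] (mod int p ^ n)"
      by - (rule eventually_elim2, assumption, assumption, auto intro: cong_add)
  qed
qed
lift_definition minus_ringAh :: "ringAh \<Rightarrow> ringAh \<Rightarrow> ringAh" is "\<lambda>x y n p. x n p - y n p"
proof -
  fix f g h k assume a: "eqAh f g" and b: "eqAh h k"
  show "eqAh (\<lambda>n p. f n p - h n p) (\<lambda>n p. g n p - k n p)" unfolding eqAh_def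
  proof
    fix n
    from a b have "\<forall>\<^sub>F p in sequentially. prime p \<longrightarrow> [f n p = g n p] (mod int p ^ n)"
      "\<forall>\<^sub>F p in sequentially. prime p \<longrightarrow> [h n p = k n p] (mod int p ^ n)"
      unfolding eqAh_def by auto
    then show "\<forall>\<^sub>F p in sequentially. prime p \<longrightarrow> [f n p - h n p = g n p - k n p] (mod int p ^ n)"
      by - (rule eventually_elim2, assumption, assumption, auto intro: cong_diff)
  qed
qed
lift_definition uminus_ringAh :: "ringAh \<Rightarrow> ringAh" is "\<lambda>x n p. - x n p"
  unfolding eqAh_def by (auto elim!: eventually_mono intro: cong_minus_minus_iff[THEN iffD2])
lift_definition times_ringAh :: "ringAh \<Rightarrow> ringAh \<Rightarrow> ringAh" is "\<lambda>x y n p. x n p * y n p"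
proof -
  fix f g h k assume a: "eqAh f g" and b: "eqAh h k"
  show "eqAh (\<lambda>n p. f n p * h n p) (\<lambda>n p. g n p * k n p)" unfolding eqAh_def
  proof
    fix n
    from a b have "\<forall>\<^sub>F p in sequentially. prime p \<longrightarrow> [f n p = g n p] (mod int p ^ n)"
      "\<forall>\<^sub>F p in sequentially. prime p \<longrightarrow> [h n p = k n p] (mod int p ^ n)"
      unfolding eqAh_def by auto
    then show "\<forall>\<^sub>F p in sequentially. prime p \<longrightarrow> [f n p * h n p = g n p * k n p] (mod int p ^ n)"
      by - (rule eventually_elim2, assumption, assumption, auto intro: cong_mult)
  qed
qed
instance
  by standard (transfer; auto intro!: eqAh_pointwise simp: algebra_simps)+
end

instantiation ringAh :: comm_monoid_mult
begin
lift_definition one_ringAh :: ringAh is "\<lambda>_ _. 1" .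
instance
  by standard (transfer; auto intro!: eqAh_pointwise simp: algebra_simps)
end

definition compatible :: "(nat \<Rightarrow> nat \<Rightarrow> int) \<Rightarrow> bool" where
  "compatible x \<longleftrightarrow> (\<forall>n. \<forall>\<^sub>F p in sequentially. prime p \<longrightarrow> [x (Suc n) p = x n p] (mod int p ^ n))"

definition Ahat :: "ringAh set" where
  "Ahat = {abs_ringAh x | x. compatible x}"

definition bp :: ringAh where
  "bp = abs_ringAh (\<lambda>n p. int p)"

definition ratAh :: "rat \<Rightarrow> ringAh" where
  "ratAh q = abs_ringAh (\<lambda>n p. ratmod q (int p ^ n))"

definition zetaAh :: "int list \<Rightarrow> ringAh" where
  "zetaAh k = abs_ringAh (\<lambda>n p. ratmod (zeta_p p k) (int p ^ n))"

definition padic_top :: "ringAh topology" where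
  "padic_top = topology_generated_by {{x + bp ^ N * z | z. z \<in> Ahat} | x N. x \<in> Ahat}"

definition ZAh :: "ringAh set" where
  "ZAh = padic_top closure_of Qalg ratAh ({bp} \<union> {zetaAh k | k. positive_index k})"

definition pos_incr_tuples :: "nat \<Rightarrow> nat list set" where
  "pos_incr_tuples r = {ns. length ns = r \<and> sorted_wrt (<) ns \<and> (\<forall>n\<in>set ns. 0 < n)}"

definition admissible :: "nat list \<Rightarrow> bool" where
  "admissible k \<longleftrightarrow> (\<forall>i\<in>set k. i \<ge> 1) \<and> (k \<noteq> [] \<longrightarrow> last k \<ge> 2)"

definition mzv :: "nat list \<Rightarrow> real" where
  "mzv k = (\<Sum>\<^sub>\<infinity>ns\<in>pos_incr_tuples (length k). \<Prod>j<length k. 1 / real (ns ! j) ^ (k ! j))"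

definition Zmzv :: "real set" where
  "Zmzv = Qalg of_rat {mzv k | k. admissible k}"

definition ZPi :: "complex set" where
  "ZPi = Qalg of_rat (complex_of_real ` Zmzv \<union> {complex_of_real pi * \<i>})"

definition IPi :: "complex set" where
  "IPi = {complex_of_real pi * \<i> * z | z. z \<in> ZPi}"

lemma ZPi_rat [simp]: "of_rat q \<in> ZPi"
  unfolding ZPi_def by (rule Qalg.rat)
lemma ZPi_0 [simp]: "0 \<in> ZPi" using ZPi_rat[of 0] by simp
lemma ZPi_1 [simp]: "1 \<in> ZPi" using ZPi_rat[of 1] by simp
lemma ZPi_add [simp]: "x \<in> ZPi \<Longrightarrow> y \<in> ZPi \<Longrightarrow> x + y \<in> ZPi"
  unfolding ZPi_def by (rule Qalg.add)
lemma ZPi_mult [simp]: "x \<in> ZPi \<Longrightarrow> y \<in> ZPi \<Longrightarrow> x * y \<in> ZPi"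
  unfolding ZPi_def by (rule Qalg.mult)
lemma ZPi_uminus [simp]: "x \<in> ZPi \<Longrightarrow> - x \<in> ZPi"
  using ZPi_mult[OF ZPi_rat[of "-1"], of x] by simp
lemma ZPi_diff [simp]: "x \<in> ZPi \<Longrightarrow> y \<in> ZPi \<Longrightarrow> x - y \<in> ZPi"
  using ZPi_add[of x "- y"] by simp

lemma IPi_0 [simp]: "0 \<in> IPi" unfolding IPi_def by (auto intro!: exI[of _ 0])
lemma IPi_add: "a \<in> IPi \<Longrightarrow> b \<in> IPi \<Longrightarrow> a + b \<in> IPi"
proof -
  assume "a \<in> IPi" "b \<in> IPi"
  then obtain z w where "z \<in> ZPi" "w \<in> ZPi" "a = complex_of_real pi * \<i> * z"
    "b = complex_of_real pi * \<i> * w" unfolding IPi_def by blast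
  then have "a + b = complex_of_real pi * \<i> * (z + w)" "z + w \<in> ZPi"
    by (simp_all add: algebra_simps)
  then show ?thesis unfolding IPi_def by blast
qed
lemma IPi_uminus: "a \<in> IPi \<Longrightarrow> - a \<in> IPi"
proof -
  assume "a \<in> IPi"
  then obtain z where "z \<in> ZPi" "a = complex_of_real pi * \<i> * z" unfolding IPi_def by blast
  then have "- a = complex_of_real pi * \<i> * (- z)" "- z \<in> ZPi" by simp_all
  then show ?thesis unfolding IPi_def by blast
qed
lemma IPi_multl: "x \<in> ZPi \<Longrightarrow> a \<in> IPi \<Longrightarrow> x * a \<in> IPi"
proof -
  assume "x \<in> ZPi" "a \<in> IPi"
  then obtain z where "z \<in> ZPi" "a = complex_of_real pi * \<i> * z" unfolding IPi_def by blast
  then have "x * a = complex_of_real pi * \<i> * (x * z)" "x * z \<in> ZPi"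
    using \<open>x \<in> ZPi\<close> by (simp_all add: algebra_simps)
  then show ?thesis unfolding IPi_def by blast
qed

definition Rz :: "complex \<Rightarrow> complex \<Rightarrow> bool" where
  "Rz x y \<longleftrightarrow> x \<in> ZPi \<and> y \<in> ZPi \<and> x - y \<in> IPi"

lemma part_equivp_Rz: "part_equivp Rz"
proof (rule part_equivpI)
  show "\<exists>x. Rz x x" by (auto simp: Rz_def intro!: exI[of _ 0])
  show "symp Rz" unfolding symp_def Rz_def
    using IPi_uminus by (metis minus_diff_eq)
  show "transp Rz" unfolding transp_def Rz_def
    using IPi_add by (metis diff_add_cancel add_diff_eq diff_diff_eq2 add.commute)
qed

text \<open>Z-bar = Z / pi^2 Z, realised (as in the paper) as Z[pi i] / pi i Z[pi i].\<close>
quotient_type zbar = complex / partial: Rz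
  by (rule part_equivp_Rz)

lemma Rz_eqI: "x \<in> ZPi \<Longrightarrow> x = y \<Longrightarrow> Rz x y"
  by (simp add: Rz_def)

instantiation zbar :: comm_ring
begin
lift_definition zero_zbar :: zbar is "0" by (simp add: Rz_def)
lift_definition plus_zbar :: "zbar \<Rightarrow> zbar \<Rightarrow> zbar" is "(+)"
proof -
  fix a b c d assume "Rz a b" "Rz c d"
  then show "Rz (a + c) (b + d)" unfolding Rz_def
    using IPi_add[of "a - b" "c - d"] by (simp add: algebra_simps)
qed
lift_definition uminus_zbar :: "zbar \<Rightarrow> zbar" is "uminus"
proof -
  fix a b assume "Rz a b"
  then show "Rz (- a) (- b)" unfolding Rz_def
    using IPi_uminus[of "a - b"] by (simp add: algebra_simps)
qed
lift_definition minus_zbar :: "zbar \<Rightarrow> zbar \<Rightarrow> zbar" is "(-)"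
proof -
  fix a b c d assume "Rz a b" "Rz c d"
  then show "Rz (a - c) (b - d)" unfolding Rz_def
    using IPi_add[of "a - b" "- (c - d)"] IPi_uminus[of "c - d"] by (simp add: algebra_simps)
qed
lift_definition times_zbar :: "zbar \<Rightarrow> zbar \<Rightarrow> zbar" is "(*)"
proof -
  fix a b c d assume "Rz a b" "Rz c d"
  then have "a * (c - d) \<in> IPi" "d * (a - b) \<in> IPi" unfolding Rz_def
    by (auto intro: IPi_multl)
  then have "a * (c - d) + d * (a - b) \<in> IPi" by (rule IPi_add)
  then show "Rz (a * c) (b * d)" using \<open>Rz a b\<close> \<open>Rz c d\<close> unfolding Rz_def
    by (simp add: algebra_simps)
qed
instance
  by standard (transfer; auto simp: Rz_def algebra_simps)+
end

instantiation zbar :: comm_monoid_mult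
begin
lift_definition one_zbar :: zbar is "1" by (simp add: Rz_def)
instance
  by standard (transfer; auto simp: Rz_def algebra_simps)
end

definition ratZ :: "rat \<Rightarrow> zbar" where
  "ratZ q = abs_zbar (of_rat q)"

definition hzeta :: "complex list \<Rightarrow> complex \<Rightarrow> complex" where
  "hzeta s t = (\<Sum>\<^sub>\<infinity>ns\<in>pos_incr_tuples (length s).
      \<Prod>j<length s. (of_nat (ns ! j) - t) powr (- (s ! j)))"

definition zetaU_series :: "complex list \<Rightarrow> complex \<Rightarrow> complex \<Rightarrow> complex" where
  "zetaU_series s tp tm = (\<Sum>i\<le>length s.
      exp (complex_of_real pi * \<i> * sum_list (drop i s)) * hzeta (take i s) (- tp) * hzeta (rev (drop i s)) tm)"

definition sep_entire :: "nat \<Rightarrow> (complex list \<Rightarrow> complex) \<Rightarrow> bool" where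
  "sep_entire r F \<longleftrightarrow> (\<forall>u. length u = r \<longrightarrow> (\<forall>j<r. (\<lambda>z. F (u[j := z])) holomorphic_on UNIV))"

text \<open>zeta_U(s; t_+, t_-): the value at s of the entire extension (Komori) of the
  series expression, which converges absolutely where all Re s_j > 1.\<close>
definition zetaU :: "complex list \<Rightarrow> complex \<Rightarrow> complex \<Rightarrow> complex" where
  "zetaU s tp tm = (THE w. \<exists>F. sep_entire (length s) F \<and>
      (\<forall>u. length u = length s \<and> (\<forall>j<length u. Re (u ! j) > 1) \<longrightarrow> F u = zetaU_series u tp tm) \<and>
      F s = w)"

definition zetaS :: "int list \<Rightarrow> zbar" where
  "zetaS k = abs_zbar (zetaU (map of_int k) 0 0)"

definition zetaShat :: "int list \<Rightarrow> zbar fps" where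
  "zetaShat k = Abs_fps (\<lambda>n. abs_zbar ((deriv ^^ n) (\<lambda>t. zetaU (map of_int k) 0 t) 0 / fact n))"

definition tadic_top :: "zbar fps topology" where
  "tadic_top = topology_generated_by {{g. \<forall>n<N. fps_nth g n = fps_nth f n} | f N. True}"

end

theory Submission imports Defs "HOL-Computational_Algebra.Fundamental_Theorem_Algebra"
begin

text \<open>Let an index have an entry - m.  Since n^m = Q(n + 1) - Q(n) for a polynomial Q with rational
  coefficients, summation by parts expresses zeta_p of the index through shorter indices, in which an
  entry next to the removed one is lowered; if - m is the last entry, the upper end contributes the
  factor Q(p).  The entire function zetaU satisfies the same identity with t in place of p.  As the
  isomorphisms respect these identities, induction on the length reduces the theorem to positive
  indices.

  The identity for zetaU, and the fact that its Taylor coefficients lie in Z[pi i], require an explicit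
  form of the analytic continuation.  The series for zetaU consists of products of sums over positive n
  and sums over t - n.  The latter have asymptotic expansions in w = log z, holomorphic on a half strip
  that joins the two branches of the logarithm; carrying them along the strip to the positive side
  cancels the divergences, and the resulting limit is entire in s.  At positive indices
  the expansions are essentially polynomials in w, so the limit is a combination of multiple harmonic
  sums in which, by the stuffle product, only multiple zeta values and powers of pi i survive.\<close>

text \<open>For small real t the truncated series of \<open>zetaU\<close> is a sum over increasing
  chains in the order 1 < ... < N < t - N < ... < t - 1. The sum \<open>zeta_p\<close> runs over
  chains in 1 < ... < p - 1, the same kind of order without a gap; hence p and t enter the recursion
  in the same way. The obstacle is the gap: telescoping across it leaves P (t - N) - P (N + 1),
  which diverges, while outside the region Re s > 1 the definition of \<open>zetaU\<close> offers
  nothing but an entire function that agrees with the series in that region. Continuing factor by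
  factor is no way out, since the single multiple Hurwitz zeta functions have poles. The expansion
  of the left sums solves its difference equation on the whole strip, so the gap contributes the
  difference of two values of one holomorphic function, and at an entry - m this supplies exactly
  the cancelling term. The estimates are generous by design: K only has to be large compared with
  the number and the size of the entries, and the identity theorem removes the dependence on K and
  on the base point \<open>w0\<close>.\<close>

section \<open>Symbols on half strips\<close>

text \<open>In the coordinate w = log z these convex half strips contain both log n and
  log (n - t) - pi i, the logarithms that carry the two kinds of sums in zetaU.  They shrink with m
  so that the map w -> log (z + 1) carries each into the previous one.\<close>

definition lstrip :: "nat \<Rightarrow> complex set" where
  "lstrip m = {w. real m + 2 < Re w \<and> - pi - (1/2)^m < Im w \<and> Im w < (1/2)^m}"

lemma open_lstrip: "open (lstrip m)"
proof -
  have "lstrip m = {w. real m + 2 < Re w} \<inter> {w. - pi - (1/2)^m < Im w} \<inter> {w. Im w < (1/2)^m}"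
    by (auto simp: lstrip_def)
  then show ?thesis
    by (simp add: open_Int open_halfspace_Re_gt open_halfspace_Im_gt open_halfspace_Im_lt)
qed

lemma convex_lstrip: "convex (lstrip m)"
proof -
  have "lstrip m = {w. real m + 2 < Re w} \<inter> {w. - pi - (1/2)^m < Im w} \<inter> {w. Im w < (1/2)^m}"
    by (auto simp: lstrip_def)
  then show ?thesis
    by (simp add: convex_Int convex_halfspace_Re_gt convex_halfspace_Im_gt convex_halfspace_Im_lt)
qed

lemma lstrip_mono: "m \<le> n \<Longrightarrow> lstrip n \<subseteq> lstrip m"
proof -
  assume "m \<le> n"
  then have "(1/2::real)^n \<le> (1/2)^m" by (rule power_decreasing) auto
  moreover have "real m \<le> real n" using \<open>m \<le> n\<close> by simp
  ultimately show ?thesis unfolding lstrip_def by (intro subsetI CollectI) (elim CollectE, linarith)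
qed

lemma lstrip_Re_pos: "w \<in> lstrip m \<Longrightarrow> Re w > 2"
  unfolding lstrip_def by auto

lemma lstrip_Im: "w \<in> lstrip m \<Longrightarrow> \<bar>Im w\<bar> \<le> 5"
proof -
  assume w: "w \<in> lstrip m"
  have "(1/2::real)^m \<le> 1" by (rule power_le_one) auto
  then show ?thesis using w pi_less_4 unfolding lstrip_def by auto
qed

text \<open>The radius is (1/2)^m - (1/2)^(Suc m), the amount by which the strip narrows from one
  level to the next. It serves as the radius of Cauchy estimates and as the room that
  \<open>shiftw\<close> needs.\<close>

lemma ball_lstrip:
  assumes "w \<in> lstrip (Suc m)" shows "cball w ((1/2)^(Suc m)) \<subseteq> lstrip m"
proof
  fix v assume "v \<in> cball w ((1/2)^(Suc m))"
  then have n: "norm (w - v) \<le> (1/2)^(Suc m)" by (simp add: dist_norm)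
  have a: "\<bar>Re w - Re v\<bar> \<le> (1/2)^(Suc m)" "\<bar>Im w - Im v\<bar> \<le> (1/2)^(Suc m)"
    using n abs_Re_le_cmod[of "w - v"] abs_Im_le_cmod[of "w - v"] by auto
  have "(1/2::real)^(Suc m) \<le> 1" by (rule power_le_one) auto
  moreover have "(1/2::real)^m = (1/2)^(Suc m) + (1/2)^(Suc m)" by simp
  ultimately show "v \<in> lstrip m" using a assms unfolding lstrip_def mem_Collect_eq of_nat_Suc by linarith
qed

text \<open>The shift z + 1 in the coordinate w = log z.\<close>

definition shiftw :: "complex \<Rightarrow> complex" where
  "shiftw w = w + Ln (1 + exp (- w))"

text \<open>This links the two ways in which the strips shrink: Re w > m + 3 on
  \<open>lstrip (Suc m)\<close> makes the displacement bound 2 exp (- Re w) of \<open>shiftw\<close>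
  at most the margin by which the strip narrows.\<close>

lemma exp_le_half_power:
  "2 * exp (- (real m + 3)) \<le> (1/2::real)^(Suc m)"
proof -
  have e: "(2::real) \<le> exp 1" using exp_ge_add_one_self[of 1] by simp
  have "(2::real)^(m+3) \<le> (exp 1)^(m+3)" using e by (intro power_mono) auto
  also have "\<dots> = exp (real m + 3)" by (simp add: exp_of_nat_mult[symmetric])
  finally have a: "(2::real)^(m+3) \<le> exp (real m + 3)" .
  have "2 * exp (- (real m + 3)) = 2 / exp (real m + 3)" unfolding exp_minus by (simp only: divide_inverse)
  also have "\<dots> \<le> 2 / 2^(m+3)" using a by (intro divide_left_mono) auto
  also have "\<dots> \<le> (1/2)^(Suc m)" by (simp add: power_add power_one_over field_simps)
  finally show ?thesis .
qed

lemma shiftw_props: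
  assumes "w \<in> lstrip (Suc m)"
  shows "norm (shiftw w - w) \<le> 2 * exp (- Re w)"
    and "norm (shiftw w - w) \<le> 1"
    and "shiftw w \<in> lstrip m"
    and "exp (shiftw w) = exp w + 1"
    and "shiftw holomorphic_on (lstrip (Suc m))"
proof -
  have small: "norm (exp (- v)) < 1/2" and bd: "2 * exp (- Re v) \<le> (1/2)^(Suc m)" if "v \<in> lstrip (Suc m)" for v
  proof -
    have "Re v > real m + 3" using that unfolding lstrip_def by auto
    then have "2 * exp (- Re v) < 2 * exp (- (real m + 3))" by simp
    also have "\<dots> \<le> (1/2::real)^(Suc m)" by (rule exp_le_half_power)
    finally have a: "2 * exp (- Re v) < (1/2)^(Suc m)" .
    then show "2 * exp (- Re v) \<le> (1/2)^(Suc m)" by simp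
    have "(1/2::real)^(Suc m) \<le> 1" by (rule power_le_one) auto
    then show "norm (exp (- v)) < 1/2" using a by simp
  qed
  show 1: "norm (shiftw w - w) \<le> 2 * exp (- Re w)"
    using norm_Ln_le[OF small[OF assms]] unfolding shiftw_def by simp
  show 2: "norm (shiftw w - w) \<le> 1"
  proof -
    have "(1/2::real)^(Suc m) \<le> 1" by (rule power_le_one) auto
    then show ?thesis using 1 bd[OF assms] by linarith
  qed
  show "shiftw w \<in> lstrip m"
    using ball_lstrip[OF assms] 1 bd[OF assms] by (auto simp: dist_norm norm_minus_commute)
  have nz: "1 + exp (- v) \<notin> \<real>\<^sub>\<le>\<^sub>0" if "v \<in> lstrip (Suc m)" for v
  proof -
    have "Re (1 + exp (-v)) > 0" using small[OF that] abs_Re_le_cmod[of "exp (-v)"] by auto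
    then show ?thesis by (auto simp: complex_nonpos_Reals_iff)
  qed
  then have "1 + exp (- w) \<noteq> 0" using assms by fastforce
  then have "exp (shiftw w) = exp w * (1 + exp (- w))" unfolding shiftw_def by (simp add: exp_add)
  also have "\<dots> = exp w + 1" by (simp add: algebra_simps exp_minus)
  finally show "exp (shiftw w) = exp w + 1" .
  show "shiftw holomorphic_on (lstrip (Suc m))"
    unfolding shiftw_def using nz by (intro holomorphic_intros) auto
qed

lemma shiftw_holomorphic: "shiftw holomorphic_on (lstrip (Suc m))"
proof -
  have "(\<exists>w. w \<in> lstrip (Suc m)) \<or> lstrip (Suc m) = {}" by blast
  then show ?thesis using shiftw_props(5) holomorphic_on_empty by metis
qed

text \<open>Symbols of order B: families of functions of w = log z, holomorphic in a parameter,
  that are O(|z|^B) uniformly in the parameter.  The flag H asks for holomorphy in the parameter.\<close>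

definition symb :: "bool \<Rightarrow> complex set \<Rightarrow> nat \<Rightarrow> real \<Rightarrow> (complex \<Rightarrow> complex \<Rightarrow> complex) \<Rightarrow> bool" where
  "symb H S m B f \<longleftrightarrow> (\<forall>x\<in>S. f x holomorphic_on lstrip m) \<and>
     (H \<longrightarrow> (\<forall>w\<in>lstrip m. (\<lambda>x. f x w) holomorphic_on S)) \<and>
     (\<exists>C. \<forall>x\<in>S. \<forall>w\<in>lstrip m. norm (f x w) \<le> C * exp (B * Re w))"

lemma symb_bound:
  assumes "symb H S m B f"
  obtains C where "C > 0" "\<And>x w. x \<in> S \<Longrightarrow> w \<in> lstrip m \<Longrightarrow> norm (f x w) \<le> C * exp (B * Re w)"
proof -
  obtain C where C: "\<forall>x\<in>S. \<forall>w\<in>lstrip m. norm (f x w) \<le> C * exp (B * Re w)"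
    using assms unfolding symb_def by blast
  have "norm (f x w) \<le> (\<bar>C\<bar>+1) * exp (B * Re w)" if "x \<in> S" "w \<in> lstrip m" for x w
  proof -
    have "norm (f x w) \<le> C * exp (B * Re w)" using C that by blast
    also have "\<dots> \<le> (\<bar>C\<bar>+1) * exp (B * Re w)" by (intro mult_right_mono) auto
    finally show ?thesis .
  qed
  then show ?thesis using that[of "\<bar>C\<bar>+1"] by force
qed

lemma symb_mono:
  assumes "symb H S m B f" "m \<le> n" "B \<le> B'"
  shows "symb H S n B' f"
proof -
  obtain C where C: "C > 0" "\<And>x w. x \<in> S \<Longrightarrow> w \<in> lstrip m \<Longrightarrow> norm (f x w) \<le> C * exp (B * Re w)"
    using symb_bound[OF assms(1)] by blast
  have sub: "lstrip n \<subseteq> lstrip m" using assms by (intro lstrip_mono)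
  have "norm (f x w) \<le> C * exp (B' * Re w)" if "x \<in> S" "w \<in> lstrip n" for x w
  proof -
    have "norm (f x w) \<le> C * exp (B * Re w)" using C that sub by blast
    also have "\<dots> \<le> C * exp (B' * Re w)" using C assms lstrip_Re_pos[OF that(2)]
      by (intro mult_left_mono) auto
    finally show ?thesis .
  qed
  then show ?thesis using assms sub unfolding symb_def
    by (meson holomorphic_on_subset subsetD)
qed

lemma symb_cong:
  assumes "symb H S m B f" "\<And>x w. x \<in> S \<Longrightarrow> w \<in> lstrip m \<Longrightarrow> f x w = g x w"
  shows "symb H S m B g"
proof -
  obtain C where C: "C > 0" "\<And>x w. x \<in> S \<Longrightarrow> w \<in> lstrip m \<Longrightarrow> norm (f x w) \<le> C * exp (B * Re w)"
    using symb_bound[OF assms(1)] by blast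
  have "g x holomorphic_on lstrip m" if "x \<in> S" for x
    using assms that holomorphic_cong[of "lstrip m" "lstrip m" "f x" "g x"] unfolding symb_def by auto
  moreover have "(\<lambda>x. g x w) holomorphic_on S" if "w \<in> lstrip m" H for w
    using assms that holomorphic_cong[of S S "\<lambda>x. f x w" "\<lambda>x. g x w"] unfolding symb_def by auto
  moreover have "norm (g x w) \<le> C * exp (B * Re w)" if "x \<in> S" "w \<in> lstrip m" for x w
    using C(2)[OF that] assms(2)[OF that] by simp
  ultimately show ?thesis unfolding symb_def by blast
qed

lemma symb_add:
  assumes "symb H S m B f" "symb H S m B g"
  shows "symb H S m B (\<lambda>x w. f x w + g x w)"
proof -
  obtain C where C: "C > 0" "\<And>x w. x \<in> S \<Longrightarrow> w \<in> lstrip m \<Longrightarrow> norm (f x w) \<le> C * exp (B * Re w)"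
    using symb_bound[OF assms(1)] by blast
  obtain D where D: "D > 0" "\<And>x w. x \<in> S \<Longrightarrow> w \<in> lstrip m \<Longrightarrow> norm (g x w) \<le> D * exp (B * Re w)"
    using symb_bound[OF assms(2)] by blast
  have "norm (f x w + g x w) \<le> (C + D) * exp (B * Re w)" if "x \<in> S" "w \<in> lstrip m" for x w
    using norm_triangle_ineq[of "f x w" "g x w"] C(2)[OF that] D(2)[OF that] by (simp add: algebra_simps)
  then show ?thesis using assms unfolding symb_def by (auto intro!: holomorphic_intros)
qed

lemma symb_mult:
  assumes "symb H S m B f" "symb H S m B' g"
  shows "symb H S m (B + B') (\<lambda>x w. f x w * g x w)"
proof -
  obtain C where C: "C > 0" "\<And>x w. x \<in> S \<Longrightarrow> w \<in> lstrip m \<Longrightarrow> norm (f x w) \<le> C * exp (B * Re w)"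
    using symb_bound[OF assms(1)] by blast
  obtain D where D: "D > 0" "\<And>x w. x \<in> S \<Longrightarrow> w \<in> lstrip m \<Longrightarrow> norm (g x w) \<le> D * exp (B' * Re w)"
    using symb_bound[OF assms(2)] by blast
  have "norm (f x w * g x w) \<le> (C * D) * exp ((B + B') * Re w)" if "x \<in> S" "w \<in> lstrip m" for x w
  proof -
    have "norm (f x w * g x w) \<le> (C * exp (B * Re w)) * (D * exp (B' * Re w))"
      unfolding norm_mult using C(2)[OF that] D(2)[OF that] C(1) by (intro mult_mono) auto
    also have "\<dots> = (C * D) * exp ((B + B') * Re w)" by (simp add: exp_add algebra_simps)
    finally show ?thesis .
  qed
  then show ?thesis using assms unfolding symb_def by (auto intro!: holomorphic_intros)
qed

lemma symb_const:
  assumes "H \<Longrightarrow> c holomorphic_on S" "\<And>x. x \<in> S \<Longrightarrow> norm (c x) \<le> C" "B \<ge> 0"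
  shows "symb H S m B (\<lambda>x w. c x)"
proof -
  have "norm (c x) \<le> \<bar>C\<bar> * exp (B * Re w)" if "x \<in> S" "w \<in> lstrip m" for x w
  proof -
    have "norm (c x) \<le> \<bar>C\<bar> * 1" using assms(2)[OF that(1)] by simp
    also have "\<dots> \<le> \<bar>C\<bar> * exp (B * Re w)"
      using assms(3) lstrip_Re_pos[OF that(2)] by (intro mult_left_mono) auto
    finally show ?thesis .
  qed
  then show ?thesis using assms(1) unfolding symb_def by (auto intro!: holomorphic_intros)
qed

lemma symb_cmult: "symb H S m B f \<Longrightarrow> symb H S m B (\<lambda>x w. a * f x w)"
  using symb_mult[of H S m 0 "\<lambda>x w. a" B f] symb_const[of H "\<lambda>x. a" S "norm a" 0 m] by simp

lemma symb_diff: "symb H S m B f \<Longrightarrow> symb H S m B g \<Longrightarrow> symb H S m B (\<lambda>x w. f x w - g x w)"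
  using symb_add[of H S m B f "\<lambda>x w. (-1) * g x w"] symb_cmult[of H S m B g "-1"] by simp

lemma symb_sum:
  assumes "finite I" "\<And>i. i \<in> I \<Longrightarrow> symb H S m B (f i)"
  shows "symb H S m B (\<lambda>x w. \<Sum>i\<in>I. f i x w)"
  using assms
proof (induction I rule: finite_induct)
  case empty
  have "symb H S m B (\<lambda>x w. 0)" unfolding symb_def by (auto intro!: exI[of _ 0])
  then show ?case by simp
next
  case (insert i I)
  then show ?case by (simp add: symb_add)
qed

text \<open>On the strip \<open>Im w\<close> is bounded by 5, so \<open>Im (c x)\<close> contributes
  only a constant factor and the real part alone decides the order.\<close>

lemma symb_exp:
  assumes "H \<Longrightarrow> c holomorphic_on S" "\<And>x. x \<in> S \<Longrightarrow> norm (c x) \<le> M" "\<And>x. x \<in> S \<Longrightarrow> a \<le> Re (c x)"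
  shows "symb H S m (- a) (\<lambda>x w. exp (- c x * w))"
proof -
  have "norm (exp (- c x * w)) \<le> exp (5 * \<bar>M\<bar>) * exp (- a * Re w)" if "x \<in> S" "w \<in> lstrip m" for x w
  proof -
    have "\<bar>Im (c x)\<bar> \<le> \<bar>M\<bar>" using assms(2)[OF that(1)] abs_Im_le_cmod[of "c x"] by linarith
    then have "\<bar>Im (c x)\<bar> * \<bar>Im w\<bar> \<le> \<bar>M\<bar> * 5" using lstrip_Im[OF that(2)] by (intro mult_mono) auto
    then have 1: "Im (c x) * Im w \<le> 5 * \<bar>M\<bar>" by (simp add: abs_mult[symmetric])
    have 2: "a * Re w \<le> Re (c x) * Re w" using assms(3)[OF that(1)] lstrip_Re_pos[OF that(2)]
      by (intro mult_right_mono) auto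
    have "norm (exp (- c x * w)) = exp (- (Re (c x) * Re w) + Im (c x) * Im w)" by simp
    also have "\<dots> \<le> exp (5 * \<bar>M\<bar> + - a * Re w)" using 1 2 by simp
    also have "\<dots> = exp (5 * \<bar>M\<bar>) * exp (- a * Re w)" by (rule exp_add)
    finally show ?thesis .
  qed
  then show ?thesis using assms(1) unfolding symb_def by (auto intro!: holomorphic_intros)
qed

section \<open>Shifts, derivatives and primitives of symbols\<close>

lemma exp_shift_bound:
  assumes "\<bar>a - b\<bar> \<le> 1" shows "exp (B * a) \<le> exp \<bar>B\<bar> * exp (B * (b::real))"
proof -
  have "B * (a - b) \<le> \<bar>B\<bar> * \<bar>a - b\<bar>" by (metis abs_ge_self abs_mult)
  also have "\<dots> \<le> \<bar>B\<bar> * 1" using assms by (intro mult_left_mono) auto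
  finally have "B * a \<le> \<bar>B\<bar> + B * b" by (simp add: algebra_simps)
  then show ?thesis by (simp add: exp_add[symmetric])
qed

lemma symb_shift:
  assumes "symb H S m B f"
  shows "symb H S (Suc m) B (\<lambda>x w. f x (shiftw w))"
proof -
  obtain C where C: "C > 0" "\<And>x w. x \<in> S \<Longrightarrow> w \<in> lstrip m \<Longrightarrow> norm (f x w) \<le> C * exp (B * Re w)"
    using symb_bound[OF assms(1)] by blast
  have "norm (f x (shiftw w)) \<le> (C * exp \<bar>B\<bar>) * exp (B * Re w)" if "x \<in> S" "w \<in> lstrip (Suc m)" for x w
  proof -
    have "\<bar>Re (shiftw w) - Re w\<bar> \<le> 1"
      using shiftw_props(2)[OF that(2)] abs_Re_le_cmod[of "shiftw w - w"] by simp
    then have "exp (B * Re (shiftw w)) \<le> exp \<bar>B\<bar> * exp (B * Re w)" by (rule exp_shift_bound)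
    moreover have "norm (f x (shiftw w)) \<le> C * exp (B * Re (shiftw w))"
      using C(2)[OF that(1)] shiftw_props(3)[OF that(2)] by blast
    ultimately show ?thesis using C(1)
      by (metis (no_types, lifting) mult.assoc mult_left_mono less_imp_le order_trans)
  qed
  moreover have "(\<lambda>w. f x (shiftw w)) holomorphic_on lstrip (Suc m)" if "x \<in> S" for x
  proof -
    have "f x \<circ> shiftw holomorphic_on lstrip (Suc m)"
    proof (rule holomorphic_on_compose_gen[where t = "lstrip m"])
      show "shiftw holomorphic_on lstrip (Suc m)"
        by (rule shiftw_holomorphic)
      show "f x holomorphic_on lstrip m" using assms that unfolding symb_def by auto
      show "shiftw ` lstrip (Suc m) \<subseteq> lstrip m" by (intro image_subsetI shiftw_props(3))
    qed
    then show ?thesis unfolding o_def .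
  qed
  ultimately show ?thesis using assms shiftw_props(3) unfolding symb_def by blast
qed

text \<open>Cauchy estimates on discs of a fixed radius: differentiation in w is z d/dz, so it costs
  a level but no order.\<close>

lemma symb_deriv_bound:
  assumes "symb H S m B f"
  obtains C where "C > 0"
    "\<And>x w. x \<in> S \<Longrightarrow> w \<in> lstrip (Suc m) \<Longrightarrow> norm (deriv (f x) w) \<le> C * exp (B * Re w)"
proof -
  obtain C where C: "C > 0" "\<And>x w. x \<in> S \<Longrightarrow> w \<in> lstrip m \<Longrightarrow> norm (f x w) \<le> C * exp (B * Re w)"
    using symb_bound[OF assms(1)] by blast
  define r where "r = (1/2::real)^(Suc m)"
  have r: "0 < r" "r \<le> 1" unfolding r_def by (simp, rule power_le_one) auto
  have "norm (deriv (f x) w) \<le> (C * exp \<bar>B\<bar> / r) * exp (B * Re w)"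
    if x: "x \<in> S" and w: "w \<in> lstrip (Suc m)" for x w
  proof -
    have sub: "cball w r \<subseteq> lstrip m" using ball_lstrip[OF w] unfolding r_def .
    have hol: "f x holomorphic_on lstrip m" using assms x unfolding symb_def by blast
    have "norm ((deriv ^^ 1) (f x) w) \<le> fact 1 * (C * exp \<bar>B\<bar> * exp (B * Re w)) / r ^ 1"
    proof (rule Cauchy_inequality)
      show "f x holomorphic_on ball w r" using hol sub ball_subset_cball holomorphic_on_subset by blast
      show "continuous_on (cball w r) (f x)"
        using hol sub holomorphic_on_imp_continuous_on holomorphic_on_subset by blast
      fix v assume v: "norm (w - v) = r"
      then have "v \<in> lstrip m" using sub by (auto simp: dist_norm)
      then have "norm (f x v) \<le> C * exp (B * Re v)" using C x by blast
      also have "\<dots> \<le> C * (exp \<bar>B\<bar> * exp (B * Re w))"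
        using v r C(1) abs_Re_le_cmod[of "w - v"] by (intro mult_left_mono exp_shift_bound) auto
      finally show "norm (f x v) \<le> C * exp \<bar>B\<bar> * exp (B * Re w)" by (simp add: mult.assoc)
    qed (use r in auto)
    then show ?thesis by simp
  qed
  then show ?thesis using that[of "C * exp \<bar>B\<bar> / r"] C r by simp
qed

text \<open>The weight \<open>exp v\<close> is the Jacobian of z = exp v: this is integration in z,
  written in the coordinate w.\<close>

definition prim :: "complex \<Rightarrow> (complex \<Rightarrow> complex) \<Rightarrow> complex \<Rightarrow> complex" where
  "prim w0 g w = contour_integral (linepath w0 w) (\<lambda>v. g v * exp v)"

lemma prim_deriv:
  assumes "g holomorphic_on lstrip m" "w0 \<in> lstrip m" "w \<in> lstrip m"
  shows "(prim w0 g has_field_derivative g w * exp w) (at w)"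
proof -
  have hol: "(\<lambda>v. g v * exp v) holomorphic_on lstrip m" using assms by (intro holomorphic_intros)
  obtain G where G: "\<And>x. x \<in> lstrip m \<Longrightarrow> (G has_field_derivative g x * exp x) (at x within lstrip m)"
    using holomorphic_convex_primitive'[OF convex_lstrip open_lstrip hol] by blast
  have "prim w0 g v = G v - G w0" if v: "v \<in> lstrip m" for v
  proof -
    have sub: "path_image (linepath w0 v) \<subseteq> lstrip m"
      using convex_lstrip[of m] assms(2) v by (simp add: closed_segment_subset)
    show ?thesis unfolding prim_def
      using contour_integral_unique[OF contour_integral_primitive[OF G valid_path_linepath sub]]
      by simp
  qed
  moreover have "((\<lambda>v. G v - G w0) has_field_derivative g w * exp w) (at w)"
    using G[OF assms(3)] at_within_open[OF assms(3) open_lstrip] by (auto intro!: derivative_eq_intros)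
  ultimately show ?thesis
    using has_field_derivative_transform_within_open[of "\<lambda>v. G v - G w0" _ w "lstrip m" "prim w0 g"] open_lstrip assms(3) by simp
qed

lemma bounded_holomorphic_lipschitz:
  assumes "f holomorphic_on ball z r" "\<And>w. w \<in> ball z r \<Longrightarrow> norm (f w) \<le> C" "norm (w - z) < r / 2" "r > 0"
  shows "norm (f w - f z) \<le> (2 * C / r) * norm (w - z)"
proof (rule field_differentiable_bound[of "ball z (r/2)" f "deriv f"])
  fix v assume v: "v \<in> ball z (r/2)"
  have sub: "cball v (r / 2) \<subseteq> ball z r"
  proof
    fix u assume "u \<in> cball v (r/2)"
    then show "u \<in> ball z r" using v dist_triangle[of z u v] by (auto simp: dist_commute)
  qed
  have "f field_differentiable at v" using assms(1,4) v
    by (intro holomorphic_on_imp_differentiable_at[of f "ball z r"]) auto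
  then show "(f has_field_derivative deriv f v) (at v within ball z (r / 2))"
    using DERIV_deriv_iff_field_differentiable has_field_derivative_at_within by blast
  have "norm ((deriv ^^ 1) f v) \<le> fact 1 * C / (r/2) ^ 1"
  proof (rule Cauchy_inequality)
    show "f holomorphic_on ball v (r/2)" using assms(1) sub ball_subset_cball holomorphic_on_subset by blast
    show "continuous_on (cball v (r/2)) f"
      using assms(1) sub holomorphic_on_imp_continuous_on holomorphic_on_subset by blast
    show "norm (f x) \<le> C" if "norm (v - x) = r/2" for x
      using assms(2) sub that by (auto simp: dist_norm)
  qed (use assms in auto)
  then show "norm (deriv f v) \<le> 2 * C / r" by (simp add: field_simps)
qed (use assms in \<open>auto simp: dist_norm norm_minus_commute\<close>)

text \<open>The bound of a symbol is uniform, so Cauchy estimates in the parameter give a Lipschitz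
  constant that serves all w near a given point; continuity in w at a fixed parameter does the rest.
  The exchange of integrals in \<open>prim_holomorphic_param\<close> depends on it.\<close>

lemma symb_jointly_continuous:
  assumes "symb True S m B f" "open S"
  shows "continuous_on (S \<times> lstrip m) (\<lambda>y. f (fst y) (snd y))"
proof -
  obtain C where C: "C > 0" "\<And>x w. x \<in> S \<Longrightarrow> w \<in> lstrip m \<Longrightarrow> norm (f x w) \<le> C * exp (B * Re w)"
    using symb_bound[OF assms(1)] by blast
  have "isCont (\<lambda>y. f (fst y) (snd y)) y" if y: "y \<in> S \<times> lstrip m" for y
  proof -
    obtain x w where xw: "y = (x, w)" "x \<in> S" "w \<in> lstrip m" using y by auto
    obtain r where r: "r > 0" "ball x r \<subseteq> S" using assms(2) xw openE by blast
    define D where "D = C * exp \<bar>B\<bar> * exp (B * Re w)"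
    have cont: "isCont (f x) w"
      using assms(1) xw open_lstrip unfolding symb_def
      by (meson continuous_on_eq_continuous_at holomorphic_on_imp_continuous_on)
    have ev1: "\<forall>\<^sub>F u in nhds y. fst u \<in> ball x (r/2)"
      by (rule eventually_nhds[THEN iffD2, OF exI[of _ "ball x (r/2) \<times> UNIV"]]) (use r xw in \<open>auto intro!: open_Times\<close>)
    have ev2: "\<forall>\<^sub>F u in nhds y. snd u \<in> lstrip m \<inter> ball w 1"
      by (rule eventually_nhds[THEN iffD2, OF exI[of _ "UNIV \<times> (lstrip m \<inter> ball w 1)"]])
         (use xw open_lstrip in \<open>auto intro!: open_Times open_Int\<close>)
    have t1: "((\<lambda>u. (2 * D / r) * norm (fst u - x) + norm (f x (snd u) - f x w)) \<longlongrightarrow> 0) (at y)"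
    proof -
      have "((\<lambda>u. f x (snd u)) \<longlongrightarrow> f x w) (at y)"
        using isCont_tendsto_compose[OF cont] xw tendsto_snd[OF tendsto_ident_at, of y UNIV] by simp
      then have "((\<lambda>u. (2 * D / r) * norm (fst u - x) + norm (f x (snd u) - f x w)) \<longlongrightarrow> (2*D/r) * norm (x - x) + norm (f x w - f x w)) (at y)"
        using xw tendsto_fst[OF tendsto_ident_at, of y UNIV] by (intro tendsto_intros) auto
      then show ?thesis by simp
    qed
    have "((\<lambda>u. f (fst u) (snd u) - f x w) \<longlongrightarrow> 0) (at y)"
    proof (rule Lim_null_comparison[OF _ t1])
      have "\<forall>\<^sub>F u in nhds y. norm (f (fst u) (snd u) - f x w) \<le> (2 * D / r) * norm (fst u - x) + norm (f x (snd u) - f x w)"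
        using ev1 ev2
      proof eventually_elim
        case (elim u)
        have "norm (f (fst u) (snd u) - f x (snd u)) \<le> (2 * D / r) * norm (fst u - x)"
        proof (rule bounded_holomorphic_lipschitz)
          show "(\<lambda>v. f v (snd u)) holomorphic_on ball x r"
            using assms(1) elim r unfolding symb_def using holomorphic_on_subset by blast
          fix v assume v: "v \<in> ball x r"
          have "norm (f v (snd u)) \<le> C * exp (B * Re (snd u))" using C elim v r by blast
          also have "\<dots> \<le> C * (exp \<bar>B\<bar> * exp (B * Re w))"
            using elim C(1) abs_Re_le_cmod[of "snd u - w"]
            by (intro mult_left_mono exp_shift_bound) (auto simp: dist_norm norm_minus_commute)
          finally show "norm (f v (snd u)) \<le> D" unfolding D_def by (simp add: mult.assoc)
        qed (use elim r in \<open>auto simp: dist_norm norm_minus_commute\<close>)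
        moreover have "norm (f (fst u) (snd u) - f x w) \<le> norm (f (fst u) (snd u) - f x (snd u)) + norm (f x (snd u) - f x w)"
          using norm_triangle_ineq[of "f (fst u) (snd u) - f x (snd u)" "f x (snd u) - f x w"] by simp
        ultimately show ?case by linarith
      qed
      then show "\<forall>\<^sub>F u in at y. norm (f (fst u) (snd u) - f x w) \<le> (2 * D / r) * norm (fst u - x) + norm (f x (snd u) - f x w)"
        using eventually_nhds_conv_at by blast
    qed
    then show ?thesis unfolding isCont_def using xw by (simp add: LIM_zero_iff)
  qed
  then show ?thesis by (meson continuous_at_imp_continuous_on)
qed

lemma continuous_on_contour_integral_linepath:
  assumes "continuous_on (K \<times> closed_segment p q) (\<lambda>(y, x). h y x)"
  shows "continuous_on K (\<lambda>y. contour_integral (linepath p q) (h y))"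
proof -
  have jc': "continuous_on (K \<times> cbox 0 (1::real)) (\<lambda>(y, t). h y (linepath p q t) * (q - p))"
  proof -
    have "continuous_on (K \<times> cbox 0 (1::real)) ((\<lambda>(y,x). h y x) \<circ> (\<lambda>y. (fst y, linepath p q (snd y))))"
    proof (rule continuous_on_compose)
      show "continuous_on (K \<times> cbox 0 (1::real)) (\<lambda>y. (fst y, linepath p q (snd y)))"
        unfolding linepath_def by (intro continuous_intros)
      show "continuous_on ((\<lambda>y. (fst y, linepath p q (snd y))) ` (K \<times> cbox 0 (1::real))) (\<lambda>(y,x). h y x)"
        by (rule continuous_on_subset[OF assms]) (auto intro!: linepath_in_path)
    qed
    then show ?thesis by (auto simp: case_prod_beta o_def intro!: continuous_intros)
  qed
  have eq: "contour_integral (linepath p q) (h y) = integral (cbox 0 1) (\<lambda>t. h y (linepath p q t) * (q - p))" for y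
    unfolding contour_integral_integral by simp
  show ?thesis unfolding eq by (rule integral_continuous_on_param[OF jc'])
qed

text \<open>Morera's theorem: the integral over a triangle of parameters moves inside the integral
  from \<open>w0\<close> to w, where the integrand is holomorphic in the parameter.\<close>

lemma prim_holomorphic_param:
  assumes sy: "symb True S m B f" and S: "open S" and w: "w0 \<in> lstrip m" "w \<in> lstrip m"
  shows "(\<lambda>x. prim w0 (f x) w) holomorphic_on S"
proof -
  have segL: "closed_segment w0 w \<subseteq> lstrip m"
    using w convex_lstrip by (simp add: closed_segment_subset)
  have jc: "continuous_on (S \<times> closed_segment w0 w) (\<lambda>(x,v). f x v * exp v)"
    using continuous_on_subset[OF symb_jointly_continuous[OF sy S], of "S \<times> closed_segment w0 w"] segL
    unfolding case_prod_beta by (intro continuous_intros) auto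
  have contS: "continuous_on S (\<lambda>x. prim w0 (f x) w)"
    unfolding prim_def by (rule continuous_on_contour_integral_linepath[OF jc])
  have "(\<lambda>x. prim w0 (f x) w) analytic_on S"
  proof (rule Morera_triangle[OF contS S], intro impI)
    fix a b c assume hull: "convex hull {a, b, c} \<subseteq> S"
    have swap: "contour_integral (linepath p q) (\<lambda>x. prim w0 (f x) w) =
        contour_integral (linepath w0 w) (\<lambda>v. contour_integral (linepath p q) (\<lambda>x. f x v * exp v))"
      if "p \<in> {a,b,c}" "q \<in> {a,b,c}" for p q
    proof -
      have pq: "closed_segment p q \<subseteq> S"
        using hull that by (meson closed_segment_subset convex_convex_hull hull_inc order_trans)
      show ?thesis unfolding prim_def
        by (rule contour_integral_swap)
           (auto intro!: continuous_on_subset[OF jc] simp: pq subsetD[OF pq])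
    qed
    let ?I = "\<lambda>p q v. contour_integral (linepath p q) (\<lambda>x. f x v * exp v)"
    have inner: "?I a b v + ?I b c v + ?I c a v = 0" if v: "v \<in> closed_segment w0 w" for v
    proof -
      have "(\<lambda>x. f x v * exp v) holomorphic_on S"
        using sy segL v unfolding symb_def by (auto intro!: holomorphic_intros)
      then have h: "(\<lambda>x. f x v * exp v) holomorphic_on convex hull {a,b,c}"
        using hull holomorphic_on_subset by blast
      show ?thesis
        by (rule has_chain_integral_chain_integral3[OF Cauchy_theorem_triangle[OF h]])
    qed
    have ct: "?I p q contour_integrable_on linepath w0 w" if "p \<in> {a,b,c}" "q \<in> {a,b,c}" for p q
    proof -
      have pq: "closed_segment p q \<subseteq> S"
        using hull that by (meson closed_segment_subset convex_convex_hull hull_inc order_trans)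
      have "continuous_on (closed_segment w0 w \<times> closed_segment p q) (\<lambda>(v, x). f x v * exp v)"
      proof -
        have "continuous_on (closed_segment w0 w \<times> closed_segment p q) ((\<lambda>(x,v). f x v * exp v) \<circ> prod.swap)"
        proof (rule continuous_on_compose)
          show "continuous_on (prod.swap ` (closed_segment w0 w \<times> closed_segment p q)) (\<lambda>(x,v). f x v * exp v)"
            by (rule continuous_on_subset[OF jc]) (use pq in auto)
        qed (rule continuous_on_swap)
        then show ?thesis by (simp add: case_prod_beta o_def)
      qed
      then have "continuous_on (closed_segment w0 w) (?I p q)"
        by (rule continuous_on_contour_integral_linepath)
      then show ?thesis by (rule contour_integrable_continuous_linepath)
    qed
    have "contour_integral (linepath a b) (\<lambda>x. prim w0 (f x) w) + contour_integral (linepath b c) (\<lambda>x. prim w0 (f x) w)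
        + contour_integral (linepath c a) (\<lambda>x. prim w0 (f x) w)
        = contour_integral (linepath w0 w) (\<lambda>v. ?I a b v + ?I b c v + ?I c a v)"
      using ct by (simp add: swap contour_integral_add contour_integrable_add)
    also have "\<dots> = contour_integral (linepath w0 w) (\<lambda>v. 0)"
      by (rule contour_integral_eq) (simp add: inner)
    finally show "contour_integral (linepath a b) (\<lambda>x. prim w0 (f x) w) + contour_integral (linepath b c) (\<lambda>x. prim w0 (f x) w)
        + contour_integral (linepath c a) (\<lambda>x. prim w0 (f x) w) = 0" by simp
  qed
  then show ?thesis by (rule analytic_imp_holomorphic)
qed

section \<open>Inverting the difference operator\<close>

text \<open>The integrand has order B + 1 but the base point contributes order 0, whence the
  maximum; the length of the segment grows like Re w and uses up the strict inequality.\<close>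

lemma symb_prim:
  assumes sy: "symb H S m B f" and S: "H \<Longrightarrow> open S" and w0: "w0 \<in> lstrip m" and B': "B' > max (B + 1) 0"
  shows "symb H S m B' (\<lambda>x. prim w0 (f x))"
proof -
  obtain C where C: "C > 0" "\<And>x w. x \<in> S \<Longrightarrow> w \<in> lstrip m \<Longrightarrow> norm (f x w) \<le> C * exp (B * Re w)"
    using symb_bound[OF sy] by blast
  define b e where "b = max (B + 1) 0" and "e = B' - b"
  have be: "b \<ge> 0" "e > 0" "B + 1 \<le> b" "B' = b + e" using B' unfolding b_def e_def by auto
  define K where "K = C * exp (b * Re w0) * (1 / e + Re w0 + 10)"
  have hol: "prim w0 (f x) holomorphic_on lstrip m" if "x \<in> S" for x
    using prim_deriv[OF _ w0, of "f x"] sy that open_lstrip unfolding symb_def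
    by (meson holomorphic_on_open)
  have "norm (prim w0 (f x) w) \<le> K * exp (B' * Re w)" if x: "x \<in> S" and w: "w \<in> lstrip m" for x w
  proof -
    have seg: "closed_segment w0 w \<subseteq> lstrip m"
      using w0 w convex_lstrip by (simp add: closed_segment_subset)
    have rp: "Re w > 0" "Re w0 > 0" using lstrip_Re_pos w w0 by fastforce+
    have "norm (f x v * exp v) \<le> C * exp (b * Re w0) * exp (b * Re w)" if v: "v \<in> closed_segment w0 w" for v
    proof -
      have vl: "v \<in> lstrip m" using v seg by blast
      obtain u where u: "0 \<le> u" "u \<le> 1" "v = (1 - u) *\<^sub>R w0 + u *\<^sub>R w" using v unfolding closed_segment_def by blast
      have "Re v = (1 - u) * Re w0 + u * Re w" using u by simp
      moreover have "(1 - u) * Re w0 \<le> 1 * Re w0" "u * Re w \<le> 1 * Re w"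
        using u rp by (intro mult_right_mono, simp_all)+
      ultimately have Rv: "Re v \<le> Re w0 + Re w" by simp
      have "norm (f x v * exp v) \<le> C * exp (B * Re v) * exp (Re v)"
        unfolding norm_mult norm_exp_eq_Re using C(2)[OF x vl] by (intro mult_right_mono) auto
      also have "\<dots> = C * exp ((B + 1) * Re v)" by (simp add: exp_add algebra_simps)
      also have "\<dots> \<le> C * exp (b * (Re w0 + Re w))"
      proof -
        have "(B + 1) * Re v \<le> b * Re v" using be(3) lstrip_Re_pos[OF vl] by (intro mult_right_mono) auto
        also have "\<dots> \<le> b * (Re w0 + Re w)" using be(1) Rv by (intro mult_left_mono) auto
        finally show ?thesis using C(1) by simp
      qed
      finally show ?thesis by (simp add: exp_add algebra_simps)
    qed
    moreover have "(\<lambda>v. f x v * exp v) contour_integrable_on linepath w0 w"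
    proof (rule contour_integrable_continuous_linepath)
      have "f x holomorphic_on lstrip m" using sy x unfolding symb_def by blast
      then have "(\<lambda>v. f x v * exp v) holomorphic_on lstrip m" by (intro holomorphic_intros)
      then show "continuous_on (closed_segment w0 w) (\<lambda>v. f x v * exp v)"
        using seg holomorphic_on_imp_continuous_on continuous_on_subset by blast
    qed
    ultimately have 1: "norm (prim w0 (f x) w) \<le> C * exp (b * Re w0) * exp (b * Re w) * norm (w - w0)"
      unfolding prim_def using C(1) by (intro contour_integral_bound_linepath) auto
    have "norm (w - w0) \<le> \<bar>Re (w - w0)\<bar> + \<bar>Im (w - w0)\<bar>" by (rule cmod_le)
    also have "\<dots> \<le> Re w + Re w0 + 10"
      using rp lstrip_Im[OF w] lstrip_Im[OF w0] by auto
    also have "\<dots> \<le> (1 / e + Re w0 + 10) * exp (e * Re w)"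
    proof -
      have "e * Re w \<le> exp (e * Re w)" using exp_ge_add_one_self[of "e * Re w"] by linarith
      then have a: "Re w \<le> 1 / e * exp (e * Re w)" using be(2) by (simp add: field_simps)
      have "(Re w0 + 10) * 1 \<le> (Re w0 + 10) * exp (e * Re w)" using rp be by (intro mult_left_mono) auto
      then show ?thesis using a by (simp add: algebra_simps)
    qed
    finally have 2: "norm (w - w0) \<le> (1 / e + Re w0 + 10) * exp (e * Re w)" .
    have "norm (prim w0 (f x) w) \<le> C * exp (b * Re w0) * exp (b * Re w) * ((1 / e + Re w0 + 10) * exp (e * Re w))"
      using 1 2 C(1) by (meson mult_left_mono order_trans less_imp_le mult_pos_pos exp_gt_zero)
    also have "\<dots> = K * exp (B' * Re w)" unfolding K_def be(4) by (simp add: exp_add algebra_simps)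
    finally show ?thesis .
  qed
  moreover have "(\<lambda>x. prim w0 (f x) w) holomorphic_on S" if "w \<in> lstrip m" H for w
    using prim_holomorphic_param[OF _ S w0 that(1), of B f] sy that(2) by simp
  ultimately show ?thesis using hol unfolding symb_def by blast
qed

definition fstep :: "complex \<Rightarrow> (complex \<Rightarrow> complex) \<Rightarrow> complex \<Rightarrow> complex" where
  "fstep w0 g = (\<lambda>w. prim w0 g (shiftw w) - prim w0 g w - g w)"

text \<open>Since exp (shiftw w) - exp w = 1, \<open>fstep w0 g w\<close> is the integral of (g v -
  g w) exp v over the segment from w to \<open>shiftw w\<close>. There g varies by O(exp ((B - 1) Re
  w)), while the length of the segment times exp (Re w) is bounded. One level pays for the
  derivative bound and one for the shift.\<close>

lemma symb_fstep:
  assumes sy: "symb H S m B f" and S: "H \<Longrightarrow> open S" and w0: "w0 \<in> lstrip (Suc (Suc m))"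
  shows "symb H S (Suc (Suc m)) (B - 1) (\<lambda>x. fstep w0 (f x))"
proof -
  have w0m: "w0 \<in> lstrip m" using w0 lstrip_mono[of m "Suc (Suc m)"] by auto
  obtain D where D: "D > 0" "\<And>x w. x \<in> S \<Longrightarrow> w \<in> lstrip (Suc m) \<Longrightarrow> norm (deriv (f x) w) \<le> D * exp (B * Re w)"
    using symb_deriv_bound[OF sy] by blast
  have "symb H S m (max (B+1) 0 + 1) (\<lambda>x. prim w0 (f x))" by (rule symb_prim[OF sy S w0m]) auto
  from symb_shift[OF this] have "symb H S (Suc (Suc m)) (max (B+1) 0 + 1) (\<lambda>x w. prim w0 (f x) (shiftw w) - prim w0 (f x) w - f x w)"
    using sy \<open>symb H S m (max (B+1) 0 + 1) (\<lambda>x. prim w0 (f x))\<close>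
    by (intro symb_diff) (auto intro: symb_mono)
  then have hol: "\<forall>x\<in>S. fstep w0 (f x) holomorphic_on lstrip (Suc (Suc m))"
    "H \<longrightarrow> (\<forall>w\<in>lstrip (Suc (Suc m)). (\<lambda>x. fstep w0 (f x) w) holomorphic_on S)"
    unfolding symb_def fstep_def by auto
  have "norm (fstep w0 (f x) w) \<le> (4 * D * exp \<bar>B\<bar> * exp 1) * exp ((B - 1) * Re w)"
    if x: "x \<in> S" and w: "w \<in> lstrip (Suc (Suc m))" for x w
  proof -
    let ?s = "closed_segment w (shiftw w)"
    have w1: "w \<in> lstrip (Suc m)" using w lstrip_mono[of "Suc m" "Suc (Suc m)"] by auto
    have seg: "?s \<subseteq> lstrip (Suc m)"
      using shiftw_props(3)[OF w] w1 convex_lstrip by (simp add: closed_segment_subset)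
    have segm: "lstrip (Suc m) \<subseteq> lstrip m" by (rule lstrip_mono) simp
    have near: "norm (v - w) \<le> norm (shiftw w - w)" if "v \<in> ?s" for v
      using segment_bound1[OF that] by (simp add: norm_minus_commute)
    have holf: "f x holomorphic_on lstrip m" using sy x unfolding symb_def by blast
    have Rv: "exp (b * Re v) \<le> exp \<bar>b\<bar> * exp (b * Re w)" if "v \<in> ?s" for v b
      using near[OF that] shiftw_props(2)[OF w] abs_Re_le_cmod[of "v - w"]
      by (intro exp_shift_bound) auto
    have df: "norm (f x v - f x w) \<le> (D * exp \<bar>B\<bar> * exp (B * Re w)) * norm (v - w)" if v: "v \<in> ?s" for v
    proof (rule field_differentiable_bound[of ?s "f x" "deriv (f x)"])
      fix u assume u: "u \<in> ?s"
      then have um: "u \<in> lstrip m" using seg segm by auto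
      then have "f x field_differentiable at u"
        using holf open_lstrip holomorphic_on_imp_differentiable_at by blast
      then show "(f x has_field_derivative deriv (f x) u) (at u within ?s)"
        using DERIV_deriv_iff_field_differentiable has_field_derivative_at_within by blast
      have "norm (deriv (f x) u) \<le> D * exp (B * Re u)" using D(2)[OF x] u seg by blast
      also have "\<dots> \<le> D * (exp \<bar>B\<bar> * exp (B * Re w))" using Rv[OF u] D(1) by (intro mult_left_mono) auto
      finally show "norm (deriv (f x) u) \<le> D * exp \<bar>B\<bar> * exp (B * Re w)" by (simp add: mult.assoc)
    qed (use v in auto)
    define \<phi> where "\<phi> = (\<lambda>v. prim w0 (f x) v - f x w * exp v)"
    have "norm (\<phi> (shiftw w) - \<phi> w)
        \<le> ((D * exp \<bar>B\<bar> * exp (B * Re w)) * (2 * exp (- Re w)) * (exp 1 * exp (Re w))) * norm (shiftw w - w)"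
    proof (rule field_differentiable_bound[of ?s \<phi> "\<lambda>v. (f x v - f x w) * exp v"])
      fix v assume v: "v \<in> ?s"
      have "v \<in> lstrip m" using v seg segm by auto
      from prim_deriv[OF holf w0m this]
      have "(\<phi> has_field_derivative (f x v - f x w) * exp v) (at v)"
        unfolding \<phi>_def by (auto intro!: derivative_eq_intros simp: algebra_simps)
      then show "(\<phi> has_field_derivative (f x v - f x w) * exp v) (at v within ?s)"
        by (rule has_field_derivative_at_within)
      have "norm (v - w) \<le> 2 * exp (- Re w)" using near[OF v] shiftw_props(1)[OF w] by linarith
      then have "norm (f x v - f x w) \<le> (D * exp \<bar>B\<bar> * exp (B * Re w)) * (2 * exp (- Re w))"
        using df[OF v] D(1) by (meson mult_left_mono order_trans less_imp_le mult_pos_pos exp_gt_zero)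
      moreover have "norm (exp v) \<le> exp 1 * exp (Re w)" using Rv[OF v, of 1] by simp
      ultimately show "norm ((f x v - f x w) * exp v) \<le> (D * exp \<bar>B\<bar> * exp (B * Re w)) * (2 * exp (- Re w)) * (exp 1 * exp (Re w))"
        unfolding norm_mult using D(1) by (intro mult_mono) auto
    qed auto
    also have "\<dots> \<le> ((D * exp \<bar>B\<bar> * exp (B * Re w)) * (2 * exp (- Re w)) * (exp 1 * exp (Re w))) * (2 * exp (- Re w))"
      using shiftw_props(1)[OF w] D(1) by (intro mult_left_mono) auto
    also have "\<dots> = (4 * D * exp \<bar>B\<bar> * exp 1) * (exp (B * Re w) * exp (- Re w) * (exp (Re w) * exp (- Re w)))"
      by (simp add: algebra_simps)
    also have "exp (B * Re w) * exp (- Re w) * (exp (Re w) * exp (- Re w)) = exp ((B - 1) * Re w)"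
      by (simp add: exp_add[symmetric] algebra_simps)
    finally have "norm (\<phi> (shiftw w) - \<phi> w) \<le> (4 * D * exp \<bar>B\<bar> * exp 1) * exp ((B - 1) * Re w)" .
    moreover have "\<phi> (shiftw w) - \<phi> w = fstep w0 (f x) w"
      unfolding \<phi>_def fstep_def using shiftw_props(4)[OF w] by (simp add: algebra_simps)
    ultimately show ?thesis by simp
  qed
  then show ?thesis using hol unfolding symb_def by blast
qed

definition fiter :: "complex \<Rightarrow> nat \<Rightarrow> (complex \<Rightarrow> complex) \<Rightarrow> complex \<Rightarrow> complex" where
  "fiter w0 l = (fstep w0 ^^ l)"

text \<open>Writing D h = h o shiftw - h, one has D (prim g) = g + fstep g, and fstep lowers the order
  by one; antidiff is the truncated Neumann series for the inverse of D.\<close>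

definition antidiff :: "nat \<Rightarrow> complex \<Rightarrow> (complex \<Rightarrow> complex) \<Rightarrow> complex \<Rightarrow> complex" where
  "antidiff K w0 g = (\<lambda>w. \<Sum>l<K. (-1)^l * prim w0 (fiter w0 l g) w)"

lemma symb_fiter:
  assumes "symb H S m B f" "H \<Longrightarrow> open S" "w0 \<in> lstrip (m + 2 * l)"
  shows "symb H S (m + 2 * l) (B - real l) (\<lambda>x. fiter w0 l (f x))"
  using assms(3)
proof (induction l)
  case 0
  then show ?case using assms by (simp add: fiter_def)
next
  case (Suc l)
  have "symb H S (m + 2 * l) (B - real l) (\<lambda>x. fiter w0 l (f x))"
    using Suc lstrip_mono[of "m + 2 * l" "m + 2 * Suc l"] by auto
  from symb_fstep[OF this assms(2)] Suc(2) show ?case by (simp add: fiter_def diff_diff_eq add.commute)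
qed

text \<open>The difference of the l-th primitive is \<open>fiter l\<close> +
  \<open>fiter (l + 1)\<close>, so the alternating sum collapses to its first and its last
  term.\<close>

lemma antidiff_shift:
  "antidiff K w0 g (shiftw w) - antidiff K w0 g w = g w - (-1)^K * fiter w0 K g w"
proof (induction K)
  case 0
  then show ?case by (simp add: antidiff_def fiter_def)
next
  case (Suc K)
  have e: "prim w0 (fiter w0 K g) (shiftw w) = fiter w0 (Suc K) g w + prim w0 (fiter w0 K g) w + fiter w0 K g w"
    by (simp add: fiter_def fstep_def)
  have "antidiff (Suc K) w0 g v = antidiff K w0 g v + (-1)^K * prim w0 (fiter w0 K g) v" for v
    by (simp add: antidiff_def)
  then have "antidiff (Suc K) w0 g (shiftw w) - antidiff (Suc K) w0 g w
      = (antidiff K w0 g (shiftw w) - antidiff K w0 g w) + (-1)^K * (fiter w0 (Suc K) g w + fiter w0 K g w)"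
    by (simp add: e algebra_simps)
  then show ?case using Suc by (simp add: algebra_simps)
qed

lemma symb_antidiff:
  assumes "symb H S m B f" "H \<Longrightarrow> open S" "w0 \<in> lstrip (m + 2 * K)" "B' > max (B + 1) 0"
  shows "symb H S (m + 2 * K) B' (\<lambda>x. antidiff K w0 (f x))"
  unfolding antidiff_def
proof (intro symb_sum symb_cmult)
  fix l assume "l \<in> {..<K}"
  then have l: "m + 2 * l \<le> m + 2 * K" by simp
  then have w0: "w0 \<in> lstrip (m + 2 * l)" using lstrip_mono[OF l] assms(3) by blast
  have "symb H S (m + 2 * l) B' (\<lambda>x. prim w0 (fiter w0 l (f x)))"
    by (rule symb_prim[OF symb_fiter[OF assms(1,2) w0] assms(2) w0]) (use assms(4) in auto)
  then show "symb H S (m + 2 * K) B' (\<lambda>x w. prim w0 (fiter w0 l (f x)) w)"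
    by (rule symb_mono) (use l in auto)
qed auto

lemma antidiff_deriv:
  assumes sy: "symb H S m B f" "H \<Longrightarrow> open S" and w0: "w0 \<in> lstrip (m + 2 * K)" and w: "w \<in> lstrip (m + 2 * K)" and x: "x \<in> S"
  shows "(antidiff K w0 (f x) has_field_derivative (\<Sum>l<K. (-1)^l * fiter w0 l (f x) w) * exp w) (at w)"
proof -
  have "(prim w0 (fiter w0 l (f x)) has_field_derivative fiter w0 l (f x) w * exp w) (at w)" if "l < K" for l
  proof (rule prim_deriv)
    have l: "m + 2 * l \<le> m + 2 * K" using that by simp
    show "w0 \<in> lstrip (m + 2 * l)" "w \<in> lstrip (m + 2 * l)" using lstrip_mono[OF l] w0 w by blast+
    then show "fiter w0 l (f x) holomorphic_on lstrip (m + 2 * l)"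
      using symb_fiter[OF sy, of w0 l] x unfolding symb_def by blast
  qed
  then have "(antidiff K w0 (f x) has_field_derivative (\<Sum>l<K. (-1)^l * (fiter w0 l (f x) w * exp w))) (at w)"
    unfolding antidiff_def by (intro DERIV_sum) (auto intro!: DERIV_cmult)
  then show ?thesis by (simp add: sum_distrib_right mult.assoc)
qed

text \<open>The sum starts at j so that leading terms can be split off: j = 0 gives the whole
  derivative up to the factor \<open>exp w\<close>, and j = 1 what remains after the source itself,
  one order lower.\<close>

lemma symb_antidiff_deriv:
  assumes sy: "symb H S m B f" "H \<Longrightarrow> open S" and w0: "w0 \<in> lstrip (m + 2 * K)" and j: "j \<le> K"
  shows "symb H S (m + 2 * K) (B - real j) (\<lambda>x w. \<Sum>l=j..<K. (-1)^l * fiter w0 l (f x) w)"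
proof (intro symb_sum symb_cmult)
  fix l assume "l \<in> {j..<K}"
  then have l: "m + 2 * l \<le> m + 2 * K" "j \<le> l" by auto
  then have w0: "w0 \<in> lstrip (m + 2 * l)" using lstrip_mono[OF l(1)] assms(3) by blast
  show "symb H S (m + 2 * K) (B - real j) (\<lambda>x w. fiter w0 l (f x) w)"
    by (rule symb_mono[OF symb_fiter[OF sy w0]]) (use l in auto)
qed auto

section \<open>Asymptotic expansion of chain sums\<close>

text \<open>Sums over chains N >= n_1 > n_2 > ... >= 1: the head of the list belongs to the largest
  summation variable.\<close>

fun chain_sum :: "(nat \<Rightarrow> 'b \<Rightarrow> 'a::comm_ring_1) \<Rightarrow> nat \<Rightarrow> 'b list \<Rightarrow> 'a" where
  "chain_sum g N [] = 1"
| "chain_sum g 0 (s # ss) = 0"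
| "chain_sum g (Suc N) (s # ss) = chain_sum g N (s # ss) + g (Suc N) s * chain_sum g N ss"

text \<open>The points n on the right and t - n on the left, in the coordinate w = log z; with this
  branch the factor exp (pi i s) of zetaU is absorbed into the weight wL.\<close>

definition rpt :: "nat \<Rightarrow> complex" where
  "rpt n = complex_of_real (ln (real n))"

definition lpt :: "complex \<Rightarrow> nat \<Rightarrow> complex" where
  "lpt t n = Ln (of_nat n - t) - \<i> * complex_of_real pi"

definition wR :: "nat \<Rightarrow> complex \<Rightarrow> complex" where
  "wR n s = exp (- s * rpt n)"

definition wL :: "complex \<Rightarrow> nat \<Rightarrow> complex \<Rightarrow> complex" where
  "wL t n s = exp (- s * lpt t n)"

lemma norm_nat_diff:
  assumes "norm t \<le> 1/2" "n \<ge> 1"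
  shows "real n / 2 \<le> norm (of_nat n - t)" "norm (of_nat n - t) \<le> 2 * real n"
    "real n / 2 \<le> Re (of_nat n - t)" "of_nat n - t \<noteq> 0"
proof -
  show 1: "real n / 2 \<le> Re (of_nat n - t)" using assms abs_Re_le_cmod[of t] by simp
  show 2: "real n / 2 \<le> norm (of_nat n - t)" using 1 complex_Re_le_cmod order_trans by blast
  show "norm (of_nat n - t) \<le> 2 * real n"
    using norm_triangle_ineq4[of "of_nat n" t] assms by simp
  show "of_nat n - t \<noteq> 0" using 2 assms by auto
qed

lemma exp_rpt: "n \<ge> 1 \<Longrightarrow> exp (rpt n) = of_nat n"
  unfolding rpt_def by (simp add: exp_of_real)

lemma exp_lpt: "norm t \<le> 1/2 \<Longrightarrow> n \<ge> 1 \<Longrightarrow> exp (lpt t n) = t - of_nat n"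
  using norm_nat_diff(4)[of t n] unfolding lpt_def by (simp add: exp_diff mult.commute)

lemma Re_rpt: "n \<ge> 1 \<Longrightarrow> exp (B * Re (rpt n)) = real n powr B"
  unfolding rpt_def by (simp add: powr_def)

lemma Re_lpt:
  assumes "norm t \<le> 1/2" "n \<ge> 1"
  shows "exp (B * Re (lpt t n)) \<le> 2 powr \<bar>B\<bar> * real n powr B"
proof -
  let ?z = "norm (of_nat n - t)"
  have z: "?z > 0" "real n > 0" using norm_nat_diff[OF assms] assms by auto
  have "exp (B * Re (lpt t n)) = ?z powr B"
    using norm_nat_diff(4)[OF assms] unfolding lpt_def by (simp add: powr_def)
  also have "\<dots> = (?z / real n) powr B * real n powr B"
    using z by (simp add: powr_divide)
  also have "(?z / real n) powr B \<le> 2 powr \<bar>B\<bar>"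
  proof -
    have l: "\<bar>ln (?z / real n)\<bar> \<le> ln 2"
    proof -
      have "ln (?z / real n) \<le> ln 2"
        using norm_nat_diff[OF assms] z by (subst ln_le_cancel_iff) (auto simp: field_simps)
      moreover have "ln (1/2) \<le> ln (?z / real n)"
        using norm_nat_diff[OF assms] z by (subst ln_le_cancel_iff) (auto simp: field_simps)
      ultimately show ?thesis by (simp add: ln_div abs_le_iff)
    qed
    have "B * ln (?z / real n) \<le> \<bar>B\<bar> * \<bar>ln (?z / real n)\<bar>" by (metis abs_ge_self abs_mult)
    also have "\<dots> \<le> \<bar>B\<bar> * ln 2" using l by (intro mult_left_mono) auto
    finally show ?thesis using z by (simp add: powr_def)
  qed
  finally show ?thesis by (simp add: mult_right_mono)
qed

lemma lpt_in_lstrip: "\<exists>N0\<ge>1. \<forall>N\<ge>N0. \<forall>t. norm t \<le> 1/2 \<longrightarrow> lpt t N \<in> lstrip m \<and> rpt N \<in> lstrip m"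
proof -
  define e where "e = (1/2::real)^m"
  have e: "e > 0" "e \<le> 1" unfolding e_def by (simp, rule power_le_one) auto
  \<comment> \<open>The first term makes |N - t| \<ge> N/2 exceed exp (m + 3), which gives the real
    part; the second makes the argument of N - t smaller than e.\<close>
  obtain N0 :: nat where N0: "real N0 > 2 * exp (real m + 3) + 1 / e + 1" using reals_Archimedean2 by blast
  have pos: "exp (real m + 3) > 0" "1 / e > 0" using e by auto
  have "lpt t N \<in> lstrip m \<and> rpt N \<in> lstrip m" if N: "N \<ge> N0" and t: "norm t \<le> 1/2" for N t
  proof -
    have rN: "real N > 2 * exp (real m + 3) + 1 / e + 1" using N N0 by simp
    then have N1: "N \<ge> 1" using pos by (cases N) auto
    let ?z = "of_nat N - t"
    note z = norm_nat_diff[OF t N1]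
    have "exp (real m + 3) \<le> norm ?z" using rN z(1) pos by linarith
    then have "ln (exp (real m + 3)) \<le> ln (norm ?z)" by (subst ln_le_cancel_iff) (auto intro: less_le_trans[OF exp_gt_zero])
    then have R: "real m + 2 < Re (lpt t N)" using z(4) unfolding lpt_def by simp
    have RR: "real m + 2 < Re (rpt N)"
    proof -
      have "exp (real m + 3) \<le> real N" using rN pos by linarith
      then have "ln (exp (real m + 3)) \<le> ln (real N)" using N1 by (subst ln_le_cancel_iff) auto
      then show ?thesis unfolding rpt_def by simp
    qed
    have "\<bar>Im (Ln ?z)\<bar> < e"
    proof -
      have Rz: "Re ?z > 0" using z(3) N1 by linarith
      then have "Im (Ln ?z) = arctan (Im ?z / Re ?z)" using Im_Ln_eq[OF z(4)] by simp
      moreover have "\<bar>arctan (Im ?z / Re ?z)\<bar> \<le> \<bar>Im ?z / Re ?z\<bar>"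
        using abs_arctan_le by blast
      moreover have "\<bar>Im ?z / Re ?z\<bar> < e"
      proof -
        have "\<bar>Im ?z\<bar> \<le> 1/2" using abs_Im_le_cmod[of t] t by simp
        moreover have "e * Re ?z > 1/2"
        proof -
          have "e * Re ?z \<ge> e * (real N / 2)" using e z(3) by (intro mult_left_mono) auto
          moreover have "e * (real N / 2) > e * ((1 / e) / 2)" using e rN pos by (intro mult_strict_left_mono divide_strict_right_mono; linarith)
          moreover have "e * ((1 / e) / 2) = 1 / 2" using e by simp
          ultimately show ?thesis by linarith
        qed
        ultimately show ?thesis using Rz by (simp add: abs_divide divide_less_eq)
      qed
      ultimately show ?thesis by linarith
    qed
    moreover have "Im (lpt t N) = Im (Ln ?z) - pi" "Im (rpt N) = 0" unfolding lpt_def rpt_def by auto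
    ultimately show ?thesis using R RR e pi_gt_zero unfolding lstrip_def e_def[symmetric] mem_Collect_eq by linarith
  qed
  moreover have "N0 \<ge> 1" using N0 pos by (cases N0) auto
  ultimately show ?thesis by blast
qed

text \<open>All strips lie in - pi - 1 < Im w < 1, of height pi + 2 < 2 pi. A point of a strip is
  therefore known once its exponential is known.\<close>

lemma lstrip_exp_inj:
  assumes "v \<in> lstrip m" "w \<in> lstrip m'" "exp v = exp w" shows "v = w"
proof (rule exp_complex_eqI)
  have p: "(1/2::real)^m \<le> 1" "(1/2::real)^m' \<le> 1" by (rule power_le_one, auto)+
  show "\<bar>Im v - Im w\<bar> < 2 * pi"
    using assms(1,2) p pi_gt3 unfolding lstrip_def by auto
qed fact

text \<open>Adding 1 to z raises n on the right but lowers n on the left, because t - (N + 1) + 1 =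
  t - N.\<close>

lemma shiftw_pts:
  assumes t: "norm t \<le> 1/2" "N \<ge> 1"
  shows "lpt t (Suc N) \<in> lstrip (Suc m) \<Longrightarrow> lpt t N \<in> lstrip m \<Longrightarrow> shiftw (lpt t (Suc N)) = lpt t N"
    "rpt N \<in> lstrip (Suc m) \<Longrightarrow> rpt (Suc N) \<in> lstrip m \<Longrightarrow> shiftw (rpt N) = rpt (Suc N)"
proof -
  assume a: "lpt t (Suc N) \<in> lstrip (Suc m)" "lpt t N \<in> lstrip m"
  show "shiftw (lpt t (Suc N)) = lpt t N"
    by (rule lstrip_exp_inj[OF shiftw_props(3)[OF a(1)] a(2)]) (use a t in \<open>simp add: shiftw_props(4) exp_lpt\<close>)
next
  assume a: "rpt N \<in> lstrip (Suc m)" "rpt (Suc N) \<in> lstrip m"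
  show "shiftw (rpt N) = rpt (Suc N)"
    by (rule lstrip_exp_inj[OF shiftw_props(3)[OF a(1)] a(2)]) (use a t in \<open>simp add: shiftw_props(4) exp_rpt\<close>)
qed

text \<open>In k^(-L-1-\<delta>) = k^(-L) k^(-1-\<delta>) the first factor is at most N^(-L) for k
  \<ge> N and the second is summable, with a bound that does not depend on x.\<close>

lemma telescoping_rate:
  fixes d :: "nat \<Rightarrow> 'x \<Rightarrow> complex"
  assumes C: "\<And>x N. x \<in> S \<Longrightarrow> N \<ge> N0 \<Longrightarrow> norm (d (Suc N) x - d N x) \<le> C * real N powr (- L - 1 - \<delta>)"
    and L: "L \<ge> 0" and \<delta>: "\<delta> > 0" and N0: "N0 \<ge> 1"
  shows "\<And>x. x \<in> S \<Longrightarrow> convergent (\<lambda>N. d N x)"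
    and "\<exists>C'. \<forall>x\<in>S. \<forall>N\<ge>N0. norm (d N x - lim (\<lambda>N. d N x)) \<le> C' * real N powr (- L)"
proof -
  have sm: "summable (\<lambda>k. real k powr (-1 - \<delta>))" using \<delta> by (subst summable_real_powr_iff) simp
  define Z where "Z = (\<Sum>k. real k powr (-1 - \<delta>))"
  have bd: "norm (d M x - d N x) \<le> (\<bar>C\<bar> * Z) * real N powr (- L)" if "x \<in> S" "N \<ge> N0" "M \<ge> N" for x N M
  proof -
    have "norm (d M x - d N x) = norm (\<Sum>k=N..<M. d (Suc k) x - d k x)"
      using sum_Suc_diff'[OF that(3), of "\<lambda>k. d k x"] by simp
    also have "\<dots> \<le> (\<Sum>k=N..<M. norm (d (Suc k) x - d k x))" by (rule norm_sum)
    also have "\<dots> \<le> (\<Sum>k=N..<M. (\<bar>C\<bar> * real N powr (- L)) * real k powr (-1 - \<delta>))"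
    proof (rule sum_mono)
      fix k assume k: "k \<in> {N..<M}"
      then have kN: "k \<ge> N" "k \<ge> N0" "real k \<ge> 1" using that N0 by auto
      have "norm (d (Suc k) x - d k x) \<le> C * real k powr (- L - 1 - \<delta>)" using C[OF that(1) kN(2)] .
      also have "\<dots> \<le> \<bar>C\<bar> * real k powr (- L - 1 - \<delta>)" by (intro mult_right_mono) auto
      also have "real k powr (- L - 1 - \<delta>) = real k powr (- L) * real k powr (-1 - \<delta>)"
        by (simp only: powr_add[symmetric]) (rule arg_cong[where f = "\<lambda>y. real k powr y"], simp)
      also have "real k powr (- L) \<le> real N powr (- L)"
        using kN L that N0 by (intro powr_mono2') auto
      finally show "norm (d (Suc k) x - d k x) \<le> (\<bar>C\<bar> * real N powr (- L)) * real k powr (-1 - \<delta>)"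
        by (simp add: mult.assoc mult_left_mono mult_right_mono)
    qed
    also have "\<dots> = (\<bar>C\<bar> * real N powr (- L)) * (\<Sum>k=N..<M. real k powr (-1 - \<delta>))" by (simp add: sum_distrib_left)
    also have "\<dots> \<le> (\<bar>C\<bar> * real N powr (- L)) * Z"
      unfolding Z_def using sm by (intro mult_left_mono sum_le_suminf) auto
    finally show ?thesis by (simp add: algebra_simps)
  qed
  show conv: "convergent (\<lambda>N. d N x)" if x: "x \<in> S" for x
  proof -
    have "summable (\<lambda>k. d (Suc k) x - d k x)"
    proof (rule summable_comparison_test_ev)
      show "\<forall>\<^sub>F k in sequentially. norm (d (Suc k) x - d k x) \<le> \<bar>C\<bar> * real k powr (-1 - \<delta>)"
        unfolding eventually_sequentially
      proof (intro exI allI impI)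
        fix k assume k: "k \<ge> N0"
        have "norm (d (Suc k) x - d k x) \<le> C * real k powr (- L - 1 - \<delta>)" using C[OF x k] .
        also have "\<dots> \<le> \<bar>C\<bar> * real k powr (- L - 1 - \<delta>)" by (intro mult_right_mono) auto
        also have "\<dots> \<le> \<bar>C\<bar> * real k powr (-1 - \<delta>)" using L k N0 by (intro mult_left_mono powr_mono) auto
        finally show "norm (d (Suc k) x - d k x) \<le> \<bar>C\<bar> * real k powr (-1 - \<delta>)" .
      qed
      show "summable (\<lambda>k. \<bar>C\<bar> * real k powr (-1 - \<delta>))" using sm by (rule summable_mult)
    qed
    then have "convergent (\<lambda>n. \<Sum>k<n. d (Suc k) x - d k x)" by (simp add: summable_iff_convergent)
    then have "convergent (\<lambda>n. d n x - d 0 x)" unfolding sum_lessThan_telescope[of "\<lambda>k. d k x"] .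
    then have "convergent (\<lambda>n. (d n x - d 0 x) + d 0 x)" by (intro convergent_add convergent_const)
    then show ?thesis by simp
  qed
  have "norm (d N x - lim (\<lambda>N. d N x)) \<le> (\<bar>C\<bar> * Z) * real N powr (- L)" if x: "x \<in> S" and N: "N \<ge> N0" for x N
  proof -
    have "(\<lambda>M. norm (d N x - d M x)) \<longlonglongrightarrow> norm (d N x - lim (\<lambda>N. d N x))"
      using conv[OF x] by (intro tendsto_intros) (simp add: convergent_LIMSEQ_iff)
    then show ?thesis
      by (rule LIMSEQ_le_const2) (use bd[OF x N] in \<open>auto simp: norm_minus_commute intro!: exI[of _ N]\<close>)
  qed
  then show "\<exists>C'. \<forall>x\<in>S. \<forall>N\<ge>N0. norm (d N x - lim (\<lambda>N. d N x)) \<le> C' * real N powr (- L)" by blast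
qed

lemma telescoping_limit:
  fixes d :: "nat \<Rightarrow> 'x \<Rightarrow> complex"
  assumes C: "\<And>x N. x \<in> S \<Longrightarrow> N \<ge> N0 \<Longrightarrow> norm (d (Suc N) x - d N x) \<le> C * real N powr (- L - 2)"
    and L: "L \<ge> 0" and N0: "N0 \<ge> 1"
  shows "\<And>x. x \<in> S \<Longrightarrow> convergent (\<lambda>N. d N x)"
    and "\<exists>C'. \<forall>x\<in>S. \<forall>N\<ge>N0. norm (d N x - lim (\<lambda>N. d N x)) \<le> C' * real N powr (- L)"
proof -
  have C1: "norm (d (Suc N) x - d N x) \<le> C * real N powr (- L - 1 - 1)" if "x \<in> S" "N \<ge> N0" for x N
    using C[OF that] by (simp only: diff_diff_eq one_add_one)
  show "\<And>x. x \<in> S \<Longrightarrow> convergent (\<lambda>N. d N x)"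
    by (rule telescoping_rate(1)[OF C1 L zero_less_one N0])
  show "\<exists>C'. \<forall>x\<in>S. \<forall>N\<ge>N0. norm (d N x - lim (\<lambda>N. d N x)) \<le> C' * real N powr (- L)"
    by (rule telescoping_rate(2)[OF C1 L zero_less_one N0])
qed

text \<open>The source of the difference equation for the left expansions. Passing from N to N + 1
  adds the weight of t - (N + 1) times the tail at N, while \<open>shiftw\<close> runs from
  \<open>lpt t (Suc N)\<close> back to \<open>lpt t N\<close>; hence the minus sign, and the tail
  \<open>a\<close> is taken at \<open>shiftw w\<close>.\<close>

definition asrc :: "complex \<Rightarrow> (complex \<Rightarrow> complex) \<Rightarrow> complex \<Rightarrow> complex" where
  "asrc s a = (\<lambda>w. - exp (- s * w) * a (shiftw w))"

text \<open>The asymptotic expansion of the left chain sums: its value at lpt t N approximates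
  chain_sum (wL t) N up to a power of N that decreases with K.\<close>

fun chain_asym :: "nat \<Rightarrow> complex \<Rightarrow> complex \<Rightarrow> complex list \<Rightarrow> complex \<Rightarrow> complex" where
  "chain_asym K w0 t [] = (\<lambda>w. 1)"
| "chain_asym K w0 t (s # ss) = (\<lambda>w. antidiff K w0 (asrc s (chain_asym K w0 t ss)) w
     + lim (\<lambda>N. chain_sum (wL t) N (s # ss) - antidiff K w0 (asrc s (chain_asym K w0 t ss)) (lpt t N)))"

text \<open>Levels used up by an index with n entries: per entry one for the \<open>shiftw\<close>
  in \<open>asrc\<close> and two for each of the K applications of \<open>fstep\<close>.\<close>

definition lev :: "nat \<Rightarrow> nat \<Rightarrow> nat" where
  "lev K n = n * (2 * K + 1)"

lemma lev_Suc: "lev K (Suc n) = Suc (lev K n) + 2 * K"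
  by (simp add: lev_def)

lemma lev_mono: "n \<le> n' \<Longrightarrow> lev K n \<le> lev K n'"
  unfolding lev_def by (rule mult_right_mono) auto

lemma norm_exp_bound:
  assumes "norm s \<le> M" "\<bar>Im w\<bar> \<le> 5" "\<bar>Re w\<bar> \<le> ln (2 * real n)"  "n \<ge> 1"
  shows "norm (exp (- s * w)) \<le> exp (5 * M) * (2 * real n) powr M"
proof -
  have "\<bar>Im s\<bar> * \<bar>Im w\<bar> \<le> M * 5" using assms abs_Im_le_cmod[of s] by (intro mult_mono) auto
  then have 1: "Im s * Im w \<le> 5 * M" by (simp add: abs_mult[symmetric])
  have "\<bar>Re s\<bar> * \<bar>Re w\<bar> \<le> M * ln (2 * real n)" using assms abs_Re_le_cmod[of s] by (intro mult_mono) auto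
  then have 2: "- (Re s * Re w) \<le> M * ln (2 * real n)" by (simp add: abs_mult[symmetric])
  have "norm (exp (- s * w)) = exp (- (Re s * Re w) + Im s * Im w)" by simp
  also have "\<dots> \<le> exp (5 * M + M * ln (2 * real n))" using 1 2 by simp
  also have "\<dots> = exp (5 * M) * (2 * real n) powr M" using assms by (simp add: exp_add powr_def)
  finally show ?thesis .
qed

lemma wL_bound:
  assumes "norm s \<le> M" "norm t \<le> 1/2" "n \<ge> 1"
  shows "norm (wL t n s) \<le> exp (5 * M) * (2 * real n) powr M"
  unfolding wL_def
proof (rule norm_exp_bound[OF assms(1) _ _ assms(3)])
  note z = norm_nat_diff[OF assms(2,3)]
  have "\<bar>Im (Ln (of_nat n - t))\<bar> < pi/2" using Re_Ln_pos_lt_imp[of "of_nat n - t"] z(3) assms(3) by linarith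
  moreover have "Im (lpt t n) = Im (Ln (of_nat n - t)) - pi" unfolding lpt_def by simp
  moreover have "pi < 3.2" using pi_approx by simp
  ultimately show "\<bar>Im (lpt t n)\<bar> \<le> 5" by linarith
  have "Re (lpt t n) = ln (norm (of_nat n - t))" unfolding lpt_def using z(4) by simp
  moreover have "ln (norm (of_nat n - t)) \<le> ln (2 * real n)" using z assms(3) by (subst ln_le_cancel_iff) auto
  moreover have "ln (1 / (2 * real n)) \<le> ln (norm (of_nat n - t))"
  proof -
    have "1 / (2 * real n) \<le> real n / 2" using assms(3) by (simp add: field_simps mult_mono[of 1 "real n" 1 "real n", simplified])
    then show ?thesis using z assms(3) by (subst ln_le_cancel_iff) auto
  qed
  ultimately show "\<bar>Re (lpt t n)\<bar> \<le> ln (2 * real n)" using assms(3) by (simp add: ln_div abs_le_iff)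
qed

lemma wR_bound:
  assumes "norm s \<le> M" "n \<ge> 1"
  shows "norm (wR n s) \<le> exp (5 * M) * (2 * real n) powr M"
  unfolding wR_def
  by (rule norm_exp_bound[OF assms(1) _ _ assms(2)]) (use assms(2) in \<open>auto simp: rpt_def\<close>)

text \<open>A crude bound, exponential in N. It is applied at one fixed N only, to bound the
  constant term of an expansion.\<close>

lemma chain_sum_le_power:
  assumes "\<And>n s. n \<ge> 1 \<Longrightarrow> n \<le> N \<Longrightarrow> s \<in> set u \<Longrightarrow> norm (g n s) \<le> G" "G \<ge> (0::real)"
  shows "norm (chain_sum g N u :: complex) \<le> (1 + G) ^ N"
  using assms(1)
proof (induction g N u rule: chain_sum.induct)
  case (3 g N s ss)
  have "norm (chain_sum g (Suc N) (s # ss)) \<le> norm (chain_sum g N (s # ss)) + norm (g (Suc N) s) * norm (chain_sum g N ss)"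
    by (simp add: norm_triangle_le norm_mult)
  also have "\<dots> \<le> (1 + G) ^ N + G * (1 + G) ^ N"
    using 3 assms(2) by (intro add_mono mult_mono) auto
  finally show ?case by (simp add: algebra_simps)
qed (use assms(2) in auto)

lemma chain_sum_unfold: "chain_sum g N (s # ss) = (\<Sum>n<N. g (Suc n) s * chain_sum g n ss)"
  by (induction N) auto

text \<open>With \<delta> = B' - (a + b + 1) a summand of size n^(a+b) is n^(B') n^(-1-\<delta>)
  \<le> N^(B') n^(-1-\<delta>), and the last factor is summable. Positivity of B' is used for the
  monotonicity of n^(B').\<close>

lemma chain_growth_step:
  fixes A B :: "'x \<Rightarrow> nat \<Rightarrow> complex"
  assumes A0: "\<And>x. x \<in> S \<Longrightarrow> A x 0 = 0"
    and A: "\<And>x N. x \<in> S \<Longrightarrow> A x (Suc N) = A x N + g x (Suc N) * B x N"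
    and B: "\<And>x N. x \<in> S \<Longrightarrow> N \<ge> 1 \<Longrightarrow> norm (B x N) \<le> C * real N powr b" and B0: "\<And>x. x \<in> S \<Longrightarrow> norm (B x 0) \<le> 1"
    and g: "\<And>x n. x \<in> S \<Longrightarrow> n \<ge> 1 \<Longrightarrow> norm (g x n) \<le> G * real n powr a"
    and b: "b \<ge> 0" and B': "B' > max (a + b + 1) 0"
  shows "\<exists>C'. \<forall>x\<in>S. \<forall>N\<ge>1. norm (A x N) \<le> C' * real N powr B'"
proof -
  define \<delta> where "\<delta> = B' - (a + b + 1)"
  have d: "\<delta> > 0" using B' unfolding \<delta>_def by simp
  have sm: "summable (\<lambda>k. real k powr (-1 - \<delta>))" using d by (subst summable_real_powr_iff) simp
  define Z where "Z = (\<Sum>k. real k powr (-1 - \<delta>))"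
  define D where "D = \<bar>G\<bar> * (\<bar>C\<bar> + 1)"
  have D0: "D \<ge> 0" unfolding D_def by simp
  have "norm (A x N) \<le> (D * Z) * real N powr B'" if x: "x \<in> S" and N: "N \<ge> 1" for x N
  proof -
    have "A x M = (\<Sum>n<M. g x (Suc n) * B x n)" for M by (induction M) (auto simp: A0 A x)
    then have "norm (A x N) \<le> (\<Sum>n<N. norm (g x (Suc n)) * norm (B x n))"
      using norm_sum[of "\<lambda>n. g x (Suc n) * B x n" "{..<N}"] by (simp add: norm_mult)
    also have "\<dots> \<le> (\<Sum>n<N. (D * real N powr B') * real (Suc n) powr (-1 - \<delta>))"
    proof (rule sum_mono)
      fix n assume n: "n \<in> {..<N}"
      have "norm (B x n) \<le> (\<bar>C\<bar> + 1) * real (Suc n) powr b"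
      proof (cases "n = 0")
        case True then show ?thesis using B0[OF x] by simp
      next
        case False
        then have "norm (B x n) \<le> C * real n powr b" using B[OF x] by simp
        also have "\<dots> \<le> (\<bar>C\<bar> + 1) * real (Suc n) powr b" using b by (intro mult_mono powr_mono2) auto
        finally show ?thesis .
      qed
      moreover have "norm (g x (Suc n)) \<le> \<bar>G\<bar> * real (Suc n) powr a"
        using g[OF x, of "Suc n"] by (rule order_trans) (auto intro: mult_right_mono)
      ultimately have "norm (g x (Suc n)) * norm (B x n) \<le> (\<bar>G\<bar> * real (Suc n) powr a) * ((\<bar>C\<bar> + 1) * real (Suc n) powr b)"
        by (intro mult_mono) auto
      also have "\<dots> = D * (real (Suc n) powr B' * real (Suc n) powr (-1 - \<delta>))"
        unfolding D_def \<delta>_def by (simp add: powr_add[symmetric])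
      also have "\<dots> \<le> D * (real N powr B' * real (Suc n) powr (-1 - \<delta>))"
        using n B' D0 by (intro mult_left_mono mult_right_mono powr_mono2) auto
      finally show "norm (g x (Suc n)) * norm (B x n) \<le> (D * real N powr B') * real (Suc n) powr (-1 - \<delta>)"
        by (simp add: mult.assoc)
    qed
    also have "\<dots> = (D * real N powr B') * (\<Sum>n<N. real (Suc n) powr (-1 - \<delta>))" by (simp add: sum_distrib_left)
    also have "\<dots> \<le> (D * real N powr B') * Z"
    proof (rule mult_left_mono)
      have "(\<Sum>n<N. real (Suc n) powr (-1 - \<delta>)) = (\<Sum>k\<in>Suc ` {..<N}. real k powr (-1 - \<delta>))"
        by (subst sum.reindex) auto
      also have "\<dots> \<le> Z" unfolding Z_def by (rule sum_le_suminf[OF sm]) auto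
      finally show "(\<Sum>n<N. real (Suc n) powr (-1 - \<delta>)) \<le> Z" .
    qed (use D0 in auto)
    finally show ?thesis by (simp add: mult.assoc mult.left_commute mult.commute)
  qed
  then show ?thesis by blast
qed

text \<open>The parameter x may move the entries of the index or the point t = \<open>T x\<close>.
  With H set, S is open, t is frozen and everything depends holomorphically on the entries; with H
  unset, S may be the disc of all t and the estimates are uniform in t. M bounds the size of the
  entries.\<close>

locale chain_asym_family =
  fixes H :: bool and S :: "complex set" and T :: "complex \<Rightarrow> complex" and M :: real
  assumes S_open: "H \<Longrightarrow> open S"
    and T_small: "\<And>x. x \<in> S \<Longrightarrow> norm (T x) \<le> 1/2"
    and T_const: "H \<Longrightarrow> \<exists>t. \<forall>x\<in>S. T x = t"
    and M_nonneg: "M \<ge> 0"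
begin

definition good :: "real \<Rightarrow> (complex \<Rightarrow> complex) \<Rightarrow> bool" where
  "good a c \<longleftrightarrow> (H \<longrightarrow> c holomorphic_on S) \<and> (\<forall>x\<in>S. norm (c x) \<le> M \<and> a \<le> Re (c x))"

lemma good_minus: "good a c \<Longrightarrow> good (- M) c"
  unfolding good_def using abs_Re_le_cmod by (smt (verit, best))

lemma symb_asrc:
  assumes "symb H S m b A" "good a c"
  shows "symb H S (Suc m) (b - a) (\<lambda>x. asrc (c x) (A x))"
proof -
  have "symb H S (Suc m) (- a) (\<lambda>x w. exp (- c x * w))"
    using assms(2) unfolding good_def by (intro symb_exp[where M = M]) auto
  from symb_cmult[OF symb_mult[OF this symb_shift[OF assms(1)]], of "-1"]
  show ?thesis unfolding asrc_def by simp
qed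

lemma chain_sum_holomorphic:
  assumes "\<And>c n. c \<in> set cs \<Longrightarrow> (\<lambda>x. g x n (c x)) holomorphic_on S"
  shows "(\<lambda>x. chain_sum (g x) N (map (\<lambda>c. c x) cs)) holomorphic_on S"
  using assms
proof (induction cs arbitrary: N)
  case Nil
  then show ?case by simp
next
  case (Cons c cs)
  then show ?case unfolding list.map by (induction N) (auto intro!: holomorphic_intros)
qed

abbreviation vals :: "(complex \<Rightarrow> complex) list \<Rightarrow> complex \<Rightarrow> complex list" where
  "vals cs x \<equiv> map (\<lambda>c. c x) cs"

text \<open>The two claims need each other: the order of the tail controls the antidifference, and
  the approximation rate of the tail makes the limit in \<open>chain_asym\<close> exist and bounds
  it uniformly. Each entry costs M + 2 in the order (M for the weight, 1 for the summation, the rest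
  as slack for \<open>symb_prim\<close>) and 2 M + 4 in the rate.\<close>

lemma chain_asym_main:
  assumes "\<forall>c\<in>set cs. good (- M) c" "w0 \<in> lstrip (lev K (length cs))" "real K > real (length cs) * (2 * M + 4)"
  shows "symb H S (lev K (length cs)) (real (length cs) * (M + 2)) (\<lambda>x. chain_asym K w0 (T x) (vals cs x)) \<and>
    (\<exists>C N0. N0 \<ge> 1 \<and> (\<forall>x\<in>S. \<forall>N\<ge>N0. norm (chain_sum (wL (T x)) N (vals cs x) - chain_asym K w0 (T x) (vals cs x) (lpt (T x) N))
       \<le> C * real N powr (- (real K - real (length cs) * (2 * M + 4)))))"
  using assms
proof (induction cs)
  case Nil
  have "symb H S (lev K 0) 0 (\<lambda>x w. 1)" by (rule symb_const[of _ _ _ 1]) auto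
  then show ?case by (auto intro!: exI[of _ "0::real"] exI[of _ "1::nat"])
next
  case (Cons c cs)
  define n where "n = length cs"
  define A where "A = (\<lambda>x. chain_asym K w0 (T x) (vals cs x))"
  define F where "F = (\<lambda>x. asrc (c x) (A x))"
  define L where "L = real K - real n * (2 * M + 4)"
  define L' where "L' = real K - real (Suc n) * (2 * M + 4)"
  have w0: "w0 \<in> lstrip (lev K (Suc n))" using Cons.prems unfolding n_def by simp
  have w0': "w0 \<in> lstrip (lev K n)" using w0 lstrip_mono[OF lev_mono[of n "Suc n" K]] by auto
  have L': "L' > 0" "L' = L - (2 * M + 4)" "L > 0"
    using Cons.prems(3) M_nonneg unfolding L'_def L_def n_def by (auto simp: algebra_simps)
  have cg: "good (- M) c" using Cons.prems by simp
  have Kn: "real K > real n * (2 * M + 4)" using L' unfolding L_def by simp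
  have IH: "symb H S (lev K n) (real n * (M + 2)) A"
    "\<exists>C N0. N0 \<ge> 1 \<and> (\<forall>x\<in>S. \<forall>N\<ge>N0. norm (chain_sum (wL (T x)) N (vals cs x) - A x (lpt (T x) N)) \<le> C * real N powr (- L))"
    using Cons.IH Cons.prems(1) w0' Kn unfolding n_def A_def L_def by auto
  define b where "b = real n * (M + 2) - - M"
  have F: "symb H S (Suc (lev K n)) b F" unfolding F_def b_def by (rule symb_asrc[OF IH(1) cg])
  have w0F: "w0 \<in> lstrip (Suc (lev K n) + 2 * K)" using w0 lev_Suc by simp
  have AD: "symb H S (lev K (Suc n)) (real (Suc n) * (M + 2)) (\<lambda>x. antidiff K w0 (F x))"
    unfolding lev_Suc by (rule symb_antidiff[OF F S_open w0F]) (use M_nonneg in \<open>auto simp: b_def algebra_simps\<close>)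
  have zetaU_ext_at: "symb H S (lev K (Suc n)) (b - real K) (\<lambda>x. fiter w0 K (F x))"
    unfolding lev_Suc by (rule symb_fiter[OF F S_open w0F])
  obtain C1 where C1: "C1 > 0" "\<And>x w. x \<in> S \<Longrightarrow> w \<in> lstrip (lev K (Suc n)) \<Longrightarrow> norm (fiter w0 K (F x) w) \<le> C1 * exp ((b - real K) * Re w)"
    using symb_bound[OF zetaU_ext_at] by blast
  obtain C2 where C2: "C2 > 0" "\<And>x w. x \<in> S \<Longrightarrow> w \<in> lstrip (lev K (Suc n)) \<Longrightarrow> norm (antidiff K w0 (F x) w) \<le> C2 * exp ((real (Suc n) * (M + 2)) * Re w)"
    using symb_bound[OF AD] by blast
  obtain C3 N1 where C3: "N1 \<ge> 1" "\<And>x N. x \<in> S \<Longrightarrow> N \<ge> N1 \<Longrightarrow> norm (chain_sum (wL (T x)) N (vals cs x) - A x (lpt (T x) N)) \<le> C3 * real N powr (- L)"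
    using IH(2) by blast
  obtain N2 where N2: "N2 \<ge> 1" "\<And>N t. N \<ge> N2 \<Longrightarrow> norm t \<le> 1/2 \<Longrightarrow> lpt t N \<in> lstrip (lev K (Suc n))"
    using lpt_in_lstrip[of "lev K (Suc n)"] by blast
  define N0 where "N0 = max N1 N2"
  define d where "d = (\<lambda>N x. chain_sum (wL (T x)) N (c x # vals cs x) - antidiff K w0 (F x) (lpt (T x) N))"
  have chain_asym_eq: "chain_asym K w0 (T x) (vals (c # cs) x) = (\<lambda>w. antidiff K w0 (F x) w + lim (\<lambda>N. d N x))" for x
    unfolding d_def F_def A_def by simp
  have bK: "b - real K \<le> - L' - 2" and bK0: "b - real K \<le> 0"
    using M_nonneg L' unfolding b_def L'_def by (auto simp: algebra_simps)
  have step: "norm (d (Suc N) x - d N x) \<le> (exp (5 * M) * 4 powr M * \<bar>C3\<bar> + C1 * 2 powr \<bar>b - real K\<bar>) * real N powr (- L' - 2)"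
    if x: "x \<in> S" and N: "N \<ge> N0" for x N
  proof -
    have NN: "N \<ge> N1" "N \<ge> N2" "N \<ge> 1" "real N \<ge> 1" using N C3(1) unfolding N0_def by auto
    let ?w = "lpt (T x) (Suc N)"
    have w: "?w \<in> lstrip (lev K (Suc n))" using N2(2)[of "Suc N"] NN T_small[OF x] by simp
    have ws: "?w \<in> lstrip (Suc (lev K n))" using w lstrip_mono[of "Suc (lev K n)" "lev K (Suc n)"] by (auto simp: lev_Suc)
    have wN: "lpt (T x) N \<in> lstrip (lev K n)"
      using N2(2)[of N] NN T_small[OF x] lstrip_mono[OF lev_mono[of n "Suc n" K]] by auto
    have sh: "shiftw ?w = lpt (T x) N" by (rule shiftw_pts(1)[OF T_small[OF x] NN(3) ws wN])
    have "d (Suc N) x - d N x = wL (T x) (Suc N) (c x) * chain_sum (wL (T x)) N (vals cs x)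
        + (antidiff K w0 (F x) (shiftw ?w) - antidiff K w0 (F x) ?w)"
      unfolding d_def sh by simp
    \<comment> \<open>The main terms cancel, as \<open>F x ?w\<close> is minus the new weight times
      the tail expansion at \<open>lpt (T x) N\<close>. What remains is the error of the tail and
      the last term of the Neumann series.\<close>
    also have "\<dots> = wL (T x) (Suc N) (c x) * (chain_sum (wL (T x)) N (vals cs x) - A x (lpt (T x) N)) - (-1)^K * fiter w0 K (F x) ?w"
    proof -
      have "F x ?w = - wL (T x) (Suc N) (c x) * A x (lpt (T x) N)" unfolding F_def asrc_def sh wL_def by simp
      then show ?thesis unfolding antidiff_shift by (simp add: algebra_simps)
    qed
    finally have eq: "d (Suc N) x - d N x = \<dots>" .
    have p1: "norm (wL (T x) (Suc N) (c x)) \<le> exp (5 * M) * 4 powr M * real N powr M"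
    proof -
      have "norm (wL (T x) (Suc N) (c x)) \<le> exp (5 * M) * (2 * real (Suc N)) powr M"
        by (rule wL_bound) (use cg x T_small in \<open>auto simp: good_def\<close>)
      also have "\<dots> \<le> exp (5 * M) * (4 * real N) powr M"
        using NN M_nonneg by (intro mult_left_mono powr_mono2) auto
      finally show ?thesis by (simp add: powr_mult)
    qed
    have "norm (wL (T x) (Suc N) (c x) * (chain_sum (wL (T x)) N (vals cs x) - A x (lpt (T x) N)))
        \<le> (exp (5 * M) * 4 powr M * real N powr M) * (\<bar>C3\<bar> * real N powr (- L))"
      unfolding norm_mult using p1 C3(2)[OF x NN(1)]
      by (intro mult_mono) (auto intro: order_trans[OF _ mult_right_mono])
    also have "\<dots> = (exp (5 * M) * 4 powr M * \<bar>C3\<bar>) * real N powr (M - L)"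
      by (simp add: powr_add[symmetric])
    also have "\<dots> \<le> (exp (5 * M) * 4 powr M * \<bar>C3\<bar>) * real N powr (- L' - 2)"
      using NN L' M_nonneg by (intro mult_left_mono powr_mono) auto
    finally have q1: "norm (wL (T x) (Suc N) (c x) * (chain_sum (wL (T x)) N (vals cs x) - A x (lpt (T x) N)))
        \<le> (exp (5 * M) * 4 powr M * \<bar>C3\<bar>) * real N powr (- L' - 2)" .
    have "norm ((-1)^K * fiter w0 K (F x) ?w) \<le> C1 * exp ((b - real K) * Re ?w)"
      using C1(2)[OF x w] by (simp add: norm_mult norm_power)
    also have "\<dots> \<le> C1 * (2 powr \<bar>b - real K\<bar> * real (Suc N) powr (b - real K))"
      using C1(1) Re_lpt[OF T_small[OF x], of "Suc N"] by (intro mult_left_mono) auto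
    also have "\<dots> \<le> C1 * (2 powr \<bar>b - real K\<bar> * real N powr (- L' - 2))"
    proof -
      have "real (Suc N) powr (b - real K) \<le> real N powr (b - real K)"
        using bK0 NN by (intro powr_mono2') auto
      also have "\<dots> \<le> real N powr (- L' - 2)" using bK NN by (intro powr_mono) auto
      finally show ?thesis using C1(1) by (intro mult_left_mono) auto
    qed
    finally have q2: "norm ((-1)^K * fiter w0 K (F x) ?w) \<le> (C1 * 2 powr \<bar>b - real K\<bar>) * real N powr (- L' - 2)"
      by (simp add: mult.assoc)
    show ?thesis unfolding eq
      by (rule order_trans[OF norm_triangle_ineq4]) (use q1 q2 in \<open>simp add: algebra_simps\<close>)
  qed
  have N01: "N0 \<ge> 1" using C3(1) unfolding N0_def by auto
  obtain C' where C': "\<And>x N. x \<in> S \<Longrightarrow> N \<ge> N0 \<Longrightarrow> norm (d N x - lim (\<lambda>N. d N x)) \<le> C' * real N powr (- L')"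
    using telescoping_limit(2)[of S N0 d, OF step _ N01] L' by auto
  have "\<exists>C N0. N0 \<ge> 1 \<and> (\<forall>x\<in>S. \<forall>N\<ge>N0. norm (chain_sum (wL (T x)) N (vals (c # cs) x) - chain_asym K w0 (T x) (vals (c # cs) x) (lpt (T x) N))
       \<le> C * real N powr (- L'))"
    unfolding chain_asym_eq using C' N01 by (intro exI[of _ C'] exI[of _ N0]) (auto simp: d_def algebra_simps)
  moreover have "symb H S (lev K (Suc n)) (real (Suc n) * (M + 2)) (\<lambda>x. chain_asym K w0 (T x) (vals (c # cs) x))"
    unfolding chain_asym_eq
  proof (rule symb_add[OF AD])
    \<comment> \<open>The limit differs from its N0-th approximation by a uniformly bounded amount,
      so it suffices to bound a single term of the sequence.\<close>
    have "norm (lim (\<lambda>N. d N x)) \<le> (1 + exp (5 * M) * (2 * real N0) powr M) ^ N0 + C2 * (2 powr \<bar>real (Suc n) * (M + 2)\<bar> * real N0 powr (real (Suc n) * (M + 2))) + \<bar>C'\<bar>"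
      if x: "x \<in> S" for x
    proof -
      have "norm (chain_sum (wL (T x)) N0 (c x # vals cs x)) \<le> (1 + exp (5 * M) * (2 * real N0) powr M) ^ N0"
      proof (rule chain_sum_le_power)
        fix n s assume a: "n \<ge> 1" "n \<le> N0" "s \<in> set (c x # vals cs x)"
        have "norm (wL (T x) n s) \<le> exp (5 * M) * (2 * real n) powr M"
          by (rule wL_bound) (use a x T_small Cons.prems(1) in \<open>auto simp: good_def\<close>)
        also have "\<dots> \<le> exp (5 * M) * (2 * real N0) powr M" using a M_nonneg by (intro mult_left_mono powr_mono2) auto
        finally show "norm (wL (T x) n s) \<le> exp (5 * M) * (2 * real N0) powr M" .
      qed auto
      moreover have "norm (antidiff K w0 (F x) (lpt (T x) N0)) \<le> C2 * (2 powr \<bar>real (Suc n) * (M + 2)\<bar> * real N0 powr (real (Suc n) * (M + 2)))"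
        using C2(2)[OF x N2(2)[of N0, OF _ T_small[OF x]]] Re_lpt[OF T_small[OF x] N01] C2(1)
        unfolding N0_def by (meson max.cobounded2 mult_left_mono order_trans less_imp_le)
      moreover have "norm (d N0 x - lim (\<lambda>N. d N x)) \<le> \<bar>C'\<bar>"
      proof -
        have "norm (d N0 x - lim (\<lambda>N. d N x)) \<le> C' * real N0 powr (- L')" using C'[OF x] by simp
        also have "\<dots> \<le> \<bar>C'\<bar> * 1"
        proof (rule mult_mono)
          show "real N0 powr (- L') \<le> 1" using powr_mono[of "- L'" 0 "real N0"] N01 L'(1) by simp
        qed auto
        finally show ?thesis by simp
      qed
      moreover have "lim (\<lambda>N. d N x) = chain_sum (wL (T x)) N0 (c x # vals cs x) - antidiff K w0 (F x) (lpt (T x) N0) - (d N0 x - lim (\<lambda>N. d N x))"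
        unfolding d_def by simp
      ultimately show ?thesis
        by (smt (verit, best) norm_triangle_ineq4)
    qed
    \<comment> \<open>The sequence is shifted by N0 because only from there on do the points lie in
      the strip and does the rate hold.\<close>
    moreover have "(\<lambda>x. lim (\<lambda>N. d N x)) holomorphic_on S" if h: H
    proof (rule holomorphic_uniform_sequence[OF S_open[OF h], of "\<lambda>N. d (N + N0)"])
      obtain t where t: "\<forall>x\<in>S. T x = t" using T_const[OF h] by blast
      fix N
      show "d (N + N0) holomorphic_on S"
      proof (cases "S = {}")
        case False
        then have tn: "norm t \<le> 1/2" using t T_small by auto
        have "(\<lambda>x. chain_sum (wL t) (N + N0) (vals (c # cs) x) - antidiff K w0 (F x) (lpt t (N + N0))) holomorphic_on S"
        proof (rule holomorphic_on_diff)
          show "(\<lambda>x. chain_sum (wL t) (N + N0) (vals (c # cs) x)) holomorphic_on S"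
          proof (rule chain_sum_holomorphic)
            fix c' n assume "c' \<in> set (c # cs)"
            then have "c' holomorphic_on S" using Cons.prems(1) h unfolding good_def by blast
            then show "(\<lambda>x. wL t n (c' x)) holomorphic_on S" unfolding wL_def by (intro holomorphic_intros)
          qed
          show "(\<lambda>x. antidiff K w0 (F x) (lpt t (N + N0))) holomorphic_on S"
            using AD h N2(2)[of "N + N0", OF _ tn] unfolding symb_def N0_def by auto
        qed
        then show ?thesis unfolding d_def using t by (subst holomorphic_cong[OF refl]) auto
      qed (auto intro: holomorphic_on_empty)
    next
      fix x assume "x \<in> S"
      then obtain r where r: "r > 0" "cball x r \<subseteq> S" using S_open[OF h] open_contains_cball by blast
      have "uniform_limit (cball x r) (\<lambda>N. d (N + N0)) (\<lambda>x. lim (\<lambda>N. d N x)) sequentially"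
      proof (rule uniform_limitI)
        fix e :: real assume e: "e > 0"
        have "(\<lambda>N. C' * real (N + N0) powr (- L')) \<longlonglongrightarrow> C' * 0"
          by (intro tendsto_mult tendsto_const LIMSEQ_ignore_initial_segment[of "\<lambda>N. real N powr (- L')"] tendsto_neg_powr filterlim_real_sequentially) (use L' in auto)
        then have "\<forall>\<^sub>F N in sequentially. C' * real (N + N0) powr (- L') < e"
          using e by (simp add: order_tendstoD(2))
        then show "\<forall>\<^sub>F N in sequentially. \<forall>y\<in>cball x r. dist (d (N + N0) y) (lim (\<lambda>N. d N y)) < e"
        proof eventually_elim
          case (elim N)
          then show ?case using C'[of _ "N + N0"] r(2) by (fastforce simp: dist_norm)
        qed
      qed
      then show "\<exists>r>0. cball x r \<subseteq> S \<and> uniform_limit (cball x r) (\<lambda>N. d (N + N0)) (\<lambda>x. lim (\<lambda>N. d N x)) sequentially"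
        using r by blast
    qed
    ultimately show "symb H S (lev K (Suc n)) (real (Suc n) * (M + 2)) (\<lambda>x w. lim (\<lambda>N. d N x))"
      using M_nonneg by (intro symb_const) auto
  qed
  ultimately show ?case unfolding n_def L'_def by simp
qed

end

section \<open>The entire extension\<close>

text \<open>For Re s > 1 the expansion has the same limit along lpt t N and along rpt (Suc N), so this
  is the truncated series for zetaU up to o(1).  Evaluated at rpt (Suc N), the difference equation of
  the expansion makes it constant in N up to an error that is small for every s.\<close>

definition zetaU_ext_seq :: "nat \<Rightarrow> complex \<Rightarrow> complex \<Rightarrow> complex list \<Rightarrow> nat \<Rightarrow> complex" where
  "zetaU_ext_seq K w0 t s N = (\<Sum>i\<le>length s. chain_sum wR N (rev (take i s)) * chain_asym K w0 t (drop i s) (rpt (Suc N)))"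

definition zetaU_ext_at :: "nat \<Rightarrow> complex \<Rightarrow> complex \<Rightarrow> complex list \<Rightarrow> complex" where
  "zetaU_ext_at K w0 t s = lim (zetaU_ext_seq K w0 t s)"

lemma chain_sum_rev_take_Suc:
  assumes "i < length s"
  shows "chain_sum g (Suc N) (rev (take (Suc i) s))
    = chain_sum g N (rev (take (Suc i) s)) + g (Suc N) (s ! i) * chain_sum g N (rev (take i s))"
  using assms by (simp add: take_Suc_conv_app_nth)

text \<open>Grouping by the right factor with i entries, the new right summand at N + 1 joins the
  change of the expansion of \<open>drop i s\<close>. The bracket is the difference equation at w =
  \<open>rpt (Suc N)\<close>, whose shift is \<open>rpt (Suc (Suc N))\<close>; this match is the
  reason for evaluating at Suc N.\<close>

lemma zetaU_ext_seq_diff: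
  "zetaU_ext_seq K w0 t s (Suc N) - zetaU_ext_seq K w0 t s N = (\<Sum>i<length s. chain_sum wR N (rev (take i s)) *
     (chain_asym K w0 t (drop i s) (rpt (Suc (Suc N))) - chain_asym K w0 t (drop i s) (rpt (Suc N))
      + wR (Suc N) (s ! i) * chain_asym K w0 t (drop (Suc i) s) (rpt (Suc (Suc N)))))"
proof -
  let ?r = "length s"
  let ?p = "\<lambda>i. chain_sum wR N (rev (take i s))"
  let ?a = "\<lambda>i. chain_asym K w0 t (drop i s) (rpt (Suc N))"
  let ?b = "\<lambda>i. chain_asym K w0 t (drop i s) (rpt (Suc (Suc N)))"
  have "zetaU_ext_seq K w0 t s (Suc N) = ?b 0 + (\<Sum>i<?r. chain_sum wR (Suc N) (rev (take (Suc i) s)) * ?b (Suc i))"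
    unfolding zetaU_ext_seq_def by (subst sum.atMost_shift) simp
  also have "\<dots> = ?b 0 + (\<Sum>i<?r. ?p (Suc i) * ?b (Suc i)) + (\<Sum>i<?r. ?p i * (wR (Suc N) (s ! i) * ?b (Suc i)))"
    by (simp add: chain_sum_rev_take_Suc algebra_simps sum.distrib del: chain_sum.simps)
  also have "?b 0 + (\<Sum>i<?r. ?p (Suc i) * ?b (Suc i)) = (\<Sum>i\<le>?r. ?p i * ?b i)"
    by (subst sum.atMost_shift) simp
  also have "\<dots> = (\<Sum>i<?r. ?p i * ?b i) + ?p ?r"
    by (simp add: lessThan_Suc_atMost[symmetric])
  finally have 1: "zetaU_ext_seq K w0 t s (Suc N) = (\<Sum>i<?r. ?p i * ?b i) + ?p ?r + (\<Sum>i<?r. ?p i * (wR (Suc N) (s ! i) * ?b (Suc i)))" .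
  have 2: "zetaU_ext_seq K w0 t s N = (\<Sum>i<?r. ?p i * ?a i) + ?p ?r"
    unfolding zetaU_ext_seq_def by (simp add: lessThan_Suc_atMost[symmetric])
  show ?thesis unfolding 1 2 by (simp add: algebra_simps sum.distrib sum_subtractf)
qed

context chain_asym_family begin

lemma right_growth:
  assumes "\<forall>c\<in>set cs. good (- M) c"
  shows "\<exists>C. \<forall>x\<in>S. \<forall>N\<ge>1. norm (chain_sum wR N (vals cs x)) \<le> C * real N powr (real (length cs) * (M + 2))"
  using assms
proof (induction cs)
  case Nil
  then show ?case by (auto intro!: exI[of _ 1])
next
  case (Cons c cs)
  then obtain C where C: "\<forall>x\<in>S. \<forall>N\<ge>1. norm (chain_sum wR N (vals cs x)) \<le> C * real N powr (real (length cs) * (M + 2))"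
    by auto
  have "norm (wR n (c x)) \<le> (exp (5 * M) * 2 powr M) * real n powr M" if "x \<in> S" "n \<ge> 1" for x n
    using wR_bound[of "c x" M n] that Cons.prems by (auto simp: good_def powr_mult mult.assoc)
  note g = this
  have B0: "norm (chain_sum wR 0 u) \<le> 1" for u by (cases u) auto
  have "\<exists>C'. \<forall>x\<in>S. \<forall>N\<ge>1. norm (chain_sum wR N (c x # vals cs x)) \<le> C' * real N powr (real (Suc (length cs)) * (M + 2))"
  proof (rule chain_growth_step[where B = "\<lambda>x N. chain_sum wR N (vals cs x)" and g = "\<lambda>x n. wR n (c x)"
          and a = M and b = "real (length cs) * (M + 2)", OF _ _ _ B0 g])
    show "norm (chain_sum wR N (vals cs x)) \<le> C * real N powr (real (length cs) * (M + 2))" if "x \<in> S" "N \<ge> 1" for x N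
      using C that by blast
  qed (use M_nonneg in \<open>auto simp: algebra_simps\<close>)
  then show ?case by simp
qed

text \<open>This is \<open>antidiff_shift\<close> read on the whole strip and not only at the points
  \<open>lpt t N\<close> that fix the constants. It thereby becomes available on the positive side,
  where the left sums themselves have no meaning.\<close>

lemma chain_asym_residual:
  assumes "\<forall>c\<in>set (c # cs). good (- M) c" "w0 \<in> lstrip (lev K (Suc (length cs)))" "real K > real (length cs) * (2 * M + 4)"
  shows "\<exists>C. \<forall>x\<in>S. \<forall>w\<in>lstrip (lev K (Suc (length cs))).
    norm (chain_asym K w0 (T x) (vals (c # cs) x) (shiftw w) - chain_asym K w0 (T x) (vals (c # cs) x) w
      + exp (- c x * w) * chain_asym K w0 (T x) (vals cs x) (shiftw w)) \<le> C * exp ((real (length cs) * (M + 2) + M - real K) * Re w)"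
proof -
  have w0': "w0 \<in> lstrip (lev K (length cs))" using assms(2) lstrip_mono[OF lev_mono[of "length cs" "Suc (length cs)" K]] by auto
  have A: "symb H S (lev K (length cs)) (real (length cs) * (M + 2)) (\<lambda>x. chain_asym K w0 (T x) (vals cs x))"
    using chain_asym_main[OF _ w0' assms(3)] assms(1) by auto
  have F: "symb H S (Suc (lev K (length cs))) (real (length cs) * (M + 2) - - M) (\<lambda>x. asrc (c x) (chain_asym K w0 (T x) (vals cs x)))"
    by (rule symb_asrc[OF A]) (use assms in auto)
  have "symb H S (lev K (Suc (length cs))) (real (length cs) * (M + 2) - - M - real K) (\<lambda>x. fiter w0 K (asrc (c x) (chain_asym K w0 (T x) (vals cs x))))"
    unfolding lev_Suc by (rule symb_fiter[OF F S_open]) (use assms(2) in \<open>auto simp: lev_Suc\<close>)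
  then obtain C where C: "C > 0" "\<And>x w. x \<in> S \<Longrightarrow> w \<in> lstrip (lev K (Suc (length cs))) \<Longrightarrow>
      norm (fiter w0 K (asrc (c x) (chain_asym K w0 (T x) (vals cs x))) w) \<le> C * exp ((real (length cs) * (M + 2) - - M - real K) * Re w)"
    by (rule symb_bound) blast
  have "chain_asym K w0 (T x) (vals (c # cs) x) (shiftw w) - chain_asym K w0 (T x) (vals (c # cs) x) w
      + exp (- c x * w) * chain_asym K w0 (T x) (vals cs x) (shiftw w)
     = - ((-1)^K * fiter w0 K (asrc (c x) (chain_asym K w0 (T x) (vals cs x))) w)" for x w
    using antidiff_shift[of K w0 "asrc (c x) (chain_asym K w0 (T x) (vals cs x))" w] by (simp add: asrc_def algebra_simps)
  then show ?thesis using C by (auto simp: norm_mult norm_power intro!: exI[of _ C])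
qed

lemma vals_drop: "drop i (vals cs x) = vals (drop i cs) x" and vals_take: "take i (vals cs x) = vals (take i cs) x"
  by (simp_all add: drop_map take_map)

text \<open>The residual of order r (M + 2) + M - K is multiplied by right chain sums of size N^(r
  (M + 2)). The hypothesis on K brings the increments down to N^(-3), so
  \<open>telescoping_limit\<close> applies uniformly in the parameter and holomorphy passes to the
  limit.\<close>

lemma zetaU_ext_at_main:
  assumes cs: "\<forall>c\<in>set cs. good (- M) c" and w0: "w0 \<in> lstrip (lev K (length cs))"
    and K: "real K > (2 * real (length cs) + 2) * (2 * M + 4)"
  shows "\<exists>C N0. N0 \<ge> 1 \<and> (\<forall>x\<in>S. \<forall>N\<ge>N0. norm (zetaU_ext_seq K w0 (T x) (vals cs x) N - zetaU_ext_at K w0 (T x) (vals cs x)) \<le> C * real N powr (-1))"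
    and "H \<Longrightarrow> (\<lambda>x. zetaU_ext_at K w0 (T x) (vals cs x)) holomorphic_on S"
proof -
  define r where "r = length cs"
  have rb: "\<exists>C. \<forall>x\<in>S. \<forall>N\<ge>1. norm (chain_sum wR N (rev (take i (vals cs x)))) \<le> C * real N powr (real r * (M + 2))" if "i \<le> r" for i
  proof -
    have "\<forall>c\<in>set (rev (take i cs)). good (- M) c" using cs by (auto dest: in_set_takeD)
    from right_growth[OF this] that obtain C where C: "\<forall>x\<in>S. \<forall>N\<ge>1. norm (chain_sum wR N (vals (rev (take i cs)) x)) \<le> C * real N powr (real i * (M + 2))"
      unfolding r_def by auto
    have "norm (chain_sum wR N (rev (take i (vals cs x)))) \<le> \<bar>C\<bar> * real N powr (real r * (M + 2))" if "x \<in> S" "N \<ge> 1" for x N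
    proof -
      have "norm (chain_sum wR N (rev (take i (vals cs x)))) \<le> C * real N powr (real i * (M + 2))"
        using C that by (simp add: rev_map take_map)
      also have "\<dots> \<le> \<bar>C\<bar> * real N powr (real r * (M + 2))"
        using that \<open>i \<le> r\<close> M_nonneg by (intro mult_mono powr_mono mult_right_mono) auto
      finally show ?thesis .
    qed
    then show ?thesis by blast
  qed
  then obtain P where P: "\<And>i x N. i \<le> r \<Longrightarrow> x \<in> S \<Longrightarrow> N \<ge> 1 \<Longrightarrow> norm (chain_sum wR N (rev (take i (vals cs x)))) \<le> P i * real N powr (real r * (M + 2))"
    by metis
  have "\<exists>C. \<forall>x\<in>S. \<forall>w\<in>lstrip (lev K r).
      norm (chain_asym K w0 (T x) (drop i (vals cs x)) (shiftw w) - chain_asym K w0 (T x) (drop i (vals cs x)) w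
      + exp (- (vals cs x ! i) * w) * chain_asym K w0 (T x) (drop (Suc i) (vals cs x)) (shiftw w)) \<le> C * exp ((real r * (M + 2) + M - real K) * Re w)"
    if i: "i < r" for i
  proof -
    have dr: "drop i cs = cs ! i # drop (Suc i) cs" using i unfolding r_def by (simp add: Cons_nth_drop_Suc)
    have g: "\<forall>c\<in>set (cs ! i # drop (Suc i) cs). good (- M) c" using cs unfolding dr[symmetric] by (auto dest: in_set_dropD)
    let ?l = "length (drop (Suc i) cs)"
    have l: "Suc ?l \<le> r" using i unfolding r_def by simp
    have sub: "lstrip (lev K r) \<subseteq> lstrip (lev K (Suc ?l))" by (rule lstrip_mono[OF lev_mono[OF l]])
    have Kl: "real K > real ?l * (2 * M + 4)"
    proof -
      have "real ?l * (2 * M + 4) \<le> (2 * real r + 2) * (2 * M + 4)" using l M_nonneg by (intro mult_right_mono) auto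
      then show ?thesis using K unfolding r_def by linarith
    qed
    from chain_asym_residual[OF g _ Kl, of w0] w0 sub obtain C where C: "\<forall>x\<in>S. \<forall>w\<in>lstrip (lev K (Suc ?l)).
      norm (chain_asym K w0 (T x) (vals (cs ! i # drop (Suc i) cs) x) (shiftw w) - chain_asym K w0 (T x) (vals (cs ! i # drop (Suc i) cs) x) w
      + exp (- (cs ! i) x * w) * chain_asym K w0 (T x) (vals (drop (Suc i) cs) x) (shiftw w)) \<le> C * exp ((real ?l * (M + 2) + M - real K) * Re w)"
      unfolding r_def by blast
    have "norm (chain_asym K w0 (T x) (drop i (vals cs x)) (shiftw w) - chain_asym K w0 (T x) (drop i (vals cs x)) w
      + exp (- (vals cs x ! i) * w) * chain_asym K w0 (T x) (drop (Suc i) (vals cs x)) (shiftw w)) \<le> \<bar>C\<bar> * exp ((real r * (M + 2) + M - real K) * Re w)"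
      if x: "x \<in> S" "w \<in> lstrip (lev K r)" for x w
    proof -
      have "vals cs x ! i = (cs ! i) x" using i unfolding r_def by simp
      then have "norm (chain_asym K w0 (T x) (drop i (vals cs x)) (shiftw w) - chain_asym K w0 (T x) (drop i (vals cs x)) w
      + exp (- (vals cs x ! i) * w) * chain_asym K w0 (T x) (drop (Suc i) (vals cs x)) (shiftw w)) \<le> C * exp ((real ?l * (M + 2) + M - real K) * Re w)"
        unfolding vals_drop dr using C x sub by auto
      also have "\<dots> \<le> \<bar>C\<bar> * exp ((real r * (M + 2) + M - real K) * Re w)"
      proof -
        have "(real ?l * (M + 2) + M - real K) * Re w \<le> (real r * (M + 2) + M - real K) * Re w"
          using l M_nonneg lstrip_Re_pos[OF x(2)] by (intro mult_right_mono diff_right_mono add_right_mono) auto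
        then show ?thesis by (intro mult_mono) auto
      qed
      finally show ?thesis .
    qed
    then show ?thesis by blast
  qed
  then obtain Q where Q: "\<And>i x w. i < r \<Longrightarrow> x \<in> S \<Longrightarrow> w \<in> lstrip (lev K r) \<Longrightarrow>
      norm (chain_asym K w0 (T x) (drop i (vals cs x)) (shiftw w) - chain_asym K w0 (T x) (drop i (vals cs x)) w
      + exp (- (vals cs x ! i) * w) * chain_asym K w0 (T x) (drop (Suc i) (vals cs x)) (shiftw w)) \<le> Q i * exp ((real r * (M + 2) + M - real K) * Re w)"
    by metis
  obtain N2 where N2: "N2 \<ge> 1" "\<And>N. N \<ge> N2 \<Longrightarrow> rpt N \<in> lstrip (lev K r)"
    using lpt_in_lstrip[of "lev K r"] by (metis norm_zero zero_le_divide_1_iff zero_le_numeral)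
  obtain N3 where N3: "N3 \<ge> 1" "\<And>N. N \<ge> N3 \<Longrightarrow> rpt N \<in> lstrip (Suc (lev K r))"
    using lpt_in_lstrip[of "Suc (lev K r)"] by (metis norm_zero zero_le_divide_1_iff zero_le_numeral)
  define N0 where "N0 = max N2 N3"
  have step: "norm (zetaU_ext_seq K w0 (T x) (vals cs x) (Suc N) - zetaU_ext_seq K w0 (T x) (vals cs x) N) \<le> (\<Sum>i<r. \<bar>P i\<bar> * \<bar>Q i\<bar>) * real N powr (- 1 - 2)"
    if x: "x \<in> S" and N: "N \<ge> N0" for x N
  proof -
    have NN: "N \<ge> 1" "Suc N \<ge> N2" "Suc N \<ge> N3" "Suc (Suc N) \<ge> N2" using N N2(1) unfolding N0_def by auto
    have sh: "shiftw (rpt (Suc N)) = rpt (Suc (Suc N))"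
      by (rule shiftw_pts(2)[of 0]) (use NN N2(2) N3(2) in auto)
    have e0: "real r * (M + 2) + M - real K \<le> 0" "real r * (M + 2) + (real r * (M + 2) + M - real K) \<le> - 1 - 2"
      using K M_nonneg unfolding r_def by (auto simp: algebra_simps intro: order_trans[OF _ less_imp_le])
    have "norm (zetaU_ext_seq K w0 (T x) (vals cs x) (Suc N) - zetaU_ext_seq K w0 (T x) (vals cs x) N)
      \<le> (\<Sum>i<r. (\<bar>P i\<bar> * \<bar>Q i\<bar>) * real N powr (- 1 - 2))"
      unfolding zetaU_ext_seq_diff length_map r_def[symmetric]
    proof (rule sum_norm_le)
      fix i assume i: "i \<in> {..<r}"
      let ?R = "chain_asym K w0 (T x) (drop i (vals cs x)) (rpt (Suc (Suc N))) - chain_asym K w0 (T x) (drop i (vals cs x)) (rpt (Suc N))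
        + wR (Suc N) (vals cs x ! i) * chain_asym K w0 (T x) (drop (Suc i) (vals cs x)) (rpt (Suc (Suc N)))"
      have "norm ?R \<le> Q i * exp ((real r * (M + 2) + M - real K) * Re (rpt (Suc N)))"
        using Q[of i x "rpt (Suc N)"] i x NN N2(2) unfolding sh wR_def by simp
      also have "\<dots> \<le> \<bar>Q i\<bar> * real N powr (real r * (M + 2) + M - real K)"
        using NN e0 by (subst Re_rpt) (auto intro!: mult_mono powr_mono2')
      finally have 1: "norm ?R \<le> \<bar>Q i\<bar> * real N powr (real r * (M + 2) + M - real K)" .
      have 2: "norm (chain_sum wR N (rev (take i (vals cs x)))) \<le> \<bar>P i\<bar> * real N powr (real r * (M + 2))"
        using P[of i x N] i x NN by (auto intro: order_trans[OF _ mult_right_mono])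
      have "norm (chain_sum wR N (rev (take i (vals cs x))) * ?R) \<le> (\<bar>P i\<bar> * real N powr (real r * (M + 2))) * (\<bar>Q i\<bar> * real N powr (real r * (M + 2) + M - real K))"
        unfolding norm_mult using 1 2 by (intro mult_mono) auto
      also have "\<dots> = (\<bar>P i\<bar> * \<bar>Q i\<bar>) * real N powr (real r * (M + 2) + (real r * (M + 2) + M - real K))"
        unfolding powr_add[of _ "real r * (M + 2)" "real r * (M + 2) + M - real K"] by (simp only: mult_ac)
      also have "\<dots> \<le> (\<bar>P i\<bar> * \<bar>Q i\<bar>) * real N powr (- 1 - 2)"
        using NN e0 by (intro mult_left_mono powr_mono) auto
      finally show "norm (chain_sum wR N (rev (take i (vals cs x))) * ?R) \<le> (\<bar>P i\<bar> * \<bar>Q i\<bar>) * real N powr (- 1 - 2)" .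
    qed
    then show ?thesis by (simp add: sum_distrib_right)
  qed
  have N01: "N0 \<ge> 1" using N2(1) unfolding N0_def by auto
  obtain C where C: "\<And>x N. x \<in> S \<Longrightarrow> N \<ge> N0 \<Longrightarrow> norm (zetaU_ext_seq K w0 (T x) (vals cs x) N - zetaU_ext_at K w0 (T x) (vals cs x)) \<le> C * real N powr (-1)"
    using telescoping_limit(2)[of S N0 "\<lambda>N x. zetaU_ext_seq K w0 (T x) (vals cs x) N", OF step _ N01] unfolding zetaU_ext_at_def by auto
  show "\<exists>C N0. N0 \<ge> 1 \<and> (\<forall>x\<in>S. \<forall>N\<ge>N0. norm (zetaU_ext_seq K w0 (T x) (vals cs x) N - zetaU_ext_at K w0 (T x) (vals cs x)) \<le> C * real N powr (-1))"
    using C N01 by blast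
  assume h: H
  show "(\<lambda>x. zetaU_ext_at K w0 (T x) (vals cs x)) holomorphic_on S"
  proof (rule holomorphic_uniform_sequence[OF S_open[OF h], of "\<lambda>N x. zetaU_ext_seq K w0 (T x) (vals cs x) (N + N0)"])
    fix N
    show "(\<lambda>x. zetaU_ext_seq K w0 (T x) (vals cs x) (N + N0)) holomorphic_on S"
      unfolding zetaU_ext_seq_def length_map
    proof (intro holomorphic_intros)
      fix i assume i: "i \<in> {..length cs}"
      have "(\<lambda>x. chain_sum wR (N + N0) (vals (rev (take i cs)) x)) holomorphic_on S"
      proof (rule chain_sum_holomorphic)
        fix c n assume "c \<in> set (rev (take i cs))"
        then have "c holomorphic_on S" using cs h unfolding good_def by (auto dest: in_set_takeD)
        then show "(\<lambda>x. wR n (c x)) holomorphic_on S" unfolding wR_def by (intro holomorphic_intros)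
      qed
      then show "(\<lambda>x. chain_sum wR (N + N0) (rev (take i (vals cs x)))) holomorphic_on S"
        by (simp add: rev_map take_map)
      have l: "length (drop i cs) \<le> r" unfolding r_def by simp
      have Kl: "real K > real (length (drop i cs)) * (2 * M + 4)"
      proof -
        have "real (length (drop i cs)) * (2 * M + 4) \<le> (2 * real r + 2) * (2 * M + 4)" using l M_nonneg by (intro mult_right_mono) auto
        then show ?thesis using K unfolding r_def by linarith
      qed
      have "symb H S (lev K (length (drop i cs))) (real (length (drop i cs)) * (M + 2)) (\<lambda>x. chain_asym K w0 (T x) (vals (drop i cs) x))"
        using chain_asym_main[OF _ _ Kl, of w0] w0 cs lstrip_mono[OF lev_mono[OF l, of K]] unfolding r_def by (auto dest: in_set_dropD)
      then have "(\<lambda>x. chain_asym K w0 (T x) (vals (drop i cs) x) w) holomorphic_on S" if "w \<in> lstrip (lev K r)" for w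
        using that h lstrip_mono[OF lev_mono[OF l, of K]] unfolding symb_def by auto
      then show "(\<lambda>x. chain_asym K w0 (T x) (drop i (vals cs x)) (rpt (Suc (N + N0)))) holomorphic_on S"
        unfolding vals_drop using N2(2) unfolding N0_def by auto
    qed
  next
    fix x assume "x \<in> S"
    then obtain d where d: "d > 0" "cball x d \<subseteq> S" using S_open[OF h] open_contains_cball by blast
    have "uniform_limit (cball x d) (\<lambda>N x. zetaU_ext_seq K w0 (T x) (vals cs x) (N + N0)) (\<lambda>x. zetaU_ext_at K w0 (T x) (vals cs x)) sequentially"
    proof (rule uniform_limitI)
      fix e :: real assume e: "e > 0"
      have "(\<lambda>N. C * real (N + N0) powr (-1)) \<longlonglongrightarrow> C * 0"
        by (intro tendsto_mult tendsto_const LIMSEQ_ignore_initial_segment[of "\<lambda>N. real N powr (-1)"] tendsto_neg_powr filterlim_real_sequentially) auto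
      then have "\<forall>\<^sub>F N in sequentially. C * real (N + N0) powr (-1) < e"
        using e by (simp add: order_tendstoD(2))
      then show "\<forall>\<^sub>F N in sequentially. \<forall>y\<in>cball x d. dist (zetaU_ext_seq K w0 (T y) (vals cs y) (N + N0)) (zetaU_ext_at K w0 (T y) (vals cs y)) < e"
      proof eventually_elim
        case (elim N)
        then show ?case using C[of _ "N + N0"] d(2) by (fastforce simp: dist_norm)
      qed
    qed
    then show "\<exists>d>0. cball x d \<subseteq> S \<and> uniform_limit (cball x d) (\<lambda>N x. zetaU_ext_seq K w0 (T x) (vals cs x) (N + N0)) (\<lambda>x. zetaU_ext_at K w0 (T x) (vals cs x)) sequentially"
      using d by blast
  qed
qed

end

section \<open>Series over increasing tuples as limits of chain sums\<close>

lemma finite_incr_tuples: "finite (incr_tuples r p)"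
proof (rule finite_subset)
  show "incr_tuples r p \<subseteq> {ns. set ns \<subseteq> {..<p} \<and> length ns = r}" unfolding incr_tuples_def by auto
qed (rule finite_lists_length_eq, simp)

lemma incr_tuples_Suc:
  "incr_tuples (Suc r) (Suc (Suc N)) = incr_tuples (Suc r) (Suc N) \<union> (\<lambda>ns. ns @ [Suc N]) ` incr_tuples r (Suc N)"
proof (intro equalityI subsetI)
  fix ns assume a: "ns \<in> incr_tuples (Suc r) (Suc (Suc N))"
  then have l: "length ns = Suc r" and s: "sorted_wrt (<) ns" and b: "\<forall>n\<in>set ns. 0 < n \<and> n < Suc (Suc N)"
    unfolding incr_tuples_def by auto
  obtain ms m where ns: "ns = ms @ [m]" using l by (cases ns rule: rev_cases) auto
  have ms: "length ms = r" "sorted_wrt (<) ms" "\<forall>x\<in>set ms. x < m" "\<forall>n\<in>set ms. 0 < n" "0 < m" "m < Suc (Suc N)"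
    using l s b unfolding ns by (auto simp: sorted_wrt_append)
  show "ns \<in> incr_tuples (Suc r) (Suc N) \<union> (\<lambda>ns. ns @ [Suc N]) ` incr_tuples r (Suc N)"
  proof (cases "m = Suc N")
    case True
    then have "ms \<in> incr_tuples r (Suc N)" using ms unfolding incr_tuples_def by auto
    then show ?thesis using True ns by auto
  next
    case False
    then have "m < Suc N" using ms by simp
    then have "\<forall>n\<in>set ns. 0 < n \<and> n < Suc N" using ms unfolding ns by auto
    then have "ns \<in> incr_tuples (Suc r) (Suc N)" using l s unfolding incr_tuples_def by simp
    then show ?thesis by simp
  qed
next
  fix ns assume "ns \<in> incr_tuples (Suc r) (Suc N) \<union> (\<lambda>ns. ns @ [Suc N]) ` incr_tuples r (Suc N)"
  then show "ns \<in> incr_tuples (Suc r) (Suc (Suc N))"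
    unfolding incr_tuples_def by (auto simp: sorted_wrt_append less_Suc_eq)
qed

text \<open>Tuples list the smallest variable first and \<open>chain_sum\<close> the largest, hence
  \<open>rev\<close>. The tuples below N + 2 split according to whether their last entry is N + 1,
  which is the recursion of \<open>chain_sum\<close>.\<close>

lemma sum_incr_tuples:
  fixes g :: "nat \<Rightarrow> 'b \<Rightarrow> 'a::comm_ring_1"
  shows "(\<Sum>ns\<in>incr_tuples (length k) (Suc N). \<Prod>j<length k. g (ns ! j) (k ! j)) = chain_sum g N (rev k)"
proof (induction N arbitrary: k)
  case 0
  show ?case
  proof (cases k rule: rev_cases)
    case Nil
    then have "incr_tuples (length k) (Suc 0) = {[]}" unfolding incr_tuples_def by auto
    then show ?thesis using Nil by simp
  next
    case (snoc k' s)
    then have "incr_tuples (length k) (Suc 0) = {}" unfolding incr_tuples_def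
      by (auto simp: length_Suc_conv)
    then show ?thesis using snoc by simp
  qed
next
  case (Suc N)
  show ?case
  proof (cases k rule: rev_cases)
    case Nil
    then have "incr_tuples (length k) (Suc (Suc N)) = {[]}" unfolding incr_tuples_def by auto
    then show ?thesis using Nil by simp
  next
    case (snoc k' s)
    let ?f = "\<lambda>k ns. \<Prod>j<length k. g (ns ! j) (k ! j)"
    have inj: "inj_on (\<lambda>ns. ns @ [Suc N]) (incr_tuples (length k') (Suc N))" by (rule inj_onI) simp
    have dis: "incr_tuples (Suc (length k')) (Suc N) \<inter> (\<lambda>ns. ns @ [Suc N]) ` incr_tuples (length k') (Suc N) = {}"
      unfolding incr_tuples_def by auto
    have "(\<Sum>ns\<in>incr_tuples (length k) (Suc (Suc N)). ?f k ns) =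
      (\<Sum>ns\<in>incr_tuples (length k) (Suc N). ?f k ns) + (\<Sum>ns\<in>incr_tuples (length k') (Suc N). ?f k (ns @ [Suc N]))"
      using snoc inj dis finite_incr_tuples
      by (simp add: incr_tuples_Suc sum.union_disjoint sum.reindex)
    also have "(\<Sum>ns\<in>incr_tuples (length k') (Suc N). ?f k (ns @ [Suc N])) = (\<Sum>ns\<in>incr_tuples (length k') (Suc N). ?f k' ns * g (Suc N) s)"
    proof (rule sum.cong[OF refl])
      fix ns assume "ns \<in> incr_tuples (length k') (Suc N)"
      then have l: "length ns = length k'" unfolding incr_tuples_def by simp
      have "(\<Prod>j<length k'. g ((ns @ [Suc N]) ! j) ((k' @ [s]) ! j)) = ?f k' ns"
        by (rule prod.cong) (auto simp: nth_append l)
      then show "?f k (ns @ [Suc N]) = ?f k' ns * g (Suc N) s" using snoc l by (simp add: nth_append)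
    qed
    also have "\<dots> = chain_sum g N (rev k') * g (Suc N) s" by (simp add: sum_distrib_right[symmetric] Suc.IH)
    finally show ?thesis using snoc Suc.IH[of k] by (simp add: mult.commute)
  qed
qed

lemma pos_incr_tuples_finite_subset:
  assumes "finite A" "A \<subseteq> pos_incr_tuples r"
  shows "\<exists>N0. \<forall>N\<ge>N0. A \<subseteq> incr_tuples r (Suc N)"
proof -
  define N0 where "N0 = Max (insert 0 (\<Union>ns\<in>A. set ns))"
  have fin: "finite (insert 0 (\<Union>ns\<in>A. set ns))" using assms by auto
  have "A \<subseteq> incr_tuples r (Suc N)" if "N \<ge> N0" for N
  proof
    fix ns assume ns: "ns \<in> A"
    have "n < Suc N" if "n \<in> set ns" for n
    proof -
      have "n \<le> N0" unfolding N0_def using fin ns that by (intro Max_ge) auto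
      then show ?thesis using \<open>N \<ge> N0\<close> by simp
    qed
    then show "ns \<in> incr_tuples r (Suc N)" using ns assms unfolding pos_incr_tuples_def incr_tuples_def by auto
  qed
  then show ?thesis by blast
qed

text \<open>Bounded absolute partial sums give summability, and the sets of tuples with entries at
  most N are cofinal among the finite subsets, so the unordered sum is the limit along them.\<close>

lemma infsum_pos_incr_tuples:
  fixes g :: "nat \<Rightarrow> 'b \<Rightarrow> 'a::{comm_ring_1,banach,real_normed_field}"
  assumes "\<And>N. chain_sum (\<lambda>n s. norm (g n s)) N (rev k) \<le> C"
  shows "(\<lambda>N. chain_sum g N (rev k)) \<longlonglongrightarrow> (\<Sum>\<^sub>\<infinity>ns\<in>pos_incr_tuples (length k). \<Prod>j<length k. g (ns ! j) (k ! j))"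
proof -
  let ?f = "\<lambda>ns. \<Prod>j<length k. g (ns ! j) (k ! j)"
  have sub: "incr_tuples r (Suc N) \<subseteq> pos_incr_tuples r" for r N
    unfolding incr_tuples_def pos_incr_tuples_def by auto
  have "(\<lambda>ns. norm (?f ns)) summable_on pos_incr_tuples (length k)"
  proof (rule nonneg_bdd_above_summable_on)
    show "bdd_above (sum (\<lambda>ns. norm (?f ns)) ` {F. F \<subseteq> pos_incr_tuples (length k) \<and> finite F})"
    proof (rule bdd_aboveI2)
      fix F assume F: "F \<in> {F. F \<subseteq> pos_incr_tuples (length k) \<and> finite F}"
      then obtain N where N: "F \<subseteq> incr_tuples (length k) (Suc N)"
        using pos_incr_tuples_finite_subset[of F "length k"] by auto
      have "sum (\<lambda>ns. norm (?f ns)) F \<le> sum (\<lambda>ns. norm (?f ns)) (incr_tuples (length k) (Suc N))"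
        using N finite_incr_tuples by (intro sum_mono2) auto
      also have "\<dots> = chain_sum (\<lambda>n s. norm (g n s)) N (rev k)"
        using sum_incr_tuples[of "\<lambda>n s. norm (g n s)" k N] by (simp add: prod_norm)
      also have "\<dots> \<le> C" by (rule assms)
      finally show "sum (\<lambda>ns. norm (?f ns)) F \<le> C" .
    qed
  qed auto
  then have "?f summable_on pos_incr_tuples (length k)" by (rule abs_summable_summable)
  then have hs: "(sum ?f \<longlongrightarrow> infsum ?f (pos_incr_tuples (length k))) (finite_subsets_at_top (pos_incr_tuples (length k)))"
    using has_sum_infsum unfolding has_sum_def by blast
  have fl: "filterlim (\<lambda>N. incr_tuples (length k) (Suc N)) (finite_subsets_at_top (pos_incr_tuples (length k))) sequentially"
    unfolding filterlim_finite_subsets_at_top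
  proof (intro allI impI)
    fix A assume A: "finite A \<and> A \<subseteq> pos_incr_tuples (length k)"
    then obtain N0 where "\<forall>N\<ge>N0. A \<subseteq> incr_tuples (length k) (Suc N)" using pos_incr_tuples_finite_subset[of A "length k"] by auto
    then show "\<forall>\<^sub>F N in sequentially. finite (incr_tuples (length k) (Suc N)) \<and> A \<subseteq> incr_tuples (length k) (Suc N) \<and> incr_tuples (length k) (Suc N) \<subseteq> pos_incr_tuples (length k)"
      unfolding eventually_sequentially using finite_incr_tuples sub by blast
  qed
  from filterlim_compose[OF hs fl] show ?thesis by (simp add: sum_incr_tuples)
qed

lemma chain_sum_bounded:
  fixes g :: "nat \<Rightarrow> 'b \<Rightarrow> real"
  assumes g: "\<And>n s. n \<ge> 1 \<Longrightarrow> s \<in> set u \<Longrightarrow> 0 \<le> g n s \<and> g n s \<le> G * real n powr (- a)" and a: "a > 1"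
  shows "\<exists>C. \<forall>N. 0 \<le> chain_sum g N u \<and> chain_sum g N u \<le> C"
  using g
proof (induction u)
  case Nil
  then show ?case by (auto intro!: exI[of _ 1])
next
  case (Cons s u)
  then obtain C where C: "\<forall>N. 0 \<le> chain_sum g N u \<and> chain_sum g N u \<le> C" by auto
  then have C0: "C \<ge> 0" using order_trans by blast
  have sm: "summable (\<lambda>k. real k powr (- a))" using a by (subst summable_real_powr_iff) simp
  have G0: "0 \<le> G" using Cons.prems[of 1 s] by simp
  have "0 \<le> chain_sum g N (s # u) \<and> chain_sum g N (s # u) \<le> G * C * (\<Sum>k. real k powr (- a))" for N
  proof
    show "0 \<le> chain_sum g N (s # u)" unfolding chain_sum_unfold using Cons.prems C by (intro sum_nonneg mult_nonneg_nonneg) auto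
    have "chain_sum g N (s # u) \<le> (\<Sum>n<N. (G * real (Suc n) powr (- a)) * C)"
      unfolding chain_sum_unfold
    proof (intro sum_mono mult_mono)
      fix n show "g (Suc n) s \<le> G * real (Suc n) powr (- a)" using Cons.prems[of "Suc n" s] by auto
    qed (use C G0 in auto)
    also have "\<dots> = G * C * (\<Sum>k\<in>Suc ` {..<N}. real k powr (- a))"
      by (subst sum.reindex) (auto simp: sum_distrib_left algebra_simps)
    also have "\<dots> \<le> G * C * (\<Sum>k. real k powr (- a))"
      using G0 C0 by (intro mult_left_mono sum_le_suminf[OF sm]) auto
    finally show "chain_sum g N (s # u) \<le> G * C * (\<Sum>k. real k powr (- a))" .
  qed
  then show ?case by blast
qed

lemma chain_sum_cong:
  assumes "\<And>n s. n \<ge> 1 \<Longrightarrow> s \<in> set u \<Longrightarrow> g n s = h n s"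
  shows "chain_sum g N u = chain_sum h N u"
  using assms
proof (induction u arbitrary: N)
  case (Cons s u)
  then show ?case unfolding chain_sum_unfold by (intro sum.cong) auto
qed simp

lemma chain_sum_scale:
  assumes "\<And>n s. n \<ge> 1 \<Longrightarrow> s \<in> set u \<Longrightarrow> g n s = f s * h n s"
  shows "chain_sum g N u = prod_list (map f u) * chain_sum h N u"
  using assms
proof (induction u arbitrary: N)
  case (Cons s u)
  then have "chain_sum g N (s # u) = (\<Sum>n<N. (f s * h (Suc n) s) * (prod_list (map f u) * chain_sum h n u))"
    unfolding chain_sum_unfold by (intro sum.cong) auto
  also have "\<dots> = prod_list (map f (s # u)) * chain_sum h N (s # u)"
    unfolding chain_sum_unfold by (simp add: sum_distrib_left algebra_simps)
  finally show ?case .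
qed simp

lemma hzeta_tendsto:
  assumes t: "norm t \<le> 1/2" and s: "\<forall>z\<in>set s. Re z > 1"
  shows "(\<lambda>N. chain_sum (\<lambda>n z. (of_nat n - t) powr (- z)) N (rev s)) \<longlonglongrightarrow> hzeta s t"
proof -
  obtain a where a: "a > 1" "\<forall>z\<in>set s. a \<le> Re z"
  proof (cases "s = []")
    case True then show ?thesis using that[of 2] by simp
  next
    case False
    then show ?thesis using s that[of "Min (Re ` set s)"] by auto
  qed
  obtain b where b: "\<forall>z\<in>set s. norm z \<le> b" using finite_set bounded_iff finite_imp_bounded[of "set s"] by blast
  define G where "G = exp (5 * \<bar>b\<bar>) * 2 powr \<bar>b\<bar>"
  have "0 \<le> norm ((of_nat n - t) powr (- z)) \<and> norm ((of_nat n - t) powr (- z)) \<le> G * real n powr (- a)"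
    if n: "n \<ge> 1" and z: "z \<in> set (rev s)" for n z
  proof -
    note p = norm_nat_diff[OF t n]
    have zb: "norm z \<le> b" "Re z \<ge> a" using z a b by auto
    let ?L = "Ln (of_nat n - t)"
    have "\<bar>Im ?L\<bar> < pi/2" using Re_Ln_pos_lt_imp[of "of_nat n - t"] p(3) n by linarith
    then have im: "\<bar>Im ?L\<bar> \<le> 5" using pi_less_4 by linarith
    have "\<bar>Im z\<bar> * \<bar>Im ?L\<bar> \<le> \<bar>b\<bar> * 5" using zb abs_Im_le_cmod[of z] im by (intro mult_mono) auto
    then have 1: "Im z * Im ?L \<le> 5 * \<bar>b\<bar>" by (simp add: abs_mult[symmetric])
    have "Re ?L = ln (norm (of_nat n - t))" using p(4) by simp
    moreover have "ln (real n / 2) \<le> ln (norm (of_nat n - t))" using p(1) n by (subst ln_le_cancel_iff) auto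
    ultimately have "ln (real n) - ln 2 \<le> Re ?L" using n by (simp add: ln_div)
    then have "Re z * (ln (real n) - ln 2) \<le> Re z * Re ?L" using zb a by (intro mult_left_mono) auto
    then have "Re z * ln (real n) - Re z * ln 2 \<le> Re z * Re ?L" by (simp only: right_diff_distrib)
    moreover have "a * ln (real n) \<le> Re z * ln (real n)" using zb n by (intro mult_right_mono) auto
    moreover have "Re z * ln 2 \<le> \<bar>b\<bar> * ln 2" using zb complex_Re_le_cmod[of z] by (intro mult_right_mono) auto
    ultimately have 2: "- (Re z * Re ?L) \<le> \<bar>b\<bar> * ln 2 - a * ln (real n)" by linarith
    have "norm ((of_nat n - t) powr (- z)) = exp (- (Re z * Re ?L) + Im z * Im ?L)"
      using p(4) by (simp add: powr_def)
    also have "\<dots> \<le> exp (5 * \<bar>b\<bar> + (\<bar>b\<bar> * ln 2 + - a * ln (real n)))" using 1 2 by simp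
    also have "\<dots> = G * real n powr (- a)" unfolding exp_add G_def using n by (simp add: powr_def)
    finally show ?thesis by simp
  qed
  from chain_sum_bounded[of "rev s" "\<lambda>n z. norm ((of_nat n - t) powr (- z))", OF this a(1)]
  obtain C where "\<And>N. chain_sum (\<lambda>n z. norm ((of_nat n - t) powr (- z))) N (rev s) \<le> C" by blast
  from infsum_pos_incr_tuples[OF this] show ?thesis unfolding hzeta_def .
qed

lemma wR_powr: "n \<ge> 1 \<Longrightarrow> wR n s = of_nat n powr (- s)"
  by (simp add: wR_def rpt_def powr_def Ln_of_nat)

lemma wL_powr: "norm t \<le> 1/2 \<Longrightarrow> n \<ge> 1 \<Longrightarrow> wL t n s = exp (complex_of_real pi * \<i> * s) * (of_nat n - t) powr (- s)"
  using norm_nat_diff(4)[of t n] by (simp add: wL_def lpt_def powr_def exp_add[symmetric] algebra_simps)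

lemma wR_tendsto:
  assumes "\<forall>z\<in>set s. Re z > 1"
  shows "(\<lambda>N. chain_sum wR N (rev s)) \<longlonglongrightarrow> hzeta s 0"
  using hzeta_tendsto[of 0 s] assms chain_sum_cong[of "rev s" wR "\<lambda>n z. (of_nat n - 0) powr (- z)"] by (simp add: wR_powr)

lemma wL_tendsto:
  assumes "norm t \<le> 1/2" "\<forall>z\<in>set s. Re z > 1"
  shows "(\<lambda>N. chain_sum (wL t) N s) \<longlonglongrightarrow> exp (complex_of_real pi * \<i> * sum_list s) * hzeta (rev s) t"
proof -
  have e: "prod_list (map (\<lambda>s. exp (complex_of_real pi * \<i> * s)) s) = exp (complex_of_real pi * \<i> * sum_list s)"
    by (induction s) (auto simp: exp_add[symmetric] algebra_simps)
  have "chain_sum (wL t) N s = exp (complex_of_real pi * \<i> * sum_list s) * chain_sum (\<lambda>n z. (of_nat n - t) powr (- z)) N s" for N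
    using chain_sum_scale[of s "wL t" "\<lambda>s. exp (complex_of_real pi * \<i> * s)" "\<lambda>n z. (of_nat n - t) powr (- z)" N]
      wL_powr[OF assms(1)] unfolding e by simp
  then show ?thesis using hzeta_tendsto[of t "rev s"] assms by (auto intro!: tendsto_intros)
qed

text \<open>For small real t this is the sum over increasing chains in 1 < ... < N < t - N < ... < t
  - 1, where i counts the entries below the gap. The left list is not reversed, since a larger n
  means a smaller t - n.\<close>

definition trunc :: "complex \<Rightarrow> complex list \<Rightarrow> nat \<Rightarrow> complex" where
  "trunc t s N = (\<Sum>i\<le>length s. chain_sum wR N (rev (take i s)) * chain_sum (wL t) N (drop i s))"

lemma trunc_tendsto:
  assumes "norm t \<le> 1/2" "\<forall>z\<in>set s. Re z > 1"
  shows "trunc t s \<longlonglongrightarrow> zetaU_series s 0 t"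
proof -
  have "(\<lambda>N. \<Sum>i\<le>length s. chain_sum wR N (rev (take i s)) * chain_sum (wL t) N (drop i s))
    \<longlonglongrightarrow> (\<Sum>i\<le>length s. hzeta (take i s) 0 * (exp (complex_of_real pi * \<i> * sum_list (drop i s)) * hzeta (rev (drop i s)) t))"
    using assms by (intro tendsto_sum tendsto_mult wR_tendsto wL_tendsto) (auto dest: in_set_takeD in_set_dropD)
  then show ?thesis unfolding trunc_def zetaU_series_def by (simp add: mult_ac)
qed

text \<open>The coordinates are released one at a time from D0 to D, each by the identity theorem in
  one variable; joint holomorphy never enters.\<close>

lemma sep_holomorphic_identity:
  assumes D: "open D" "connected D" and D0: "open D0" "D0 \<noteq> {}" "D0 \<subseteq> D"
    and F: "\<And>u j. length u = r \<Longrightarrow> set u \<subseteq> D \<Longrightarrow> j < r \<Longrightarrow> (\<lambda>z. F (u[j := z])) holomorphic_on D"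
    and G: "\<And>u j. length u = r \<Longrightarrow> set u \<subseteq> D \<Longrightarrow> j < r \<Longrightarrow> (\<lambda>z. G (u[j := z])) holomorphic_on D"
    and eq: "\<And>u. length u = r \<Longrightarrow> set u \<subseteq> D0 \<Longrightarrow> F u = (G u :: complex)"
    and u: "length u = r" "set u \<subseteq> D"
  shows "F u = G u"
proof -
  have "\<forall>u. length u = r \<and> set u \<subseteq> D \<and> (\<forall>i<r. m \<le> i \<longrightarrow> u ! i \<in> D0) \<longrightarrow> F u = G u" if "m \<le> r" for m
    using that
  proof (induction m)
    case 0
    then show ?case using eq by (auto simp: subset_iff in_set_conv_nth)
  next
    case (Suc m)
    show ?case
    proof (intro allI impI)
      fix u assume u: "length u = r \<and> set u \<subseteq> D \<and> (\<forall>i<r. Suc m \<le> i \<longrightarrow> u ! i \<in> D0)"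
      have m: "m < r" using Suc by simp
      have "F (u[m := z]) = G (u[m := z])" if "z \<in> D0" for z
      proof -
        have "set (u[m := z]) \<subseteq> D" using u that D0 set_update_subset_insert[of u m z] by blast
        moreover have "\<forall>i<r. m \<le> i \<longrightarrow> u[m := z] ! i \<in> D0"
          using u that m by (auto simp: nth_list_update)
        ultimately show ?thesis using Suc u by simp
      qed
      then have "F (u[m := u ! m]) = G (u[m := u ! m])"
        using analytic_continuation_open[OF D0(1) D(1) D0(2) D(2) D0(3), of "\<lambda>z. F (u[m := z])" "\<lambda>z. G (u[m := z])" "u ! m"]
          F[of u m] G[of u m] u m nth_mem by blast
      then show "F u = G u" by simp
    qed
  qed
  from this[of r] u show ?thesis by auto
qed

section \<open>Growth orders adapted to the index, and the region of convergence\<close>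

lemma right_left_close:
  assumes "norm t \<le> 1/2" "N \<ge> 2"
  shows "\<bar>Re (rpt (Suc N)) - Re (lpt t N)\<bar> \<le> 1" "norm (rpt (Suc N) - lpt t N) \<le> 6"
proof -
  have N1: "N \<ge> 1" using assms by simp
  note z = norm_nat_diff[OF assms(1) N1]
  let ?q = "real (Suc N) / norm (of_nat N - t)"
  have zp: "norm (of_nat N - t) > 0" using z by simp
  have lo: "norm (of_nat N - t) \<ge> real N - 1/2" using norm_triangle_ineq2[of "of_nat N" t] assms by simp
  have hi: "norm (of_nat N - t) \<le> real N + 1/2" using norm_triangle_ineq4[of "of_nat N" t] assms by simp
  have R: "Re (rpt (Suc N)) - Re (lpt t N) = ln ?q"
    using z zp unfolding rpt_def lpt_def by (simp add: ln_div)
  have e: "(2::real) \<le> exp 1" using exp_ge_add_one_self[of 1] by simp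
  have "?q \<le> 2"
  proof -
    have "real (Suc N) \<le> 2 * norm (of_nat N - t)" using lo assms(2) by simp
    then show ?thesis using zp by (simp add: divide_le_eq)
  qed
  then have "?q \<le> exp 1" using e by linarith
  moreover have q1: "?q \<ge> 1" using hi zp by (simp add: le_divide_eq)
  ultimately have "ln ?q \<le> ln (exp 1)" by (subst ln_le_cancel_iff) (linarith, simp_all)
  then have "ln ?q \<le> 1" by simp
  moreover have "ln ?q \<ge> 0" using q1 by simp
  ultimately show A: "\<bar>Re (rpt (Suc N)) - Re (lpt t N)\<bar> \<le> 1" unfolding R by simp
  have "\<bar>Im (Ln (of_nat N - t))\<bar> < pi/2" using Re_Ln_pos_lt_imp[of "of_nat N - t"] z(3) N1 by linarith
  moreover have "Im (lpt t N) = Im (Ln (of_nat N - t)) - pi" "Im (rpt (Suc N)) = 0" unfolding lpt_def rpt_def by simp_all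
  moreover have "pi < 3.2" using pi_approx by simp
  ultimately have B: "\<bar>Im (rpt (Suc N)) - Im (lpt t N)\<bar> \<le> 5" by linarith
  show "norm (rpt (Suc N) - lpt t N) \<le> 6" using cmod_le[of "rpt (Suc N) - lpt t N"] A B by simp
qed

text \<open>An order for expansions and right chain sums whose entries have real parts at least
  \<open>as\<close>: the source has the order of the tail minus a, and summation turns B into
  anything above max (B + 1) 0. The slack is e per entry.\<close>

primrec ordl :: "real \<Rightarrow> real list \<Rightarrow> real" where
  "ordl e [] = 0"
| "ordl e (a # as) = max (ordl e as - a + 1) 0 + e"

lemma ordl_nonneg: "e > 0 \<Longrightarrow> ordl e as \<ge> 0"
  by (induction as) auto

lemma symb_at:
  assumes "symb H S m B f" "w \<in> lstrip m"
  shows "H \<Longrightarrow> (\<lambda>x. f x w) holomorphic_on S" "\<exists>C. \<forall>x\<in>S. norm (f x w) \<le> C"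
  using assms unfolding symb_def by blast+

lemma symb_lipschitz:
  assumes "symb H S m \<beta> D" "\<And>x w. x \<in> S \<Longrightarrow> w \<in> lstrip m \<Longrightarrow> (g x has_field_derivative D x w) (at w)"
  shows "\<exists>C>0. \<forall>x\<in>S. \<forall>v\<in>lstrip m. \<forall>w\<in>lstrip m. \<bar>Re v - Re w\<bar> \<le> 1 \<longrightarrow> norm (g x v - g x w) \<le> C * exp (\<beta> * Re w) * norm (v - w)"
proof -
  obtain C where C: "C > 0" "\<And>x w. x \<in> S \<Longrightarrow> w \<in> lstrip m \<Longrightarrow> norm (D x w) \<le> C * exp (\<beta> * Re w)"
    using symb_bound[OF assms(1)] by blast
  have "norm (g x v - g x w) \<le> (C * exp \<bar>\<beta>\<bar>) * exp (\<beta> * Re w) * norm (v - w)"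
    if x: "x \<in> S" and v: "v \<in> lstrip m" and w: "w \<in> lstrip m" and vw: "\<bar>Re v - Re w\<bar> \<le> 1" for x v w
  proof (rule field_differentiable_bound[of "closed_segment w v" "g x" "D x"])
    fix u assume u: "u \<in> closed_segment w v"
    have ul: "u \<in> lstrip m" using u v w convex_lstrip closed_segment_subset by blast
    then show "(g x has_field_derivative D x u) (at u within closed_segment w v)"
      using assms(2)[OF x] has_field_derivative_at_within by blast
    obtain q where q: "0 \<le> q" "q \<le> 1" "u = (1 - q) *\<^sub>R w + q *\<^sub>R v" using u unfolding closed_segment_def by blast
    have "Re u - Re w = q * (Re v - Re w)" unfolding q(3) by (simp add: algebra_simps)
    then have "\<bar>Re u - Re w\<bar> = q * \<bar>Re v - Re w\<bar>" using q(1) by (simp add: abs_mult)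
    also have "\<dots> \<le> 1 * 1" using q vw by (intro mult_mono) auto
    finally have "exp (\<beta> * Re u) \<le> exp \<bar>\<beta>\<bar> * exp (\<beta> * Re w)" by (intro exp_shift_bound) simp
    then have "C * exp (\<beta> * Re u) \<le> C * (exp \<bar>\<beta>\<bar> * exp (\<beta> * Re w))" using C(1) by (intro mult_left_mono) auto
    then show "norm (D x u) \<le> C * exp \<bar>\<beta>\<bar> * exp (\<beta> * Re w)"
      using C(2)[OF x ul] by (simp only: mult.assoc)
  qed auto
  then show ?thesis using C(1) by (intro exI[of _ "C * exp \<bar>\<beta>\<bar>"]) auto
qed

context chain_asym_family begin

lemma chain_asym_order:
  assumes "list_all2 good as cs" "w0 \<in> lstrip (lev K (length cs))" "real K > real (length cs) * (2 * M + 4)" "e > 0"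
  shows "symb H S (lev K (length cs)) (ordl e as) (\<lambda>x. chain_asym K w0 (T x) (vals cs x))"
  using assms(1-3)
proof (induction as cs rule: list_all2_induct)
  case Nil
  show ?case by (simp, rule symb_const[of _ _ _ 1]) auto
next
  case (Cons a as c cs)
  let ?n = "length cs"
  have w0: "w0 \<in> lstrip (lev K (Suc ?n))" using Cons.prems by simp
  have w0': "w0 \<in> lstrip (lev K ?n)" using w0 lstrip_mono[OF lev_mono[of ?n "Suc ?n" K]] by auto
  have K': "real K > real ?n * (2 * M + 4)" using Cons.prems M_nonneg by (auto simp: algebra_simps)
  have gm: "\<forall>c\<in>set (c # cs). good (- M) c"
    using Cons.hyps good_minus by (fastforce simp: list_all2_conv_all_nth in_set_conv_nth)
  define F where "F = (\<lambda>x. asrc (c x) (chain_asym K w0 (T x) (vals cs x)))"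
  have F: "symb H S (Suc (lev K ?n)) (ordl e as - a) F"
    unfolding F_def by (rule symb_asrc[OF Cons.IH[OF w0' K']]) (use Cons.hyps in auto)
  have AD: "symb H S (lev K (Suc ?n)) (ordl e (a # as)) (\<lambda>x. antidiff K w0 (F x))"
    unfolding lev_Suc by (rule symb_antidiff[OF F S_open]) (use w0 assms(4) in \<open>auto simp: lev_Suc\<close>)
  have full: "symb H S (lev K (Suc ?n)) (real (Suc ?n) * (M + 2)) (\<lambda>x. chain_asym K w0 (T x) (vals (c # cs) x))"
    using chain_asym_main[OF gm, of w0 K] Cons.prems by simp
  \<comment> \<open>The constant term is recovered as a difference of two values at
    \<open>w0\<close>, so its boundedness and holomorphy follow from \<open>chain_asym_main\<close>
    without a second study of the limit.\<close>
  define q where "q = (\<lambda>x. chain_asym K w0 (T x) (vals (c # cs) x) w0 - antidiff K w0 (F x) w0)"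
  have eq: "chain_asym K w0 (T x) (vals (c # cs) x) = (\<lambda>w. antidiff K w0 (F x) w + q x)" for x
    unfolding q_def F_def by simp
  have "symb H S (lev K (Suc ?n)) (ordl e (a # as)) (\<lambda>x w. q x)"
  proof -
    obtain C1 where C1: "\<forall>x\<in>S. norm (chain_asym K w0 (T x) (vals (c # cs) x) w0) \<le> C1" using symb_at(2)[OF full w0] by blast
    obtain C2 where C2: "\<forall>x\<in>S. norm (antidiff K w0 (F x) w0) \<le> C2" using symb_at(2)[OF AD w0] by blast
    have "norm (q x) \<le> C1 + C2" if "x \<in> S" for x
      unfolding q_def by (rule order_trans[OF norm_triangle_ineq4]) (use C1 C2 that in \<open>auto intro: add_mono\<close>)
    moreover have "q holomorphic_on S" if H
      unfolding q_def using symb_at(1)[OF full w0 that] symb_at(1)[OF AD w0 that] by (intro holomorphic_on_diff)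
    ultimately show ?thesis using ordl_nonneg[OF assms(4), of "a # as"] by (intro symb_const) auto
  qed
  from symb_add[OF AD this] show ?case unfolding eq by simp
qed

text \<open>The term l = 0 of the Neumann series differentiates to the source times
  \<open>exp w\<close>; the terms l \<ge> 1 are one order lower and are collected in R. At positive
  integers this makes the derivative of an expansion the negative of its tail, up to small
  terms.\<close>

lemma chain_asym_deriv_order:
  assumes "list_all2 good as cs" "good a c" "w0 \<in> lstrip (lev K (Suc (length cs)))" "real K > real (length cs) * (2 * M + 4)" "e > 0"
  defines "F \<equiv> (\<lambda>x. asrc (c x) (chain_asym K w0 (T x) (vals cs x)))"
  shows "\<exists>R. symb H S (lev K (Suc (length cs))) (ordl e as - a) R \<and>
     (\<forall>x\<in>S. \<forall>w\<in>lstrip (lev K (Suc (length cs))).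
        (chain_asym K w0 (T x) (vals (c # cs) x) has_field_derivative (F x w * exp w + R x w)) (at w))"
    and "symb H S (Suc (lev K (length cs))) (ordl e as - a) F"
proof -
  let ?n = "length cs"
  have w0': "w0 \<in> lstrip (lev K ?n)" using assms(3) lstrip_mono[OF lev_mono[of ?n "Suc ?n" K]] by auto
  show F: "symb H S (Suc (lev K ?n)) (ordl e as - a) F"
    unfolding F_def by (rule symb_asrc[OF chain_asym_order[OF assms(1) w0' assms(4,5)] assms(2)])
  have w0F: "w0 \<in> lstrip (Suc (lev K ?n) + 2 * K)" using assms(3) lev_Suc by simp
  have K1: "1 \<le> K" using assms(4) M_nonneg by (cases K) (auto simp: mult_less_0_iff dest: order.strict_trans1[rotated])
  define R where "R = (\<lambda>x w. (\<Sum>l=1..<K. (-1)^l * fiter w0 l (F x) w) * exp (- (-1) * w))"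
  have "symb H S (Suc (lev K ?n) + 2 * K) (ordl e as - a - real 1 + - (-1)) R"
    unfolding R_def by (intro symb_mult symb_antidiff_deriv[OF F S_open w0F K1] symb_exp[of _ "\<lambda>x. -1" _ 1]) auto
  then have Rs: "symb H S (lev K (Suc ?n)) (ordl e as - a) R" by (simp add: lev_Suc)
  have "(chain_asym K w0 (T x) (vals (c # cs) x) has_field_derivative (F x w * exp w + R x w)) (at w)"
    if x: "x \<in> S" and w: "w \<in> lstrip (lev K (Suc ?n))" for x w
  proof -
    have w': "w \<in> lstrip (Suc (lev K ?n) + 2 * K)" using w lev_Suc by simp
    have "{..<K} = insert 0 {1..<K}" using K1 by auto
    then have "(\<Sum>l<K. (-1)^l * fiter w0 l (F x) w) = F x w + (\<Sum>l=1..<K. (-1)^l * fiter w0 l (F x) w)"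
      by (simp add: fiter_def)
    then have "(antidiff K w0 (F x) has_field_derivative (F x w * exp w + R x w)) (at w)"
      using antidiff_deriv[OF F S_open w0F w' x] unfolding R_def by (simp add: algebra_simps)
    then show ?thesis unfolding F_def by (auto intro!: derivative_eq_intros)
  qed
  then show "\<exists>R. symb H S (lev K (Suc (length cs))) (ordl e as - a) R \<and>
     (\<forall>x\<in>S. \<forall>w\<in>lstrip (lev K (Suc (length cs))).
        (chain_asym K w0 (T x) (vals (c # cs) x) has_field_derivative (F x w * exp w + R x w)) (at w))"
    using Rs by blast
qed

lemma chain_asym_lipschitz:
  assumes "list_all2 good as cs" "good a c" "w0 \<in> lstrip (lev K (Suc (length cs)))" "real K > real (length cs) * (2 * M + 4)" "e > 0"
  shows "\<exists>C>0. \<forall>x\<in>S. \<forall>v\<in>lstrip (lev K (Suc (length cs))). \<forall>w\<in>lstrip (lev K (Suc (length cs))). \<bar>Re v - Re w\<bar> \<le> 1 \<longrightarrow>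
    norm (chain_asym K w0 (T x) (vals (c # cs) x) v - chain_asym K w0 (T x) (vals (c # cs) x) w) \<le> C * exp ((ordl e as - a + 1) * Re w) * norm (v - w)"
proof -
  obtain R where R: "symb H S (lev K (Suc (length cs))) (ordl e as - a) R"
    "\<And>x w. x \<in> S \<Longrightarrow> w \<in> lstrip (lev K (Suc (length cs))) \<Longrightarrow>
        (chain_asym K w0 (T x) (vals (c # cs) x) has_field_derivative (asrc (c x) (chain_asym K w0 (T x) (vals cs x)) w * exp w + R x w)) (at w)"
    using chain_asym_deriv_order(1)[OF assms] by blast
  have F: "symb H S (Suc (lev K (length cs))) (ordl e as - a) (\<lambda>x. asrc (c x) (chain_asym K w0 (T x) (vals cs x)))"
    by (rule chain_asym_deriv_order(2)[OF assms])
  have "symb H S (Suc (lev K (length cs))) (ordl e as - a + - (-1)) (\<lambda>x w. asrc (c x) (chain_asym K w0 (T x) (vals cs x)) w * exp (- (-1) * w))"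
    by (intro symb_mult F symb_exp[of _ "\<lambda>x. -1" _ 1]) auto
  then have "symb H S (lev K (Suc (length cs))) (ordl e as - a + 1) (\<lambda>x w. asrc (c x) (chain_asym K w0 (T x) (vals cs x)) w * exp w)"
    by (auto intro: symb_mono simp: lev_Suc)
  from symb_lipschitz[OF symb_add[OF this symb_mono[OF R(1)]] R(2)] show ?thesis by simp
qed

lemma chain_order:
  assumes "list_all2 good as cs" "e > 0"
  shows "\<exists>C\<ge>0. \<forall>x\<in>S. \<forall>N\<ge>1. norm (chain_sum wR N (vals cs x)) \<le> C * real N powr (ordl e as)"
  using assms(1)
proof (induction as cs rule: list_all2_induct)
  case Nil
  show ?case by (auto intro!: exI[of _ 1])
next
  case (Cons a as c cs)
  obtain C where C: "\<forall>x\<in>S. \<forall>N\<ge>1. norm (chain_sum wR N (vals cs x)) \<le> C * real N powr (ordl e as)"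
    using Cons by blast
  have B0: "norm (chain_sum wR 0 u) \<le> 1" for u by (cases u) auto
  have g: "norm (wR n (c x)) \<le> 1 * real n powr (- a)" if "x \<in> S" "n \<ge> 1" for x n
  proof -
    have "norm (wR n (c x)) = real n powr (- Re (c x))" using that unfolding wR_def rpt_def by (simp add: powr_def)
    also have "\<dots> \<le> real n powr (- a)" using Cons.hyps that unfolding good_def by (intro powr_mono) auto
    finally show ?thesis by simp
  qed
  have "\<exists>C'. \<forall>x\<in>S. \<forall>N\<ge>1. norm (chain_sum wR N (c x # vals cs x)) \<le> C' * real N powr (ordl e (a # as))"
  proof (rule chain_growth_step[where B = "\<lambda>x N. chain_sum wR N (vals cs x)" and g = "\<lambda>x n. wR n (c x)"
          and a = "- a" and b = "ordl e as", OF _ _ _ B0 g])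
    show "norm (chain_sum wR N (vals cs x)) \<le> C * real N powr (ordl e as)" if "x \<in> S" "N \<ge> 1" for x N
      using C that by blast
  qed (use assms(2) ordl_nonneg in \<open>auto simp: algebra_simps\<close>)
  then obtain C' where C': "\<forall>x\<in>S. \<forall>N\<ge>1. norm (chain_sum wR N (c x # vals cs x)) \<le> C' * real N powr (ordl e (a # as))" by blast
  have "\<forall>x\<in>S. \<forall>N\<ge>1. norm (chain_sum wR N (c x # vals cs x)) \<le> \<bar>C'\<bar> * real N powr (ordl e (a # as))"
    using C' by (meson abs_ge_self mult_right_mono order_trans powr_ge_zero)
  then show ?case by (intro exI[of _ "\<bar>C'\<bar>"]) auto
qed

end

definition jump :: "nat \<Rightarrow> complex \<Rightarrow> complex \<Rightarrow> complex list \<Rightarrow> nat \<Rightarrow> complex" where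
  "jump K w0 t s N = chain_asym K w0 t s (rpt (Suc N)) - chain_asym K w0 t s (lpt t N)"

context chain_asym_family begin

text \<open>The points \<open>rpt (Suc N)\<close> and \<open>lpt t N\<close> stay at bounded
  distance, so a jump is no larger than the derivative of the expansion, which is one order above
  its source.\<close>

lemma jump_bound:
  assumes as: "list_all2 good as cs" and w0: "w0 \<in> lstrip (lev K (length cs))" and K: "real K > real (length cs) * (2 * M + 4)"
    and e: "e > 0" and i: "i < length cs"
  shows "\<exists>C N0. C \<ge> 0 \<and> N0 \<ge> 1 \<and> (\<forall>x\<in>S. \<forall>N\<ge>N0. norm (chain_sum wR N (rev (take i (vals cs x))) * jump K w0 (T x) (drop i (vals cs x)) N)
     \<le> C * real N powr (ordl e (rev (take i as)) + (ordl e (drop (Suc i) as) - as ! i + 1)))"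
proof -
  let ?l = "length (drop (Suc i) cs)"
  let ?\<beta> = "ordl e (drop (Suc i) as) - as ! i + 1"
  have la: "length as = length cs" using as by (rule list_all2_lengthD)
  have dr: "drop i cs = cs ! i # drop (Suc i) cs" using i by (simp add: Cons_nth_drop_Suc)
  have l: "Suc ?l \<le> length cs" using i by simp
  have w0': "w0 \<in> lstrip (lev K (Suc ?l))" using w0 lstrip_mono[OF lev_mono[OF l, of K]] by auto
  have K': "real K > real ?l * (2 * M + 4)"
  proof -
    have "real ?l * (2 * M + 4) \<le> real (length cs) * (2 * M + 4)" using M_nonneg by (intro mult_right_mono) auto
    then show ?thesis using K by linarith
  qed
  have gi: "good (as ! i) (cs ! i)" using as i by (simp add: list_all2_conv_all_nth)
  have gd: "list_all2 good (drop (Suc i) as) (drop (Suc i) cs)" using as by (rule list_all2_dropI)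
  have gr: "list_all2 good (rev (take i as)) (rev (take i cs))" using list_all2_takeI[OF as, of i] by (simp only: list_all2_rev)
  obtain C1 where C1: "C1 > 0" "\<And>x v w. x \<in> S \<Longrightarrow> v \<in> lstrip (lev K (Suc ?l)) \<Longrightarrow> w \<in> lstrip (lev K (Suc ?l)) \<Longrightarrow> \<bar>Re v - Re w\<bar> \<le> 1 \<Longrightarrow>
    norm (chain_asym K w0 (T x) (vals (cs ! i # drop (Suc i) cs) x) v - chain_asym K w0 (T x) (vals (cs ! i # drop (Suc i) cs) x) w) \<le> C1 * exp (?\<beta> * Re w) * norm (v - w)"
    using chain_asym_lipschitz[OF gd gi w0' K' e] by metis
  obtain C2 where C2: "C2 \<ge> 0" "\<And>x N. x \<in> S \<Longrightarrow> N \<ge> 1 \<Longrightarrow> norm (chain_sum wR N (vals (rev (take i cs)) x)) \<le> C2 * real N powr ordl e (rev (take i as))"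
    using chain_order[OF gr e] by blast
  obtain N2 where N2: "N2 \<ge> 1" "\<And>N t. N \<ge> N2 \<Longrightarrow> norm t \<le> 1/2 \<Longrightarrow> lpt t N \<in> lstrip (lev K (Suc ?l)) \<and> rpt N \<in> lstrip (lev K (Suc ?l))"
    using lpt_in_lstrip[of "lev K (Suc ?l)"] by blast
  define N0 where "N0 = max N2 2"
  have "norm (chain_sum wR N (rev (take i (vals cs x))) * jump K w0 (T x) (drop i (vals cs x)) N)
     \<le> (C2 * (C1 * 2 powr \<bar>?\<beta>\<bar> * 6)) * real N powr (ordl e (rev (take i as)) + ?\<beta>)" if x: "x \<in> S" and N: "N \<ge> N0" for x N
  proof -
    have NN: "N \<ge> N2" "N \<ge> 2" "N \<ge> 1" "Suc N \<ge> N2" using N unfolding N0_def by auto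
    note c = right_left_close[OF T_small[OF x] NN(2)]
    have "norm (jump K w0 (T x) (drop i (vals cs x)) N) \<le> C1 * exp (?\<beta> * Re (lpt (T x) N)) * norm (rpt (Suc N) - lpt (T x) N)"
      unfolding jump_def vals_drop dr
      by (rule C1(2)[OF x _ _ c(1)]) (use N2(2)[OF NN(1) T_small[OF x]] N2(2)[OF NN(4) T_small[OF x]] in auto)
    also have "\<dots> \<le> C1 * (2 powr \<bar>?\<beta>\<bar> * real N powr ?\<beta>) * 6"
      using C1(1) Re_lpt[OF T_small[OF x] NN(3), of ?\<beta>] c(2) by (intro mult_mono mult_left_mono) auto
    finally have 1: "norm (jump K w0 (T x) (drop i (vals cs x)) N) \<le> (C1 * 2 powr \<bar>?\<beta>\<bar> * 6) * real N powr ?\<beta>" by (simp only: mult_ac)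
    have 2: "norm (chain_sum wR N (rev (take i (vals cs x)))) \<le> C2 * real N powr ordl e (rev (take i as))"
      using C2(2)[OF x NN(3)] by (simp add: rev_map take_map)
    have "norm (chain_sum wR N (rev (take i (vals cs x))) * jump K w0 (T x) (drop i (vals cs x)) N)
      \<le> (C2 * real N powr ordl e (rev (take i as))) * ((C1 * 2 powr \<bar>?\<beta>\<bar> * 6) * real N powr ?\<beta>)"
      unfolding norm_mult using 1 2 C2(1) by (intro mult_mono) auto
    then show ?thesis unfolding powr_add[of _ "ordl e (rev (take i as))" ?\<beta>] by (simp only: mult_ac)
  qed
  moreover have "N0 \<ge> 1" unfolding N0_def by simp
  ultimately show ?thesis using C1(1) C2(1)
    by (intro exI[of _ "C2 * (C1 * 2 powr \<bar>?\<beta>\<bar> * 6)"] exI[of _ N0]) auto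
qed

text \<open>In \<open>zetaU_ext_seq\<close> each value at \<open>rpt (Suc N)\<close> is the value at
  \<open>lpt t N\<close> plus a jump, and the value at \<open>lpt t N\<close> is the left chain sum
  up to a power that beats the growth of the right factor. The continuation is thus an elementary
  truncated sum corrected by what happens in the gap.\<close>

lemma zetaU_ext_at_split:
  assumes cs: "\<forall>c\<in>set cs. good (- M) c" and w0: "w0 \<in> lstrip (lev K (length cs))"
    and K: "real K > (2 * real (length cs) + 2) * (2 * M + 4)"
  shows "\<exists>C N0. C \<ge> 0 \<and> N0 \<ge> 1 \<and> (\<forall>x\<in>S. \<forall>N\<ge>N0. norm (zetaU_ext_at K w0 (T x) (vals cs x) - (trunc (T x) (vals cs x) N +
     (\<Sum>i<length cs. chain_sum wR N (rev (take i (vals cs x))) * jump K w0 (T x) (drop i (vals cs x)) N))) \<le> C * real N powr (-1))"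
proof -
  let ?r = "length cs"
  obtain C N0 where C: "N0 \<ge> 1" "\<And>x N. x \<in> S \<Longrightarrow> N \<ge> N0 \<Longrightarrow> norm (zetaU_ext_seq K w0 (T x) (vals cs x) N - zetaU_ext_at K w0 (T x) (vals cs x)) \<le> C * real N powr (-1)"
    using zetaU_ext_at_main(1)[OF cs w0 K] by blast
  have "\<exists>C N0. C \<ge> 0 \<and> N0 \<ge> 1 \<and> (\<forall>x\<in>S. \<forall>N\<ge>N0. norm (chain_sum wR N (rev (take i (vals cs x))) *
      (chain_sum (wL (T x)) N (drop i (vals cs x)) - chain_asym K w0 (T x) (drop i (vals cs x)) (lpt (T x) N))) \<le> C * real N powr (-1))"
    if i: "i \<le> ?r" for i
  proof -
    let ?l = "length (drop i cs)"
    have l: "?l \<le> ?r" by simp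
    have w0': "w0 \<in> lstrip (lev K ?l)" using w0 lstrip_mono[OF lev_mono[OF l, of K]] by auto
    have le: "real ?l * (2 * M + 4) \<le> real ?r * (2 * M + 4)" using M_nonneg by (intro mult_right_mono) auto
    then have K': "real K > real ?l * (2 * M + 4)" using K M_nonneg by (auto simp: algebra_simps intro: add_strict_increasing order.strict_trans1)
    obtain C1 N1 where C1: "N1 \<ge> 1" "\<And>x N. x \<in> S \<Longrightarrow> N \<ge> N1 \<Longrightarrow> norm (chain_sum (wL (T x)) N (vals (drop i cs) x) - chain_asym K w0 (T x) (vals (drop i cs) x) (lpt (T x) N))
       \<le> C1 * real N powr (- (real K - real ?l * (2 * M + 4)))"
      using chain_asym_main[OF _ w0' K'] cs by (meson in_set_dropD)
    have "\<forall>c\<in>set (rev (take i cs)). good (- M) c" using cs by (auto dest: in_set_takeD)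
    from right_growth[OF this] i obtain C2 where C2: "\<And>x N. x \<in> S \<Longrightarrow> N \<ge> 1 \<Longrightarrow> norm (chain_sum wR N (vals (rev (take i cs)) x)) \<le> C2 * real N powr (real i * (M + 2))"
      by (auto simp: min_absorb2)
    have "norm (chain_sum wR N (rev (take i (vals cs x))) *
      (chain_sum (wL (T x)) N (drop i (vals cs x)) - chain_asym K w0 (T x) (drop i (vals cs x)) (lpt (T x) N))) \<le> (\<bar>C2\<bar> * \<bar>C1\<bar>) * real N powr (-1)"
      if x: "x \<in> S" and N: "N \<ge> N1" for x N
    proof -
      have N1: "N \<ge> 1" using N C1(1) by simp
      have "norm (chain_sum wR N (rev (take i (vals cs x))) *
        (chain_sum (wL (T x)) N (drop i (vals cs x)) - chain_asym K w0 (T x) (drop i (vals cs x)) (lpt (T x) N)))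
        \<le> (\<bar>C2\<bar> * real N powr (real i * (M + 2))) * (\<bar>C1\<bar> * real N powr (- (real K - real ?l * (2 * M + 4))))"
        unfolding norm_mult vals_drop using C2[OF x N1] C1(2)[OF x N]
        by (intro mult_mono) (auto simp: rev_map take_map intro: order_trans[OF _ mult_right_mono])
      also have "\<dots> = (\<bar>C2\<bar> * \<bar>C1\<bar>) * real N powr (real i * (M + 2) + - (real K - real ?l * (2 * M + 4)))"
        unfolding powr_add by (simp only: mult_ac)
      also have "\<dots> \<le> (\<bar>C2\<bar> * \<bar>C1\<bar>) * real N powr (-1)"
      proof -
        have "real i * (M + 2) \<le> real ?r * (M + 2)" using i M_nonneg by (intro mult_right_mono) auto
        moreover have "real ?r * M \<ge> 0" using M_nonneg by simp
        ultimately have "real i * (M + 2) + - (real K - real ?l * (2 * M + 4)) \<le> -1"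
          using le K M_nonneg by (simp add: algebra_simps)
        then show ?thesis using N1 by (intro mult_left_mono powr_mono) auto
      qed
      finally show ?thesis .
    qed
    then show ?thesis using C1(1) by (intro exI[of _ "\<bar>C2\<bar> * \<bar>C1\<bar>"] exI[of _ N1]) auto
  qed
  then obtain CC NN where CC: "\<And>i. i \<le> ?r \<Longrightarrow> CC i \<ge> 0" "\<And>i x N. i \<le> ?r \<Longrightarrow> x \<in> S \<Longrightarrow> N \<ge> NN i \<Longrightarrow> norm (chain_sum wR N (rev (take i (vals cs x))) *
      (chain_sum (wL (T x)) N (drop i (vals cs x)) - chain_asym K w0 (T x) (drop i (vals cs x)) (lpt (T x) N))) \<le> CC i * real N powr (-1)"
    by metis
  define N1 where "N1 = max N0 (Max (NN ` {..?r}))"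
  have "norm (zetaU_ext_at K w0 (T x) (vals cs x) - (trunc (T x) (vals cs x) N +
     (\<Sum>i<?r. chain_sum wR N (rev (take i (vals cs x))) * jump K w0 (T x) (drop i (vals cs x)) N))) \<le> (\<bar>C\<bar> + (\<Sum>i\<le>?r. CC i)) * real N powr (-1)"
    if x: "x \<in> S" and N: "N \<ge> N1" for x N
  proof -
    have NNi: "N \<ge> NN i" if "i \<le> ?r" for i
    proof -
      have "NN i \<le> Max (NN ` {..?r})" using that by (intro Max_ge) auto
      then show ?thesis using N unfolding N1_def by linarith
    qed
    let ?p = "\<lambda>i. chain_sum wR N (rev (take i (vals cs x)))"
    \<comment> \<open>The term with i = r vanishes because the expansion of the empty index is the
      constant 1.\<close>
    have "(\<Sum>i<?r. ?p i * jump K w0 (T x) (drop i (vals cs x)) N) = (\<Sum>i\<le>?r. ?p i * jump K w0 (T x) (drop i (vals cs x)) N)"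
      by (simp add: lessThan_Suc_atMost[symmetric] jump_def)
    then have "trunc (T x) (vals cs x) N + (\<Sum>i<?r. ?p i * jump K w0 (T x) (drop i (vals cs x)) N) - zetaU_ext_seq K w0 (T x) (vals cs x) N
      = (\<Sum>i\<le>?r. ?p i * (chain_sum (wL (T x)) N (drop i (vals cs x)) - chain_asym K w0 (T x) (drop i (vals cs x)) (lpt (T x) N)))"
      unfolding trunc_def zetaU_ext_seq_def jump_def by (simp add: sum.distrib[symmetric] sum_subtractf[symmetric] algebra_simps)
    also have "norm \<dots> \<le> (\<Sum>i\<le>?r. CC i * real N powr (-1))"
      by (rule sum_norm_le) (use CC(2) x NNi in auto)
    finally have 1: "norm (trunc (T x) (vals cs x) N + (\<Sum>i<?r. ?p i * jump K w0 (T x) (drop i (vals cs x)) N) - zetaU_ext_seq K w0 (T x) (vals cs x) N)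
      \<le> (\<Sum>i\<le>?r. CC i) * real N powr (-1)" by (simp only: sum_distrib_right)
    have "norm (zetaU_ext_seq K w0 (T x) (vals cs x) N - zetaU_ext_at K w0 (T x) (vals cs x)) \<le> C * real N powr (-1)"
      using C(2)[OF x] N unfolding N1_def by simp
    also have "\<dots> \<le> \<bar>C\<bar> * real N powr (-1)" by (intro mult_right_mono) auto
    finally have 2: "norm (zetaU_ext_seq K w0 (T x) (vals cs x) N - zetaU_ext_at K w0 (T x) (vals cs x)) \<le> \<bar>C\<bar> * real N powr (-1)" .
    have tri: "norm (f - a) \<le> norm (a - g) + norm (g - f)" for f a g :: complex
      using norm_triangle_ineq[of "a - g" "g - f"] by (simp add: norm_minus_commute)
    show ?thesis using tri[of "zetaU_ext_at K w0 (T x) (vals cs x)" "trunc (T x) (vals cs x) N +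
     (\<Sum>i<?r. ?p i * jump K w0 (T x) (drop i (vals cs x)) N)" "zetaU_ext_seq K w0 (T x) (vals cs x) N"] 1 2 unfolding distrib_right by linarith
  qed
  moreover have "N1 \<ge> 1" using C(1) unfolding N1_def by simp
  moreover have "\<bar>C\<bar> + (\<Sum>i\<le>?r. CC i) \<ge> 0" using CC(1) by (intro add_nonneg_nonneg sum_nonneg) auto
  ultimately show ?thesis by blast
qed

end

lemma powr_neg_tendsto: "g < 0 \<Longrightarrow> (\<lambda>N. C * real N powr g) \<longlonglongrightarrow> 0"
  using tendsto_mult[OF tendsto_const[of C] tendsto_neg_powr[OF _ filterlim_real_sequentially, of g]] by simp

text \<open>I collects the positions whose jumps need not tend to 0. It is empty in the region of
  convergence, and a singleton when one nonpositive entry stands among entries with large real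
  part.\<close>

lemma zetaU_ext_at_tendsto:
  assumes t: "norm t \<le> 1/2" and s: "length as = length s" "\<And>i. i < length s \<Longrightarrow> norm (s ! i) \<le> M \<and> as ! i \<le> Re (s ! i)" and M: "M \<ge> 0"
    and w0: "w0 \<in> lstrip (lev K (length s))" and K: "real K > (2 * real (length s) + 2) * (2 * M + 4)" and e: "e > 0"
    and I: "I \<subseteq> {..<length s}" and neg: "\<And>i. i < length s \<Longrightarrow> i \<notin> I \<Longrightarrow> ordl e (rev (take i as)) + (ordl e (drop (Suc i) as) - as ! i + 1) < 0"
  shows "(\<lambda>N. trunc t s N + (\<Sum>i\<in>I. chain_sum wR N (rev (take i s)) * jump K w0 t (drop i s) N)) \<longlonglongrightarrow> zetaU_ext_at K w0 t s"
proof -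
  interpret chain_asym_family False "{0}" "\<lambda>_. t" M
    by unfold_locales (use t M in auto)
  \<comment> \<open>Constant functions on a one-point parameter set turn the statements of the
    locale into statements about the single index s.\<close>
  define cs where "cs = map (\<lambda>c (_::complex). c) s"
  have v: "vals cs x = s" for x unfolding cs_def by (simp add: o_def)
  have lc: "length cs = length s" unfolding cs_def by simp
  have g: "list_all2 good as cs" unfolding list_all2_conv_all_nth lc s(1)
    using s(2) by (auto simp: good_def cs_def)
  have gm: "\<forall>c\<in>set cs. good (- M) c"
    using g good_minus by (fastforce simp: list_all2_conv_all_nth in_set_conv_nth)
  have K': "real K > real (length s) * (2 * M + 4)"
  proof -
    have "real (length s) * (2 * M + 4) \<le> (2 * real (length s) + 2) * (2 * M + 4)" using M by (intro mult_right_mono) auto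
    then show ?thesis using K by linarith
  qed
  have z: "(\<lambda>N. chain_sum wR N (rev (take i s)) * jump K w0 t (drop i s) N) \<longlonglongrightarrow> 0" if i: "i < length s" "i \<notin> I" for i
  proof -
    obtain C N0 where C: "\<And>N. N \<ge> N0 \<Longrightarrow> norm (chain_sum wR N (rev (take i s)) * jump K w0 t (drop i s) N)
     \<le> C * real N powr (ordl e (rev (take i as)) + (ordl e (drop (Suc i) as) - as ! i + 1))"
      using jump_bound[OF g, of w0 K e i] w0 K' e i unfolding v lc by auto
    show ?thesis
      by (rule Lim_null_comparison[OF _ powr_neg_tendsto[OF neg[OF i], of C]])
         (use C in \<open>auto simp: eventually_sequentially intro!: exI[of _ N0]\<close>)
  qed
  obtain C N0 where C: "\<And>N. N \<ge> N0 \<Longrightarrow> norm (zetaU_ext_at K w0 t s - (trunc t s N +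
     (\<Sum>i<length s. chain_sum wR N (rev (take i s)) * jump K w0 t (drop i s) N))) \<le> C * real N powr (-1)"
    using zetaU_ext_at_split[OF gm, of w0 K] w0 K unfolding v lc by auto
  have 1: "(\<lambda>N. zetaU_ext_at K w0 t s - (trunc t s N + (\<Sum>i<length s. chain_sum wR N (rev (take i s)) * jump K w0 t (drop i s) N))) \<longlonglongrightarrow> 0"
    by (rule Lim_null_comparison[OF _ powr_neg_tendsto[of "-1" C]])
       (use C in \<open>auto simp: eventually_sequentially intro!: exI[of _ N0]\<close>)
  have 2: "(\<lambda>N. \<Sum>i\<in>{..<length s} - I. chain_sum wR N (rev (take i s)) * jump K w0 t (drop i s) N) \<longlonglongrightarrow> 0"
    by (rule tendsto_null_sum) (use z in auto)
  have "(\<lambda>N. zetaU_ext_at K w0 t s - ((zetaU_ext_at K w0 t s - (trunc t s N + (\<Sum>i<length s. chain_sum wR N (rev (take i s)) * jump K w0 t (drop i s) N)))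
     + (\<Sum>i\<in>{..<length s} - I. chain_sum wR N (rev (take i s)) * jump K w0 t (drop i s) N))) \<longlonglongrightarrow> zetaU_ext_at K w0 t s - (0 + 0)"
    by (intro tendsto_intros 1 2)
  moreover have "zetaU_ext_at K w0 t s - ((zetaU_ext_at K w0 t s - (trunc t s N + (\<Sum>i<length s. chain_sum wR N (rev (take i s)) * jump K w0 t (drop i s) N)))
     + (\<Sum>i\<in>{..<length s} - I. chain_sum wR N (rev (take i s)) * jump K w0 t (drop i s) N))
     = trunc t s N + (\<Sum>i\<in>I. chain_sum wR N (rev (take i s)) * jump K w0 t (drop i s) N)" for N
    using sum.subset_diff[OF I finite_lessThan, of "\<lambda>i. chain_sum wR N (rev (take i s)) * jump K w0 t (drop i s) N"] by simp
  ultimately show ?thesis by simp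
qed

lemma ordl_replicate:
  assumes "a \<ge> 1 + e" "e > 0" shows "ordl e (replicate n a) \<le> e"
proof (induction n)
  case (Suc n)
  then show ?case using assms by auto
qed (use assms in auto)

lemma zetaU_ext_at_series:
  assumes t: "norm t \<le> 1/2" and s: "\<forall>z\<in>set s. norm z \<le> M \<and> Re z > 1" and M: "M \<ge> 0"
    and w0: "w0 \<in> lstrip (lev K (length s))" and K: "real K > (2 * real (length s) + 2) * (2 * M + 4)"
  shows "zetaU_ext_at K w0 t s = zetaU_series s 0 t"
proof -
  obtain a where a: "a > 1" "\<forall>z\<in>set s. a \<le> Re z"
  proof (cases "s = []")
    case True then show ?thesis using that[of 2] by simp
  next
    case False
    then show ?thesis using s that[of "Min (Re ` set s)"] by auto
  qed
  \<comment> \<open>With a = 1 + 3 e the exponent of every jump is at most e + (e - a + 1) = -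
    e.\<close>
  define e where "e = (a - 1) / 3"
  have e: "e > 0" "a = 1 + 3 * e" using a unfolding e_def by (auto simp: field_simps)
  have "(\<lambda>N. trunc t s N + (\<Sum>i\<in>{}. chain_sum wR N (rev (take i s)) * jump K w0 t (drop i s) N)) \<longlonglongrightarrow> zetaU_ext_at K w0 t s"
  proof (rule zetaU_ext_at_tendsto[OF t _ _ M w0 K e(1), of "replicate (length s) a"])
    fix i assume "i < length s"
    then show "norm (s ! i) \<le> M \<and> replicate (length s) a ! i \<le> Re (s ! i)" using s a by simp
  next
    fix i assume i: "i < length s"
    have "ordl e (replicate k a) \<le> e" for k using ordl_replicate e by simp
    then show "ordl e (rev (take i (replicate (length s) a))) + (ordl e (drop (Suc i) (replicate (length s) a)) - replicate (length s) a ! i + 1) < 0"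
      using i e by (simp add: take_replicate) (smt (verit))
  qed auto
  then have "trunc t s \<longlonglongrightarrow> zetaU_ext_at K w0 t s" by simp
  moreover have "trunc t s \<longlonglongrightarrow> zetaU_series s 0 t" using trunc_tendsto[OF t] s by blast
  ultimately show ?thesis using LIMSEQ_unique by blast
qed

lemma zetaU_ext_at_sep_holomorphic:
  assumes t: "norm t \<le> 1/2" and M: "M \<ge> 0" and u: "set u \<subseteq> ball 0 M" and j: "j < length u"
    and w0: "w0 \<in> lstrip (lev K (length u))" and K: "real K > (2 * real (length u) + 2) * (2 * M + 4)"
  shows "(\<lambda>z. zetaU_ext_at K w0 t (u[j := z])) holomorphic_on ball 0 M"
proof -
  interpret chain_asym_family True "ball 0 M" "\<lambda>_. t" M
    by unfold_locales (use t M in auto)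
  define cs where "cs = (map (\<lambda>c (_::complex). c) u)[j := (\<lambda>z. z)]"
  have v: "vals cs z = u[j := z]" for z unfolding cs_def by (simp add: map_update o_def)
  have lc: "length cs = length u" unfolding cs_def by simp
  have "\<forall>c\<in>set cs. good (- M) c"
  proof
    fix c assume "c \<in> set cs"
    then have "c = (\<lambda>z. z) \<or> (\<exists>y\<in>set u. c = (\<lambda>_. y))"
      using set_update_subset_insert[of "map (\<lambda>c (_::complex). c) u" j "\<lambda>z. z"] unfolding cs_def by auto
    then have "c holomorphic_on ball 0 M" "\<forall>x\<in>ball 0 M. norm (c x) \<le> M" using u by auto
    moreover have "- M \<le> Re y" if "norm y \<le> M" for y using abs_Re_le_cmod[of y] that by linarith
    ultimately show "good (- M) c" unfolding good_def by blast
  qed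
  from zetaU_ext_at_main(2)[OF this, of w0 K] show ?thesis using w0 K unfolding v lc by simp
qed

section \<open>Gluing the local continuations into one entire function\<close>

definition order_choice :: "real \<Rightarrow> nat \<Rightarrow> nat" where
  "order_choice M r = nat \<lceil>(2 * real r + 2) * (2 * M + 4)\<rceil> + 1"

definition base_choice :: "nat \<Rightarrow> nat \<Rightarrow> complex" where
  "base_choice K r = of_real (real (lev K r) + 3)"

lemma base_choice_in: "base_choice K r \<in> lstrip (lev K r)"
proof -
  have p: "(0::real) < (1/2) ^ lev K r" by simp
  have "- pi - (1/2) ^ lev K r < 0" using pi_gt_zero p by linarith
  then show ?thesis using p unfolding base_choice_def lstrip_def mem_Collect_eq by simp
qed

lemma order_choice_gt: "real (order_choice M r) > (2 * real r + 2) * (2 * M + 4)"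
  unfolding order_choice_def by linarith

text \<open>The radius 3 + (sum of the norms) exceeds every entry and also 2, so that the ball meets
  the region of convergence. The base point is an arbitrary real point of the strip;
  \<open>zetaU_ext_at_unique\<close> makes the choices immaterial.\<close>

definition zetaU_ext :: "complex \<Rightarrow> complex list \<Rightarrow> complex" where
  "zetaU_ext t s = (let K = order_choice (3 + sum_list (map norm s)) (length s) in zetaU_ext_at K (base_choice K (length s)) t s)"

text \<open>Two choices of K and \<open>w0\<close> give separately holomorphic functions on the same
  ball, and both equal the series where Re > 1. As M > 2, the point 2 shows that this part of the
  ball is not empty.\<close>

lemma zetaU_ext_at_unique:
  assumes t: "norm t \<le> 1/2" and M: "2 < M" "M \<le> M'" and s: "set s \<subseteq> ball 0 M"
    and w0: "w0 \<in> lstrip (lev K (length s))" and K: "real K > (2 * real (length s) + 2) * (2 * M + 4)"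
    and w0': "w0' \<in> lstrip (lev K' (length s))" and K': "real K' > (2 * real (length s) + 2) * (2 * M' + 4)"
  shows "zetaU_ext_at K w0 t s = zetaU_ext_at K' w0' t s"
proof (rule sep_holomorphic_identity[where D = "ball 0 M" and D0 = "ball 0 M \<inter> {z. Re z > 1}" and r = "length s"])
  show "open (ball 0 M \<inter> {z. Re z > 1})" by (intro open_Int open_ball open_halfspace_Re_gt)
  have "(2::complex) \<in> ball 0 M \<inter> {z. Re z > 1}" using M by simp
  then show "ball (0::complex) M \<inter> {z. Re z > 1} \<noteq> {}" by blast
  have KM: "real K' > (2 * real (length s) + 2) * (2 * M + 4)"
  proof -
    have "(2 * real (length s) + 2) * (2 * M + 4) \<le> (2 * real (length s) + 2) * (2 * M' + 4)" using M by (intro mult_left_mono) auto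
    then show ?thesis using K' by linarith
  qed
  fix u :: "complex list" and j assume u: "length u = length s" "set u \<subseteq> ball 0 M" "j < length s"
  show "(\<lambda>z. zetaU_ext_at K w0 t (u[j := z])) holomorphic_on ball 0 M" "(\<lambda>z. zetaU_ext_at K' w0' t (u[j := z])) holomorphic_on ball 0 M"
    using zetaU_ext_at_sep_holomorphic[OF t _ u(2), of j] w0 K w0' KM u M by auto
next
  have KM: "real K' > (2 * real (length s) + 2) * (2 * M + 4)"
  proof -
    have "(2 * real (length s) + 2) * (2 * M + 4) \<le> (2 * real (length s) + 2) * (2 * M' + 4)" using M by (intro mult_left_mono) auto
    then show ?thesis using K' by linarith
  qed
  fix u assume u: "length u = length s" "set u \<subseteq> ball 0 M \<inter> {z. Re z > 1}"
  then have "\<forall>z\<in>set u. norm z \<le> M \<and> 1 < Re z" by auto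
  then show "zetaU_ext_at K w0 t u = zetaU_ext_at K' w0' t u"
    using zetaU_ext_at_series[OF t, of u M] w0 K w0' KM u M by simp
qed (use s in auto)

lemma sum_list_norm_ge: "z \<in> set s \<Longrightarrow> norm z \<le> sum_list (map norm s)"
  by (rule member_le_sum_list) auto

lemma sum_list_norm_nonneg: "0 \<le> sum_list (map norm s)"
  by (rule sum_list_nonneg) auto

lemma zetaU_ext_eq_zetaU_ext_at:
  assumes t: "norm t \<le> 1/2" and M: "2 < M" and s: "set s \<subseteq> ball 0 M"
    and w0: "w0 \<in> lstrip (lev K (length s))" and K: "real K > (2 * real (length s) + 2) * (2 * M + 4)"
  shows "zetaU_ext t s = zetaU_ext_at K w0 t s"
proof -
  let ?M = "3 + sum_list (map norm s)"
  have M3: "2 < ?M" using sum_list_norm_nonneg[of s] by linarith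
  have sM: "set s \<subseteq> ball 0 ?M" using sum_list_norm_ge[of _ s] by fastforce
  show ?thesis
  proof (cases "?M \<le> M")
    case True
    show ?thesis unfolding zetaU_ext_def Let_def
      by (rule zetaU_ext_at_unique[OF t M3 True sM base_choice_in order_choice_gt w0 K])
  next
    case False
    then have "M \<le> ?M" by simp
    from zetaU_ext_at_unique[OF t M this s w0 K base_choice_in order_choice_gt] show ?thesis unfolding zetaU_ext_def Let_def by simp
  qed
qed

text \<open>The parameters in \<open>zetaU_ext\<close> vary with s, so holomorphy is checked on
  balls, on each of which one choice of K and \<open>w0\<close> serves all arguments; every z lies
  in such a ball.\<close>

lemma zetaU_ext_sep_entire: "norm t \<le> 1/2 \<Longrightarrow> sep_entire r (zetaU_ext t)"
  unfolding sep_entire_def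
proof (intro allI impI)
  fix u :: "complex list" and j
  assume t: "norm t \<le> 1/2" and u: "length u = r" "j < r"
  have "(\<lambda>z. zetaU_ext t (u[j := z])) holomorphic_on ball 0 M" if M: "M > 3 + sum_list (map norm u)" for M
  proof -
    have M2: "2 < M" using M sum_list_norm_nonneg[of u] by linarith
    have uM: "set u \<subseteq> ball 0 M" using sum_list_norm_ge[of _ u] M by fastforce
    have eq: "zetaU_ext t (u[j := z]) = zetaU_ext_at (order_choice M r) (base_choice (order_choice M r) r) t (u[j := z])" if "z \<in> ball 0 M" for z
    proof (rule zetaU_ext_eq_zetaU_ext_at[OF t M2])
      show "set (u[j := z]) \<subseteq> ball 0 M" using uM that set_update_subset_insert[of u j z] by auto
      show "base_choice (order_choice M r) r \<in> lstrip (lev (order_choice M r) (length (u[j := z])))" using base_choice_in u by simp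
      show "(2 * real (length (u[j := z])) + 2) * (2 * M + 4) < real (order_choice M r)" unfolding length_list_update u(1) by (rule order_choice_gt)
    qed
    have hol: "(\<lambda>z. zetaU_ext_at (order_choice M r) (base_choice (order_choice M r) r) t (u[j := z])) holomorphic_on ball 0 M"
    proof (rule zetaU_ext_at_sep_holomorphic[OF t _ uM])
      show "base_choice (order_choice M r) r \<in> lstrip (lev (order_choice M r) (length u))" using base_choice_in u by simp
      show "(2 * real (length u) + 2) * (2 * M + 4) < real (order_choice M r)" unfolding u(1) by (rule order_choice_gt)
    qed (use u M2 in auto)
    show ?thesis by (rule holomorphic_transform[OF hol]) (simp add: eq)
  qed
  note b = this
  show "(\<lambda>z. zetaU_ext t (u[j := z])) holomorphic_on UNIV"
    unfolding holomorphic_on_def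
  proof (intro ballI)
    fix z :: complex
    define M where "M = 4 + sum_list (map norm u) + norm z"
    have "(\<lambda>z. zetaU_ext t (u[j := z])) holomorphic_on ball 0 M"
    proof (rule b)
      show "3 + sum_list (map norm u) < M" using norm_ge_zero[of z] unfolding M_def by linarith
    qed
    moreover have "z \<in> ball 0 M" unfolding M_def using sum_list_norm_nonneg[of u] by simp
    ultimately show "(\<lambda>z. zetaU_ext t (u[j := z])) field_differentiable at z within UNIV"
      using holomorphic_on_imp_differentiable_at by fastforce
  qed
qed

lemma zetaU_ext_series:
  assumes t: "norm t \<le> 1/2" and s: "\<forall>z\<in>set s. Re z > 1"
  shows "zetaU_ext t s = zetaU_series s 0 t"
  unfolding zetaU_ext_def Let_def
proof (rule zetaU_ext_at_series[OF t _ _ base_choice_in order_choice_gt])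
  show "\<forall>z\<in>set s. norm z \<le> 3 + sum_list (map norm s) \<and> 1 < Re z"
  proof
    fix z assume z: "z \<in> set s"
    have "norm z \<le> 3 + sum_list (map norm s)" using sum_list_norm_ge[OF z] by linarith
    then show "norm z \<le> 3 + sum_list (map norm s) \<and> 1 < Re z" using s z by blast
  qed
  show "0 \<le> 3 + sum_list (map norm s)" using sum_list_norm_nonneg[of s] by linarith
qed

lemma sep_entire_identity:
  assumes "sep_entire r F" "sep_entire r G" "\<And>u. length u = r \<Longrightarrow> \<forall>z\<in>set u. Re z > B \<Longrightarrow> F u = G u" "length u = r"
  shows "F u = G u"
proof (rule sep_holomorphic_identity[where D = UNIV and D0 = "{z. Re z > B}" and r = r])
  have "complex_of_real (B + 1) \<in> {z. Re z > B}" by simp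
  then show "{z::complex. Re z > B} \<noteq> {}" by blast
  fix v :: "complex list" assume "length v = r" "set v \<subseteq> {z. B < Re z}"
  then show "F v = G v" by (intro assms(3)) auto
qed (use assms in \<open>auto simp: sep_entire_def open_halfspace_Re_gt\<close>)

text \<open>For the description operator in \<open>zetaU\<close>, existence is given by
  \<open>zetaU_ext\<close>, and uniqueness by the identity theorem applied from the region of
  convergence.\<close>

theorem zetaU_eq_zetaU_ext:
  assumes t: "norm t \<le> 1/2"
  shows "zetaU s 0 t = zetaU_ext t s"
proof -
  have zetaU_ext: "sep_entire (length s) (zetaU_ext t) \<and> (\<forall>u. length u = length s \<and> (\<forall>j<length u. Re (u ! j) > 1) \<longrightarrow> zetaU_ext t u = zetaU_series u 0 t)"
    using zetaU_ext_sep_entire[OF t] zetaU_ext_series[OF t] by (auto simp: all_set_conv_all_nth)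
  have "F s = zetaU_ext t s" if F: "sep_entire (length s) F" "\<forall>u. length u = length s \<and> (\<forall>j<length u. Re (u ! j) > 1) \<longrightarrow> F u = zetaU_series u 0 t" for F
    by (rule sep_entire_identity[OF F(1), of _ 1]) (use zetaU_ext F(2) in \<open>auto simp: all_set_conv_all_nth\<close>)
  then show ?thesis unfolding zetaU_def using zetaU_ext by (intro the_equality) auto
qed

section \<open>Nonpositive entries\<close>

text \<open>Entries are functions of n instead of exponents, because summation by parts multiplies a
  neighbouring entry by a polynomial that is only afterwards expanded into powers.\<close>

abbreviation csf :: "nat \<Rightarrow> (nat \<Rightarrow> 'a::comm_ring_1) list \<Rightarrow> 'a" where
  "csf \<equiv> chain_sum (\<lambda>n q. q n)"

lemma chain_sum_csf: "chain_sum g N u = csf N (map (\<lambda>s n. g n s) u)"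
  by (induction g N u rule: chain_sum.induct) auto

text \<open>The upper limit of the telescoped sum: the variable of q stays below that of
  \<open>last A\<close>, so q adds up to Q at that variable, or to Q (N + 1) if no larger variable
  exists.\<close>

definition mergeL :: "nat \<Rightarrow> (nat \<Rightarrow> 'a::comm_ring_1) list \<Rightarrow> (nat \<Rightarrow> 'a) \<Rightarrow> (nat \<Rightarrow> 'a) list \<Rightarrow> 'a" where
  "mergeL N A Q B = (if A = [] then Q (Suc N) * csf N B else csf N (butlast A @ (\<lambda>n. last A n * Q n) # B))"

text \<open>The lower limit: the variable of q starts one above that of \<open>hd B\<close>, hence
  \<open>Q (Suc n)\<close>, or at 1 if no smaller variable exists.\<close>

definition mergeR :: "nat \<Rightarrow> (nat \<Rightarrow> 'a::comm_ring_1) list \<Rightarrow> (nat \<Rightarrow> 'a) \<Rightarrow> (nat \<Rightarrow> 'a) list \<Rightarrow> 'a" where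
  "mergeR N A Q B = (if B = [] then Q 1 * csf N A else csf N (A @ (\<lambda>n. hd B n * Q (Suc n)) # tl B))"

lemma csf_telescope:
  fixes Q :: "nat \<Rightarrow> 'a::comm_ring_1"
  assumes q: "\<And>n. n \<ge> 1 \<Longrightarrow> q n = Q (Suc n) - Q n"
  shows "csf N (A @ q # B) = mergeL N A Q B - mergeR N A Q B"
proof (induction N arbitrary: A)
  case 0
  have c0: "csf 0 u = (if u = [] then 1 else 0)" for u :: "(nat \<Rightarrow> 'a) list" by (cases u) auto
  show ?case by (auto simp: c0 mergeL_def mergeR_def)
next
  case (Suc N)
  show ?case
  proof (cases A)
    case Nil
    have "csf (Suc N) (q # B) = mergeL N [] Q B - mergeR N [] Q B + (Q (Suc (Suc N)) - Q (Suc N)) * csf N B"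
      using Suc.IH[of "[]"] q[of "Suc N"] by simp
    also have "\<dots> = mergeL (Suc N) [] Q B - mergeR (Suc N) [] Q B"
      by (cases B) (auto simp: mergeL_def mergeR_def algebra_simps)
    finally show ?thesis using Nil by simp
  next
    case (Cons a A')
    have "csf (Suc N) (A @ q # B) = (mergeL N A Q B - mergeR N A Q B) + a (Suc N) * (mergeL N A' Q B - mergeR N A' Q B)"
      using Suc.IH[of A] Suc.IH[of A'] Cons by simp
    also have "\<dots> = mergeL (Suc N) A Q B - mergeR (Suc N) A Q B"
      unfolding Cons by (auto simp: mergeL_def mergeR_def algebra_simps)
    finally show ?thesis .
  qed
qed

lemma csf_linear:
  fixes c :: "'i \<Rightarrow> 'a::comm_ring_1"
  assumes "finite I"
  shows "csf N (A @ (\<lambda>n. \<Sum>i\<in>I. c i * f i n) # B) = (\<Sum>i\<in>I. c i * csf N (A @ f i # B))"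
proof (induction N arbitrary: A)
  case 0
  have c0: "csf 0 u = (if u = [] then 1 else 0)" for u :: "(nat \<Rightarrow> 'a) list" by (cases u) auto
  show ?case by (simp add: c0)
next
  case (Suc N)
  show ?case
  proof (cases A)
    case Nil
    have "csf N ((\<lambda>n. \<Sum>i\<in>I. c i * f i n) # B) = (\<Sum>i\<in>I. c i * csf N (f i # B))"
      using Suc[of "[]"] by simp
    then show ?thesis using Nil by (simp add: sum_distrib_left sum_distrib_right sum.distrib algebra_simps)
  next
    case (Cons a A')
    then show ?thesis using Suc[of A] Suc[of A'] by (simp add: sum_distrib_left sum.distrib algebra_simps)
  qed
qed

section \<open>Summation by parts in the two-sided truncated sums\<close>

definition rv :: "(complex \<Rightarrow> complex) list \<Rightarrow> (nat \<Rightarrow> complex) list" where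
  "rv = map (\<lambda>\<phi> n. \<phi> (rpt n))"

definition lv :: "complex \<Rightarrow> (complex \<Rightarrow> complex) list \<Rightarrow> (nat \<Rightarrow> complex) list" where
  "lv t = map (\<lambda>\<phi> n. \<phi> (lpt t n))"

definition trunc2 :: "complex \<Rightarrow> (complex \<Rightarrow> complex) list \<Rightarrow> nat \<Rightarrow> complex" where
  "trunc2 t \<phi>s N = (\<Sum>i\<le>length \<phi>s. csf N (rv (rev (take i \<phi>s))) * csf N (lv t (drop i \<phi>s)))"

definition pw :: "complex \<Rightarrow> complex \<Rightarrow> complex" where
  "pw s w = exp (- s * w)"

lemma trunc_trunc2: "trunc t s N = trunc2 t (map pw s) N"
  unfolding trunc_def trunc2_def
  by (intro sum.cong) (auto simp: chain_sum_csf[of wR] chain_sum_csf[of "wL t"] rv_def lv_def take_map drop_map rev_map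
      wR_def wL_def pw_def o_def)

lemma trunc2_linear:
  assumes "finite I"
  shows "trunc2 t (A @ (\<lambda>w. \<Sum>i\<in>I. c i * f i w) # B) N = (\<Sum>i\<in>I. c i * trunc2 t (A @ f i # B) N)"
proof -
  let ?g = "\<lambda>w. \<Sum>i\<in>I. c i * f i w"
  have "csf N (rv (rev (take j (A @ ?g # B)))) * csf N (lv t (drop j (A @ ?g # B)))
      = (\<Sum>i\<in>I. c i * (csf N (rv (rev (take j (A @ f i # B)))) * csf N (lv t (drop j (A @ f i # B)))))" for j
  proof (cases "j \<le> length A")
    case True
    have "csf N (lv t (drop j A @ ?g # B)) = (\<Sum>i\<in>I. c i * csf N (lv t (drop j A @ f i # B)))"
      unfolding lv_def using csf_linear[OF assms, of N "lv t (drop j A)" c "\<lambda>i n. f i (lpt t n)" "lv t B"] by (simp add: lv_def)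
    then show ?thesis using True by (simp add: sum_distrib_left algebra_simps)
  next
    case False
    then obtain k where k: "j = length A + Suc k" by (metis add_Suc_right less_imp_Suc_add not_le)
    have "csf N (rv (rev (A @ ?g # take k B))) = (\<Sum>i\<in>I. c i * csf N (rv (rev (A @ f i # take k B))))"
      unfolding rv_def using csf_linear[OF assms, of N "rv (rev (take k B))" c "\<lambda>i n. f i (rpt n)" "rv (rev A)"] by (simp add: rv_def)
    then show ?thesis using k by (simp add: sum_distrib_left sum_distrib_right algebra_simps)
  qed
  then have "trunc2 t (A @ ?g # B) N = (\<Sum>j\<le>length A + Suc (length B). \<Sum>i\<in>I. c i * (csf N (rv (rev (take j (A @ f i # B)))) * csf N (lv t (drop j (A @ f i # B)))))"
    unfolding trunc2_def by simp
  also have "\<dots> = (\<Sum>i\<in>I. c i * trunc2 t (A @ f i # B) N)"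
    unfolding trunc2_def sum_distrib_left by (subst sum.swap) simp
  finally show ?thesis .
qed

lemma sum_split_at:
  fixes f :: "nat \<Rightarrow> 'a::comm_monoid_add"
  shows "(\<Sum>i\<le>a + Suc b. f i) = (\<Sum>i\<le>a. f i) + (\<Sum>k\<le>b. f (a + Suc k))"
proof (induction b)
  case (Suc b)
  then show ?case by (simp add: add.assoc)
qed simp

text \<open>Neighbours in 1, ..., N and in t - N, ..., t - 1 differ by 1, so telescoping is exact on
  each side: an upper limit at z gives P z, a lower limit P (z + 1). The extra term on the left
  belongs to the split with X below and Y above the gap, where the limits at the gap are N + 1 and t
  - N.\<close>

lemma trunc2_merge:
  assumes t: "norm t \<le> 1/2" and P: "\<And>x. P (x + 1) - P x = x ^ m"
  shows "trunc2 t (X @ pw (- of_nat m) # Y) N + csf N (rv (rev X)) * csf N (lv t Y) * (P (t - of_nat N) - P (of_nat N + 1))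
    = (if Y = [] then P t * trunc2 t X N else trunc2 t (X @ (\<lambda>w. hd Y w * P (exp w)) # tl Y) N)
    - (if X = [] then P 1 * trunc2 t Y N else trunc2 t (butlast X @ (\<lambda>w. last X w * P (exp w + 1)) # Y) N)"
proof -
  define q where "q = pw (- of_nat m)"
  define QR where "QR = (\<lambda>n. P (of_nat n))"
  \<comment> \<open>On the left n counts downwards in z = t - n, so the primitive in n is minus P,
    moved by one step: QL (n + 1) - QL n = P (t - n + 1) - P (t - n).\<close>
  define QL where "QL = (\<lambda>n. - P (t - of_nat n + 1))"
  have qR: "q (rpt n) = QR (Suc n) - QR n" if "n \<ge> 1" for n
  proof -
    have "q (rpt n) = exp (rpt n) ^ m" by (simp add: q_def pw_def exp_of_nat_mult)
    then show ?thesis using exp_rpt[OF that] P[of "of_nat n"] by (simp add: QR_def add.commute)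
  qed
  have qL: "q (lpt t n) = QL (Suc n) - QL n" if "n \<ge> 1" for n
  proof -
    have "q (lpt t n) = exp (lpt t n) ^ m" by (simp add: q_def pw_def exp_of_nat_mult)
    then show ?thesis using exp_lpt[OF t that] P[of "t - of_nat n"] by (simp add: QL_def algebra_simps)
  qed
  define Tr where "Tr = (\<lambda>u i. csf N (rv (rev (take i u))) * csf N (lv t (drop i u)))"
  have T2: "trunc2 t u N = (\<Sum>i\<le>length u. Tr u i)" for u unfolding trunc2_def Tr_def ..
  let ?Z = "X @ q # Y"
  let ?YP = "X @ (\<lambda>w. hd Y w * P (exp w)) # tl Y"
  let ?XP = "butlast X @ (\<lambda>w. last X w * P (exp w + 1)) # Y"
  define E where "E = csf N (rv (rev X)) * csf N (lv t Y)"
  \<comment> \<open>\<open>cy i\<close> and \<open>cx i\<close> are the contributions at the split i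
    once the removed entry has been absorbed by its upper or its lower neighbour, or by the outer
    boundary values P t and P 1.\<close>
  define cy where "cy = (\<lambda>i. if Y = [] then P t * Tr X i else Tr ?YP i)"
  define cx where "cx = (\<lambda>i. if X = [] then P 1 * Tr Y i else Tr ?XP i)"
  have csf_posR: "csf N (A @ [\<phi>] @ B) = csf N (A @ [\<psi>] @ B)" if "\<And>n. n \<ge> 1 \<Longrightarrow> \<phi> n = \<psi> n" for A B and \<phi> \<psi> :: "nat \<Rightarrow> complex"
    using that by (simp, induction A arbitrary: N) (auto simp: chain_sum_unfold)
  have left: "Tr ?Z i = (if i = length X then - E * P (t - of_nat N) else - cx i) + cy i" if i: "i \<le> length X" for i
  proof -
    have "csf N (lv t (drop i ?Z)) = csf N (lv t (drop i X) @ (\<lambda>n. q (lpt t n)) # lv t Y)"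
      using i by (simp add: lv_def)
    also have "\<dots> = mergeL N (lv t (drop i X)) QL (lv t Y) - mergeR N (lv t (drop i X)) QL (lv t Y)"
      by (rule csf_telescope) (rule qL)
    finally have 1: "csf N (lv t (drop i ?Z)) = mergeL N (lv t (drop i X)) QL (lv t Y) - mergeR N (lv t (drop i X)) QL (lv t Y)" .
    have tk: "take i ?Z = take i X" using i by simp
    have mR: "csf N (rv (rev (take i X))) * mergeR N (lv t (drop i X)) QL (lv t Y) = - cy i"
    proof (cases Y)
      case Nil
      then show ?thesis by (simp add: mergeR_def lv_def QL_def cy_def Tr_def)
    next
      case (Cons y Y')
      \<comment> \<open>The one-term sum lets \<open>csf_linear\<close> extract the factor
        -1.\<close>
      have "csf N (lv t (drop i X) @ [\<lambda>n. y (lpt t n) * QL (Suc n)] @ lv t Y') = csf N (lv t (drop i X) @ [\<lambda>n. \<Sum>j\<in>{()}. -1 * (y (lpt t n) * P (exp (lpt t n)))] @ lv t Y')"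
        by (rule csf_posR) (simp add: QL_def exp_lpt[OF t])
      also have "\<dots> = - csf N (lv t (drop i X) @ (\<lambda>n. y (lpt t n) * P (exp (lpt t n))) # lv t Y')"
        using csf_linear[of "{()}" N "lv t (drop i X)" "\<lambda>_. -1" "\<lambda>_ n. y (lpt t n) * P (exp (lpt t n))" "lv t Y'"] by simp
      finally show ?thesis using i Cons by (simp add: mergeR_def lv_def cy_def Tr_def)
    qed
    have mL: "csf N (rv (rev (take i X))) * mergeL N (lv t (drop i X)) QL (lv t Y) = (if i = length X then - E * P (t - of_nat N) else - cx i)"
    proof (cases "i = length X")
      case True
      then show ?thesis by (simp add: mergeL_def lv_def QL_def E_def)
    next
      case False
      then have iX: "i < length X" "X \<noteq> []" "drop i X \<noteq> []" using i by auto
      have dX: "drop i ?XP = butlast (drop i X) @ (\<lambda>w. last X w * P (exp w + 1)) # Y" "take i ?XP = take i X"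
        using iX by (auto simp: butlast_conv_take drop_take take_butlast min_def)
      have "csf N (butlast (lv t (drop i X)) @ [\<lambda>n. last (lv t (drop i X)) n * QL n] @ lv t Y) = csf N (butlast (lv t (drop i X)) @ [\<lambda>n. \<Sum>j\<in>{()}. -1 * (last X (lpt t n) * P (exp (lpt t n) + 1))] @ lv t Y)"
        by (rule csf_posR) (use iX in \<open>simp add: QL_def exp_lpt[OF t] lv_def last_map\<close>)
      also have "\<dots> = - csf N (butlast (lv t (drop i X)) @ (\<lambda>n. last X (lpt t n) * P (exp (lpt t n) + 1)) # lv t Y)"
        using csf_linear[of "{()}" N "butlast (lv t (drop i X))" "\<lambda>_. -1" "\<lambda>_ n. last X (lpt t n) * P (exp (lpt t n) + 1)" "lv t Y"] by simp
      finally show ?thesis using iX False dX by (simp add: mergeL_def lv_def cx_def Tr_def map_butlast)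
    qed
    show ?thesis unfolding Tr_def 1 tk using mL mR by (simp add: right_diff_distrib)
  qed
  \<comment> \<open>A split beyond the removed entry has its number lowered by one in the shortened
    lists, whence \<open>length X + k\<close> on the right-hand side. At k = 0 the removed entry is
    the last one before the gap.\<close>
  have right: "Tr ?Z (length X + Suc k) = (if k = 0 then P (of_nat N + 1) * E else cy (length X + k)) - cx (length X + k)" if k: "k \<le> length Y" for k
  proof -
    have "csf N (rv (rev (take (length X + Suc k) ?Z))) = csf N (rv (rev (take k Y)) @ (\<lambda>n. q (rpt n)) # rv (rev X))"
      by (simp add: rv_def)
    also have "\<dots> = mergeL N (rv (rev (take k Y))) QR (rv (rev X)) - mergeR N (rv (rev (take k Y))) QR (rv (rev X))"
      by (rule csf_telescope) (rule qR)
    finally have 1: "csf N (rv (rev (take (length X + Suc k) ?Z))) = mergeL N (rv (rev (take k Y))) QR (rv (rev X)) - mergeR N (rv (rev (take k Y))) QR (rv (rev X))" .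
    have dr: "drop (length X + Suc k) ?Z = drop k Y" by simp
    have mR: "mergeR N (rv (rev (take k Y))) QR (rv (rev X)) * csf N (lv t (drop k Y)) = cx (length X + k)"
    proof (cases X rule: rev_cases)
      case Nil
      then show ?thesis by (simp add: mergeR_def rv_def QR_def cx_def Tr_def)
    next
      case (snoc X' x)
      have "csf N (rv (rev (take k Y)) @ [\<lambda>n. x (rpt n) * QR (Suc n)] @ rv (rev X')) = csf N (rv (rev (take k Y)) @ [\<lambda>n. x (rpt n) * P (exp (rpt n) + 1)] @ rv (rev X'))"
        by (rule csf_posR) (simp add: QR_def exp_rpt add.commute)
      then show ?thesis using snoc by (simp add: mergeR_def rv_def cx_def Tr_def)
    qed
    have mL: "mergeL N (rv (rev (take k Y))) QR (rv (rev X)) * csf N (lv t (drop k Y)) = (if k = 0 then P (of_nat N + 1) * E else cy (length X + k))"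
    proof (cases "k = 0")
      case True
      then show ?thesis by (simp add: mergeL_def rv_def QR_def E_def add.commute)
    next
      case False
      then obtain k' y Y' where kk: "k = Suc k'" "Y = y # Y'" using k by (cases k; cases Y) auto
      have "csf N (rv (rev (take k' Y')) @ [\<lambda>n. y (rpt n) * QR n] @ rv (rev X)) = csf N (rv (rev (take k' Y')) @ [\<lambda>n. y (rpt n) * P (exp (rpt n))] @ rv (rev X))"
        by (rule csf_posR) (simp add: QR_def exp_rpt)
      then show ?thesis using kk by (simp add: mergeL_def rv_def cy_def Tr_def)
    qed
    show ?thesis unfolding Tr_def 1 dr using mL mR by (simp add: left_diff_distrib)
  qed
  have L: "trunc2 t ?Z N = (\<Sum>i\<le>length X. Tr ?Z i) + (\<Sum>k\<le>length Y. Tr ?Z (length X + Suc k))"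
  proof -
    have "length ?Z = length X + Suc (length Y)" by simp
    then show ?thesis unfolding T2 by (simp only: sum_split_at)
  qed
  have 1: "(\<Sum>i\<le>length X. Tr ?Z i) = - E * P (t - of_nat N) - (\<Sum>i<length X. cx i) + (\<Sum>i\<le>length X. cy i)"
    by (simp add: left sum.distrib lessThan_Suc_atMost[symmetric] sum_negf)
  have 2: "(\<Sum>k\<le>length Y. Tr ?Z (length X + Suc k)) = P (of_nat N + 1) * E + (\<Sum>k<length Y. cy (length X + Suc k)) - (\<Sum>k\<le>length Y. cx (length X + k))"
  proof -
    have "(\<Sum>k\<le>length Y. Tr ?Z (length X + Suc k))
        = (\<Sum>k\<le>length Y. (if k = 0 then P (of_nat N + 1) * E else cy (length X + k)) - cx (length X + k))"
      by (rule sum.cong[OF refl], rule right) simp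
    also have "\<dots> = (\<Sum>k\<le>length Y. (if k = 0 then P (of_nat N + 1) * E else cy (length X + k))) - (\<Sum>k\<le>length Y. cx (length X + k))"
      by (rule sum_subtractf)
    also have "(\<Sum>k\<le>length Y. (if k = 0 then P (of_nat N + 1) * E else cy (length X + k))) = P (of_nat N + 1) * E + (\<Sum>k<length Y. cy (length X + Suc k))"
      by (subst sum.atMost_shift) simp
    finally show ?thesis .
  qed
  have cyS: "(\<Sum>i\<le>length X. cy i) + (\<Sum>k<length Y. cy (length X + Suc k)) = (if Y = [] then P t * trunc2 t X N else trunc2 t ?YP N)"
  proof (cases Y)
    case Nil
    then show ?thesis by (simp add: cy_def T2 sum_distrib_left)
  next
    case (Cons y Y')
    have l: "length ?YP = length X + Suc (length Y')" using Cons by simp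
    have "trunc2 t ?YP N = (\<Sum>i\<le>length X. Tr ?YP i) + (\<Sum>k\<le>length Y'. Tr ?YP (length X + Suc k))"
      unfolding T2 l sum_split_at ..
    then show ?thesis using Cons by (simp add: cy_def lessThan_Suc_atMost)
  qed
  have cxS: "(\<Sum>i<length X. cx i) + (\<Sum>k\<le>length Y. cx (length X + k)) = (if X = [] then P 1 * trunc2 t Y N else trunc2 t ?XP N)"
  proof (cases X rule: rev_cases)
    case Nil
    then show ?thesis by (simp add: cx_def T2 sum_distrib_left)
  next
    case (snoc X' x)
    have l: "length ?XP = length X' + Suc (length Y)" using snoc by simp
    have "trunc2 t ?XP N = (\<Sum>i\<le>length X'. Tr ?XP i) + (\<Sum>k\<le>length Y. Tr ?XP (length X' + Suc k))"
      unfolding T2 l sum_split_at ..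
    then show ?thesis using snoc by (simp add: cx_def lessThan_Suc_atMost)
  qed
  have "trunc2 t ?Z N + E * (P (t - of_nat N) - P (of_nat N + 1)) = ((\<Sum>i\<le>length X. cy i) + (\<Sum>k<length Y. cy (length X + Suc k))) - ((\<Sum>i<length X. cx i) + (\<Sum>k\<le>length Y. cx (length X + k)))"
    unfolding L 1 2 by (simp add: algebra_simps)
  then show ?thesis unfolding cyS cxS E_def q_def .
qed

section \<open>Linearity of the antidifference, and its values on polynomials\<close>

lemma seg_lstrip: "w0 \<in> lstrip m \<Longrightarrow> w \<in> lstrip m \<Longrightarrow> closed_segment w0 w \<subseteq> lstrip m"
  using convex_lstrip by (simp add: closed_segment_subset)

lemma prim_cong:
  assumes "\<And>v. v \<in> lstrip m \<Longrightarrow> f v = g v" "w0 \<in> lstrip m" "w \<in> lstrip m"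
  shows "prim w0 f w = prim w0 g w"
  unfolding prim_def using seg_lstrip[OF assms(2,3)] assms(1) by (intro contour_integral_eq) auto

lemma prim_lincomb:
  assumes "f holomorphic_on lstrip m" "g holomorphic_on lstrip m" "w0 \<in> lstrip m" "w \<in> lstrip m"
  shows "prim w0 (\<lambda>v. a * f v + g v) w = a * prim w0 f w + prim w0 g w"
proof -
  have i: "(\<lambda>v. h v * exp v) contour_integrable_on linepath w0 w" if "h holomorphic_on lstrip m" for h
  proof (rule contour_integrable_continuous_linepath)
    have "(\<lambda>v. h v * exp v) holomorphic_on lstrip m" using that by (intro holomorphic_intros)
    then show "continuous_on (closed_segment w0 w) (\<lambda>v. h v * exp v)"
      using seg_lstrip[OF assms(3,4)] holomorphic_on_imp_continuous_on continuous_on_subset by blast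
  qed
  have "prim w0 (\<lambda>v. a * f v + g v) w = contour_integral (linepath w0 w) (\<lambda>v. a * (f v * exp v) + g v * exp v)"
    unfolding prim_def by (simp add: algebra_simps)
  also have "\<dots> = a * prim w0 f w + prim w0 g w"
    unfolding prim_def using i[OF assms(1)] i[OF assms(2)]
    by (subst contour_integral_add) (auto intro: contour_integrable_lmul simp: contour_integral_lmul)
  finally show ?thesis .
qed

lemma fiter_lincomb:
  assumes "symb False {0} m B (\<lambda>_. f)" "symb False {0} m B' (\<lambda>_. g)" "w0 \<in> lstrip (m + 2 * l)" "w \<in> lstrip (m + 2 * l)"
  shows "fiter w0 l (\<lambda>v. a * f v + g v) w = a * fiter w0 l f w + fiter w0 l g w"
  using assms(3,4)
proof (induction l arbitrary: w)
  case 0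
  then show ?case by (simp add: fiter_def)
next
  case (Suc l)
  let ?n = "m + 2 * l"
  have sub: "lstrip (m + 2 * Suc l) \<subseteq> lstrip ?n" "lstrip (m + 2 * Suc l) \<subseteq> lstrip (Suc ?n)" by (rule lstrip_mono, simp)+
  have w0: "w0 \<in> lstrip ?n" and w: "w \<in> lstrip ?n" and tw: "shiftw w \<in> lstrip ?n"
    using Suc.prems sub shiftw_props(3)[of w ?n] by auto
  have hf: "fiter w0 l f holomorphic_on lstrip ?n" and hg: "fiter w0 l g holomorphic_on lstrip ?n"
    using symb_fiter[OF assms(1) _ w0] symb_fiter[OF assms(2) _ w0] unfolding symb_def by auto
  have p: "prim w0 (fiter w0 l (\<lambda>v. a * f v + g v)) v = a * prim w0 (fiter w0 l f) v + prim w0 (fiter w0 l g) v"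
    if "v \<in> lstrip ?n" for v
    using prim_cong[OF Suc.IH[OF w0] w0 that] prim_lincomb[OF hf hg w0 that] by simp
  have e: "fiter w0 (Suc l) h w = prim w0 (fiter w0 l h) (shiftw w) - prim w0 (fiter w0 l h) w - fiter w0 l h w" for h
    by (simp add: fiter_def fstep_def)
  show ?case unfolding e p[OF tw] p[OF w] Suc.IH[OF w0 w] by (simp add: algebra_simps)
qed

lemma antidiff_lincomb:
  assumes f: "symb False {0} m B (\<lambda>_. f)" and g: "symb False {0} m B' (\<lambda>_. g)" and w0: "w0 \<in> lstrip (m + 2 * K)" and w: "w \<in> lstrip (m + 2 * K)"
  shows "antidiff K w0 (\<lambda>v. a * f v + g v) w = a * antidiff K w0 f w + antidiff K w0 g w"
proof -
  have "prim w0 (fiter w0 l (\<lambda>v. a * f v + g v)) w = a * prim w0 (fiter w0 l f) w + prim w0 (fiter w0 l g) w" if "l < K" for l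
  proof -
    have sub: "lstrip (m + 2 * K) \<subseteq> lstrip (m + 2 * l)" using that by (intro lstrip_mono) simp
    have w0': "w0 \<in> lstrip (m + 2 * l)" and w': "w \<in> lstrip (m + 2 * l)" using w0 w sub by auto
    have hf: "fiter w0 l f holomorphic_on lstrip (m + 2 * l)" and hg: "fiter w0 l g holomorphic_on lstrip (m + 2 * l)"
      using symb_fiter[OF f _ w0'] symb_fiter[OF g _ w0'] unfolding symb_def by auto
    show ?thesis
      using prim_cong[OF fiter_lincomb[OF f g w0'] w0' w'] prim_lincomb[OF hf hg w0' w'] by simp
  qed
  then show ?thesis unfolding antidiff_def by (simp add: sum_distrib_left sum.distrib algebra_simps)
qed

text \<open>Along the real integers the increments decay geometrically, which gives a limit c with a
  rate; any other w is compared with the integer just above Re w, at distance at most 6.\<close>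

lemma small_deriv_const:
  assumes D: "symb False {0} m \<beta> (\<lambda>_. D)" and g: "\<And>w. w \<in> lstrip m \<Longrightarrow> (g has_field_derivative D w) (at w)" and b: "\<beta> < 0"
  shows "\<exists>c. symb False {0} m \<beta> (\<lambda>_ w. g w - c)"
proof -
  obtain C where C: "C > 0" "\<And>v w. v \<in> lstrip m \<Longrightarrow> w \<in> lstrip m \<Longrightarrow> \<bar>Re v - Re w\<bar> \<le> 1 \<Longrightarrow> norm (g v - g w) \<le> C * exp (\<beta> * Re w) * norm (v - w)"
    using symb_lipschitz[OF D, of "\<lambda>_. g"] g by auto
  define p where "p = (\<lambda>n::nat. complex_of_real (real n))"
  have pin: "p n \<in> lstrip m" if "n \<ge> m + 3" for n
  proof -
    have "(0::real) < (1/2)^m" by simp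
    then have "- pi - (1/2)^m < 0" "(0::real) < (1/2)^m" using pi_gt_zero by linarith+
    then show ?thesis using that unfolding p_def lstrip_def mem_Collect_eq by simp
  qed
  define q where "q = exp \<beta>"
  have q: "0 < q" "q < 1" using b unfolding q_def by auto
  have qn: "exp (\<beta> * real n) = q ^ n" for n unfolding q_def by (simp add: exp_of_nat_mult[symmetric] mult.commute)
  have st: "norm (g (p (Suc n)) - g (p n)) \<le> C * q ^ n" if "n \<ge> m + 3" for n
    using C(2)[OF pin pin, of "Suc n" n] that unfolding p_def by (simp add: qn)
  have bd: "norm (g (p k) - g (p n)) \<le> C / (1 - q) * q ^ n" if "n \<ge> m + 3" "k \<ge> n" for n k
  proof -
    have "norm (g (p k) - g (p n)) = norm (\<Sum>i=n..<k. g (p (Suc i)) - g (p i))"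
      using sum_Suc_diff'[OF that(2), of "\<lambda>i. g (p i)"] by simp
    also have "\<dots> \<le> (\<Sum>i=n..<k. C * q ^ i)" using st that by (intro sum_norm_le) auto
    also have "\<dots> = C * (q ^ n * (\<Sum>i<k - n. q ^ i))"
    proof -
      have "(\<Sum>i=n..<k. q ^ i) = (\<Sum>i<k - n. q ^ (i + n))"
        using that(2) sum.shift_bounds_nat_ivl[of "\<lambda>i. q ^ i" 0 n "k - n"] by (simp add: atLeast0LessThan)
      also have "\<dots> = q ^ n * (\<Sum>i<k - n. q ^ i)" by (simp add: sum_distrib_left power_add mult_ac)
      finally show ?thesis by (simp only: sum_distrib_left[symmetric])
    qed
    also have "(\<Sum>i<k - n. q ^ i) \<le> 1 / (1 - q)"
      using q sum_le_suminf[of "\<lambda>i. q ^ i" "{..<k - n}"] by (simp add: suminf_geometric summable_geometric)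
    then have "C * (q ^ n * (\<Sum>i<k - n. q ^ i)) \<le> C * (q ^ n * (1 / (1 - q)))"
      using C(1) q by (intro mult_left_mono) auto
    finally show ?thesis by (simp add: field_simps)
  qed
  have "Cauchy (\<lambda>n. g (p (n + (m + 3))))"
  proof (rule CauchyI')
    fix e :: real assume e: "e > 0"
    have "(\<lambda>n. C / (1 - q) * q ^ (n + (m + 3))) \<longlonglongrightarrow> C / (1 - q) * 0"
      using q by (intro tendsto_mult tendsto_const LIMSEQ_ignore_initial_segment LIMSEQ_power_zero) auto
    then have "\<forall>\<^sub>F n in sequentially. C / (1 - q) * q ^ (n + (m + 3)) < e" using e by (simp add: order_tendstoD(2))
    then obtain M where M: "\<And>n. n \<ge> M \<Longrightarrow> C / (1 - q) * q ^ (n + (m + 3)) < e" unfolding eventually_sequentially by blast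
    have "dist (g (p (k + (m + 3)))) (g (p (n + (m + 3)))) < e" if "k \<ge> M" "n > k" for k n
      using bd[of "k + (m + 3)" "n + (m + 3)"] M[of k] that by (simp add: dist_norm norm_minus_commute)
    then show "\<exists>M. \<forall>k\<ge>M. \<forall>n>k. dist (g (p (k + (m + 3)))) (g (p (n + (m + 3)))) < e" by blast
  qed
  then obtain c where "(\<lambda>n. g (p (n + (m + 3)))) \<longlonglongrightarrow> c" using Cauchy_convergent_iff convergent_def by blast
  then have c: "(\<lambda>n. g (p n)) \<longlonglongrightarrow> c" by (rule LIMSEQ_offset)
  have cn: "norm (g (p n) - c) \<le> C / (1 - q) * q ^ n" if "n \<ge> m + 3" for n
  proof (rule LIMSEQ_le_const2)
    show "(\<lambda>k. norm (g (p n) - g (p k))) \<longlonglongrightarrow> norm (g (p n) - c)" by (intro tendsto_intros c)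
    show "\<exists>N. \<forall>k\<ge>N. norm (g (p n) - g (p k)) \<le> C / (1 - q) * q ^ n"
      using bd[OF that] by (auto simp: norm_minus_commute intro!: exI[of _ n])
  qed
  have "norm (g w - c) \<le> (6 * C + C / (1 - q)) * exp (\<beta> * Re w)" if w: "w \<in> lstrip m" for w
  proof -
    define n where "n = nat \<lceil>Re w\<rceil>"
    have R: "Re w > real m + 2" using w unfolding lstrip_def by simp
    have n: "Re w \<le> real n" "real n < Re w + 1" unfolding n_def using R by linarith+
    then have nm: "n \<ge> m + 3" using R by linarith
    have "norm (p n - w) \<le> \<bar>Re (p n - w)\<bar> + \<bar>Im (p n - w)\<bar>" by (rule cmod_le)
    also have "\<dots> \<le> 6" using n lstrip_Im[OF w] unfolding p_def by auto
    finally have d: "norm (p n - w) \<le> 6" .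
    have "norm (g (p n) - g w) \<le> C * exp (\<beta> * Re w) * norm (p n - w)"
      by (rule C(2)[OF pin[OF nm] w]) (use n in \<open>auto simp: p_def\<close>)
    also have "\<dots> \<le> C * exp (\<beta> * Re w) * 6" using C(1) d by (intro mult_left_mono) auto
    finally have 1: "norm (g (p n) - g w) \<le> 6 * C * exp (\<beta> * Re w)" by simp
    have "norm (g (p n) - c) \<le> C / (1 - q) * exp (\<beta> * real n)" using cn[OF nm] by (simp add: qn)
    also have "\<dots> \<le> C / (1 - q) * exp (\<beta> * Re w)"
      using C(1) q b n by (intro mult_left_mono) (auto intro: mult_left_mono_neg)
    finally have 2: "norm (g (p n) - c) \<le> C / (1 - q) * exp (\<beta> * Re w)" .
    have "norm (g w - c) \<le> norm (g (p n) - g w) + norm (g (p n) - c)"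
      using norm_triangle_ineq4[of "g (p n) - c" "g (p n) - g w"] by simp
    then show ?thesis using 1 2 unfolding distrib_right by linarith
  qed
  moreover have "(\<lambda>w. g w - c) holomorphic_on lstrip m"
    using g open_lstrip by (intro holomorphic_intros) (auto simp: holomorphic_on_open)
  ultimately show ?thesis unfolding symb_def by (intro exI[of _ c]) auto
qed

text \<open>The Neumann series of antidiff for the monomial x^m, where it terminates.\<close>

definition poly_primitive :: "complex poly \<Rightarrow> complex poly" where
  "poly_primitive p = (\<Sum>i\<le>degree p. monom (coeff p i / of_nat (Suc i)) (Suc i))"

fun faul_term :: "nat \<Rightarrow> nat \<Rightarrow> complex poly" where
  "faul_term m 0 = monom 1 m"
| "faul_term m (Suc l) = pcompose (poly_primitive (faul_term m l)) [:1, 1:] - poly_primitive (faul_term m l) - faul_term m l"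

definition faulhaber :: "nat \<Rightarrow> complex poly" where
  "faulhaber m = (\<Sum>l\<le>m. smult ((-1)^l) (poly_primitive (faul_term m l)))"

lemma pderiv_poly_primitive: "pderiv (poly_primitive p) = p"
proof -
  have "pderiv (poly_primitive p) = (\<Sum>i\<le>degree p. monom (coeff p i) i)"
    unfolding poly_primitive_def by (simp add: higher_pderiv_sum[of 1, simplified] pderiv_monom del: of_nat_Suc)
  then show ?thesis by (simp add: poly_as_sum_of_monoms)
qed

lemma prim_poly:
  assumes "w0 \<in> lstrip m" "w \<in> lstrip m" "\<And>v. v \<in> lstrip m \<Longrightarrow> f v = poly p (exp v)"
  shows "prim w0 f w = poly (poly_primitive p) (exp w) - poly (poly_primitive p) (exp w0)"
proof -
  have "((\<lambda>v. poly (poly_primitive p) (exp v)) has_field_derivative poly p (exp v) * exp v) (at v within lstrip m)" for v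
  proof -
    have "(poly (poly_primitive p) has_field_derivative poly p (exp v)) (at (exp v))"
      using poly_DERIV[of "poly_primitive p" "exp v"] by (simp add: pderiv_poly_primitive)
    from DERIV_chain2[OF this DERIV_exp] show ?thesis by (rule has_field_derivative_at_within)
  qed
  from contour_integral_unique[OF contour_integral_primitive[OF this valid_path_linepath]]
  have "prim w0 (\<lambda>v. poly p (exp v)) w = poly (poly_primitive p) (exp w) - poly (poly_primitive p) (exp w0)"
    unfolding prim_def using seg_lstrip[OF assms(1,2)] by simp
  then show ?thesis using prim_cong[OF assms(3,1,2)] by simp
qed

text \<open>For a polynomial in z = exp w the primitive is again a polynomial up to a constant fixed
  by \<open>w0\<close>, and this constant cancels in the difference taken by
  \<open>fstep\<close>.\<close>

lemma fiter_exp: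
  assumes "w0 \<in> lstrip (2 * l)" "w \<in> lstrip (2 * l)"
  shows "fiter w0 l (\<lambda>w. exp (of_nat m * w)) w = poly (faul_term m l) (exp w)"
  using assms
proof (induction l arbitrary: w)
  case 0
  then show ?case by (simp add: fiter_def poly_monom exp_of_nat_mult)
next
  case (Suc l)
  have sub: "lstrip (2 * Suc l) \<subseteq> lstrip (2 * l)" "lstrip (2 * Suc l) \<subseteq> lstrip (Suc (2 * l))" by (rule lstrip_mono, simp)+
  have w0: "w0 \<in> lstrip (2 * l)" and w: "w \<in> lstrip (2 * l)" and w1: "w \<in> lstrip (Suc (2 * l))"
    using Suc.prems sub by auto
  have tw: "shiftw w \<in> lstrip (2 * l)" by (rule shiftw_props(3)[OF w1])
  have "fiter w0 (Suc l) h w = prim w0 (fiter w0 l h) (shiftw w) - prim w0 (fiter w0 l h) w - fiter w0 l h w" for h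
    by (simp add: fiter_def fstep_def)
  then show ?case
    using prim_poly[OF w0 tw Suc.IH[OF w0]] prim_poly[OF w0 w Suc.IH[OF w0]] Suc.IH[OF w0 w] shiftw_props(4)[OF w1]
    by (simp add: poly_pcompose add.commute)
qed

lemma symb_exp_nat: "symb False {0} m (real k) (\<lambda>_ w. exp (of_nat k * w))"
  using symb_exp[of False "\<lambda>_. - of_nat k" "{0}" "real k" "- real k" m] by simp

lemma poly_tendsto_0:
  fixes p :: "complex poly"
  assumes "(\<lambda>n. poly p (of_nat n)) \<longlonglongrightarrow> 0" shows "p = 0"
proof -
  obtain a q where p: "p = pCons a q" by (cases p)
  have "q = 0"
  proof (rule ccontr)
    assume "q \<noteq> 0"
    from poly_infinity[OF this, of 1 a] obtain r where r: "\<And>z. r \<le> norm z \<Longrightarrow> 1 \<le> norm (poly p z)" unfolding p by blast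
    have "\<forall>\<^sub>F n in sequentially. norm (poly p (of_nat n)) < 1"
      using tendsto_norm[OF assms] by (intro order_tendstoD(2)[of _ 0]) auto
    moreover have "\<forall>\<^sub>F n in sequentially. r \<le> real n" using filterlim_real_sequentially by (simp add: filterlim_at_top)
    ultimately have "\<forall>\<^sub>F n in sequentially. False"
    proof eventually_elim
      case (elim n)
      then show ?case using r[of "of_nat n"] by simp
    qed
    then show False by simp
  qed
  then have "(\<lambda>n. a) \<longlonglongrightarrow> 0" using assms unfolding p by simp
  then have "a = 0" using LIMSEQ_unique tendsto_const by blast
  then show ?thesis using p \<open>q = 0\<close> by simp
qed

text \<open>The analytic estimate does the algebra: m + 1 steps lower the order m to -1, so the
  polynomial tends to 0 along the integers and must vanish; the later terms vanish with it.\<close>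

lemma faul_term_eq_0: "l > m \<Longrightarrow> faul_term m l = 0"
proof (induction l)
  case (Suc l)
  show ?case
  proof (cases "l = m")
    case True
    define w0 where "w0 = base_choice (2 * Suc m) 1"
    have "lstrip (lev (2 * Suc m) 1) \<subseteq> lstrip (0 + 2 * Suc m)" by (rule lstrip_mono) (simp add: lev_def)
    then have w0: "w0 \<in> lstrip (0 + 2 * Suc m)" using base_choice_in[of "2 * Suc m" 1] unfolding w0_def by blast
    have "symb False {0} (0 + 2 * Suc m) (real m - real (Suc m)) (\<lambda>_. fiter w0 (Suc m) (\<lambda>w. exp (of_nat m * w)))"
      by (rule symb_fiter[OF symb_exp_nat _ w0]) simp
    then obtain C where C: "\<And>w. w \<in> lstrip (0 + 2 * Suc m) \<Longrightarrow> norm (fiter w0 (Suc m) (\<lambda>w. exp (of_nat m * w)) w) \<le> C * exp ((-1) * Re w)"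
      by (rule symb_bound) auto
    obtain N0 where N0: "N0 \<ge> 1" "\<And>N. N \<ge> N0 \<Longrightarrow> rpt N \<in> lstrip (0 + 2 * Suc m)"
      using lpt_in_lstrip[of "0 + 2 * Suc m"] by (metis norm_zero zero_le_divide_1_iff zero_le_numeral)
    have "norm (poly (faul_term m (Suc m)) (of_nat N)) \<le> C * real N powr (-1)" if "N \<ge> N0" for N
    proof -
      have N1: "N \<ge> 1" using that N0(1) by simp
      have "fiter w0 (Suc m) (\<lambda>w. exp (of_nat m * w)) (rpt N) = poly (faul_term m (Suc m)) (exp (rpt N))"
        using fiter_exp[of w0 "Suc m" "rpt N" m] w0 N0(2)[OF that] by simp
      then show ?thesis using C[OF N0(2)[OF that]] Re_rpt[OF N1, of "-1"] exp_rpt[OF N1] by simp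
    qed
    then have "(\<lambda>n. poly (faul_term m (Suc m)) (of_nat n)) \<longlonglongrightarrow> 0"
      by (intro Lim_null_comparison[OF _ powr_neg_tendsto[of "-1" C]]) (auto simp: eventually_sequentially)
    then show ?thesis using True poly_tendsto_0 by blast
  next
    case False
    then have "faul_term m l = 0" using Suc by simp
    then show ?thesis by (simp add: poly_primitive_def)
  qed
qed simp

text \<open>The alternating sum telescopes to x^m plus, up to sign, the value of
  \<open>faul_term m (Suc m)\<close>, which is zero.\<close>

lemma faulhaber_diff: "poly (faulhaber m) (x + 1) - poly (faulhaber m) x = x ^ m"
proof -
  have "(\<Sum>l\<le>n. (-1)^l * (poly (poly_primitive (faul_term m l)) (x + 1) - poly (poly_primitive (faul_term m l)) x)) = x ^ m + (-1)^n * poly (faul_term m (Suc n)) x" for n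
    by (induction n) (simp_all add: poly_pcompose poly_monom algebra_simps)
  from this[of m] show ?thesis
    unfolding faulhaber_def by (simp add: poly_sum faul_term_eq_0 sum_subtractf algebra_simps del: faul_term.simps(2))
qed

text \<open>For K > m the Neumann series of the monomial is complete, and the constants coming from
  \<open>w0\<close> drop out of a difference. The values agree with \<open>faulhaber\<close> in
  spite of the different logarithms of the two points, as only exponentials enter.\<close>

lemma antidiff_exp_diff:
  assumes K: "K > m" and w0: "w0 \<in> lstrip (k + 2 * K)" and v: "v \<in> lstrip (k + 2 * K)" and w: "w \<in> lstrip (k + 2 * K)"
  shows "antidiff K w0 (\<lambda>w. exp (of_nat m * w)) v - antidiff K w0 (\<lambda>w. exp (of_nat m * w)) w = poly (faulhaber m) (exp v) - poly (faulhaber m) (exp w)"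
proof -
  have p: "prim w0 (fiter w0 l (\<lambda>w. exp (of_nat m * w))) u = poly (poly_primitive (faul_term m l)) (exp u) - poly (poly_primitive (faul_term m l)) (exp w0)"
    if "l < K" "u \<in> lstrip (k + 2 * K)" for l u
  proof -
    have sub: "lstrip (k + 2 * K) \<subseteq> lstrip (2 * l)" using that(1) by (intro lstrip_mono) simp
    then have "w0 \<in> lstrip (2 * l)" "u \<in> lstrip (2 * l)" using w0 that(2) by auto
    then show ?thesis using fiter_exp by (intro prim_poly) auto
  qed
  have "antidiff K w0 (\<lambda>w. exp (of_nat m * w)) v - antidiff K w0 (\<lambda>w. exp (of_nat m * w)) w
    = (\<Sum>l<K. (-1)^l * (poly (poly_primitive (faul_term m l)) (exp v) - poly (poly_primitive (faul_term m l)) (exp w)))"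
    unfolding antidiff_def sum_subtractf[symmetric]
  proof (rule sum.cong[OF refl])
    fix l assume "l \<in> {..<K}"
    then have "prim w0 (fiter w0 l (\<lambda>w. exp (of_nat m * w))) v - prim w0 (fiter w0 l (\<lambda>w. exp (of_nat m * w))) w
      = poly (poly_primitive (faul_term m l)) (exp v) - poly (poly_primitive (faul_term m l)) (exp w)" using p[of l v] p[of l w] v w by simp
    then show "(-1)^l * prim w0 (fiter w0 l (\<lambda>w. exp (of_nat m * w))) v - (-1)^l * prim w0 (fiter w0 l (\<lambda>w. exp (of_nat m * w))) w
      = (-1)^l * (poly (poly_primitive (faul_term m l)) (exp v) - poly (poly_primitive (faul_term m l)) (exp w))" by (simp only: right_diff_distrib[symmetric])
  qed
  also have "\<dots> = (\<Sum>l\<le>m. (-1)^l * (poly (poly_primitive (faul_term m l)) (exp v) - poly (poly_primitive (faul_term m l)) (exp w)))"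
    using K by (intro sum.mono_neutral_right) (auto simp: faul_term_eq_0 poly_primitive_def)
  also have "\<dots> = poly (faulhaber m) (exp v) - poly (faulhaber m) (exp w)"
    unfolding faulhaber_def by (simp add: poly_sum sum_subtractf algebra_simps)
  finally show ?thesis .
qed

text \<open>Only rational coefficients act on all the rings in which the recursion is used; hence
  the care for rationality.\<close>

definition rat_poly :: "complex poly \<Rightarrow> bool" where
  "rat_poly p \<longleftrightarrow> (\<forall>i. coeff p i \<in> \<rat>)"

lemma rat_poly_closure:
  "rat_poly p \<Longrightarrow> rat_poly q \<Longrightarrow> rat_poly (p + q)" "rat_poly p \<Longrightarrow> rat_poly q \<Longrightarrow> rat_poly (p - q)"
  "rat_poly p \<Longrightarrow> rat_poly q \<Longrightarrow> rat_poly (p * q)" "a \<in> \<rat> \<Longrightarrow> rat_poly (monom a n)" "a \<in> \<rat> \<Longrightarrow> rat_poly p \<Longrightarrow> rat_poly (smult a p)"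
  "rat_poly 0" "a \<in> \<rat> \<Longrightarrow> rat_poly p \<Longrightarrow> rat_poly (pCons a p)"
  by (auto simp: rat_poly_def coeff_mult coeff_pCons intro!: Rats_sum split: nat.splits)

lemma rat_poly_sum: "(\<And>i. i \<in> I \<Longrightarrow> rat_poly (f i)) \<Longrightarrow> rat_poly (\<Sum>i\<in>I. f i)"
  by (induction I rule: infinite_finite_induct) (auto intro: rat_poly_closure)

lemma rat_poly_poly_primitive: "rat_poly p \<Longrightarrow> rat_poly (poly_primitive p)"
  unfolding poly_primitive_def by (intro rat_poly_sum rat_poly_closure Rats_divide) (auto simp: rat_poly_def simp del: of_nat_Suc)

lemma rat_poly_pcompose: "rat_poly p \<Longrightarrow> rat_poly q \<Longrightarrow> rat_poly (pcompose p q)"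
proof (induction p)
  case (pCons a p)
  have "a \<in> \<rat>" "rat_poly p" using pCons.prems(1) unfolding rat_poly_def by (metis coeff_pCons_0, metis coeff_pCons_Suc)
  then show ?case using pCons by (auto simp: pcompose_pCons intro!: rat_poly_closure)
qed (auto intro: rat_poly_closure)

lemma rat_poly_faulhaber: "rat_poly (faulhaber m)" "rat_poly (pcompose (faulhaber m) [:1, 1:])"
proof -
  have x: "rat_poly [:1, 1:]" by (intro rat_poly_closure) auto
  have "rat_poly (faul_term m l)" for l
    by (induction l) (auto intro!: rat_poly_closure rat_poly_poly_primitive rat_poly_pcompose)
  then show "rat_poly (faulhaber m)" unfolding faulhaber_def by (intro rat_poly_sum rat_poly_closure rat_poly_poly_primitive) auto
  then show "rat_poly (pcompose (faulhaber m) [:1, 1:])" using x by (rule rat_poly_pcompose)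
qed

definition faul_deg :: "nat \<Rightarrow> nat" where
  "faul_deg m = max (degree (faulhaber m)) (degree (pcompose (faulhaber m) [:1, 1:]))"

definition faul_coeff :: "nat \<Rightarrow> nat \<Rightarrow> rat" where
  "faul_coeff m e = (SOME q. of_rat q = coeff (faulhaber m) e)"

text \<open>Coefficients of P (x + 1), which is what a lower limit of summation contributes to the
  smaller neighbour.\<close>

definition faul_shift_coeff :: "nat \<Rightarrow> nat \<Rightarrow> rat" where
  "faul_shift_coeff m e = (SOME q. of_rat q = coeff (pcompose (faulhaber m) [:1, 1:]) e)"

lemma faulhaber_faul_coeff: "poly (faulhaber m) x = (\<Sum>e\<le>faul_deg m. of_rat (faul_coeff m e) * x ^ e)"
  and faulhaber_faul_shift_coeff: "poly (faulhaber m) (x + 1) = (\<Sum>e\<le>faul_deg m. of_rat (faul_shift_coeff m e) * x ^ e)"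
proof -
  have c: "of_rat (faul_coeff m e) = coeff (faulhaber m) e" "of_rat (faul_shift_coeff m e) = coeff (pcompose (faulhaber m) [:1, 1:]) e" for e
    using rat_poly_faulhaber[of m] unfolding faul_coeff_def faul_shift_coeff_def rat_poly_def by (metis (mono_tags, lifting) Rats_cases someI)+
  have al: "poly p x = (\<Sum>i\<le>n. coeff p i * x ^ i)" if "degree p \<le> n" for p :: "complex poly" and n
    using that unfolding poly_altdef by (intro sum.mono_neutral_left) (auto simp: coeff_eq_0)
  show "poly (faulhaber m) x = (\<Sum>e\<le>faul_deg m. of_rat (faul_coeff m e) * x ^ e)" unfolding c by (rule al) (simp add: faul_deg_def)
  have "poly (faulhaber m) (x + 1) = poly (pcompose (faulhaber m) [:1, 1:]) x" by (simp add: poly_pcompose add.commute)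
  then show "poly (faulhaber m) (x + 1) = (\<Sum>e\<le>faul_deg m. of_rat (faul_shift_coeff m e) * x ^ e)" unfolding c by (simp add: al faul_deg_def)
qed

text \<open>Entries with large real part make the expansion of \<open>ys\<close> a constant c up to
  order 2 - A. The source of the entry - m is then - c z^m up to a small term, so the jump is - c
  times the difference of \<open>faulhaber\<close> across the gap, and the left chain sum tends to c
  as well.\<close>

lemma jump_polynomial:
  assumes t: "norm t \<le> 1/2" and ys: "\<And>y. y \<in> set ys \<Longrightarrow> norm y \<le> M \<and> A \<le> Re y" and M: "M \<ge> 0" "real m \<le> M" "A \<le> M" and A: "A \<ge> 3"
    and w0: "w0 \<in> lstrip (lev K (Suc (length ys)))" and K: "real K > (2 * real (Suc (length ys)) + 2) * (2 * M + 4)"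
    and D: "D \<ge> 0" "real m \<le> D" "\<exists>C. \<forall>N\<ge>1. norm (poly (faulhaber m) (of_nat N + 1) - poly (faulhaber m) (t - of_nat N)) \<le> C * real N powr D"
  shows "\<exists>C N0. \<forall>N\<ge>N0. norm (jump K w0 t (- of_nat m # ys) N
      + chain_sum (wL t) N ys * (poly (faulhaber m) (of_nat N + 1) - poly (faulhaber m) (t - of_nat N))) \<le> C * real N powr (D + 3 - A)"
proof -
  interpret chain_asym_family False "{0}" "\<lambda>_. t" M
    by unfold_locales (use t M in auto)
  define cs where "cs = map (\<lambda>c (_::complex). c) ys"
  have v: "vals cs x = ys" for x unfolding cs_def by (simp add: o_def)
  have lc: "length cs = length ys" unfolding cs_def by simp
  have g: "list_all2 good (replicate (length ys) A) cs" unfolding list_all2_conv_all_nth lc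
    using ys by (auto simp: good_def cs_def)
  have gm: "\<forall>c\<in>set cs. good (- M) c"
    using g good_minus by (fastforce simp: list_all2_conv_all_nth in_set_conv_nth)
  let ?n = "length ys"
  have le: "real ?n * (2 * M + 4) \<le> (2 * real (Suc ?n) + 2) * (2 * M + 4)" using M by (intro mult_right_mono) auto
  then have K1: "real K > real ?n * (2 * M + 4)" using K by linarith
  have w0': "w0 \<in> lstrip (lev K ?n)" using w0 lstrip_mono[OF lev_mono[of ?n "Suc ?n" K]] by auto
  have Km: "K > m"
  proof -
    have "4 * (2 * M + 4) \<le> (2 * real (Suc ?n) + 2) * (2 * M + 4)" using M by (intro mult_right_mono) auto
    then have "4 * (2 * M + 4) < real K" using K by (rule le_less_trans)
    moreover have "real m \<le> 4 * (2 * M + 4)" using M(1,2) by simp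
    ultimately have "real m < real K" by (rule le_less_trans[rotated])
    then show ?thesis by simp
  qed
  define a where "a = chain_asym K w0 t ys"
  define L where "L = A - 2"
  have L: "L \<ge> 1" using A unfolding L_def by simp
  have "\<exists>c. symb False {0} (lev K ?n) (- L) (\<lambda>_ w. a w - c)"
  proof (cases ys)
    case Nil
    have "symb False {0} (lev K ?n) (- L) (\<lambda>_ w. a w - 1)"
      unfolding a_def Nil symb_def by (auto intro!: exI[of _ 0])
    then show ?thesis by blast
  next
    case (Cons y ys')
    define cs' where "cs' = map (\<lambda>c (_::complex). c) ys'"
    have v': "vals cs' x = ys'" for x unfolding cs'_def by (simp add: o_def)
    have g': "list_all2 good (replicate (length ys') A) cs'" unfolding list_all2_conv_all_nth
      using ys Cons by (auto simp: good_def cs'_def)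
    have gy: "good A (\<lambda>_. y)" using ys Cons by (auto simp: good_def)
    have l': "length cs' = length ys'" "?n = Suc (length ys')" unfolding cs'_def using Cons by auto
    have K2: "real K > real (length cs') * (2 * M + 4)"
    proof -
      have "real (length cs') * (2 * M + 4) \<le> real ?n * (2 * M + 4)" using M l' by (intro mult_right_mono) auto
      then show ?thesis using K1 by linarith
    qed
    have w0y: "w0 \<in> lstrip (lev K (Suc (length cs')))" using w0' l' by simp
    let ?F = "\<lambda>x. asrc ((\<lambda>_. y) x) (chain_asym K w0 t (vals cs' x))"
    \<comment> \<open>The tail after y has order at most 1, so the derivative of the expansion has
      order at most 1 - A + 1 = - L.\<close>
    have o: "ordl 1 (replicate (length ys') A) \<le> 1" using A by (intro ordl_replicate) auto
    from chain_asym_deriv_order(1)[OF g' gy w0y K2, of 1] obtain R where R: "symb False {0} (lev K ?n) (ordl 1 (replicate (length ys') A) - A) R"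
      "\<forall>x\<in>{0}. \<forall>w\<in>lstrip (lev K ?n). (chain_asym K w0 t (vals ((\<lambda>_. y) # cs') x) has_field_derivative ?F x w * exp w + R x w) (at w)"
      using l' by auto
    have F: "symb False {0} (Suc (lev K (length cs'))) (ordl 1 (replicate (length ys') A) - A) ?F"
      using chain_asym_deriv_order(2)[OF g' gy w0y K2, of 1] by simp
    have "symb False {0} (Suc (lev K (length cs'))) (ordl 1 (replicate (length ys') A) - A + - (-1)) (\<lambda>x w. ?F x w * exp (- (-1) * w))"
      by (intro symb_mult F symb_exp[of _ "\<lambda>x. -1" _ 1]) auto
    then have F1: "symb False {0} (Suc (lev K (length cs'))) (ordl 1 (replicate (length ys') A) - A + - (-1)) (\<lambda>x w. ?F x w * exp w)"
      by simp
    have F2: "symb False {0} (lev K ?n) (- L) (\<lambda>x w. ?F x w * exp w)"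
      by (rule symb_mono[OF F1]) (use o in \<open>auto simp: l' lev_Suc L_def\<close>)
    have R2: "symb False {0} (lev K ?n) (- L) R" using R(1) by (rule symb_mono) (use o in \<open>auto simp: L_def\<close>)
    have S2: "symb False {0} (lev K ?n) (- L) (\<lambda>_ w. ?F 0 w * exp w + R 0 w)"
      by (rule symb_cong[OF symb_add[OF F2 R2]]) auto
    show ?thesis
      by (rule small_deriv_const[OF S2]) (use R(2) L in \<open>auto simp: a_def Cons v'\<close>)
  qed
  then obtain c where c: "symb False {0} (lev K ?n) (- L) (\<lambda>_ w. a w - c)" by blast
  \<comment> \<open>The part of the source that is left after replacing the expansion of
    \<open>ys\<close> by its limit c; its order is m - L.\<close>
  define f2 where "f2 = (\<lambda>w. - exp (of_nat m * w) * (a (shiftw w) - c))"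
  have f2: "symb False {0} (Suc (lev K ?n)) (real m + - L) (\<lambda>_. f2)"
    using symb_cmult[OF symb_mult[OF symb_exp_nat[of "Suc (lev K ?n)" m] symb_shift[OF c]], where a = "-1"] unfolding f2_def by simp
  define F where "F = asrc (- of_nat m) a"
  have F_eq: "F = (\<lambda>w. (- c) * exp (of_nat m * w) + f2 w)"
    unfolding F_def asrc_def f2_def by (auto simp: algebra_simps)
  have w0F: "w0 \<in> lstrip (Suc (lev K ?n) + 2 * K)" using w0 lev_Suc by simp
  have AD: "antidiff K w0 F w = (- c) * antidiff K w0 (\<lambda>w. exp (of_nat m * w)) w + antidiff K w0 f2 w" if "w \<in> lstrip (lev K (Suc ?n))" for w
    unfolding F_eq by (rule antidiff_lincomb[OF symb_exp_nat f2 w0F]) (use that lev_Suc in auto)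
  have D2: "symb False {0} (Suc (lev K ?n) + 2 * K) (real m + - L - real 0 + - (-1)) (\<lambda>x w. (\<Sum>l=0..<K. (-1)^l * fiter w0 l f2 w) * exp (- (-1) * w))"
    by (intro symb_mult symb_antidiff_deriv[OF f2 _ w0F] symb_exp[of _ "\<lambda>x. -1" _ 1]) auto
  obtain C1 where C1: "C1 > 0" "\<And>v w. v \<in> lstrip (lev K (Suc ?n)) \<Longrightarrow> w \<in> lstrip (lev K (Suc ?n)) \<Longrightarrow> \<bar>Re v - Re w\<bar> \<le> 1 \<Longrightarrow>
      norm (antidiff K w0 f2 v - antidiff K w0 f2 w) \<le> C1 * exp ((real m - L + 1) * Re w) * norm (v - w)"
  proof -
    have "(antidiff K w0 f2 has_field_derivative (\<Sum>l=0..<K. (-1)^l * fiter w0 l f2 w) * exp (- (-1) * w)) (at w)" if "w \<in> lstrip (Suc (lev K ?n) + 2 * K)" for w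
      using antidiff_deriv[OF f2 _ w0F that] by (simp add: lessThan_atLeast0)
    from symb_lipschitz[OF D2, of "\<lambda>_. antidiff K w0 f2", OF this] that show ?thesis by (auto simp: lev_Suc)
  qed
  obtain C2 N2 where C2: "N2 \<ge> 1" "\<And>N. N \<ge> N2 \<Longrightarrow> norm (chain_sum (wL t) N ys - a (lpt t N)) \<le> C2 * real N powr (- (real K - real ?n * (2 * M + 4)))"
    using chain_asym_main[OF gm, of w0 K] w0' K1 unfolding v lc a_def by auto
  obtain C3 where C3: "C3 > 0" "\<And>w. w \<in> lstrip (lev K ?n) \<Longrightarrow> norm (a w - c) \<le> C3 * exp (- L * Re w)"
    by (rule symb_bound[OF c]) auto
  obtain C4 where C4: "\<And>N. N \<ge> 1 \<Longrightarrow> norm (poly (faulhaber m) (of_nat N + 1) - poly (faulhaber m) (t - of_nat N)) \<le> C4 * real N powr D" using D(3) by blast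
  obtain N3 where N3: "N3 \<ge> 1" "\<And>N. N \<ge> N3 \<Longrightarrow> lpt t N \<in> lstrip (lev K (Suc ?n)) \<and> rpt N \<in> lstrip (lev K (Suc ?n))"
    using lpt_in_lstrip[of "lev K (Suc ?n)"] t by blast
  define N0 where "N0 = max 2 (max N2 N3)"
  define CC where "CC = C1 * 2 powr \<bar>real m - L + 1\<bar> * 6 + (\<bar>C2\<bar> + C3 * 2 powr \<bar>- L\<bar>) * \<bar>C4\<bar>"
  have "norm (jump K w0 t (- of_nat m # ys) N
      + chain_sum (wL t) N ys * (poly (faulhaber m) (of_nat N + 1) - poly (faulhaber m) (t - of_nat N))) \<le> CC * real N powr (D + 3 - A)" if N: "N \<ge> N0" for N
  proof -
    have NN: "N \<ge> 2" "N \<ge> N2" "N \<ge> N3" "Suc N \<ge> N3" "N \<ge> 1" "real N \<ge> 1" using N unfolding N0_def by auto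
    let ?r = "rpt (Suc N)" and ?l = "lpt t N"
    have pr: "?r \<in> lstrip (lev K (Suc ?n))" and faul_term: "?l \<in> lstrip (lev K (Suc ?n))" using N3(2) NN by auto
    have pl': "?l \<in> lstrip (lev K ?n)" using faul_term lstrip_mono[OF lev_mono[of ?n "Suc ?n" K]] by auto
    note cl = right_left_close[OF t NN(1)]
    let ?dP = "poly (faulhaber m) (of_nat N + 1) - poly (faulhaber m) (t - of_nat N)"
    have "jump K w0 t (- of_nat m # ys) N = antidiff K w0 F ?r - antidiff K w0 F ?l"
      unfolding jump_def F_def a_def by simp
    also have "\<dots> = - c * (antidiff K w0 (\<lambda>w. exp (of_nat m * w)) ?r - antidiff K w0 (\<lambda>w. exp (of_nat m * w)) ?l) + (antidiff K w0 f2 ?r - antidiff K w0 f2 ?l)"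
      unfolding AD[OF pr] AD[OF faul_term] by (simp add: algebra_simps)
    also have "antidiff K w0 (\<lambda>w. exp (of_nat m * w)) ?r - antidiff K w0 (\<lambda>w. exp (of_nat m * w)) ?l = ?dP"
      using antidiff_exp_diff[OF Km w0F, of ?r ?l] pr faul_term lev_Suc exp_rpt[of "Suc N"] exp_lpt[OF t NN(5)] by (simp add: add.commute)
    finally have j: "jump K w0 t (- of_nat m # ys) N = - c * ?dP + (antidiff K w0 f2 ?r - antidiff K w0 f2 ?l)" .
    have eq: "jump K w0 t (- of_nat m # ys) N + chain_sum (wL t) N ys * ?dP = (antidiff K w0 f2 ?r - antidiff K w0 f2 ?l) + (chain_sum (wL t) N ys - c) * ?dP"
      unfolding j by (simp add: algebra_simps)
    have "norm (antidiff K w0 f2 ?r - antidiff K w0 f2 ?l) \<le> C1 * exp ((real m - L + 1) * Re ?l) * norm (?r - ?l)"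
      by (rule C1(2)[OF pr faul_term cl(1)])
    also have "\<dots> \<le> C1 * (2 powr \<bar>real m - L + 1\<bar> * real N powr (real m - L + 1)) * 6"
      using C1(1) Re_lpt[OF t NN(5), of "real m - L + 1"] cl(2) by (intro mult_mono mult_left_mono) auto
    also have "\<dots> = (C1 * 2 powr \<bar>real m - L + 1\<bar> * 6) * real N powr (real m - L + 1)" by (simp only: mult_ac)
    also have "\<dots> \<le> (C1 * 2 powr \<bar>real m - L + 1\<bar> * 6) * real N powr (D + 3 - A)"
      using C1(1) NN D unfolding L_def by (intro mult_left_mono powr_mono) auto
    finally have q1: "norm (antidiff K w0 f2 ?r - antidiff K w0 f2 ?l) \<le> (C1 * 2 powr \<bar>real m - L + 1\<bar> * 6) * real N powr (D + 3 - A)" .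
    have "norm (chain_sum (wL t) N ys - c) \<le> norm (chain_sum (wL t) N ys - a ?l) + norm (a ?l - c)"
      using norm_triangle_ineq[of "chain_sum (wL t) N ys - a ?l" "a ?l - c"] by simp
    also have "\<dots> \<le> \<bar>C2\<bar> * real N powr (- L) + C3 * (2 powr \<bar>- L\<bar> * real N powr (- L))"
    proof (rule add_mono)
      have "norm (chain_sum (wL t) N ys - a ?l) \<le> C2 * real N powr (- (real K - real ?n * (2 * M + 4)))" using C2(2) NN by blast
      also have "\<dots> \<le> \<bar>C2\<bar> * real N powr (- L)"
      proof (intro mult_mono powr_mono)
        have "real ?n * M \<ge> 0" using M by simp
        then show "- (real K - real ?n * (2 * M + 4)) \<le> - L" using K M A unfolding L_def by (simp add: algebra_simps)
      qed (use NN in auto)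
      finally show "norm (chain_sum (wL t) N ys - a ?l) \<le> \<bar>C2\<bar> * real N powr (- L)" .
      have "norm (a ?l - c) \<le> C3 * exp (- L * Re ?l)" by (rule C3(2)[OF pl'])
      also have "\<dots> \<le> C3 * (2 powr \<bar>- L\<bar> * real N powr (- L))" using C3(1) Re_lpt[OF t NN(5), of "- L"] by (intro mult_left_mono) auto
      finally show "norm (a ?l - c) \<le> C3 * (2 powr \<bar>- L\<bar> * real N powr (- L))" .
    qed
    also have "\<dots> = (\<bar>C2\<bar> + C3 * 2 powr \<bar>- L\<bar>) * real N powr (- L)" by (simp add: algebra_simps)
    finally have "norm (chain_sum (wL t) N ys - c) \<le> (\<bar>C2\<bar> + C3 * 2 powr \<bar>- L\<bar>) * real N powr (- L)" .
    moreover have "norm ?dP \<le> \<bar>C4\<bar> * real N powr D"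
      using C4[OF NN(5)] by (rule order_trans) (intro mult_right_mono, auto)
    ultimately have "norm ((chain_sum (wL t) N ys - c) * ?dP) \<le> ((\<bar>C2\<bar> + C3 * 2 powr \<bar>- L\<bar>) * real N powr (- L)) * (\<bar>C4\<bar> * real N powr D)"
      unfolding norm_mult using C3(1) by (intro mult_mono) auto
    also have "\<dots> = ((\<bar>C2\<bar> + C3 * 2 powr \<bar>- L\<bar>) * \<bar>C4\<bar>) * real N powr (- L + D)"
      unfolding powr_add by (simp only: mult_ac)
    also have "\<dots> \<le> ((\<bar>C2\<bar> + C3 * 2 powr \<bar>- L\<bar>) * \<bar>C4\<bar>) * real N powr (D + 3 - A)"
      using C3(1) NN unfolding L_def by (intro mult_left_mono powr_mono) auto
    finally have q2: "norm ((chain_sum (wL t) N ys - c) * ?dP) \<le> ((\<bar>C2\<bar> + C3 * 2 powr \<bar>- L\<bar>) * \<bar>C4\<bar>) * real N powr (D + 3 - A)" .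
    show ?thesis unfolding eq
      by (rule order_trans[OF norm_triangle_ineq]) (use q1 q2 in \<open>simp add: CC_def distrib_right\<close>)
  qed
  then show ?thesis by blast
qed

lemma poly_growth:
  assumes t: "norm t \<le> 1/2"
  shows "\<exists>C. \<forall>N\<ge>1. norm (poly (faulhaber m) (of_nat N + 1) - poly (faulhaber m) (t - of_nat N)) \<le> C * real N powr real (faul_deg m)"
proof -
  define C where "C = (\<Sum>e\<le>faul_deg m. norm (of_rat (faul_coeff m e) :: complex)) * 2 ^ faul_deg m"
  have b: "norm (poly (faulhaber m) x) \<le> C * real N powr real (faul_deg m)" if x: "norm x \<le> 2 * real N" and N: "N \<ge> 1" for x N
  proof -
    have "norm (poly (faulhaber m) x) \<le> (\<Sum>e\<le>faul_deg m. norm (of_rat (faul_coeff m e) :: complex) * (2 ^ faul_deg m * real N powr real (faul_deg m)))"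
      unfolding faulhaber_faul_coeff
    proof (rule sum_norm_le)
      fix e assume e: "e \<in> {..faul_deg m}"
      have "norm x ^ e \<le> (2 * real N) ^ e" using x by (intro power_mono) auto
      also have "\<dots> \<le> (2 * real N) ^ faul_deg m" using e N by (intro power_increasing) auto
      also have "\<dots> = 2 ^ faul_deg m * real N powr real (faul_deg m)" using N by (simp add: power_mult_distrib powr_realpow)
      finally show "norm (of_rat (faul_coeff m e) * x ^ e) \<le> norm (of_rat (faul_coeff m e) :: complex) * (2 ^ faul_deg m * real N powr real (faul_deg m))"
        unfolding norm_mult norm_power by (intro mult_left_mono) auto
    qed
    then show ?thesis unfolding C_def by (simp add: sum_distrib_right[symmetric] mult.assoc)
  qed
  have "norm (poly (faulhaber m) (of_nat N + 1) - poly (faulhaber m) (t - of_nat N)) \<le> (C + C) * real N powr real (faul_deg m)" if N: "N \<ge> 1" for N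
  proof -
    have "norm (of_nat N + 1 :: complex) = real N + 1" by (metis norm_of_nat of_nat_Suc add.commute)
    then have 1: "norm (of_nat N + 1 :: complex) \<le> 2 * real N" using N by simp
    have 2: "norm (t - of_nat N) \<le> 2 * real N" using norm_nat_diff(2)[OF t N] by (simp add: norm_minus_commute)
    show ?thesis unfolding distrib_right
      by (rule order_trans[OF norm_triangle_ineq4]) (intro add_mono b[OF 1 N] b[OF 2 N])
  qed
  then show ?thesis by blast
qed

section \<open>The recursion for the continued function at complex arguments\<close>

lemma ordl_replicate_mixed:
  assumes "A \<ge> real m + 10"
  shows "ordl 1 (replicate a A @ (- real m) # replicate b A) \<le> real m + 3"
proof (induction a)
  case 0
  have "ordl 1 (replicate b A) \<le> 1" using assms by (intro ordl_replicate) auto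
  then show ?case by simp
next
  case (Suc a)
  then show ?case using assms by simp
qed

text \<open>Here the remaining entries are complex: the identity is first proved where their real
  parts are large and then continued, so integer indices would not do. The entry - m is inserted
  before position j, with larger neighbour \<open>u ! j\<close> and smaller neighbour
  \<open>u ! (j - 1)\<close>.\<close>

definition nonpos_rec_complex :: "complex \<Rightarrow> nat \<Rightarrow> nat \<Rightarrow> (complex list \<Rightarrow> complex) \<Rightarrow> complex list \<Rightarrow> complex" where
  "nonpos_rec_complex t m j F u = (if j = length u then poly (faulhaber m) t * F u else (\<Sum>e\<le>faul_deg m. of_rat (faul_coeff m e) * F (u[j := u ! j - of_nat e])))
     - (if j = 0 then poly (faulhaber m) 1 * F u else (\<Sum>e\<le>faul_deg m. of_rat (faul_shift_coeff m e) * F (u[j - 1 := u ! (j - 1) - of_nat e])))"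

lemma pw_poly: "pw y w * poly (faulhaber m) (exp w) = (\<Sum>e\<le>faul_deg m. of_rat (faul_coeff m e) * pw (y - of_nat e) w)"
  "pw y w * poly (faulhaber m) (exp w + 1) = (\<Sum>e\<le>faul_deg m. of_rat (faul_shift_coeff m e) * pw (y - of_nat e) w)"
proof -
  have "pw y w * exp w ^ e = pw (y - of_nat e) w" for e
    unfolding pw_def by (simp add: exp_of_nat_mult[symmetric] exp_add[symmetric] algebra_simps)
  note e = this
  show "pw y w * poly (faulhaber m) (exp w) = (\<Sum>e\<le>faul_deg m. of_rat (faul_coeff m e) * pw (y - of_nat e) w)"
    unfolding faulhaber_faul_coeff sum_distrib_left by (simp add: e[symmetric] mult.left_commute)
  show "pw y w * poly (faulhaber m) (exp w + 1) = (\<Sum>e\<le>faul_deg m. of_rat (faul_shift_coeff m e) * pw (y - of_nat e) w)"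
    unfolding faulhaber_faul_shift_coeff sum_distrib_left by (simp add: e[symmetric] mult.left_commute)
qed

lemma trunc_merge:
  assumes t: "norm t \<le> 1/2" and j: "j \<le> length u"
  shows "trunc t (take j u @ (- of_nat m) # drop j u) N
      + chain_sum wR N (rev (take j u)) * chain_sum (wL t) N (drop j u) * (poly (faulhaber m) (t - of_nat N) - poly (faulhaber m) (of_nat N + 1))
    = nonpos_rec_complex t m j (\<lambda>u. trunc t u N) u"
proof -
  let ?X = "map pw (take j u)" and ?Y = "map pw (drop j u)"
  have 1: "csf N (rv (rev ?X)) = chain_sum wR N (rev (take j u))"
    by (simp add: chain_sum_csf[of wR] rv_def rev_map o_def wR_def pw_def)
  have 2: "csf N (lv t ?Y) = chain_sum (wL t) N (drop j u)"
    by (simp add: chain_sum_csf[of "wL t"] lv_def o_def wL_def pw_def)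
  have Y: "trunc2 t (?X @ (\<lambda>w. hd ?Y w * poly (faulhaber m) (exp w)) # tl ?Y) N = (\<Sum>e\<le>faul_deg m. of_rat (faul_coeff m e) * trunc t (u[j := u ! j - of_nat e]) N)"
    if "j < length u"
  proof -
    have d: "drop j u = u ! j # drop (Suc j) u" using that by (simp add: Cons_nth_drop_Suc)
    have "trunc2 t (?X @ (\<lambda>w. hd ?Y w * poly (faulhaber m) (exp w)) # tl ?Y) N
      = trunc2 t (?X @ (\<lambda>w. \<Sum>e\<le>faul_deg m. of_rat (faul_coeff m e) * pw (u ! j - of_nat e) w) # map pw (drop (Suc j) u)) N"
      unfolding d by (simp add: pw_poly)
    also have "\<dots> = (\<Sum>e\<le>faul_deg m. of_rat (faul_coeff m e) * trunc2 t (?X @ pw (u ! j - of_nat e) # map pw (drop (Suc j) u)) N)"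
      by (rule trunc2_linear) simp
    finally show ?thesis using that by (simp add: trunc_trunc2 upd_conv_take_nth_drop)
  qed
  have X: "trunc2 t (butlast ?X @ (\<lambda>w. last ?X w * poly (faulhaber m) (exp w + 1)) # ?Y) N = (\<Sum>e\<le>faul_deg m. of_rat (faul_shift_coeff m e) * trunc t (u[j - 1 := u ! (j - 1) - of_nat e]) N)"
    if j0: "j \<noteq> 0"
  proof -
    obtain i where i: "j = Suc i" using j0 by (cases j) auto
    have iu: "i < length u" using i j by simp
    have d: "take j u = take i u @ [u ! i]" using i iu by (simp add: take_Suc_conv_app_nth)
    have "trunc2 t (butlast ?X @ (\<lambda>w. last ?X w * poly (faulhaber m) (exp w + 1)) # ?Y) N
      = trunc2 t (map pw (take i u) @ (\<lambda>w. \<Sum>e\<le>faul_deg m. of_rat (faul_shift_coeff m e) * pw (u ! i - of_nat e) w) # ?Y) N"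
      unfolding d by (simp add: pw_poly)
    also have "\<dots> = (\<Sum>e\<le>faul_deg m. of_rat (faul_shift_coeff m e) * trunc2 t (map pw (take i u) @ pw (u ! i - of_nat e) # ?Y) N)"
      by (rule trunc2_linear) simp
    finally show ?thesis using i iu by (simp add: trunc_trunc2 upd_conv_take_nth_drop)
  qed
  have e: "?Y = [] \<longleftrightarrow> j = length u" "?X = [] \<longleftrightarrow> j = 0 \<or> u = []" using j by auto
  show ?thesis
    unfolding trunc_trunc2[of t "take j u @ _"] list.map map_append 1[symmetric] 2[symmetric]
    using trunc2_merge[OF t faulhaber_diff, of ?X m ?Y N] e X Y j
    by (cases "u = []") (auto simp: nonpos_rec_complex_def trunc_trunc2)
qed

lemma nonpos_rec_complex_tendsto:
  assumes "\<And>u. u \<in> U \<Longrightarrow> (\<lambda>N. F u N) \<longlonglongrightarrow> G u" "u \<in> U" "\<And>i e. i < length u \<Longrightarrow> e \<le> faul_deg m \<Longrightarrow> u[i := u ! i - of_nat e] \<in> U" "j \<le> length u"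
  shows "(\<lambda>N. nonpos_rec_complex t m j (\<lambda>u. F u N) u) \<longlonglongrightarrow> nonpos_rec_complex t m j G u"
  unfolding nonpos_rec_complex_def using assms by (auto intro!: tendsto_intros simp: le_less)

text \<open>Among entries of large real part only the jump at the inserted entry survives, and by
  \<open>jump_polynomial\<close> it cancels the gap term of \<open>trunc_merge\<close>. The indices
  on the other side lie in the region of convergence, where truncations converge.\<close>

lemma zetaU_ext_recursion_large:
  assumes t: "norm t \<le> 1/2" and j: "j \<le> length u" and u: "\<And>y. y \<in> set u \<Longrightarrow> Re y > real (faul_deg m) + real m + 10"
  shows "zetaU_ext t (take j u @ (- of_nat m) # drop j u) = nonpos_rec_complex t m j (zetaU_ext t) u"
proof -
  \<comment> \<open>\<open>faul_deg m\<close> covers the lowering of a neighbour, which must keep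
    its real part above 1, and also the growth of the polynomial; m covers the order caused by - m;
    10 covers the remaining constants.\<close>
  define A where "A = real (faul_deg m) + real m + 10"
  define M where "M = 3 + sum_list (map norm u) + real m + A"
  have s0: "sum_list (map norm u) \<ge> 0" by (rule sum_list_norm_nonneg)
  have M: "M \<ge> 0" "real m < M" "A \<le> M" "2 < M" using s0 unfolding M_def A_def by auto
  have uM: "norm y < M" if "y \<in> set u" for y using sum_list_norm_ge[OF that] unfolding M_def A_def by linarith
  define s where "s = take j u @ (- of_nat m) # drop j u"
  have ls: "length s = Suc (length u)" using j unfolding s_def by simp
  define as where "as = replicate j A @ (- real m) # replicate (length u - j) A"
  define K where "K = order_choice M (length s)"
  define w0 where "w0 = base_choice K (length s)"
  have w0: "w0 \<in> lstrip (lev K (length s))" unfolding w0_def by (rule base_choice_in)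
  have K: "real K > (2 * real (length s) + 2) * (2 * M + 4)" unfolding K_def by (rule order_choice_gt)
  have set_s: "set s \<subseteq> ball 0 M" using uM M by (auto simp: s_def dest: in_set_takeD in_set_dropD)
  have zetaU_ext_s: "zetaU_ext t s = zetaU_ext_at K w0 t s" by (rule zetaU_ext_eq_zetaU_ext_at[OF t M(4) set_s w0 K])
  have las: "length as = length s" using j unfolding as_def ls by simp
  have tk: "take j s = take j u" "drop j s = (- of_nat m) # drop j u" using j unfolding s_def by auto
  \<comment> \<open>Away from j a jump has exponent at most 1 + (m + 3) - A + 1 < 0, whether the
    entry - m lies below or above it.\<close>
  have lim: "(\<lambda>N. trunc t s N + (\<Sum>i\<in>{j}. chain_sum wR N (rev (take i s)) * jump K w0 t (drop i s) N)) \<longlonglongrightarrow> zetaU_ext_at K w0 t s"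
  proof (rule zetaU_ext_at_tendsto[OF t las _ M(1) w0 K, of 1])
    fix i assume i: "i < length s"
    show "norm (s ! i) \<le> M \<and> as ! i \<le> Re (s ! i)"
    proof (cases "i = j")
      case True
      then show ?thesis using j M unfolding s_def as_def by (simp add: nth_append)
    next
      case False
      then have "s ! i \<in> set u" "as ! i = A"
        using i j ls unfolding s_def as_def by (auto simp: nth_append nth_Cons split: nat.splits)
      then show ?thesis using uM[of "s ! i"] u[of "s ! i"] unfolding A_def by auto
    qed
  next
    show "{j} \<subseteq> {..<length s}" using j ls by simp
  next
    fix i assume i: "i < length s" "i \<notin> {j}"
    have o1: "ordl 1 (replicate k A) \<le> 1" for k unfolding A_def by (intro ordl_replicate) auto
    have o2: "ordl 1 (replicate a A @ (- real m) # replicate b A) \<le> real m + 3" for a b by (rule ordl_replicate_mixed) (simp add: A_def)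
    show "ordl 1 (rev (take i as)) + (ordl 1 (drop (Suc i) as) - as ! i + 1) < 0"
    proof (cases "i < j")
      case True
      then have "rev (take i as) = replicate i A" "drop (Suc i) as = replicate (j - Suc i) A @ (- real m) # replicate (length u - j) A" "as ! i = A"
        unfolding as_def by (auto simp: nth_append)
      then show ?thesis using o1[of i] o2[of "j - Suc i" "length u - j"] unfolding A_def by auto
    next
      case False
      then obtain k where k: "i = j + Suc k" using i by (metis add_Suc_right less_imp_Suc_add linorder_neqE_nat singletonI)
      then have kl: "k < length u - j" using i(1) j ls by simp
      have "rev (take i as) = replicate k A @ (- real m) # replicate j A" "drop (Suc i) as = replicate (length u - j - Suc k) A" "as ! i = A"
        using kl unfolding as_def k by (auto simp: nth_append)
      then show ?thesis using o2[of k j] o1[of "length u - j - Suc k"] unfolding A_def by auto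
    qed
  qed auto
  let ?p = "\<lambda>N. chain_sum wR N (rev (take j u))"
  let ?l = "\<lambda>N. chain_sum (wL t) N (drop j u)"
  let ?dP = "\<lambda>N. poly (faulhaber m) (of_nat N + 1) - poly (faulhaber m) (t - of_nat N)"
  have eqN: "trunc t s N + (\<Sum>i\<in>{j}. chain_sum wR N (rev (take i s)) * jump K w0 t (drop i s) N)
     = nonpos_rec_complex t m j (\<lambda>u. trunc t u N) u + ?p N * (jump K w0 t (- of_nat m # drop j u) N + ?l N * ?dP N)" for N
    using trunc_merge[OF t j, of m N] unfolding s_def[symmetric] by (simp add: tk algebra_simps)
  have err: "(\<lambda>N. ?p N * (jump K w0 t (- of_nat m # drop j u) N + ?l N * ?dP N)) \<longlonglongrightarrow> 0"
  proof -
    have lj: "Suc (length (drop j u)) \<le> length s" using ls by simp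
    have K': "real K > (2 * real (Suc (length (drop j u))) + 2) * (2 * M + 4)"
    proof -
      have "(2 * real (Suc (length (drop j u))) + 2) * (2 * M + 4) \<le> (2 * real (length s) + 2) * (2 * M + 4)"
        using lj M by (intro mult_right_mono) auto
      then show ?thesis using K by linarith
    qed
    have w0': "w0 \<in> lstrip (lev K (Suc (length (drop j u))))" using w0 lstrip_mono[OF lev_mono[OF lj, of K]] by auto
    have "\<exists>C N0. \<forall>N\<ge>N0. norm (jump K w0 t (- of_nat m # drop j u) N + ?l N * ?dP N) \<le> C * real N powr (real (faul_deg m + m) + 3 - A)"
    proof (rule jump_polynomial[OF t _ M(1) _ M(3) _ w0' K'])
      show "norm y \<le> M \<and> A \<le> Re y" if "y \<in> set (drop j u)" for y
        using uM[of y] u[of y] in_set_dropD[OF that] unfolding A_def by auto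
      obtain C where C: "\<forall>N\<ge>1. norm (?dP N) \<le> C * real N powr real (faul_deg m)" using poly_growth[OF t] by blast
      have "norm (?dP N) \<le> \<bar>C\<bar> * real N powr real (faul_deg m + m)" if "N \<ge> 1" for N
      proof -
        have "norm (?dP N) \<le> C * real N powr real (faul_deg m)" using C that by blast
        also have "\<dots> \<le> \<bar>C\<bar> * real N powr real (faul_deg m + m)" using that by (intro mult_mono powr_mono) auto
        finally show ?thesis .
      qed
      then show "\<exists>C. \<forall>N\<ge>1. norm (?dP N) \<le> C * real N powr real (faul_deg m + m)" by blast
    qed (use M in \<open>auto simp: A_def\<close>)
    then obtain C N0 where C: "\<And>N. N \<ge> N0 \<Longrightarrow> norm (jump K w0 t (- of_nat m # drop j u) N + ?l N * ?dP N) \<le> C * real N powr (real (faul_deg m + m) + 3 - A)" by blast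
    interpret chain_asym_family False "{0}" "\<lambda>_. t" M
      by unfold_locales (use t M in auto)
    define cs where "cs = map (\<lambda>c (_::complex). c) (rev (take j u))"
    have v: "vals cs x = rev (take j u)" for x unfolding cs_def by (simp add: o_def rev_map)
    have g: "list_all2 good (replicate j A) cs"
      using j u uM unfolding list_all2_conv_all_nth cs_def A_def
      by (auto simp: good_def rev_nth min_def intro!: less_imp_le dest: nth_mem)
    obtain C2 where C2: "C2 \<ge> 0" "\<forall>N\<ge>1. norm (?p N) \<le> C2 * real N powr (ordl 1 (replicate j A))"
      using chain_order[OF g, of 1] unfolding v by auto
    have o1: "ordl 1 (replicate j A) \<le> 1" unfolding A_def by (intro ordl_replicate) auto
    have "norm (?p N * (jump K w0 t (- of_nat m # drop j u) N + ?l N * ?dP N)) \<le> (C2 * \<bar>C\<bar>) * real N powr (-1)" if N: "N \<ge> max 1 N0" for N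
    proof -
      have "norm (?p N * (jump K w0 t (- of_nat m # drop j u) N + ?l N * ?dP N)) \<le> (C2 * real N powr (ordl 1 (replicate j A))) * (\<bar>C\<bar> * real N powr (real (faul_deg m + m) + 3 - A))"
        unfolding norm_mult using C2 C[of N] N
        by (intro mult_mono) (auto intro: order_trans[OF _ mult_right_mono])
      also have "\<dots> = (C2 * \<bar>C\<bar>) * real N powr (ordl 1 (replicate j A) + (real (faul_deg m + m) + 3 - A))" unfolding powr_add by (simp only: mult_ac)
      also have "\<dots> \<le> (C2 * \<bar>C\<bar>) * real N powr (-1)" using C2(1) N o1 unfolding A_def by (intro mult_left_mono powr_mono) auto
      finally show ?thesis .
    qed
    then show ?thesis
      by (intro Lim_null_comparison[OF _ powr_neg_tendsto[of "-1" "C2 * \<bar>C\<bar>"]]) (auto simp: eventually_sequentially intro!: exI[of _ "max 1 N0"])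
  qed
  define U where "U = {v::complex list. \<forall>z\<in>set v. Re z > 1}"
  have tr: "trunc t v \<longlonglongrightarrow> zetaU_ext t v" if "v \<in> U" for v
    using trunc_tendsto[OF t, of v] zetaU_ext_series[OF t, of v] that unfolding U_def by auto
  have uU: "u[i := u ! i - of_nat e] \<in> U" if "i < length u" "e \<le> faul_deg m" for i e
  proof -
    have "Re z > 1" if z: "z \<in> set (u[i := u ! i - of_nat e])" for z
    proof -
      have "z = u ! i - of_nat e \<or> z \<in> set u" using set_update_subset_insert[of u i "u ! i - of_nat e"] z by auto
      then show ?thesis using u[of z] u[of "u ! i"] nth_mem[OF \<open>i < length u\<close>] \<open>e \<le> faul_deg m\<close> by fastforce
    qed
    then show ?thesis unfolding U_def by blast
  qed
  have u0: "u \<in> U" unfolding U_def using u by fastforce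
  have "(\<lambda>N. nonpos_rec_complex t m j (\<lambda>u. trunc t u N) u) \<longlonglongrightarrow> nonpos_rec_complex t m j (zetaU_ext t) u"
    by (rule nonpos_rec_complex_tendsto[of U]) (use tr uU u0 j in auto)
  from tendsto_add[OF this err] have "(\<lambda>N. trunc t s N + (\<Sum>i\<in>{j}. chain_sum wR N (rev (take i s)) * jump K w0 t (drop i s) N)) \<longlonglongrightarrow> nonpos_rec_complex t m j (zetaU_ext t) u"
    unfolding eqN by simp
  from LIMSEQ_unique[OF lim this] show ?thesis using zetaU_ext_s unfolding s_def by simp
qed

lemma sep_entireD: "sep_entire r F \<Longrightarrow> length u = r \<Longrightarrow> j < r \<Longrightarrow> (\<lambda>z. F (u[j := z])) holomorphic_on UNIV"
  unfolding sep_entire_def by blast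

lemma sep_entire_shift:
  assumes F: "sep_entire r F" and k: "k < r"
  shows "sep_entire r (\<lambda>u. F (u[k := u ! k - c]))"
  unfolding sep_entire_def
proof (intro allI impI)
  fix u :: "complex list" and j assume u: "length u = r" "j < r"
  show "(\<lambda>z. F ((u[j := z])[k := (u[j := z]) ! k - c])) holomorphic_on UNIV"
  proof (cases "j = k")
    case True
    have "(\<lambda>z. F (u[k := z])) \<circ> (\<lambda>z. z - c) holomorphic_on UNIV"
      by (rule holomorphic_on_compose_gen[where t = UNIV]) (use sep_entireD[OF F u(1) k] in \<open>auto intro!: holomorphic_intros\<close>)
    then show ?thesis using True u k by (simp add: o_def)
  next
    case False
    have "(\<lambda>z. F ((u[k := u ! k - c])[j := z])) holomorphic_on UNIV"
      by (rule sep_entireD[OF F]) (use u in auto)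
    then show ?thesis using False u by (simp add: list_update_swap)
  qed
qed

text \<open>With - m and its position fixed, both sides are separately entire in the other entries,
  so the identity spreads from large real parts to all u.\<close>

theorem zetaU_ext_recursion:
  assumes t: "norm t \<le> 1/2" and j: "j \<le> length u"
  shows "zetaU_ext t (take j u @ (- of_nat m) # drop j u) = nonpos_rec_complex t m j (zetaU_ext t) u"
proof -
  define r where "r = length u"
  have "(\<lambda>u. zetaU_ext t (take j u @ (- of_nat m) # drop j u)) u = (\<lambda>u. nonpos_rec_complex t m j (zetaU_ext t) u) u"
  proof (rule sep_entire_identity[where r = r and B = "real (faul_deg m) + real m + 10"])
    show "sep_entire r (\<lambda>u. zetaU_ext t (take j u @ (- of_nat m) # drop j u))"
      unfolding sep_entire_def
    proof (intro allI impI)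
      fix v :: "complex list" and i assume v: "length v = r" "i < r"
      let ?s = "take j v @ (- of_nat m) # drop j v"
      \<comment> \<open>Inserting - m renumbers the entries: coordinate i of v becomes coordinate i
        or i + 1 of the longer list, and holomorphy in it is inherited.\<close>
      have ls: "length ?s = Suc r" using v j unfolding r_def by simp
      have "take j (v[i := z]) @ (- of_nat m) # drop j (v[i := z]) = ?s[(if i < j then i else Suc i) := z]" for z
        using v j unfolding r_def by (auto simp: list_update_append take_update_swap drop_update_swap Suc_diff_le min_def list_update_beyond)
      then show "(\<lambda>z. zetaU_ext t (take j (v[i := z]) @ (- of_nat m) # drop j (v[i := z]))) holomorphic_on UNIV"
        using sep_entireD[OF zetaU_ext_sep_entire[OF t, of "Suc r"] ls, of "if i < j then i else Suc i"] v by simp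
    qed
    show "sep_entire r (nonpos_rec_complex t m j (zetaU_ext t))"
      unfolding sep_entire_def
    proof (intro allI impI)
      fix v :: "complex list" and i assume v: "length v = r" "i < r"
      have h: "(\<lambda>z. zetaU_ext t (v[i := z])) holomorphic_on UNIV" by (rule sep_entireD[OF zetaU_ext_sep_entire[OF t] v])
      have hs: "(\<lambda>z. zetaU_ext t ((v[i := z])[k := (v[i := z]) ! k - c])) holomorphic_on UNIV" if "k < r" for k c
        by (rule sep_entireD[OF sep_entire_shift[OF zetaU_ext_sep_entire[OF t] that] v])
      have "j \<noteq> length (v[i := z]) \<longleftrightarrow> j < r" for z using v j unfolding r_def by auto
      then show "(\<lambda>z. nonpos_rec_complex t m j (zetaU_ext t) (v[i := z])) holomorphic_on UNIV"
        unfolding nonpos_rec_complex_def using h hs v j by (cases "j = r"; cases "j = 0") (auto simp: r_def intro!: holomorphic_intros)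
    qed
    show "zetaU_ext t (take j v @ (- of_nat m) # drop j v) = nonpos_rec_complex t m j (zetaU_ext t) v" if "length v = r" "\<forall>z\<in>set v. real (faul_deg m) + real m + 10 < Re z" for v
      by (rule zetaU_ext_recursion_large[OF t]) (use that j r_def in auto)
  qed (simp add: r_def)
  then show ?thesis .
qed

section \<open>Positive integer indices\<close>

text \<open>The ones at the head belong to the largest variables and cause the logarithmic
  divergence; their number is the degree in w of the expansion.\<close>

definition leading_ones :: "nat list \<Rightarrow> nat" where
  "leading_ones ks = length (takeWhile (\<lambda>k. k = 1) ks)"

lemma leading_ones_simps [simp]: "leading_ones [] = 0" "leading_ones (1 # ks) = Suc (leading_ones ks)" "leading_ones (Suc 0 # ks) = Suc (leading_ones ks)" "k \<noteq> 1 \<Longrightarrow> leading_ones (k # ks) = 0"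
  by (auto simp: leading_ones_def)

lemma leading_ones_le: "leading_ones ks \<le> length ks"
  unfolding leading_ones_def by (rule length_takeWhile_le)

definition cn :: "nat list \<Rightarrow> complex list" where
  "cn ks = map of_nat ks"

lemma lstrip_diff_bound:
  assumes "v \<in> lstrip m" "w \<in> lstrip m" "\<bar>Re v - Re w\<bar> \<le> 1"
  shows "norm (v - w) \<le> 11"
  using cmod_le[of "v - w"] lstrip_Im[OF assms(1)] lstrip_Im[OF assms(2)] assms(3) by auto

lemma ordl_leading_ones: "e > 0 \<Longrightarrow> ordl e (replicate n 1) = real n * e"
  by (induction n) (auto simp: algebra_simps)

text \<open>At positive integers the expansion behaves as a polynomial in w with d/dw (1 # ks) = - ks, up
  to exponentially small terms.\<close>

lemma chain_asym_taylor:
  assumes ks: "\<forall>k\<in>set ks. k \<ge> 1 \<and> real k \<le> M" and M: "M \<ge> 1" and len: "length ks \<le> r"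
    and w0: "w0 \<in> lstrip (lev K (length ks))" and K: "real K > real (length ks) * (2 * M + 4)"
  shows "\<exists>C\<ge>0. \<forall>t v w. norm t \<le> 1/2 \<longrightarrow> v \<in> lstrip (lev K (length ks)) \<longrightarrow> w \<in> lstrip (lev K (length ks)) \<longrightarrow> \<bar>Re v - Re w\<bar> \<le> 1 \<longrightarrow>
    norm (chain_asym K w0 t (cn ks) v - (\<Sum>l\<le>leading_ones ks. (w - v) ^ l / fact l * chain_asym K w0 t (cn (drop l ks)) w)) \<le> C * exp (- (1/2) * Re w)"
  using ks len w0 K
proof (induction ks)
  case Nil
  show ?case by (auto intro!: exI[of _ 0] simp: cn_def)
next
  case (Cons k ks)
  interpret chain_asym_family False "cball 0 (1/2)" "\<lambda>x. x" M
    by unfold_locales (use M in auto)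
  let ?n = "length ks"
  define cs where "cs = map (\<lambda>k (_::complex). of_nat k :: complex) ks"
  have v: "vals cs x = cn ks" for x unfolding cs_def cn_def by (simp add: o_def)
  have lc: "length cs = ?n" unfolding cs_def by simp
  \<comment> \<open>The accumulated slack of at most r entries stays below 1/4, so every error
    exponent below is at most 1/4 - 1 and hence at most - 1/2.\<close>
  define e where "e = 1 / (4 * (real r + 1))"
  have e: "e > 0" unfolding e_def by simp
  have ne: "real n * e \<le> 1/4" if "n \<le> r" for n
    using that unfolding e_def by (simp add: field_simps)
  have g: "list_all2 good (replicate ?n 1) cs" unfolding list_all2_conv_all_nth lc
    using Cons.prems(1) by (auto simp: good_def cs_def)
  have w0: "w0 \<in> lstrip (lev K (Suc ?n))" using Cons.prems by simp
  have w0': "w0 \<in> lstrip (lev K ?n)" using w0 lstrip_mono[OF lev_mono[of ?n "Suc ?n" K]] by auto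
  have K': "real K > real ?n * (2 * M + 4)" using Cons.prems(4) M by (auto simp: algebra_simps)
  have IH: "\<exists>C\<ge>0. \<forall>t v w. norm t \<le> 1/2 \<longrightarrow> v \<in> lstrip (lev K ?n) \<longrightarrow> w \<in> lstrip (lev K ?n) \<longrightarrow> \<bar>Re v - Re w\<bar> \<le> 1 \<longrightarrow>
    norm (chain_asym K w0 t (cn ks) v - (\<Sum>l\<le>leading_ones ks. (w - v) ^ l / fact l * chain_asym K w0 t (cn (drop l ks)) w)) \<le> C * exp (- (1/2) * Re w)"
    by (rule Cons.IH) (use Cons.prems w0' K' in auto)
  have sub: "lstrip (lev K (Suc ?n)) \<subseteq> lstrip (lev K ?n)" "lstrip (lev K (Suc ?n)) \<subseteq> lstrip (Suc (lev K ?n))"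
    by (rule lstrip_mono, simp add: lev_Suc)+
  \<comment> \<open>Only the distinction between 1 and at least 2 matters for the first entry: at 2
    the derivative of the expansion already decays and the Taylor sum reduces to its constant
    term.\<close>
  have gk: "good (real (min k 2)) (\<lambda>_. of_nat k)" using Cons.prems(1) by (auto simp: good_def)
  have w0c: "w0 \<in> lstrip (lev K (Suc (length cs)))" and Kc: "real K > real (length cs) * (2 * M + 4)" using w0 K' lc by auto
  have cnk: "cn (k # ks) = vals ((\<lambda>_. of_nat k) # cs) x" for x using v by (simp add: cn_def)
  show ?case
  proof (cases "k = 1")
    case False
    then have k2: "k \<ge> 2" using Cons.prems(1) by auto
    have mk: "real (min k 2) = 2" using k2 by simp
    obtain C where C: "C > 0"
      "\<forall>x\<in>cball 0 (1/2). \<forall>v\<in>lstrip (lev K (Suc ?n)). \<forall>w\<in>lstrip (lev K (Suc ?n)). \<bar>Re v - Re w\<bar> \<le> 1 \<longrightarrow>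
        norm (chain_asym K w0 x (cn (k # ks)) v - chain_asym K w0 x (cn (k # ks)) w) \<le> C * exp ((real ?n * e - 2 + 1) * Re w) * norm (v - w)"
      using chain_asym_lipschitz[OF g gk w0c Kc e, unfolded cnk[symmetric] lc ordl_leading_ones[OF e] mk] by blast
    have "norm (chain_asym K w0 t (cn (k # ks)) v - chain_asym K w0 t (cn (k # ks)) w) \<le> (11 * C) * exp (- (1/2) * Re w)"
      if "norm t \<le> 1/2" "v \<in> lstrip (lev K (Suc ?n))" "w \<in> lstrip (lev K (Suc ?n))" "\<bar>Re v - Re w\<bar> \<le> 1" for t v w
    proof -
      have "norm (chain_asym K w0 t (cn (k # ks)) v - chain_asym K w0 t (cn (k # ks)) w) \<le> C * exp ((real ?n * e - 2 + 1) * Re w) * norm (v - w)"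
      proof -
        have "t \<in> cball 0 (1/2)" using that(1) by simp
        then show ?thesis using C(2) that by blast
      qed
      also have "\<dots> \<le> C * exp (- (1/2) * Re w) * 11"
      proof (intro mult_mono mult_left_mono)
        have "real ?n * e - 2 + 1 \<le> - (1/2)" using ne[of ?n] Cons.prems(2) by simp
        then show "exp ((real ?n * e - 2 + 1) * Re w) \<le> exp (- (1/2) * Re w)"
          using lstrip_Re_pos[OF that(3)] by (simp only: exp_le_cancel_iff) (intro mult_right_mono, auto)
      qed (use C(1) lstrip_diff_bound[OF that(2,3,4)] in auto)
      finally show ?thesis by (simp add: mult_ac)
    qed
    then show ?thesis using False C(1) by (intro exI[of _ "11 * C"]) auto
  next
    case True
    have gk1: "good 1 (\<lambda>_. of_nat k)" using gk True by simp
    obtain C1 where C1: "C1 \<ge> 0" "\<And>t v w. norm t \<le> 1/2 \<Longrightarrow> v \<in> lstrip (lev K ?n) \<Longrightarrow> w \<in> lstrip (lev K ?n) \<Longrightarrow> \<bar>Re v - Re w\<bar> \<le> 1 \<Longrightarrow>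
    norm (chain_asym K w0 t (cn ks) v - (\<Sum>l\<le>leading_ones ks. (w - v) ^ l / fact l * chain_asym K w0 t (cn (drop l ks)) w)) \<le> C1 * exp (- (1/2) * Re w)"
      using IH by blast
    obtain R where R: "symb False (cball 0 (1/2)) (lev K (Suc ?n)) (real ?n * e - 1) R"
      "\<forall>x\<in>cball 0 (1/2). \<forall>w\<in>lstrip (lev K (Suc ?n)).
        (chain_asym K w0 x (cn (k # ks)) has_field_derivative asrc (of_nat k) (chain_asym K w0 x (cn ks)) w * exp w + R x w) (at w)"
      using chain_asym_deriv_order(1)[OF g gk1 w0c Kc e, unfolded cnk[symmetric] v lc ordl_leading_ones[OF e]] by blast
    have R2: "(chain_asym K w0 x (cn (k # ks)) has_field_derivative asrc 1 (chain_asym K w0 x (cn ks)) w * exp w + R x w) (at w)"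
      if "norm x \<le> 1/2" "w \<in> lstrip (lev K (Suc ?n))" for x w
    proof -
      have "x \<in> cball 0 (1/2)" using that(1) by simp
      then show ?thesis using R(2) that(2) True by simp
    qed
    obtain C2 where C2: "C2 > 0" "\<And>x w. norm x \<le> 1/2 \<Longrightarrow> w \<in> lstrip (lev K (Suc ?n)) \<Longrightarrow> norm (R x w) \<le> C2 * exp ((real ?n * e - 1) * Re w)"
      by (rule symb_bound[OF R(1)]) auto
    \<comment> \<open>The derivative of the expansion involves the tail at \<open>shiftw u\<close>.
      Replacing this by u is harmless, since the displacement O(exp (- Re u)) outweighs the slow
      growth of the derivative.\<close>
    have "\<exists>C3>0. \<forall>x u. norm x \<le> 1/2 \<longrightarrow> u \<in> lstrip (lev K (Suc ?n)) \<longrightarrow>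
       norm (chain_asym K w0 x (cn ks) (shiftw u) - chain_asym K w0 x (cn ks) u) \<le> C3 * exp (- (1/2) * Re u)"
    proof (cases ks)
      case Nil
      then show ?thesis by (auto simp: cn_def intro!: exI[of _ 1])
    next
      case (Cons k' ks')
      define cs' where "cs' = map (\<lambda>k (_::complex). of_nat k :: complex) ks'"
      have v': "vals cs' x = cn ks'" for x unfolding cs'_def cn_def by (simp add: o_def)
      have lc': "length cs' = length ks'" "?n = Suc (length ks')" unfolding cs'_def using Cons by auto
      have g': "list_all2 good (replicate (length ks') 1) cs'" unfolding list_all2_conv_all_nth lc'
        using Cons.prems(1) Cons by (auto simp: good_def cs'_def)
      have gk': "good 1 (\<lambda>_. of_nat k')" using Cons.prems(1) Cons by (auto simp: good_def)
      have w0c': "w0 \<in> lstrip (lev K (Suc (length cs')))" using w0' lc' by simp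
      have Kc': "real K > real (length cs') * (2 * M + 4)" using K' lc' M by (auto simp: algebra_simps)
      have cnk': "cn ks = vals ((\<lambda>_. of_nat k') # cs') x" for x using v' Cons by (simp add: cn_def)
      obtain C where C: "C > 0"
        "\<forall>x\<in>cball 0 (1/2). \<forall>v\<in>lstrip (lev K ?n). \<forall>w\<in>lstrip (lev K ?n). \<bar>Re v - Re w\<bar> \<le> 1 \<longrightarrow>
        norm (chain_asym K w0 x (cn ks) v - chain_asym K w0 x (cn ks) w) \<le> C * exp ((real (length ks') * e - 1 + 1) * Re w) * norm (v - w)"
        using chain_asym_lipschitz[OF g' gk' w0c' Kc' e, unfolded cnk'[symmetric] lc'(1) lc'(2)[symmetric] ordl_leading_ones[OF e]] by blast
      have "norm (chain_asym K w0 x (cn ks) (shiftw u) - chain_asym K w0 x (cn ks) u) \<le> (2 * C) * exp (- (1/2) * Re u)"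
        if x: "norm x \<le> 1/2" and u: "u \<in> lstrip (lev K (Suc ?n))" for x u
      proof -
        have u1: "u \<in> lstrip (Suc (lev K ?n))" "u \<in> lstrip (lev K ?n)" using u sub by auto
        have su: "shiftw u \<in> lstrip (lev K ?n)" by (rule shiftw_props(3)[OF u1(1)])
        have R1: "\<bar>Re (shiftw u) - Re u\<bar> \<le> 1" using shiftw_props(2)[OF u1(1)] abs_Re_le_cmod[of "shiftw u - u"] by simp
        have "norm (chain_asym K w0 x (cn ks) (shiftw u) - chain_asym K w0 x (cn ks) u) \<le> C * exp ((real (length ks') * e - 1 + 1) * Re u) * norm (shiftw u - u)"
        proof -
          have "x \<in> cball 0 (1/2)" using x by simp
          then show ?thesis using C(2) su u1(2) R1 by blast
        qed
        also have "\<dots> \<le> C * exp ((real (length ks') * e - 1 + 1) * Re u) * (2 * exp (- Re u))"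
          using shiftw_props(1)[OF u1(1)] C(1) by (intro mult_left_mono) auto
        also have "\<dots> = (2 * C) * (exp ((real (length ks') * e - 1 + 1) * Re u) * exp (- Re u))" by (simp only: mult_ac)
        also have "\<dots> = (2 * C) * exp ((real (length ks') * e - 1) * Re u)" unfolding exp_add[symmetric] by (simp add: algebra_simps)
        also have "\<dots> \<le> (2 * C) * exp (- (1/2) * Re u)"
        proof (rule mult_left_mono)
          have "real (length ks') * e - 1 \<le> - (1/2)" using ne[of "length ks'"] Cons.prems(2) lc' by simp
          then show "exp ((real (length ks') * e - 1) * Re u) \<le> exp (- (1/2) * Re u)"
            using lstrip_Re_pos[OF u] by (simp only: exp_le_cancel_iff) (intro mult_right_mono, auto)
        qed (use C(1) in auto)
        finally show ?thesis .
      qed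
      then show ?thesis using C(1) by (intro exI[of _ "2 * C"]) auto
    qed
    then obtain C3 where C3: "C3 > 0" "\<And>x u. norm x \<le> 1/2 \<Longrightarrow> u \<in> lstrip (lev K (Suc ?n)) \<Longrightarrow>
       norm (chain_asym K w0 x (cn ks) (shiftw u) - chain_asym K w0 x (cn ks) u) \<le> C3 * exp (- (1/2) * Re u)" by blast
    define CC where "CC = ((C3 + C2) * exp (1/2) + C1) * 11"
    have "norm (chain_asym K w0 t (cn (k # ks)) v - (\<Sum>l\<le>leading_ones (k # ks). (w - v) ^ l / fact l * chain_asym K w0 t (cn (drop l (k # ks))) w)) \<le> CC * exp (- (1/2) * Re w)"
      if t: "norm t \<le> 1/2" and v: "v \<in> lstrip (lev K (Suc ?n))" and w: "w \<in> lstrip (lev K (Suc ?n))" and vw: "\<bar>Re v - Re w\<bar> \<le> 1" for t v w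
    proof -
      define a where "a = (\<lambda>l. chain_asym K w0 t (cn (drop l (k # ks))) w)"
      \<comment> \<open>The Taylor remainder seen as a function of the target point u. It vanishes
        at w, and its derivative is minus the remainder for \<open>ks\<close> up to small terms, so
        the induction hypothesis bounds it along the segment from w to v.\<close>
      define g where "g = (\<lambda>u. chain_asym K w0 t (cn (k # ks)) u - (\<Sum>l\<le>Suc (leading_ones ks). (w - u) ^ l / fact l * a l))"
      have gw: "g w = 0" unfolding g_def a_def by (subst sum.atMost_shift) simp
      let ?s = "closed_segment w v"
      have "norm (g v - g w) \<le> (((C3 + C2) * exp (1/2) + C1) * exp (- (1/2) * Re w)) * norm (v - w)"
      proof (rule field_differentiable_bound[of ?s g "\<lambda>u. asrc 1 (chain_asym K w0 t (cn ks)) u * exp u + R t u + (\<Sum>l\<le>leading_ones ks. (w - u) ^ l / fact l * a (Suc l))"])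
        fix u assume u: "u \<in> ?s"
        have ul: "u \<in> lstrip (lev K (Suc ?n))" using u seg_lstrip[OF w v] by auto
        have ul': "u \<in> lstrip (lev K ?n)" "u \<in> lstrip (Suc (lev K ?n))" "w \<in> lstrip (lev K ?n)" using ul w sub by auto
        have pd: "((\<lambda>u. (w - u) ^ l / fact l * a l) has_field_derivative (case l of 0 \<Rightarrow> 0 | Suc j \<Rightarrow> - ((w - u) ^ j / fact j * a (Suc j)))) (at u)" for l
        proof (cases l)
          case (Suc j)
          have "((\<lambda>u. (w - u) ^ l / fact l * a l) has_field_derivative (of_nat l * (w - u) ^ (l - 1) * (0 - 1)) / fact l * a l) (at u)"
            by (auto intro!: derivative_eq_intros)
          moreover have "(of_nat l * (w - u) ^ (l - 1) * (0 - 1)) / fact l = - ((w - u) ^ j / (fact j :: complex))"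
            using Suc by (simp del: of_nat_Suc)
          ultimately show ?thesis using Suc by simp
        qed simp
        have "((\<lambda>u. \<Sum>l\<le>Suc (leading_ones ks). (w - u) ^ l / fact l * a l) has_field_derivative (\<Sum>l\<le>Suc (leading_ones ks). case l of 0 \<Rightarrow> 0 | Suc j \<Rightarrow> - ((w - u) ^ j / fact j * a (Suc j)))) (at u)"
          by (intro DERIV_sum pd)
        then have "((\<lambda>u. \<Sum>l\<le>Suc (leading_ones ks). (w - u) ^ l / fact l * a l) has_field_derivative - (\<Sum>l\<le>leading_ones ks. (w - u) ^ l / fact l * a (Suc l))) (at u)"
          by (subst (asm) (2) sum.atMost_shift) (simp add: sum_negf lessThan_Suc_atMost)
        from DERIV_diff[OF R2[OF t ul] this]
        have "(g has_field_derivative asrc 1 (chain_asym K w0 t (cn ks)) u * exp u + R t u + (\<Sum>l\<le>leading_ones ks. (w - u) ^ l / fact l * a (Suc l))) (at u)"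
          unfolding g_def by (simp only: diff_minus_eq_add)
        then show "(g has_field_derivative asrc 1 (chain_asym K w0 t (cn ks)) u * exp u + R t u + (\<Sum>l\<le>leading_ones ks. (w - u) ^ l / fact l * a (Suc l))) (at u within ?s)"
          by (rule has_field_derivative_at_within)
        obtain q where q: "0 \<le> q" "q \<le> 1" "u = (1 - q) *\<^sub>R w + q *\<^sub>R v" using u unfolding closed_segment_def by blast
        have "Re u - Re w = q * (Re v - Re w)" unfolding q(3) by (simp add: algebra_simps)
        then have "\<bar>Re u - Re w\<bar> = q * \<bar>Re v - Re w\<bar>" using q(1) by (simp add: abs_mult)
        also have "\<dots> \<le> 1 * 1" using q vw by (intro mult_mono) auto
        finally have uw: "\<bar>Re u - Re w\<bar> \<le> 1" by simp
        have eu: "exp (- (1/2) * Re u) \<le> exp (1/2) * exp (- (1/2) * Re w)"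
          using exp_shift_bound[OF uw, of "- (1/2)"] by simp
        have F: "asrc 1 (chain_asym K w0 t (cn ks)) u * exp u = - chain_asym K w0 t (cn ks) (shiftw u)"
          unfolding asrc_def by (simp add: exp_minus)
        have aS: "a (Suc l) = chain_asym K w0 t (cn (drop l ks)) w" for l unfolding a_def by simp
        have n1: "norm (chain_asym K w0 t (cn ks) (shiftw u) - chain_asym K w0 t (cn ks) u) \<le> C3 * (exp (1/2) * exp (- (1/2) * Re w))"
          using C3(2)[OF t ul] mult_left_mono[OF eu, of C3] C3(1) by linarith
        have n2: "norm (R t u) \<le> C2 * (exp (1/2) * exp (- (1/2) * Re w))"
        proof -
          have "real ?n * e - 1 \<le> - (1/2)" using ne[of ?n] Cons.prems(2) by simp
          then have "exp ((real ?n * e - 1) * Re u) \<le> exp (- (1/2) * Re u)"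
            using lstrip_Re_pos[OF ul] by (simp only: exp_le_cancel_iff) (intro mult_right_mono, auto)
          then have "exp ((real ?n * e - 1) * Re u) \<le> exp (1/2) * exp (- (1/2) * Re w)" using eu by (rule order_trans)
          then have "C2 * exp ((real ?n * e - 1) * Re u) \<le> C2 * (exp (1/2) * exp (- (1/2) * Re w))"
            using C2(1) by (intro mult_left_mono) auto
          then show ?thesis using C2(2)[OF t ul] by linarith
        qed
        have n3: "norm (chain_asym K w0 t (cn ks) u - (\<Sum>l\<le>leading_ones ks. (w - u) ^ l / fact l * a (Suc l))) \<le> C1 * exp (- (1/2) * Re w)"
          unfolding aS by (rule C1(2)[OF t ul'(1) ul'(3) uw])
        have tri: "norm (- x + y + s) \<le> norm (x - z) + norm y + norm (z - s)" for x y z s :: complex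
        proof -
          have "- x + y + s = - (x - z) + y - (z - s)" by simp
          then show ?thesis
            by (metis (no_types, opaque_lifting) norm_minus_cancel norm_triangle_ineq norm_triangle_ineq4 add_mono order_trans order_refl)
        qed
        show "norm (asrc 1 (chain_asym K w0 t (cn ks)) u * exp u + R t u + (\<Sum>l\<le>leading_ones ks. (w - u) ^ l / fact l * a (Suc l))) \<le> ((C3 + C2) * exp (1/2) + C1) * exp (- (1/2) * Re w)"
          unfolding F using tri[of "chain_asym K w0 t (cn ks) (shiftw u)" "R t u" "\<Sum>l\<le>leading_ones ks. (w - u) ^ l / fact l * a (Suc l)" "chain_asym K w0 t (cn ks) u"] n1 n2 n3
          by (simp add: algebra_simps)
      qed auto
      also have "\<dots> \<le> (((C3 + C2) * exp (1/2) + C1) * exp (- (1/2) * Re w)) * 11"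
        using lstrip_diff_bound[OF v w vw] C1(1) C2(1) C3(1) by (intro mult_left_mono) auto
      finally have "norm (g v) \<le> CC * exp (- (1/2) * Re w)" unfolding gw CC_def by (simp only: diff_zero mult_ac)
      then show ?thesis unfolding g_def a_def using True by simp
    qed
    moreover have "CC \<ge> 0" unfolding CC_def using C1(1) C2(1) C3(1) by simp
    ultimately show ?thesis by (intro exI[of _ CC]) auto
  qed
qed

text \<open>The expansions at rpt (Suc N) are moved to lpt t N, that is by - pi i, and replaced there by
  the chain sums that they approximate.\<close>

definition Phi :: "nat list \<Rightarrow> complex \<Rightarrow> nat \<Rightarrow> complex" where
  "Phi ks t N = (\<Sum>i\<le>length ks. chain_sum wR N (rev (take i (cn ks))) *
     (\<Sum>l\<le>leading_ones (drop i ks). (- \<i> * complex_of_real pi) ^ l / fact l * chain_sum (wL t) N (cn (drop (i + l) ks))))"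

text \<open>Apart from the branch term, the difference is the logarithm of (N - t)/(N + 1) = 1 +
  O(1/N).\<close>

lemma lpt_rpt_diff:
  assumes t: "norm t \<le> 1/2" and N: "N \<ge> 3"
  shows "norm ((lpt t N - rpt (Suc N)) - (- \<i> * complex_of_real pi)) \<le> 3 * real N powr (-1)"
proof -
  have N1: "N \<ge> 1" using N by simp
  note z = norm_nat_diff[OF t N1]
  define q where "q = - (1 + t) / of_nat (Suc N)"
  have nq: "norm q \<le> (3/2) / real (Suc N)"
  proof -
    have "norm (1 + t) \<le> 3/2" using norm_triangle_ineq[of 1 t] t by simp
    then show ?thesis unfolding q_def norm_divide norm_minus_cancel norm_of_nat by (intro divide_right_mono) auto
  qed
  have s: "(3/2) / real (Suc N) < 1/2" using N by (simp add: field_simps)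
  have q1: "1 + q = (of_nat N - t) / of_nat (Suc N)" unfolding q_def by (simp add: field_simps del: of_nat_Suc) simp
  have nz: "1 + q \<noteq> 0" unfolding q1 using z(4) by (simp del: of_nat_Suc)
  have "norm q < 1/2" using nq s by (rule order.strict_trans1)
  then have Rq: "Re (1 + q) > 0" using abs_Re_le_cmod[of q] by simp
  have "Ln (of_nat N - t) = rpt (Suc N) + Ln (1 + q)"
  proof (rule exp_complex_eqI)
    have "\<bar>Im (Ln (of_nat N - t))\<bar> < pi/2" using Re_Ln_pos_lt_imp[of "of_nat N - t"] z(3) N1 by linarith
    moreover have "\<bar>Im (Ln (1 + q))\<bar> < pi/2" using Re_Ln_pos_lt_imp[OF Rq] .
    ultimately show "\<bar>Im (Ln (of_nat N - t)) - Im (rpt (Suc N) + Ln (1 + q))\<bar> < 2 * pi" unfolding rpt_def by simp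
    show "exp (Ln (of_nat N - t)) = exp (rpt (Suc N) + Ln (1 + q))"
      using z(4) nz exp_rpt[of "Suc N"] unfolding exp_add by (simp add: q1 del: of_nat_Suc)
  qed
  then have "(lpt t N - rpt (Suc N)) - (- \<i> * complex_of_real pi) = Ln (1 + q)" unfolding lpt_def by simp
  moreover have "norm (Ln (1 + q)) \<le> 2 * norm q" by (rule norm_Ln_le) (use nq s in linarith)
  moreover have "2 * norm q \<le> 3 * real N powr (-1)"
  proof -
    have "(3/2) / real (Suc N) \<le> (3/2) / real N" using N by (intro divide_left_mono) auto
    then have "norm q \<le> (3/2) * (1 / real N)" using order_trans[OF nq] by simp
    moreover have "real N powr (-1) = 1 / real N" using N by (simp add: powr_minus_divide)
    ultimately show ?thesis by linarith
  qed
  ultimately show ?thesis by simp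
qed

lemma power_diff_bound:
  fixes a b :: complex
  assumes "norm a \<le> R" "norm b \<le> R"
  shows "norm (a ^ l - b ^ l) \<le> real l * R ^ (l - 1) * norm (a - b)"
proof (induction l)
  case (Suc l)
  have R0: "R \<ge> 0" using assms(1) norm_ge_zero order_trans by blast
  have "a ^ Suc l - b ^ Suc l = a * (a ^ l - b ^ l) + (a - b) * b ^ l" by (simp add: algebra_simps)
  then have "norm (a ^ Suc l - b ^ Suc l) \<le> norm a * norm (a ^ l - b ^ l) + norm (a - b) * norm b ^ l"
    by (metis norm_triangle_ineq norm_mult norm_power)
  also have "\<dots> \<le> R * (real l * R ^ (l - 1) * norm (a - b)) + norm (a - b) * R ^ l"
    using assms Suc R0 by (intro add_mono mult_mono power_mono) auto
  also have "\<dots> = real (Suc l) * R ^ (Suc l - 1) * norm (a - b)"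
    by (cases l) (auto simp: algebra_simps)
  finally show ?case .
qed simp

text \<open>At positive integers all growth is logarithmic; the slack e = 1/(8 (r + 1)) per entry
  turns it into N^(1/8), which the errors below absorb.\<close>

lemma positive_bounds:
  assumes ks: "\<forall>k\<in>set ks. k \<ge> 1 \<and> real k \<le> M" and M: "M \<ge> 1" and len: "length ks \<le> r"
    and w0: "w0 \<in> lstrip (lev K r)" and K: "real K > (2 * real r + 2) * (2 * M + 4)"
  shows "\<exists>C N0. C \<ge> 0 \<and> N0 \<ge> 1 \<and> (\<forall>t N. norm t \<le> 1/2 \<longrightarrow> N \<ge> N0 \<longrightarrow> norm (chain_asym K w0 t (cn ks) (lpt t N)) \<le> C * real N powr (1/8))"
    and "\<exists>C N0. C \<ge> 0 \<and> N0 \<ge> 1 \<and> (\<forall>t N. norm t \<le> 1/2 \<longrightarrow> N \<ge> N0 \<longrightarrow> norm (chain_sum (wL t) N (cn ks) - chain_asym K w0 t (cn ks) (lpt t N)) \<le> C * real N powr (-1))"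
    and "\<exists>C. C \<ge> 0 \<and> (\<forall>N\<ge>1. norm (chain_sum wR N (cn ks)) \<le> C * real N powr (1/8))"
proof -
  interpret chain_asym_family False "cball 0 (1/2)" "\<lambda>x. x" M
    by unfold_locales (use M in auto)
  let ?n = "length ks"
  define cs where "cs = map (\<lambda>k (_::complex). of_nat k :: complex) ks"
  have v: "vals cs x = cn ks" for x unfolding cs_def cn_def by (simp add: o_def)
  have lc: "length cs = ?n" unfolding cs_def by simp
  define e where "e = 1 / (8 * (real r + 1))"
  have e: "e > 0" unfolding e_def by simp
  have ne: "real ?n * e \<le> 1/8" using len unfolding e_def by (simp add: field_simps)
  have g: "list_all2 good (replicate ?n 1) cs" unfolding list_all2_conv_all_nth lc
    using ks by (auto simp: good_def cs_def)
  have gm: "\<forall>c\<in>set cs. good (- M) c"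
    using g good_minus by (fastforce simp: list_all2_conv_all_nth in_set_conv_nth)
  have w0n: "w0 \<in> lstrip (lev K ?n)" using w0 lstrip_mono[OF lev_mono[OF len, of K]] by auto
  have le: "real ?n * (2 * M + 4) \<le> real r * (2 * M + 4)" using len M by (intro mult_right_mono) auto
  have rM: "real r * M \<ge> 0" using M by simp
  have Kn: "real K > real ?n * (2 * M + 4)" "real K - real ?n * (2 * M + 4) \<ge> 1" using K le rM M by (auto simp: algebra_simps)
  obtain N2 where N2: "N2 \<ge> 1" "\<And>N t. N \<ge> N2 \<Longrightarrow> norm t \<le> 1/2 \<Longrightarrow> lpt t N \<in> lstrip (lev K ?n)"
    using lpt_in_lstrip[of "lev K ?n"] by blast
  have "symb False (cball 0 (1/2)) (lev K ?n) (real ?n * e) (\<lambda>x. chain_asym K w0 x (cn ks))"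
    using chain_asym_order[OF g _ _ e, of w0 K] w0n Kn(1) unfolding v lc ordl_leading_ones[OF e] by simp
  then have sy: "symb False (cball 0 (1/2)) (lev K ?n) (1/8) (\<lambda>x. chain_asym K w0 x (cn ks))" by (rule symb_mono) (use ne in auto)
  obtain C where C: "C > 0" "\<And>x w. x \<in> cball 0 (1/2) \<Longrightarrow> w \<in> lstrip (lev K ?n) \<Longrightarrow> norm (chain_asym K w0 x (cn ks) w) \<le> C * exp ((1/8) * Re w)"
    by (rule symb_bound[OF sy]) blast
  have "norm (chain_asym K w0 t (cn ks) (lpt t N)) \<le> (C * 2 powr \<bar>1/8\<bar>) * real N powr (1/8)" if t: "norm t \<le> 1/2" and N: "N \<ge> N2" for t N
  proof -
    have "norm (chain_asym K w0 t (cn ks) (lpt t N)) \<le> C * exp ((1/8) * Re (lpt t N))" using C(2)[of t] t N2(2)[OF N t] by simp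
    also have "\<dots> \<le> C * (2 powr \<bar>1/8\<bar> * real N powr (1/8))" using C(1) Re_lpt[OF t, of N "1/8"] N N2(1) by (intro mult_left_mono) auto
    finally show ?thesis by (simp add: mult.assoc)
  qed
  then show "\<exists>C N0. C \<ge> 0 \<and> N0 \<ge> 1 \<and> (\<forall>t N. norm t \<le> 1/2 \<longrightarrow> N \<ge> N0 \<longrightarrow> norm (chain_asym K w0 t (cn ks) (lpt t N)) \<le> C * real N powr (1/8))"
    using C(1) N2(1) by (intro exI[of _ "C * 2 powr \<bar>1/8\<bar>"] exI[of _ N2]) auto
  obtain C1 N1 where C1: "N1 \<ge> 1" "\<forall>x\<in>cball 0 (1/2). \<forall>N\<ge>N1. norm (chain_sum (wL x) N (cn ks) - chain_asym K w0 x (cn ks) (lpt x N)) \<le> C1 * real N powr (- (real K - real ?n * (2 * M + 4)))"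
    using chain_asym_main[OF gm, of w0 K] w0n Kn(1) unfolding v lc by blast
  have "norm (chain_sum (wL t) N (cn ks) - chain_asym K w0 t (cn ks) (lpt t N)) \<le> \<bar>C1\<bar> * real N powr (-1)" if t: "norm t \<le> 1/2" and N: "N \<ge> N1" for t N
  proof -
    have tc: "t \<in> cball 0 (1/2)" using t by simp
    have "norm (chain_sum (wL t) N (cn ks) - chain_asym K w0 t (cn ks) (lpt t N)) \<le> C1 * real N powr (- (real K - real ?n * (2 * M + 4)))" using C1(2) tc N by blast
    also have "\<dots> \<le> \<bar>C1\<bar> * real N powr (-1)" using Kn(2) N C1(1) by (intro mult_mono powr_mono) auto
    finally show ?thesis .
  qed
  then show "\<exists>C N0. C \<ge> 0 \<and> N0 \<ge> 1 \<and> (\<forall>t N. norm t \<le> 1/2 \<longrightarrow> N \<ge> N0 \<longrightarrow> norm (chain_sum (wL t) N (cn ks) - chain_asym K w0 t (cn ks) (lpt t N)) \<le> C * real N powr (-1))"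
    using C1(1) by (intro exI[of _ "\<bar>C1\<bar>"] exI[of _ N1]) auto
  obtain C2 where C2': "C2 \<ge> 0 \<and> (\<forall>x\<in>cball (0::complex) (1/2). \<forall>N\<ge>1. norm (chain_sum wR N (cn ks)) \<le> C2 * real N powr (real ?n * e))"
    using chain_order[OF g e, unfolded v ordl_leading_ones[OF e]] by (rule exE)
  have C2: "C2 \<ge> 0" "\<And>N. N \<ge> 1 \<Longrightarrow> norm (chain_sum wR N (cn ks)) \<le> C2 * real N powr (real ?n * e)"
    using C2' bspec[OF conjunct2[OF C2'], of 0] by simp_all
  have "norm (chain_sum wR N (cn ks)) \<le> C2 * real N powr (1/8)" if "N \<ge> 1" for N
  proof -
    have "norm (chain_sum wR N (cn ks)) \<le> C2 * real N powr (real ?n * e)" by (rule C2(2)[OF that])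
    also have "\<dots> \<le> C2 * real N powr (1/8)" using C2(1) that ne by (intro mult_left_mono powr_mono) auto
    finally show ?thesis .
  qed
  then show "\<exists>C. C \<ge> 0 \<and> (\<forall>N\<ge>1. norm (chain_sum wR N (cn ks)) \<le> C * real N powr (1/8))" using C2(1) by blast
qed

text \<open>The value at \<open>rpt (Suc N)\<close> is expanded by \<open>chain_asym_taylor\<close>
  around \<open>lpt t N\<close>; the displacement is - pi i + O(1/N), and the expansions there are
  chain sums up to O(1/N). The worst product of an error with a growing factor is N^(-1)
  N^(1/8).\<close>

lemma positive_jump:
  assumes ks: "\<forall>k\<in>set ks. k \<ge> 1 \<and> real k \<le> M" and M: "M \<ge> 1" and len: "length ks \<le> r"
    and w0: "w0 \<in> lstrip (lev K r)" and K: "real K > (2 * real r + 2) * (2 * M + 4)"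
  shows "\<exists>C N0. C \<ge> 0 \<and> N0 \<ge> 1 \<and> (\<forall>t N. norm t \<le> 1/2 \<longrightarrow> N \<ge> N0 \<longrightarrow>
    norm (chain_sum (wL t) N (cn ks) + jump K w0 t (cn ks) N - (\<Sum>l\<le>leading_ones ks. (- \<i> * complex_of_real pi) ^ l / fact l * chain_sum (wL t) N (cn (drop l ks)))) \<le> C * real N powr (-1/2))"
proof -
  let ?n = "length ks" and ?p = "- \<i> * complex_of_real pi"
  have w0n: "w0 \<in> lstrip (lev K ?n)" using w0 lstrip_mono[OF lev_mono[OF len, of K]] by auto
  have le: "real ?n * (2 * M + 4) \<le> real r * (2 * M + 4)" using len M by (intro mult_right_mono) auto
  have rM: "real r * M \<ge> 0" using M by simp
  have Kn: "real K > real ?n * (2 * M + 4)" using K le rM M by (auto simp: algebra_simps)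
  obtain C1 where C1: "C1 \<ge> 0" "\<And>t v w. norm t \<le> 1/2 \<Longrightarrow> v \<in> lstrip (lev K ?n) \<Longrightarrow> w \<in> lstrip (lev K ?n) \<Longrightarrow> \<bar>Re v - Re w\<bar> \<le> 1 \<Longrightarrow>
    norm (chain_asym K w0 t (cn ks) v - (\<Sum>l\<le>leading_ones ks. (w - v) ^ l / fact l * chain_asym K w0 t (cn (drop l ks)) w)) \<le> C1 * exp (- (1/2) * Re w)"
    using chain_asym_taylor[OF ks M len w0n Kn] by blast
  have dk: "\<forall>k\<in>set (drop l ks). k \<ge> 1 \<and> real k \<le> M" "length (drop l ks) \<le> r" for l
    using ks len by (auto dest: in_set_dropD)
  have "\<forall>l. \<exists>C N0. C \<ge> 0 \<and> N0 \<ge> 1 \<and> (\<forall>t N. norm t \<le> 1/2 \<longrightarrow> N \<ge> N0 \<longrightarrow> norm (chain_asym K w0 t (cn (drop l ks)) (lpt t N)) \<le> C * real N powr (1/8))"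
    using positive_bounds(1)[OF dk(1) M dk(2) w0 K] by blast
  then obtain A NA where A: "\<And>l. A l \<ge> 0" "\<And>l t N. norm t \<le> 1/2 \<Longrightarrow> N \<ge> NA l \<Longrightarrow> norm (chain_asym K w0 t (cn (drop l ks)) (lpt t N)) \<le> A l * real N powr (1/8)"
    by metis
  have "\<forall>l. \<exists>C N0. C \<ge> 0 \<and> N0 \<ge> 1 \<and> (\<forall>t N. norm t \<le> 1/2 \<longrightarrow> N \<ge> N0 \<longrightarrow> norm (chain_sum (wL t) N (cn (drop l ks)) - chain_asym K w0 t (cn (drop l ks)) (lpt t N)) \<le> C * real N powr (-1))"
    using positive_bounds(2)[OF dk(1) M dk(2) w0 K] by blast
  then obtain E NE where E: "\<And>l. E l \<ge> 0" "\<And>l t N. norm t \<le> 1/2 \<Longrightarrow> N \<ge> NE l \<Longrightarrow> norm (chain_sum (wL t) N (cn (drop l ks)) - chain_asym K w0 t (cn (drop l ks)) (lpt t N)) \<le> E l * real N powr (-1)"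
    by metis
  obtain N2 where N2: "N2 \<ge> 1" "\<And>N t. N \<ge> N2 \<Longrightarrow> norm t \<le> 1/2 \<Longrightarrow> lpt t N \<in> lstrip (lev K ?n) \<and> rpt N \<in> lstrip (lev K ?n)"
    using lpt_in_lstrip[of "lev K ?n"] by blast
  define N0 where "N0 = Max (insert N2 (insert 3 (NA ` {..leading_ones ks} \<union> NE ` {..leading_ones ks})))"
  define CC where "CC = C1 * 2 powr (1/2) + E 0 + (\<Sum>l\<le>leading_ones ks. real l * 6 ^ (l - 1) * 3 * A l + pi ^ l * E l)"
  have "norm (chain_sum (wL t) N (cn ks) + jump K w0 t (cn ks) N - (\<Sum>l\<le>leading_ones ks. ?p ^ l / fact l * chain_sum (wL t) N (cn (drop l ks)))) \<le> CC * real N powr (-1/2)"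
    if t: "norm t \<le> 1/2" and N: "N \<ge> N0" for t N
  proof -
    have fin: "finite (insert N2 (insert 3 (NA ` {..leading_ones ks} \<union> NE ` {..leading_ones ks})))" by simp
    have NN: "N \<ge> N2" "N \<ge> 3" "\<And>l. l \<le> leading_ones ks \<Longrightarrow> N \<ge> NA l" "\<And>l. l \<le> leading_ones ks \<Longrightarrow> N \<ge> NE l"
      using N unfolding N0_def by (auto simp: Max_le_iff[OF fin])
    have N1: "N \<ge> 1" "N \<ge> 2" "Suc N \<ge> N2" "real N \<ge> 1" using NN by auto
    let ?w = "lpt t N" and ?v = "rpt (Suc N)"
    have wl: "?w \<in> lstrip (lev K ?n)" and vl: "?v \<in> lstrip (lev K ?n)" using N2(2) NN N1 t by auto
    note cl = right_left_close[OF t N1(2)]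
    define a where "a = (\<lambda>l. chain_asym K w0 t (cn (drop l ks)) ?w)"
    define m where "m = (\<lambda>l. chain_sum (wL t) N (cn (drop l ks)))"
    have m0: "chain_sum (wL t) N (cn ks) = m 0" "chain_asym K w0 t (cn ks) ?w = a 0" unfolding m_def a_def by auto
    \<comment> \<open>Three errors: the Taylor remainder, the approximation of the chain sum in
      degree 0, and in each degree the replacement of the displacement by - pi i and of the
      expansion by a chain sum.\<close>
    have eq: "chain_sum (wL t) N (cn ks) + jump K w0 t (cn ks) N - (\<Sum>l\<le>leading_ones ks. ?p ^ l / fact l * m l)
      = (chain_asym K w0 t (cn ks) ?v - (\<Sum>l\<le>leading_ones ks. (?w - ?v) ^ l / fact l * a l)) + (m 0 - a 0)
        + (\<Sum>l\<le>leading_ones ks. ((?w - ?v) ^ l - ?p ^ l) / fact l * a l - ?p ^ l / fact l * (m l - a l))"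
      unfolding jump_def m0 by (simp add: algebra_simps sum.distrib sum_subtractf diff_divide_distrib)
    have pw: "real N powr (-1) \<le> real N powr (-1/2)" "real N powr (-7/8) \<le> real N powr (-1/2)"
      by (rule powr_mono, simp, rule N1(4))+
    have b1: "norm (chain_asym K w0 t (cn ks) ?v - (\<Sum>l\<le>leading_ones ks. (?w - ?v) ^ l / fact l * a l)) \<le> (C1 * 2 powr (1/2)) * real N powr (-1/2)"
    proof -
      have "norm (chain_asym K w0 t (cn ks) ?v - (\<Sum>l\<le>leading_ones ks. (?w - ?v) ^ l / fact l * a l)) \<le> C1 * exp (- (1/2) * Re ?w)"
        unfolding a_def by (rule C1(2)[OF t vl wl cl(1)])
      also have "\<dots> \<le> C1 * (2 powr \<bar>- (1/2)\<bar> * real N powr (- (1/2)))" using C1(1) Re_lpt[OF t N1(1), of "- (1/2)"] by (intro mult_left_mono) auto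
      finally show ?thesis by (simp add: mult.assoc)
    qed
    have b2: "norm (m 0 - a 0) \<le> E 0 * real N powr (-1/2)"
    proof -
      have "norm (m 0 - a 0) \<le> E 0 * real N powr (-1)" unfolding m_def a_def by (rule E(2)[OF t NN(4)]) simp
      also have "\<dots> \<le> E 0 * real N powr (-1/2)" using pw(1) E(1) by (intro mult_left_mono) auto
      finally show ?thesis .
    qed
    have b3: "norm (((?w - ?v) ^ l - ?p ^ l) / fact l * a l - ?p ^ l / fact l * (m l - a l)) \<le> (real l * 6 ^ (l - 1) * 3 * A l + pi ^ l * E l) * real N powr (-1/2)"
      if l: "l \<le> leading_ones ks" for l
    proof -
      have f: "norm (x / fact l :: complex) \<le> norm x" for x
        using divide_left_mono[of 1 "fact l" "norm x"] fact_ge_1[of l, where 'a = real] by (simp add: norm_divide)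
      have np: "norm ?p \<le> 6" using pi_less_4 by (simp add: norm_mult)
      have wv: "norm (?w - ?v) \<le> 6" using cl(2) by (simp add: norm_minus_commute)
      have "norm (((?w - ?v) ^ l - ?p ^ l) / fact l) \<le> real l * 6 ^ (l - 1) * norm ((?w - ?v) - ?p)"
        using f power_diff_bound[OF wv np, of l] order_trans by blast
      also have "\<dots> \<le> real l * 6 ^ (l - 1) * (3 * real N powr (-1))" using lpt_rpt_diff[OF t NN(2)] by (intro mult_left_mono) auto
      finally have 1: "norm (((?w - ?v) ^ l - ?p ^ l) / fact l) \<le> real l * 6 ^ (l - 1) * (3 * real N powr (-1))" .
      have 2: "norm (a l) \<le> A l * real N powr (1/8)" unfolding a_def by (rule A(2)[OF t NN(3)[OF l]])
      have "norm (((?w - ?v) ^ l - ?p ^ l) / fact l * a l) \<le> (real l * 6 ^ (l - 1) * (3 * real N powr (-1))) * (A l * real N powr (1/8))"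
        unfolding norm_mult[of _ "a l"] using 1 2 by (intro mult_mono) auto
      also have "\<dots> = (real l * 6 ^ (l - 1) * 3 * A l) * (real N powr (-1) * real N powr (1/8))" by (simp only: mult_ac)
      also have "real N powr (-1) * real N powr (1/8) = real N powr (-7/8)" unfolding powr_add[symmetric] by simp
      also have "(real l * 6 ^ (l - 1) * 3 * A l) * real N powr (-7/8) \<le> (real l * 6 ^ (l - 1) * 3 * A l) * real N powr (-1/2)"
        using pw(2) A(1)[of l] by (intro mult_left_mono) auto
      finally have 3: "norm (((?w - ?v) ^ l - ?p ^ l) / fact l * a l) \<le> (real l * 6 ^ (l - 1) * 3 * A l) * real N powr (-1/2)" .
      have "norm (m l - a l) \<le> E l * real N powr (-1)" unfolding m_def a_def by (rule E(2)[OF t NN(4)[OF l]])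
      then have 4: "norm (m l - a l) \<le> E l * real N powr (-1/2)" using pw(1) mult_left_mono[OF pw(1) E(1)[of l]] by linarith
      have "norm (?p ^ l / fact l) \<le> pi ^ l" using f[of "?p ^ l"] by (simp add: norm_power norm_mult)
      then have "norm (?p ^ l / fact l * (m l - a l)) \<le> pi ^ l * (E l * real N powr (-1/2))"
        unfolding norm_mult[of _ "m l - a l"] using 4 by (intro mult_mono) auto
      then have 5: "norm (?p ^ l / fact l * (m l - a l)) \<le> (pi ^ l * E l) * real N powr (-1/2)" by (simp only: mult.assoc)
      show ?thesis unfolding distrib_right by (rule order_trans[OF norm_triangle_ineq4 add_mono[OF 3 5]])
    qed
    have b4: "norm (\<Sum>l\<le>leading_ones ks. ((?w - ?v) ^ l - ?p ^ l) / fact l * a l - ?p ^ l / fact l * (m l - a l)) \<le> (\<Sum>l\<le>leading_ones ks. real l * 6 ^ (l - 1) * 3 * A l + pi ^ l * E l) * real N powr (-1/2)"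
      unfolding sum_distrib_right by (rule sum_norm_le) (use b3 in auto)
    have "norm (chain_sum (wL t) N (cn ks) + jump K w0 t (cn ks) N - (\<Sum>l\<le>leading_ones ks. ?p ^ l / fact l * m l)) \<le> CC * real N powr (-1/2)"
      unfolding eq CC_def distrib_right by (rule order_trans[OF norm_triangle_ineq add_mono[OF order_trans[OF norm_triangle_ineq add_mono[OF b1 b2]] b4]])
    then show ?thesis unfolding m_def .
  qed
  moreover have "CC \<ge> 0" unfolding CC_def using C1(1) E(1) A(1) by (intro add_nonneg_nonneg sum_nonneg mult_nonneg_nonneg) auto
  moreover have "N0 \<ge> 1"
  proof -
    have "N2 \<le> N0" unfolding N0_def by (rule Max_ge) auto
    then show ?thesis using N2(1) by simp
  qed
  ultimately show ?thesis by blast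
qed

text \<open>The jump error N^(-1/2) is multiplied by right sums of size N^(1/8). Uniformity in t is
  the point, because Taylor coefficients in t are taken afterwards.\<close>

theorem zetaU_ext_Phi:
  assumes ks: "\<forall>k\<in>set ks. k \<ge> 1"
  shows "\<exists>C N0. \<forall>t N. norm t \<le> 1/2 \<longrightarrow> N \<ge> N0 \<longrightarrow> norm (zetaU_ext t (cn ks) - Phi ks t N) \<le> C * real N powr (-1/4)"
proof -
  let ?r = "length ks"
  define M where "M = 3 + real (sum_list ks)"
  have M: "M \<ge> 1" "2 < M" unfolding M_def by auto
  have kM: "real k < M" if "k \<in> set ks" for k using member_le_sum_list[OF that] unfolding M_def by simp
  have ksM: "\<forall>k\<in>set ks. k \<ge> 1 \<and> real k \<le> M" using ks kM by (auto intro: less_imp_le)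
  define K where "K = order_choice M ?r"
  define w0 where "w0 = base_choice K ?r"
  have w0: "w0 \<in> lstrip (lev K ?r)" unfolding w0_def by (rule base_choice_in)
  have K: "real K > (2 * real ?r + 2) * (2 * M + 4)" unfolding K_def by (rule order_choice_gt)
  have zetaU_ext: "zetaU_ext t (cn ks) = zetaU_ext_at K w0 t (cn ks)" if "norm t \<le> 1/2" for t
    by (rule zetaU_ext_eq_zetaU_ext_at[OF that M(2)]) (use kM w0 K in \<open>auto simp: cn_def\<close>)
  interpret chain_asym_family False "cball 0 (1/2)" "\<lambda>x. x" M
    by unfold_locales (use M in auto)
  define cs where "cs = map (\<lambda>k (_::complex). of_nat k :: complex) ks"
  have v: "vals cs x = cn ks" for x unfolding cs_def cn_def by (simp add: o_def)
  have lc: "length cs = ?r" unfolding cs_def by simp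
  have gm: "\<forall>c\<in>set cs. good (- M) c" using ksM unfolding good_def cs_def by (auto intro: order_trans[of _ 0])
  obtain C1 N1 where C1: "C1 \<ge> 0" "N1 \<ge> 1" "\<forall>x\<in>cball 0 (1/2). \<forall>N\<ge>N1. norm (zetaU_ext_at K w0 x (cn ks) - (trunc x (cn ks) N +
     (\<Sum>i<?r. chain_sum wR N (rev (take i (cn ks))) * jump K w0 x (drop i (cn ks)) N))) \<le> C1 * real N powr (-1)"
    using zetaU_ext_at_split[OF gm, of w0 K] w0 K unfolding v lc by blast
  have dk: "\<forall>k\<in>set (drop i ks). k \<ge> 1 \<and> real k \<le> M" "length (drop i ks) \<le> ?r" for i
    using ksM by (auto dest: in_set_dropD)
  have tk: "\<forall>k\<in>set (rev (take i ks)). k \<ge> 1 \<and> real k \<le> M" "length (rev (take i ks)) \<le> ?r" for i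
    using ksM by (auto dest: in_set_takeD)
  define err where "err = (\<lambda>i t N. norm (chain_sum (wL t) N (cn (drop i ks)) + jump K w0 t (cn (drop i ks)) N
    - (\<Sum>l\<le>leading_ones (drop i ks). (- \<i> * complex_of_real pi) ^ l / fact l * chain_sum (wL t) N (cn (drop l (drop i ks))))))"
  have "\<forall>i. \<exists>C N0. C \<ge> 0 \<and> N0 \<ge> 1 \<and> (\<forall>t N. norm t \<le> 1/2 \<longrightarrow> N \<ge> N0 \<longrightarrow> err i t N \<le> C * real N powr (-1/2))"
    unfolding err_def by (rule allI, rule positive_jump[OF dk(1) M(1) dk(2) w0 K])
  then obtain J NJ where J: "\<And>i. J i \<ge> 0" "\<And>i t N. norm t \<le> 1/2 \<Longrightarrow> N \<ge> NJ i \<Longrightarrow> err i t N \<le> J i * real N powr (-1/2)"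
    by metis
  have "\<forall>i. \<exists>C. C \<ge> 0 \<and> (\<forall>N\<ge>1. norm (chain_sum wR N (cn (rev (take i ks)))) \<le> C * real N powr (1/8))"
    using positive_bounds(3)[OF tk(1) M(1) tk(2) w0 K] by blast
  then obtain G where G: "\<And>i. G i \<ge> 0" "\<And>i N. N \<ge> 1 \<Longrightarrow> norm (chain_sum wR N (cn (rev (take i ks)))) \<le> G i * real N powr (1/8)"
    by metis
  define N0 where "N0 = Max (insert N1 (NJ ` {..?r}))"
  have "norm (zetaU_ext t (cn ks) - Phi ks t N) \<le> (C1 + (\<Sum>i\<le>?r. G i * J i)) * real N powr (-1/4)" if t: "norm t \<le> 1/2" and N: "N \<ge> N0" for t N
  proof -
    have fin: "finite (insert N1 (NJ ` {..?r}))" by simp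
    have NN: "N \<ge> N1" "\<And>i. i \<le> ?r \<Longrightarrow> N \<ge> NJ i" using N unfolding N0_def by (auto simp: Max_le_iff[OF fin])
    have N1: "N \<ge> 1" using NN(1) C1(2) by simp
    define p where "p = (\<lambda>i. chain_sum wR N (rev (take i (cn ks))))"
    define q where "q = (\<lambda>i. chain_sum (wL t) N (cn (drop i ks)) + jump K w0 t (cn (drop i ks)) N)"
    define s where "s = (\<lambda>i. \<Sum>l\<le>leading_ones (drop i ks). (- \<i> * complex_of_real pi) ^ l / fact l * chain_sum (wL t) N (cn (drop (i + l) ks)))"
    have dcn: "drop i (cn ks) = cn (drop i ks)" for i by (simp add: cn_def drop_map)
    have tcn: "p i = chain_sum wR N (cn (rev (take i ks)))" for i unfolding p_def by (simp add: cn_def take_map rev_map)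
    have lcn: "length (cn ks) = ?r" by (simp add: cn_def)
    have jr: "jump K w0 t (drop ?r (cn ks)) N = 0" by (simp add: cn_def jump_def)
    have "trunc t (cn ks) N + (\<Sum>i<?r. p i * jump K w0 t (drop i (cn ks)) N) = trunc t (cn ks) N + (\<Sum>i\<le>?r. p i * jump K w0 t (drop i (cn ks)) N)"
      using jr by (simp add: lessThan_Suc_atMost[symmetric])
    also have "\<dots> = (\<Sum>i\<le>?r. p i * q i)"
      unfolding trunc_def p_def q_def dcn lcn by (simp add: algebra_simps sum.distrib)
    finally have e: "trunc t (cn ks) N + (\<Sum>i<?r. p i * jump K w0 t (drop i (cn ks)) N) = (\<Sum>i\<le>?r. p i * q i)" .
    have tc: "t \<in> cball 0 (1/2)" using t by simp
    have "norm (zetaU_ext t (cn ks) - (\<Sum>i\<le>?r. p i * q i)) \<le> C1 * real N powr (-1)"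
      unfolding zetaU_ext[OF t] e[symmetric] unfolding p_def by (rule C1(3)[rule_format, OF tc NN(1)])
    also have "\<dots> \<le> C1 * real N powr (-1/4)" using C1(1) N1 by (intro mult_left_mono powr_mono) auto
    finally have 2: "norm (zetaU_ext t (cn ks) - (\<Sum>i\<le>?r. p i * q i)) \<le> C1 * real N powr (-1/4)" .
    have "norm ((\<Sum>i\<le>?r. p i * q i) - (\<Sum>i\<le>?r. p i * s i)) \<le> (\<Sum>i\<le>?r. (G i * J i) * real N powr (-1/4))"
      unfolding sum_subtractf[symmetric]
    proof (rule sum_norm_le)
      fix i assume i: "i \<in> {..?r}"
      have "norm (q i - s i) \<le> J i * real N powr (-1/2)"
        using J(2)[OF t NN(2), of i] i unfolding q_def s_def err_def by (simp add: add.commute)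
      moreover have "norm (p i) \<le> G i * real N powr (1/8)" unfolding tcn by (rule G(2)[OF N1])
      ultimately have "norm (p i * (q i - s i)) \<le> (G i * real N powr (1/8)) * (J i * real N powr (-1/2))"
        unfolding norm_mult using G(1) by (intro mult_mono) auto
      also have "\<dots> = (G i * J i) * (real N powr (1/8) * real N powr (-1/2))" by (simp only: mult_ac)
      also have "\<dots> \<le> (G i * J i) * real N powr (-1/4)"
        unfolding powr_add[symmetric] using G(1)[of i] J(1)[of i] N1 by (intro mult_left_mono powr_mono) auto
      finally show "norm (p i * q i - p i * s i) \<le> (G i * J i) * real N powr (-1/4)" by (simp only: right_diff_distrib)
    qed
    then have 3: "norm ((\<Sum>i\<le>?r. p i * q i) - (\<Sum>i\<le>?r. p i * s i)) \<le> (\<Sum>i\<le>?r. G i * J i) * real N powr (-1/4)" by (simp only: sum_distrib_right)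
    have Ph: "Phi ks t N = (\<Sum>i\<le>?r. p i * s i)" unfolding Phi_def p_def s_def ..
    have "norm (zetaU_ext t (cn ks) - Phi ks t N) \<le> norm (zetaU_ext t (cn ks) - (\<Sum>i\<le>?r. p i * q i)) + norm ((\<Sum>i\<le>?r. p i * q i) - (\<Sum>i\<le>?r. p i * s i))"
      unfolding Ph using norm_triangle_ineq[of "zetaU_ext t (cn ks) - (\<Sum>i\<le>?r. p i * q i)" "(\<Sum>i\<le>?r. p i * q i) - (\<Sum>i\<le>?r. p i * s i)"] by simp
    then show ?thesis using 2 3 unfolding distrib_right by linarith
  qed
  then show ?thesis by blast
qed

section \<open>Regularised multiple harmonic sums\<close>

text \<open>The stuffle product with a single entry 1: the new variable either falls between two
  others or coincides with one of them, which raises the exponent there.\<close>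

lemma stuffle_one:
  fixes x :: "nat \<Rightarrow> 'a::comm_ring_1"
  defines "E \<equiv> chain_sum (\<lambda>n k. x n ^ k)"
  shows "E N [1] * E N u = (\<Sum>i\<le>length u. E N (take i u @ 1 # drop i u)) + (\<Sum>i<length u. E N (u[i := u ! i + 1]))"
proof (induction N arbitrary: u)
  case 0
  have "take i u @ 1 # drop i u \<noteq> []" for i by simp
  then have "E 0 (take i u @ 1 # drop i u) = 0" for i unfolding E_def by (metis chain_sum.simps(2) neq_Nil_conv)
  moreover have "E 0 (u[i := u ! i + 1]) = 0" if "i < length u" for i
  proof -
    have "u[i := u ! i + 1] \<noteq> []" using that by auto
    then show ?thesis unfolding E_def by (metis chain_sum.simps(2) neq_Nil_conv)
  qed
  ultimately show ?case by (simp add: E_def)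
next
  case (Suc N)
  show ?case
  proof (cases u)
    case Nil
    then show ?thesis by (simp add: E_def)
  next
    case (Cons k v)
    define a where "a = x (Suc N)"
    have E: "E (Suc N) (j # w) = E N (j # w) + a ^ j * E N w" for j w unfolding E_def a_def by simp
    have E0: "E N [] = 1" by (simp add: E_def)
    have "E (Suc N) [1] * E (Suc N) u = (E N [1] + a) * (E N (k # v) + a ^ k * E N v)"
      unfolding Cons E E0 by simp
    also have "\<dots> = E N [1] * E N (k # v) + a * E N (k # v) + a ^ k * (E N [1] * E N v) + a ^ (k + 1) * E N v"
      by (simp add: algebra_simps)
    also have "\<dots> = (\<Sum>i\<le>length u. E (Suc N) (take i u @ 1 # drop i u)) + (\<Sum>i<length u. E (Suc N) (u[i := u ! i + 1]))"
      unfolding Suc.IH Cons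
      by (simp add: sum.atMost_Suc_shift sum.lessThan_Suc_shift E sum.distrib sum_distrib_left algebra_simps del: sum.atMost_Suc sum.lessThan_Suc)
    finally show ?thesis .
  qed
qed

text \<open>Inserting 1 within or directly after the initial block of ones always gives the same
  list, and inserting it further on does not lengthen the block. This separates the term to be
  solved for from terms that the induction already covers.\<close>

lemma leading_ones_insert:
  "i \<le> leading_ones v \<Longrightarrow> take i v @ 1 # drop i v = 1 # v"
  "leading_ones v < i \<Longrightarrow> i \<le> length v \<Longrightarrow> leading_ones (take i v @ 1 # drop i v) = leading_ones v"
proof -
  show "i \<le> leading_ones v \<Longrightarrow> take i v @ 1 # drop i v = 1 # v"
  proof (induction v arbitrary: i)
    case (Cons k v)
    then show ?case by (cases i; cases "k = 1") auto
  qed simp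
  show "leading_ones v < i \<Longrightarrow> i \<le> length v \<Longrightarrow> leading_ones (take i v @ 1 # drop i v) = leading_ones v"
  proof (induction v arbitrary: i)
    case (Cons k v)
    then show ?case by (cases i; cases "k = 1") auto
  qed simp
qed

lemma leading_ones_raise: "\<forall>k\<in>set v. k \<ge> 1 \<Longrightarrow> i < length v \<Longrightarrow> leading_ones (v[i := v ! i + 1]) \<le> leading_ones v"
proof (induction v arbitrary: i)
  case (Cons k v)
  then show ?case by (cases i; cases "k = 1") auto
qed simp

definition mhs :: "nat \<Rightarrow> nat list \<Rightarrow> complex" where
  "mhs = chain_sum (\<lambda>n k. inverse (of_nat n) ^ k)"

lemma mhs_stuffle: "mhs N [1] * mhs N u = (\<Sum>i\<le>length u. mhs N (take i u @ 1 # drop i u)) + (\<Sum>i<length u. mhs N (u[i := u ! i + 1]))"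
  unfolding mhs_def by (rule stuffle_one)

lemma mhs_growth:
  assumes "\<forall>k\<in>set u. k \<ge> 1" "e > 0"
  shows "\<exists>C. \<forall>N\<ge>1. norm (mhs N u) \<le> C * real N powr e"
  using assms
proof (induction u arbitrary: e)
  case Nil
  have "1 \<le> 1 * real N powr e" if "N \<ge> 1" for N using that Nil by (simp add: ge_one_powr_ge_zero)
  then show ?case unfolding mhs_def by (intro exI[of _ 1]) simp
next
  case (Cons k u)
  obtain C where C: "\<forall>N\<ge>1. norm (mhs N u) \<le> C * real N powr (e/2)" using Cons.IH[of "e/2"] Cons.prems by auto
  have "\<exists>C'. \<forall>x\<in>{()}. \<forall>N\<ge>1. norm (mhs N (k # u)) \<le> C' * real N powr e"
  proof (rule chain_growth_step[where B = "\<lambda>_ N. mhs N u" and g = "\<lambda>_ n. inverse (of_nat n) ^ k" and b = "e/2" and a = "-1" and G = 1 and C = C])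
    show "norm (inverse (of_nat n) ^ k :: complex) \<le> 1 * real n powr (-1)" if "n \<ge> 1" for n
    proof -
      have "norm (inverse (of_nat n) ^ k :: complex) = inverse (real n) ^ k" by (simp add: norm_power norm_inverse)
      also have "\<dots> \<le> inverse (real n) ^ 1" using Cons.prems that by (intro power_decreasing) (auto simp: inverse_le_1_iff)
      finally show ?thesis using that by (simp add: powr_minus)
    qed
    show "norm (mhs 0 u) \<le> 1" by (cases u) (auto simp: mhs_def)
  qed (use C Cons.prems in \<open>auto simp: mhs_def\<close>)
  then show ?case by simp
qed

text \<open>Without leading ones the largest variable has exponent at least 2, so the sum converges;
  the list is reversed because \<open>mzv\<close> puts the largest variable last.\<close>

lemma mhs_admissible:
  assumes u: "\<forall>k\<in>set u. k \<ge> 1" "leading_ones u = 0"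
  shows "\<exists>C. \<forall>N\<ge>1. norm (mhs N u - of_real (mzv (rev u))) \<le> C * real N powr (- 1/2)"
    and "of_real (mzv (rev u)) \<in> ZPi"
proof -
  have mzr: "mhs N u = of_real (chain_sum (\<lambda>n k. 1 / real n ^ k) N u)" for N u
  proof (induction N arbitrary: u)
    case 0 then show ?case by (cases u) (auto simp: mhs_def)
  next
    case (Suc N)
    then show ?case by (cases u) (auto simp: mhs_def power_inverse divide_inverse)
  qed
  have adm: "admissible (rev u)"
    using u unfolding admissible_def by (cases u) (auto simp: last_rev leading_ones_def split: if_splits)
  then show "of_real (mzv (rev u)) \<in> ZPi" unfolding ZPi_def Zmzv_def by (intro Qalg.gen UnI1 imageI) auto
  show "\<exists>C. \<forall>N\<ge>1. norm (mhs N u - of_real (mzv (rev u))) \<le> C * real N powr (- 1/2)"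
  proof (cases u)
    case Nil
    have "pos_incr_tuples 0 = {[]}" unfolding pos_incr_tuples_def by auto
    then have "mzv [] = 1" unfolding mzv_def by simp
    then show ?thesis using Nil by (intro exI[of _ 0]) (simp add: mhs_def)
  next
    case (Cons k v)
    have k: "k \<ge> 2" using u Cons by (cases "k = 1") auto
    obtain C where C: "\<And>N. N \<ge> 1 \<Longrightarrow> norm (mhs N v) \<le> C * real N powr (1/8)"
      using mhs_growth[of v "1/8"] u Cons by auto
    have inc: "norm (mhs (Suc N) u - mhs N u) \<le> C * real N powr (- (1/2) - 1 - 3/8)" if N: "N \<ge> 1" for N
    proof -
      have "norm (mhs (Suc N) u - mhs N u) = inverse (real (Suc N)) ^ k * norm (mhs N v)"
        using Cons by (simp add: mhs_def norm_mult norm_power norm_inverse del: of_nat_Suc)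
      also have "\<dots> \<le> real N powr (-2) * (C * real N powr (1/8))"
      proof (intro mult_mono C N)
        have "inverse (real (Suc N)) ^ k \<le> inverse (real (Suc N)) ^ 2" using k by (intro power_decreasing) (auto simp: inverse_le_1_iff)
        also have "\<dots> \<le> inverse (real N) ^ 2" using N by (intro power_mono le_imp_inverse_le) auto
        also have "\<dots> = real N powr (-2)" using N by (simp add: powr_minus powr_numeral power_inverse)
        finally show "inverse (real (Suc N)) ^ k \<le> real N powr (-2)" .
      qed auto
      also have "\<dots> = C * (real N powr (-2) * real N powr (1/8))" by simp
      also have "\<dots> = C * real N powr (- (1/2) - 1 - 3/8)" unfolding powr_add[symmetric] by simp
      finally show ?thesis .
    qed
    \<comment> \<open>The increments are at most N^(-2) N^(1/8), and 2 - 1/8 = 1/2 + 1 +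
      3/8.\<close>
    note tel = telescoping_rate[of "{()}" 1 "\<lambda>N _. mhs N u" C "1/2" "3/8"]
    have conv: "convergent (\<lambda>N. mhs N u)" using tel(1) inc by simp
    then have "Bseq (\<lambda>N. mhs N u)" by (rule convergent_imp_Bseq)
    then obtain B where B: "\<And>N. norm (mhs N u) \<le> B" by (auto simp: Bseq_def)
    have "(\<lambda>N. chain_sum (\<lambda>n k. 1 / real n ^ k) N (rev (rev u))) \<longlonglongrightarrow>
      (\<Sum>\<^sub>\<infinity>ns\<in>pos_incr_tuples (length (rev u)). \<Prod>j<length (rev u). 1 / real (ns ! j) ^ (rev u ! j))"
    proof (rule infsum_pos_incr_tuples)
      show "chain_sum (\<lambda>n s. norm (1 / real n ^ s)) N (rev (rev u)) \<le> B" for N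
        using B[of N] unfolding mzr by simp
    qed
    then have "(\<lambda>N. chain_sum (\<lambda>n k. 1 / real n ^ k) N u) \<longlonglongrightarrow> mzv (rev u)" unfolding mzv_def by simp
    then have "(\<lambda>N. mhs N u) \<longlonglongrightarrow> of_real (mzv (rev u))" unfolding mzr by (rule tendsto_of_real)
    then have "lim (\<lambda>N. mhs N u) = of_real (mzv (rev u))" by (rule limI)
    then show ?thesis using tel(2) inc by simp
  qed
qed

text \<open>Sequences asymptotic to a polynomial in the harmonic numbers with coefficients in ZPi, with
  an error smaller than every power of log N.  If such a sequence converges, the polynomial is
  constant.\<close>

definition regularizable :: "(nat \<Rightarrow> complex) set" where
  "regularizable = {x. \<exists>p. (\<forall>i. coeff p i \<in> ZPi) \<and> (\<forall>k. (\<lambda>N. (x N - poly p (mhs N [1])) * mhs N [1] ^ k) \<longlonglongrightarrow> 0)}"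

lemma regularizableI: "(\<And>i. coeff p i \<in> ZPi) \<Longrightarrow> (\<And>k. (\<lambda>N. (x N - poly p (mhs N [1])) * mhs N [1] ^ k) \<longlonglongrightarrow> 0) \<Longrightarrow> x \<in> regularizable"
  unfolding regularizable_def by blast

lemma regularizableE:
  assumes "x \<in> regularizable"
  obtains p where "\<And>i. coeff p i \<in> ZPi" "\<And>k. (\<lambda>N. (x N - poly p (mhs N [1])) * mhs N [1] ^ k) \<longlonglongrightarrow> 0"
  using assms unfolding regularizable_def by blast

lemma ZPi_sum: "(\<And>i. i \<in> A \<Longrightarrow> f i \<in> ZPi) \<Longrightarrow> sum f A \<in> ZPi"
  by (induction A rule: infinite_finite_induct) auto

lemma regularizable_add: assumes "x \<in> regularizable" "y \<in> regularizable" shows "(\<lambda>N. x N + y N) \<in> regularizable"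
proof -
  obtain p where p: "\<And>i. coeff p i \<in> ZPi" "\<And>k. (\<lambda>N. (x N - poly p (mhs N [1])) * mhs N [1] ^ k) \<longlonglongrightarrow> 0"
    using regularizableE[OF assms(1)] by blast
  obtain q where q: "\<And>i. coeff q i \<in> ZPi" "\<And>k. (\<lambda>N. (y N - poly q (mhs N [1])) * mhs N [1] ^ k) \<longlonglongrightarrow> 0"
    using regularizableE[OF assms(2)] by blast
  show ?thesis
  proof (rule regularizableI[of "p + q"])
    show "(\<lambda>N. (x N + y N - poly (p + q) (mhs N [1])) * mhs N [1] ^ k) \<longlonglongrightarrow> 0" for k
      using tendsto_add[OF p(2)[of k] q(2)[of k]] by (simp add: algebra_simps)
  qed (use p q in simp)
qed

text \<open>This is the reason for asking for all powers k in \<open>regularizable\<close>: errors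
  remain null after multiplication by a polynomial in the harmonic numbers, so products stay in the
  set.\<close>

lemma tendsto_0_poly:
  fixes h :: "nat \<Rightarrow> complex"
  assumes "\<And>k. (\<lambda>N. d N * h N ^ k) \<longlonglongrightarrow> 0"
  shows "(\<lambda>N. d N * h N ^ k * poly q (h N)) \<longlonglongrightarrow> 0"
proof -
  have "(\<lambda>N. \<Sum>i\<le>degree q. coeff q i * (d N * h N ^ (k + i))) \<longlonglongrightarrow> 0"
    by (intro tendsto_null_sum tendsto_mult_right_zero assms)
  moreover have "(\<Sum>i\<le>degree q. coeff q i * (d N * h N ^ (k + i))) = d N * h N ^ k * poly q (h N)" for N
    unfolding poly_altdef sum_distrib_left by (intro sum.cong) (auto simp: power_add)
  ultimately show ?thesis by simp
qed

lemma regularizable_mult: assumes "x \<in> regularizable" "y \<in> regularizable" shows "(\<lambda>N. x N * y N) \<in> regularizable"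
proof -
  obtain p where p: "\<And>i. coeff p i \<in> ZPi" "\<And>k. (\<lambda>N. (x N - poly p (mhs N [1])) * mhs N [1] ^ k) \<longlonglongrightarrow> 0"
    using regularizableE[OF assms(1)] by blast
  obtain q where q: "\<And>i. coeff q i \<in> ZPi" "\<And>k. (\<lambda>N. (y N - poly q (mhs N [1])) * mhs N [1] ^ k) \<longlonglongrightarrow> 0"
    using regularizableE[OF assms(2)] by blast
  show ?thesis
  proof (rule regularizableI[of "p * q"])
    show "coeff (p * q) i \<in> ZPi" for i unfolding coeff_mult by (intro ZPi_sum ZPi_mult p q)
    fix k
    let ?h = "\<lambda>N. mhs N [1]"
    let ?dx = "\<lambda>N. x N - poly p (?h N)" and ?dy = "\<lambda>N. y N - poly q (?h N)"
    have "(\<lambda>N. (?dx N * ?h N ^ 0) * (?dy N * ?h N ^ k) + ?dx N * ?h N ^ k * poly q (?h N) + ?dy N * ?h N ^ k * poly p (?h N)) \<longlonglongrightarrow> 0 * 0 + 0 + 0"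
      by (intro tendsto_add tendsto_mult tendsto_0_poly p(2) q(2))
    moreover have "(?dx N * ?h N ^ 0) * (?dy N * ?h N ^ k) + ?dx N * ?h N ^ k * poly q (?h N) + ?dy N * ?h N ^ k * poly p (?h N)
      = (x N * y N - poly (p * q) (?h N)) * ?h N ^ k" for N by (simp add: algebra_simps)
    ultimately show "(\<lambda>N. (x N * y N - poly (p * q) (mhs N [1])) * mhs N [1] ^ k) \<longlonglongrightarrow> 0" by simp
  qed
qed

lemma regularizable_const: "z \<in> ZPi \<Longrightarrow> (\<lambda>N. z) \<in> regularizable"
  by (rule regularizableI[of "[:z:]"]) (auto simp: coeff_pCons split: nat.splits)

lemma regularizable_harm: "(\<lambda>N. mhs N [1]) \<in> regularizable"
  by (rule regularizableI[of "[:0, 1:]"]) (auto simp: coeff_pCons split: nat.splits)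

lemma regularizable_sum: "(\<And>i. i \<in> A \<Longrightarrow> f i \<in> regularizable) \<Longrightarrow> (\<lambda>N. \<Sum>i\<in>A. f i N) \<in> regularizable"
  by (induction A rule: infinite_finite_induct) (auto intro: regularizable_add regularizable_const)

lemma regularizable_cmult: "z \<in> ZPi \<Longrightarrow> x \<in> regularizable \<Longrightarrow> (\<lambda>N. z * x N) \<in> regularizable"
  by (intro regularizable_mult regularizable_const)

lemma regularizable_diff: "x \<in> regularizable \<Longrightarrow> y \<in> regularizable \<Longrightarrow> (\<lambda>N. x N - y N) \<in> regularizable"
  using regularizable_add[of x "\<lambda>N. (-1) * y N"] regularizable_cmult[of "-1" y] by simp

text \<open>Harmonic numbers grow more slowly than any positive power of N. For a given k the
  exponent e = 1/(4 (k + 1)) keeps their k-th power below N^(1/4), against an error of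
  N^(-1/2).\<close>

lemma regularizable_fast:
  assumes z: "z \<in> ZPi" and C: "\<And>N. N \<ge> 1 \<Longrightarrow> norm (x N - z) \<le> C * real N powr (- 1/2)"
  shows "x \<in> regularizable"
proof (rule regularizableI[of "[:z:]"])
  fix k
  define e where "e = 1 / (4 * (real k + 1))"
  have e: "e > 0" "e * real k \<le> 1/4" unfolding e_def by (auto simp: field_simps)
  obtain G where G: "\<And>N. N \<ge> 1 \<Longrightarrow> norm (mhs N [1]) \<le> G * real N powr e" using mhs_growth[of "[1]" e] e by auto
  show "(\<lambda>N. (x N - poly [:z:] (mhs N [1])) * mhs N [1] ^ k) \<longlonglongrightarrow> 0"
  proof (rule Lim_null_comparison)
    show "\<forall>\<^sub>F N in sequentially. norm ((x N - poly [:z:] (mhs N [1])) * mhs N [1] ^ k) \<le> (\<bar>C\<bar> * \<bar>G\<bar> ^ k) * real N powr (- 1/4)"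
      unfolding eventually_sequentially
    proof (intro exI[of _ 1] allI impI)
      fix N :: nat assume N: "N \<ge> 1"
      have h: "norm (mhs N [1]) ^ k \<le> \<bar>G\<bar> ^ k * real N powr (1/4)"
      proof -
        have "norm (mhs N [1]) \<le> \<bar>G\<bar> * real N powr e"
          by (rule order_trans[OF G[OF N]]) (intro mult_right_mono, auto)
        then have "norm (mhs N [1]) ^ k \<le> (\<bar>G\<bar> * real N powr e) ^ k" by (intro power_mono) auto
        also have "\<dots> = \<bar>G\<bar> ^ k * real N powr (e * real k)" using N by (simp add: power_mult_distrib powr_power mult.commute)
        also have "\<dots> \<le> \<bar>G\<bar> ^ k * real N powr (1/4)" using e N by (intro mult_left_mono powr_mono) auto
        finally show ?thesis .
      qed
      have x: "norm (x N - z) \<le> \<bar>C\<bar> * real N powr (- 1/2)"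
        by (rule order_trans[OF C[OF N]]) (intro mult_right_mono, auto)
      have "norm ((x N - poly [:z:] (mhs N [1])) * mhs N [1] ^ k) = norm (x N - z) * norm (mhs N [1]) ^ k"
        by (simp add: norm_mult norm_power)
      also have "\<dots> \<le> (\<bar>C\<bar> * real N powr (- 1/2)) * (\<bar>G\<bar> ^ k * real N powr (1/4))"
        by (intro mult_mono x h) auto
      also have "\<dots> = (\<bar>C\<bar> * \<bar>G\<bar> ^ k) * (real N powr (- 1/2) * real N powr (1/4))" by (simp only: mult_ac)
      also have "\<dots> = (\<bar>C\<bar> * \<bar>G\<bar> ^ k) * real N powr (- 1/4)" unfolding powr_add[symmetric] by simp
      finally show "norm ((x N - poly [:z:] (mhs N [1])) * mhs N [1] ^ k) \<le> (\<bar>C\<bar> * \<bar>G\<bar> ^ k) * real N powr (- 1/4)" .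
    qed
    show "(\<lambda>N. (\<bar>C\<bar> * \<bar>G\<bar> ^ k) * real N powr (- 1/4)) \<longlonglongrightarrow> 0" by (rule powr_neg_tendsto) simp
  qed
qed (use z in \<open>auto simp: coeff_pCons split: nat.splits\<close>)

text \<open>Induction on the number of leading ones: the stuffle product of 1 with the tail v
  contains \<open>1 # v\<close> with a positive multiplicity and otherwise only sums with fewer
  leading ones.\<close>

lemma regularizable_mhs: "\<forall>k\<in>set u. k \<ge> 1 \<Longrightarrow> (\<lambda>N. mhs N u) \<in> regularizable"
proof (induction "leading_ones u" arbitrary: u rule: less_induct)
  case less
  show ?case
  proof (cases "leading_ones u = 0")
    case True
    obtain C where "\<forall>N\<ge>1. norm (mhs N u - of_real (mzv (rev u))) \<le> C * real N powr (- 1/2)"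
      using mhs_admissible(1)[OF less.prems True] by blast
    then show ?thesis using mhs_admissible(2)[OF less.prems True] by (intro regularizable_fast) auto
  next
    case False
    then obtain v where v: "u = 1 # v" by (cases u) (auto simp: leading_ones_def split: if_splits)
    define a where "a = leading_ones v"
    have a: "a \<le> length v" unfolding a_def by (rule leading_ones_le)
    have pv: "\<forall>k\<in>set v. k \<ge> 1" using less.prems v by simp
    have ou: "leading_ones u = Suc a" unfolding v a_def by simp
    \<comment> \<open>The insertions at positions 0, ..., a all produce u itself, whence the
      multiplicity a + 1; solving for \<open>mhs N u\<close> divides by it, which is allowed as
      \<open>ZPi\<close> contains the rationals.\<close>
    have eq: "of_nat (Suc a) * mhs N u = mhs N [1] * mhs N v - (\<Sum>i\<in>{Suc a..length v}. mhs N (take i v @ 1 # drop i v)) - (\<Sum>i<length v. mhs N (v[i := v ! i + 1]))" for N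
    proof -
      have "(\<Sum>i\<le>length v. mhs N (take i v @ 1 # drop i v)) = (\<Sum>i\<le>a. mhs N (take i v @ 1 # drop i v)) + (\<Sum>i\<in>{Suc a..length v}. mhs N (take i v @ 1 # drop i v))"
        using a by (subst sum.union_disjoint[symmetric]) (auto intro!: sum.cong)
      also have "(\<Sum>i\<le>a. mhs N (take i v @ 1 # drop i v)) = of_nat (Suc a) * mhs N u"
        using leading_ones_insert(1)[of _ v] unfolding v a_def by simp
      finally show ?thesis using mhs_stuffle[of N v] by simp
    qed
    have "(\<lambda>N. mhs N [1] * mhs N v - (\<Sum>i\<in>{Suc a..length v}. mhs N (take i v @ 1 # drop i v)) - (\<Sum>i<length v. mhs N (v[i := v ! i + 1]))) \<in> regularizable"
    proof (intro regularizable_diff regularizable_mult regularizable_sum regularizable_harm)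
      show "(\<lambda>N. mhs N v) \<in> regularizable" using less.hyps[of v] pv ou a_def by simp
      show "(\<lambda>N. mhs N (take i v @ 1 # drop i v)) \<in> regularizable" if "i \<in> {Suc a..length v}" for i
      proof (rule less.hyps)
        show "leading_ones (take i v @ 1 # drop i v) < leading_ones u" using leading_ones_insert(2)[of v i] that unfolding ou a_def by simp
        show "\<forall>k\<in>set (take i v @ 1 # drop i v). 1 \<le> k" using pv by (auto dest: in_set_takeD in_set_dropD)
      qed
      show "(\<lambda>N. mhs N (v[i := v ! i + 1])) \<in> regularizable" if "i \<in> {..<length v}" for i
      proof (rule less.hyps)
        show "leading_ones (v[i := v ! i + 1]) < leading_ones u" using leading_ones_raise[OF pv, of i] that unfolding ou a_def by simp
        show "\<forall>k\<in>set (v[i := v ! i + 1]). 1 \<le> k" using pv set_update_subset_insert[of v i "v ! i + 1"] by auto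
      qed
    qed
    then have "(\<lambda>N. of_nat (Suc a) * mhs N u) \<in> regularizable" unfolding eq .
    then have "(\<lambda>N. of_rat (inverse (of_nat (Suc a))) * (of_nat (Suc a) * mhs N u)) \<in> regularizable" by (rule regularizable_cmult[OF ZPi_rat])
    moreover have "of_rat (inverse (of_nat (Suc a))) * (of_nat (Suc a) * mhs N u) = mhs N u" for N
      by (simp add: of_rat_inverse del: of_nat_Suc)
    ultimately show ?thesis by (simp only:)
  qed
qed

text \<open>A nonconstant polynomial is unbounded along the harmonic numbers. Convergence therefore
  forces a constant polynomial, and the limit is its coefficient in \<open>ZPi\<close>.\<close>

lemma regularizable_limit:
  assumes "x \<in> regularizable" "x \<longlonglongrightarrow> l" shows "l \<in> ZPi"
proof -
  obtain p where p: "\<And>i. coeff p i \<in> ZPi" "\<And>k. (\<lambda>N. (x N - poly p (mhs N [1])) * mhs N [1] ^ k) \<longlonglongrightarrow> 0"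
    using regularizableE[OF assms(1)] by blast
  have "(\<lambda>N. x N - poly p (mhs N [1])) \<longlonglongrightarrow> 0" using p(2)[of 0] by simp
  then have lim: "(\<lambda>N. poly p (mhs N [1])) \<longlonglongrightarrow> l" using tendsto_diff[OF assms(2)] by fastforce
  obtain c q where pq: "p = pCons c q" by (cases p)
  show ?thesis
  proof (cases "q = 0")
    case True
    then have "(\<lambda>N. c) \<longlonglongrightarrow> l" using lim pq by simp
    then have "l = c" by (simp add: LIMSEQ_const_iff)
    then show ?thesis using p(1)[of 0] pq by simp
  next
    case False
    have "Bseq (\<lambda>N. poly p (mhs N [1]))" using lim by (intro convergent_imp_Bseq) (auto simp: convergent_def)
    then obtain B where B: "\<And>N. norm (poly p (mhs N [1])) \<le> B" by (auto simp: Bseq_def)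
    obtain r where r: "\<forall>z. r \<le> norm z \<longrightarrow> B + 1 \<le> norm (poly (pCons c q) z)" using poly_infinity[OF False, of "B + 1" c] by blast
    have hN: "norm (mhs N [1]) = harm N" for N
    proof -
      have "mhs N [1] = of_real (harm N)" by (induction N) (auto simp: mhs_def harm_Suc harm_expand(1))
      then show ?thesis using harm_nonneg[of N] by (simp only: norm_of_real) simp
    qed
    obtain N where "harm N \<ge> r" using harm_at_top by (auto simp: filterlim_at_top eventually_sequentially)
    then have "B + 1 \<le> norm (poly p (mhs N [1]))" using r hN pq by simp
    then show ?thesis using B[of N] by simp
  qed
qed

section \<open>Taylor coefficients in t at positive indices\<close>

definition mhs_left :: "complex \<Rightarrow> nat \<Rightarrow> nat list \<Rightarrow> complex" where
  "mhs_left t = chain_sum (\<lambda>n k. inverse (t - of_nat n) ^ k)"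

text \<open>The same chain sum over formal power series, with \<open>fps_X\<close> for t: the Taylor
  expansion at 0 without any analysis.\<close>

definition mhs_left_fps :: "nat \<Rightarrow> nat list \<Rightarrow> complex fps" where
  "mhs_left_fps = chain_sum (\<lambda>n k. inverse (fps_X - of_nat n) ^ k)"

lemma chain_sum_map: "chain_sum g N (map f u) = chain_sum (\<lambda>n k. g n (f k)) N u"
proof (induction N arbitrary: u)
  case 0 then show ?case by (cases u) auto
next
  case (Suc N)
  show ?case
  proof (cases u)
    case (Cons k v)
    then show ?thesis using Suc.IH[of "k # v"] Suc.IH[of v] by simp
  qed simp
qed

text \<open>At integer exponents the branch in \<open>lpt\<close> disappears, so in
  \<open>Phi\<close> powers of pi i occur only in the explicit coefficients.\<close>

lemma chain_sum_wL_nat: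
  assumes "norm t \<le> 1/2" shows "chain_sum (wL t) N (cn u) = mhs_left t N u"
proof -
  have "wL t n (of_nat k) = inverse (t - of_nat n) ^ k" if "n \<ge> 1" for n k
  proof -
    have "wL t n (of_nat k) = exp (of_nat k * (- lpt t n))" by (simp add: wL_def)
    also have "\<dots> = inverse (exp (lpt t n)) ^ k" by (simp only: exp_of_nat_mult exp_minus)
    finally show ?thesis using exp_lpt[OF assms that] by simp
  qed
  then show ?thesis unfolding cn_def chain_sum_map mhs_left_def by (intro chain_sum_cong) auto
qed

lemma chain_sum_wR_nat: "chain_sum wR N (cn u) = mhs N u"
proof -
  have "wR n (of_nat k) = inverse (of_nat n) ^ k" if "n \<ge> 1" for n k
  proof -
    have "wR n (of_nat k) = exp (of_nat k * (- rpt n))" by (simp add: wR_def)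
    also have "\<dots> = inverse (exp (rpt n)) ^ k" by (simp only: exp_of_nat_mult exp_minus)
    finally show ?thesis using exp_rpt[OF that] by simp
  qed
  then show ?thesis unfolding cn_def chain_sum_map mhs_def by (intro chain_sum_cong) auto
qed

lemma Phi_nat:
  assumes "norm t \<le> 1/2"
  shows "Phi ks t N = (\<Sum>i\<le>length ks. mhs N (rev (take i ks)) *
     (\<Sum>l\<le>leading_ones (drop i ks). (- \<i> * complex_of_real pi) ^ l / fact l * mhs_left t N (drop (i + l) ks)))"
proof -
  have "rev (take i (cn ks)) = cn (rev (take i ks))" for i
    by (simp add: cn_def take_map rev_map)
  then show ?thesis unfolding Phi_def by (simp add: chain_sum_wR_nat chain_sum_wL_nat[OF assms])
qed

lemma fps_denominator: "fps_nth (fps_X - of_nat (Suc n) :: complex fps) 0 \<noteq> 0"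
  by (simp add: fps_of_nat[symmetric] del: of_nat_Suc)

lemma mhs_left_expansion: "(\<lambda>t. mhs_left t N u) has_fps_expansion mhs_left_fps N u"
proof (induction N arbitrary: u)
  case 0 then show ?case by (cases u) (auto simp: mhs_left_def mhs_left_fps_def)
next
  case (Suc N)
  show ?case
  proof (cases u)
    case Nil then show ?thesis by (auto simp: mhs_left_def mhs_left_fps_def)
  next
    case (Cons k v)
    have "(\<lambda>t::complex. inverse (t - of_nat (Suc N))) has_fps_expansion inverse (fps_X - of_nat (Suc N))"
      using fps_denominator[of N] unfolding fps_of_nat[symmetric]
      by (intro has_fps_expansion_inverse has_fps_expansion_diff has_fps_expansion_fps_X has_fps_expansion_const) auto
    then have "(\<lambda>t. mhs_left t N u + inverse (t - of_nat (Suc N)) ^ k * mhs_left t N v) has_fps_expansion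
      mhs_left_fps N u + inverse (fps_X - of_nat (Suc N)) ^ k * mhs_left_fps N v"
      by (intro has_fps_expansion_add has_fps_expansion_mult has_fps_expansion_power Suc.IH)
    then show ?thesis unfolding Cons by (simp add: mhs_left_def mhs_left_fps_def)
  qed
qed

lemma mhs_left_holomorphic: "(\<lambda>t. mhs_left t N u) holomorphic_on ball 0 (1/2)"
proof (induction N arbitrary: u)
  case 0 then show ?case by (cases u) (auto simp: mhs_left_def)
next
  case (Suc N)
  have nz: "t - of_nat (Suc N) \<noteq> 0" if "t \<in> ball 0 (1/2)" for t :: complex
    using norm_nat_diff(4)[of t "Suc N"] that by (auto simp del: of_nat_Suc)
  show ?case
  proof (cases u)
    case (Cons k v)
    have "(\<lambda>t. mhs_left t N u + inverse (t - of_nat (Suc N)) ^ k * mhs_left t N v) holomorphic_on ball 0 (1/2)"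
      by (intro holomorphic_intros Suc.IH nz)
    then show ?thesis unfolding Cons by (simp add: mhs_left_def)
  qed (simp add: mhs_left_def)
qed

text \<open>Differentiating (t - n)^(-k) gives - k (t - n)^(-k-1): the derivative raises one entry
  at a time and stays among sums with positive entries.\<close>

lemma mhs_left_fps_deriv: "fps_deriv (mhs_left_fps N u) = - (\<Sum>i<length u. of_nat (u ! i) * mhs_left_fps N (u[i := u ! i + 1]))"
proof (induction N arbitrary: u)
  case 0
  have "mhs_left_fps 0 (u[i := u ! i + 1]) = 0" if "i < length u" for i
  proof -
    have "u[i := u ! i + 1] \<noteq> []" using that by auto
    then show ?thesis unfolding mhs_left_fps_def by (metis chain_sum.simps(2) neq_Nil_conv)
  qed
  moreover have "fps_deriv (mhs_left_fps 0 u) = 0" by (cases u) (auto simp: mhs_left_fps_def)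
  ultimately show ?case by simp
next
  case (Suc N)
  show ?case
  proof (cases u)
    case (Cons k v)
    define a :: "complex fps" where "a = inverse (fps_X - of_nat (Suc N))"
    have E: "mhs_left_fps (Suc N) (j # w) = mhs_left_fps N (j # w) + a ^ j * mhs_left_fps N w" for j w unfolding mhs_left_fps_def a_def by simp
    have d1: "fps_deriv a = - (a ^ 2)"
      unfolding a_def using fps_denominator[of N] by (subst fps_inverse_deriv) (auto simp: fps_of_nat[symmetric] simp del: of_nat_Suc)
    have d: "fps_deriv (a ^ k) = - (of_nat k * a ^ (k + 1))"
      unfolding fps_deriv_power d1 by (cases k) (auto simp: fps_of_nat power2_eq_square simp del: of_nat_Suc)
    show ?thesis
      unfolding Cons E fps_deriv_add fps_deriv_mult d Suc.IH
      by (simp add: sum.lessThan_Suc_shift E sum.distrib sum_distrib_left algebra_simps del: sum.lessThan_Suc)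
  qed (simp add: mhs_left_fps_def)
qed

text \<open>At t = 0 the left sum is a harmonic sum up to sign, and each further coefficient comes
  from the derivative by division by n + 1.\<close>

lemma regularizable_mhs_left_fps: "\<forall>k\<in>set u. k \<ge> 1 \<Longrightarrow> (\<lambda>N. fps_nth (mhs_left_fps N u) n) \<in> regularizable"
proof (induction n arbitrary: u)
  case 0
  have "fps_nth (mhs_left_fps N u) 0 = prod_list (map (\<lambda>k. (-1) ^ k) u) * mhs N u" for N
  proof -
    have "fps_nth (mhs_left_fps N u) 0 = mhs_left 0 N u"
      using fps_nth_fps_expansion[OF mhs_left_expansion, of N u 0] by simp
    also have "\<dots> = prod_list (map (\<lambda>k. (-1) ^ k) u) * mhs N u"
      unfolding mhs_left_def mhs_def by (intro chain_sum_scale) (simp add: power_minus[of "inverse _"])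
    finally show ?thesis .
  qed
  moreover have "prod_list (map (\<lambda>k. (-1) ^ k) u) \<in> ZPi"
  proof (induction u)
    case (Cons k u)
    have "(-1 :: complex) ^ k \<in> ZPi" by (induction k) auto
    then show ?case using Cons by simp
  qed simp
  ultimately show ?case using regularizable_mhs[OF 0] by (simp add: regularizable_cmult)
next
  case (Suc n)
  have "(\<lambda>N. - (\<Sum>i<length u. of_nat (u ! i) * fps_nth (mhs_left_fps N (u[i := u ! i + 1])) n)) \<in> regularizable" (is "?x \<in> _")
  proof -
    have "(\<lambda>N. \<Sum>i<length u. of_nat (u ! i) * fps_nth (mhs_left_fps N (u[i := u ! i + 1])) n) \<in> regularizable"
    proof (intro regularizable_sum regularizable_cmult)
      fix i assume "i \<in> {..<length u}"
      show "of_nat (u ! i) \<in> ZPi" using ZPi_rat[of "of_nat (u ! i)"] by simp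
      show "(\<lambda>N. fps_nth (mhs_left_fps N (u[i := u ! i + 1])) n) \<in> regularizable"
        using Suc.prems set_update_subset_insert[of u i "u ! i + 1"] by (intro Suc.IH) auto
    qed
    from regularizable_cmult[OF _ this, of "-1"] show ?thesis by simp
  qed
  then have "(\<lambda>N. of_rat (inverse (of_nat (Suc n))) * ?x N) \<in> regularizable" by (rule regularizable_cmult[OF ZPi_rat])
  moreover have "of_rat (inverse (of_nat (Suc n))) * ?x N = fps_nth (mhs_left_fps N u) (Suc n)" for N
  proof -
    have "?x N = of_nat (Suc n) * fps_nth (mhs_left_fps N u) (Suc n)"
      using arg_cong[OF mhs_left_fps_deriv[of N u], of "\<lambda>F. fps_nth F n"]
      by (simp add: fps_sum_nth fps_of_nat[symmetric] del: of_nat_Suc)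
    then show ?thesis by (simp add: of_rat_inverse del: of_nat_Suc)
  qed
  ultimately show ?case by (simp only:)
qed

lemma ZPi_power: "x \<in> ZPi \<Longrightarrow> x ^ l \<in> ZPi"
  by (induction l) auto

text \<open>Uniform convergence of the holomorphic truncations on the disc passes to the Taylor
  coefficients. Those of the truncations are regularizable sequences with coefficients in
  \<open>ZPi\<close>, and a convergent sequence of this kind has its limit in
  \<open>ZPi\<close>.\<close>

theorem zetaU_ext_positive:
  assumes ks: "\<forall>k\<in>set ks. k \<ge> 1"
  shows "(\<lambda>t. zetaU_ext t (cn ks)) holomorphic_on ball 0 (1/2)"
    and "fps_nth (fps_expansion (\<lambda>t. zetaU_ext t (cn ks)) 0) n \<in> ZPi"
proof -
  define c where "c = (\<lambda>l. (- \<i> * complex_of_real pi) ^ l / fact l)"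
  define P where "P = (\<lambda>N t. \<Sum>i\<le>length ks. mhs N (rev (take i ks)) * (\<Sum>l\<le>leading_ones (drop i ks). c l * mhs_left t N (drop (i + l) ks)))"
  have PPhi: "P N t = Phi ks t N" if "norm t \<le> 1/2" for N t
    unfolding P_def c_def Phi_nat[OF that] ..
  have c: "c l \<in> ZPi" for l
  proof -
    have "(- \<i> * complex_of_real pi) \<in> ZPi"
    proof -
      have "complex_of_real pi * \<i> \<in> ZPi" unfolding ZPi_def by (rule Qalg.gen) simp
      from ZPi_uminus[OF this] show ?thesis by (simp add: mult.commute)
    qed
    then have "(- \<i> * complex_of_real pi) ^ l \<in> ZPi" by (rule ZPi_power)
    then have "of_rat (inverse (fact l)) * (- \<i> * complex_of_real pi) ^ l \<in> ZPi" by (rule ZPi_mult[OF ZPi_rat])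
    moreover have "of_rat (inverse (fact l)) = inverse (fact l :: complex)"
      by (metis of_nat_fact of_rat_inverse of_rat_of_nat_eq)
    ultimately show ?thesis unfolding c_def by (simp add: divide_inverse mult.commute)
  qed
  obtain C N0 where C: "\<And>t N. norm t \<le> 1/2 \<Longrightarrow> N \<ge> N0 \<Longrightarrow> norm (zetaU_ext t (cn ks) - Phi ks t N) \<le> C * real N powr (-1/4)"
    using zetaU_ext_Phi[OF ks] by blast
  have ul: "uniform_limit (ball 0 (1/2)) P (\<lambda>t. zetaU_ext t (cn ks)) sequentially"
    unfolding uniform_limit_iff
  proof (intro allI impI)
    fix e :: real assume "e > 0"
    have "(\<lambda>N. C * real N powr (-1/4)) \<longlonglongrightarrow> 0" by (rule powr_neg_tendsto) simp
    then have "\<forall>\<^sub>F N in sequentially. C * real N powr (-1/4) < e" using \<open>e > 0\<close> by (rule order_tendstoD)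
    then show "\<forall>\<^sub>F N in sequentially. \<forall>t\<in>ball 0 (1/2). dist (P N t) (zetaU_ext t (cn ks)) < e"
      using eventually_ge_at_top[of N0]
    proof eventually_elim
      case (elim N)
      show ?case
      proof
        fix t :: complex assume "t \<in> ball 0 (1/2)"
        then have t: "norm t \<le> 1/2" by simp
        show "dist (P N t) (zetaU_ext t (cn ks)) < e"
          using C[OF t elim(2)] elim(1) unfolding PPhi[OF t] dist_norm norm_minus_commute[of "Phi ks t N"] by linarith
      qed
    qed
  qed
  have Ph: "P N holomorphic_on ball 0 (1/2)" for N
    unfolding P_def by (intro holomorphic_intros mhs_left_holomorphic)
  show hol: "(\<lambda>t. zetaU_ext t (cn ks)) holomorphic_on ball 0 (1/2)"
  proof (rule holomorphic_uniform_sequence[OF open_ball Ph])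
    fix x :: complex assume "x \<in> ball 0 (1/2)"
    then obtain d where d: "d > 0" "cball x d \<subseteq> ball 0 (1/2)" using open_contains_cball by blast
    then show "\<exists>d>0. cball x d \<subseteq> ball 0 (1/2) \<and> uniform_limit (cball x d) P (\<lambda>t. zetaU_ext t (cn ks)) sequentially"
      using uniform_limit_on_subset[OF ul] by blast
  qed
  define F where "F = (\<lambda>N. \<Sum>i\<le>length ks. fps_const (mhs N (rev (take i ks))) * (\<Sum>l\<le>leading_ones (drop i ks). fps_const (c l) * mhs_left_fps N (drop (i + l) ks)))"
  have PF: "P N has_fps_expansion F N" for N
    unfolding P_def F_def by (intro has_fps_expansion_sum has_fps_expansion_cmult_left mhs_left_expansion)
  have "(\<lambda>N. fps_nth (F N) n) \<longlonglongrightarrow> fps_nth (fps_expansion (\<lambda>t. zetaU_ext t (cn ks)) 0) n"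
    unfolding fps_nth_fps_expansion[OF PF] fps_expansion_def fps_nth_Abs_fps
    by (intro tendsto_divide tendsto_const higher_deriv_complex_uniform_limit[OF ul]) (auto simp: Ph)
  moreover have "(\<lambda>N. fps_nth (F N) n) \<in> regularizable"
    unfolding F_def fps_sum_nth fps_mult_left_const_nth
  proof (intro regularizable_sum regularizable_mult regularizable_const c regularizable_mhs regularizable_mhs_left_fps)
    show "\<forall>k\<in>set (rev (take i ks)). 1 \<le> k" for i using ks by (auto dest: in_set_takeD)
    show "\<forall>k\<in>set (drop i ks). 1 \<le> k" for i using ks by (auto dest: in_set_dropD)
  qed
  ultimately show "fps_nth (fps_expansion (\<lambda>t. zetaU_ext t (cn ks)) 0) n \<in> ZPi" by (rule regularizable_limit[rotated])
qed

section \<open>The recursion in the target rings\<close>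

text \<open>The reduction of an index with entry - m inserted at position j of k.  It is used in
  several rings: sc is the action of rational scalars and \<open>\<tau>\<close> stands for t, p, bp, or 0.\<close>

definition nonpos_rec :: "(rat \<Rightarrow> 'r \<Rightarrow> 'r) \<Rightarrow> 'r \<Rightarrow> nat \<Rightarrow> nat \<Rightarrow> (int list \<Rightarrow> 'r) \<Rightarrow> int list \<Rightarrow> 'r::{comm_monoid_add,times}" where
  "nonpos_rec sc \<tau> m j G k =
    (if j = length k then \<Sum>e\<le>faul_deg m. sc (faul_coeff m e) (((*) \<tau> ^^ e) (G k))
     else \<Sum>e\<le>faul_deg m. sc (faul_coeff m e) (G (k[j := k ! j - int e])))
    + (if j = 0 then sc (- faul_shift_coeff m 0) (G k)
       else \<Sum>e\<le>faul_deg m. sc (- faul_shift_coeff m e) (G (k[j - 1 := k ! (j - 1) - int e])))"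

text \<open>A relation that respects zero, addition, rational scalars and multiplication by \<tau>
  respects the whole recursion. All transfers between rings are instances: functions and their
  expansions, coefficients and their residues, families over p and their classes, and the graph of
  an isomorphism. Families over one point serve where nothing varies.\<close>

lemma nonpos_rec_rel:
  fixes R :: "('i \<Rightarrow> 'a::{comm_monoid_add,times}) \<Rightarrow> 'b::{comm_monoid_add,times} \<Rightarrow> bool"
  assumes R0: "R (\<lambda>i. 0) 0"
    and Radd: "\<And>x y x' y'. R x x' \<Longrightarrow> R y y' \<Longrightarrow> R (\<lambda>i. x i + y i) (x' + y')"
    and Rsc: "\<And>q x x'. R x x' \<Longrightarrow> R (\<lambda>i. sc i q (x i)) (sc' q x')"
    and Rtt: "\<And>x x'. R x x' \<Longrightarrow> R (\<lambda>i. \<tau> i * x i) (\<tau>' * x')"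
    and G: "\<And>k'. length k' = length k \<Longrightarrow> R (\<lambda>i. G i k') (G' k')"
  shows "R (\<lambda>i. nonpos_rec (sc i) (\<tau> i) m j (G i) k) (nonpos_rec sc' \<tau>' m j G' k)"
proof -
  have Rsum: "R (\<lambda>i. \<Sum>e\<in>A. f e i) (\<Sum>e\<in>A. f' e)" if "\<And>e. R (f e) (f' e)" for A :: "nat set" and f f'
    by (induction A rule: infinite_finite_induct) (auto intro: R0 Radd that)
  have Rpow: "R (\<lambda>i. ((*) (\<tau> i) ^^ e) (G i k)) (((*) \<tau>' ^^ e) (G' k))" for e
    by (induction e) (auto intro: G Rtt)
  have Rif: "R (\<lambda>i. if b then f i else g i) (if b then f' else g')" if "R f f'" "R g g'" for b f f' g g'
    using that by simp
  show ?thesis unfolding nonpos_rec_def by (intro Radd Rif Rsum Rsc Rpow G) auto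
qed

definition zetaU_fps :: "int list \<Rightarrow> complex fps" where
  "zetaU_fps k = fps_expansion (\<lambda>t. zetaU_ext t (map of_int k)) 0"

lemma nonpos_rec_zetaU_ext:
  assumes t: "norm t \<le> 1/2" and j: "j \<le> length k"
  shows "zetaU_ext t (map of_int (take j k @ (- int m) # drop j k)) = nonpos_rec (\<lambda>q x. of_rat q * x) t m j (\<lambda>k. zetaU_ext t (map of_int k)) k"
proof -
  let ?u = "map of_int k :: complex list"
  have pw: "((*) t ^^ e) x = t ^ e * x" for e x by (induction e) (auto simp: mult.assoc)
  have up: "?u[i := ?u ! i - of_nat e] = map of_int (k[i := k ! i - int e])" if "i < length k" for i e
    using that by (simp add: map_update)
  have "zetaU_ext t (map of_int (take j k @ (- int m) # drop j k)) = nonpos_rec_complex t m j (zetaU_ext t) ?u"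
    using zetaU_ext_recursion[OF t, of j ?u m] j by (simp add: take_map drop_map)
  also have "\<dots> = nonpos_rec (\<lambda>q x. of_rat q * x) t m j (\<lambda>k. zetaU_ext t (map of_int k)) k"
  proof -
    have 1: "poly (faulhaber m) t * x = (\<Sum>e\<le>faul_deg m. of_rat (faul_coeff m e) * (t ^ e * x))" for x
      unfolding faulhaber_faul_coeff sum_distrib_right by (simp add: mult.assoc)
    have "poly (faulhaber m) (0 + 1) = of_rat (faul_shift_coeff m 0)" unfolding faulhaber_faul_shift_coeff by (simp add: power_0_left sum.delta if_distrib cong: if_cong)
    then have 2: "poly (faulhaber m) 1 = of_rat (faul_shift_coeff m 0)" by simp
    have A: "(if j = length ?u then poly (faulhaber m) t * zetaU_ext t ?u else \<Sum>e\<le>faul_deg m. of_rat (faul_coeff m e) * zetaU_ext t (?u[j := ?u ! j - of_nat e]))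
      = (if j = length k then \<Sum>e\<le>faul_deg m. of_rat (faul_coeff m e) * (t ^ e * zetaU_ext t ?u) else \<Sum>e\<le>faul_deg m. of_rat (faul_coeff m e) * zetaU_ext t (map of_int (k[j := k ! j - int e])))"
      using j up 1 by auto
    \<comment> \<open>The sign moves into the rational scalar, as \<open>nonpos_rec\<close> uses
      addition only. The value P 1 is the constant coefficient of P (x + 1).\<close>
    have B: "(if j = 0 then poly (faulhaber m) 1 * zetaU_ext t ?u else \<Sum>e\<le>faul_deg m. of_rat (faul_shift_coeff m e) * zetaU_ext t (?u[j - 1 := ?u ! (j - 1) - of_nat e]))
      = - (if j = 0 then of_rat (- faul_shift_coeff m 0) * zetaU_ext t ?u else \<Sum>e\<le>faul_deg m. of_rat (- faul_shift_coeff m e) * zetaU_ext t (map of_int (k[j - 1 := k ! (j - 1) - int e])))"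
      using j up[of "j - 1"] by (auto simp: 2 of_rat_minus sum_negf)
    show ?thesis unfolding nonpos_rec_complex_def nonpos_rec_def pw A B by simp
  qed
  finally show ?thesis .
qed

text \<open>The three properties are bundled so that they pass through the recursion together;
  membership in \<open>ZPi\<close> is what gives the reduction modulo pi i a meaning.\<close>

definition expands_ZPi :: "(complex \<Rightarrow> complex) \<Rightarrow> complex fps \<Rightarrow> bool" where
  "expands_ZPi f F \<longleftrightarrow> f holomorphic_on ball 0 (1/2) \<and> f has_fps_expansion F \<and> (\<forall>n. fps_nth F n \<in> ZPi)"

lemma expands_ZPi_holo:
  assumes "f holomorphic_on ball 0 (1/2)" "\<And>n. fps_nth (fps_expansion f 0) n \<in> ZPi"
  shows "expands_ZPi f (fps_expansion f 0)"
  unfolding expands_ZPi_def using assms has_fps_expansion_fps_expansion[OF open_ball _ assms(1)] by auto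

lemma expands_ZPi_cong:
  assumes "expands_ZPi f F" "\<And>t. norm t < 1/2 \<Longrightarrow> g t = f t"
  shows "expands_ZPi g F"
proof -
  have "g holomorphic_on ball 0 (1/2)"
    using assms(1) unfolding expands_ZPi_def by (elim conjE) (rule holomorphic_transform, assumption, use assms(2) in auto)
  moreover have "\<forall>\<^sub>F t in nhds 0. g t = f t"
    using eventually_nhds_in_open[of "ball 0 (1/2)" 0] by (auto elim!: eventually_mono simp: assms(2))
  then have "g has_fps_expansion F"
    using assms(1) has_fps_expansion_cong[of g f F F] unfolding expands_ZPi_def by auto
  ultimately show ?thesis using assms(1) unfolding expands_ZPi_def by blast
qed

lemma expands_ZPi_unique: "expands_ZPi f F \<Longrightarrow> F = fps_expansion f 0"
  unfolding expands_ZPi_def by (auto intro!: fps_ext simp: fps_expansion_def fps_nth_fps_expansion)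

lemma expands_ZPi_nonpos_rec:
  assumes G: "\<And>k'. length k' = length k \<Longrightarrow> expands_ZPi (\<lambda>t. G t k') (G' k')"
  shows "expands_ZPi (\<lambda>t. nonpos_rec (\<lambda>q x. of_rat q * x) t m j (G t) k) (nonpos_rec (\<lambda>q x. fps_const (of_rat q) * x) fps_X m j G' k)"
proof (rule nonpos_rec_rel[where R = expands_ZPi])
  show "expands_ZPi (\<lambda>i. 0) 0" by (auto simp: expands_ZPi_def)
  show "expands_ZPi (\<lambda>i. x i + y i) (x' + y')" if "expands_ZPi x x'" "expands_ZPi y y'" for x y x' y'
    using that unfolding expands_ZPi_def by (auto intro: holomorphic_intros has_fps_expansion_add)
  show "expands_ZPi (\<lambda>i. of_rat q * x i) (fps_const (of_rat q) * x')" if "expands_ZPi x x'" for q x x'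
    using that unfolding expands_ZPi_def by (auto intro: holomorphic_intros has_fps_expansion_cmult_left)
  show "expands_ZPi (\<lambda>i. i * x i) (fps_X * x')" if "expands_ZPi x x'" for x x'
    using that unfolding expands_ZPi_def by (auto intro!: holomorphic_intros has_fps_expansion_mult has_fps_expansion_fps_X)
qed (rule G)

lemma nonpositive_split:
  assumes "\<not> positive_index k"
  obtains j m k' where "k = take j k' @ (- int m) # drop j k'" "j \<le> length k'" "length k = Suc (length k')"
proof -
  obtain x where x: "x \<in> set k" "x \<le> 0" using assms unfolding positive_index_def by force
  then obtain a b where ab: "k = a @ x # b" by (metis split_list)
  show ?thesis using x by (intro that[of "length a" "a @ b" "nat (- x)"]) (auto simp: ab)
qed

text \<open>Induction on the length: positive indices are settled by
  \<open>zetaU_ext_positive\<close>, and otherwise one nonpositive entry is removed. The shorter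
  indices may again have nonpositive entries, which the induction covers.\<close>

theorem expands_ZPi_zetaU_fps: "expands_ZPi (\<lambda>t. zetaU_ext t (map of_int k)) (zetaU_fps k)"
proof (induction "length k" arbitrary: k rule: less_induct)
  case less
  show ?case
  proof (cases "positive_index k")
    case True
    define ks where "ks = map nat k"
    have k: "\<forall>i\<in>set ks. i \<ge> 1" using True unfolding ks_def positive_index_def by force
    have "map of_int k = cn ks"
      using True unfolding ks_def positive_index_def cn_def by (auto simp: order_less_imp_le)
    then show ?thesis unfolding zetaU_fps_def using zetaU_ext_positive[OF k] by (intro expands_ZPi_holo) auto
  next
    case False
    obtain j m k' where k: "k = take j k' @ (- int m) # drop j k'" "j \<le> length k'" "length k = Suc (length k')"
      using nonpositive_split[OF False] by blast
    have "expands_ZPi (\<lambda>t. nonpos_rec (\<lambda>q x. of_rat q * x) t m j (\<lambda>k. zetaU_ext t (map of_int k)) k') (nonpos_rec (\<lambda>q x. fps_const (of_rat q) * x) fps_X m j zetaU_fps k')"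
      by (rule expands_ZPi_nonpos_rec) (rule less, use k in simp)
    then have *: "expands_ZPi (\<lambda>t. zetaU_ext t (map of_int k)) (nonpos_rec (\<lambda>q x. fps_const (of_rat q) * x) fps_X m j zetaU_fps k')"
      by (rule expands_ZPi_cong) (use nonpos_rec_zetaU_ext[of _ j k' m] k in simp)
    show ?thesis using expands_ZPi_unique[OF *] * unfolding zetaU_fps_def by simp
  qed
qed

lemma zetaU_fps_recursion:
  assumes "j \<le> length k"
  shows "zetaU_fps (take j k @ (- int m) # drop j k) = nonpos_rec (\<lambda>q x. fps_const (of_rat q) * x) fps_X m j zetaU_fps k"
proof -
  have "expands_ZPi (\<lambda>t. nonpos_rec (\<lambda>q x. of_rat q * x) t m j (\<lambda>k. zetaU_ext t (map of_int k)) k) (nonpos_rec (\<lambda>q x. fps_const (of_rat q) * x) fps_X m j zetaU_fps k)"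
    by (intro expands_ZPi_nonpos_rec expands_ZPi_zetaU_fps)
  then have "expands_ZPi (\<lambda>t. zetaU_ext t (map of_int (take j k @ (- int m) # drop j k))) (nonpos_rec (\<lambda>q x. fps_const (of_rat q) * x) fps_X m j zetaU_fps k)"
    by (rule expands_ZPi_cong) (use nonpos_rec_zetaU_ext[of _ j k m] assms in simp)
  from expands_ZPi_unique[OF this] show ?thesis unfolding zetaU_fps_def by simp
qed

lemma zetaU_fps_ZPi: "fps_nth (zetaU_fps k) n \<in> ZPi"
  using expands_ZPi_zetaU_fps[of k] unfolding expands_ZPi_def by blast

lemma Rz_ZPi: "x \<in> ZPi \<Longrightarrow> Rz x x"
  by (rule Rz_eqI) auto

lemma abs_zbar_add: "x \<in> ZPi \<Longrightarrow> y \<in> ZPi \<Longrightarrow> abs_zbar (x + y) = abs_zbar x + abs_zbar y"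
  by (simp add: plus_zbar.abs_eq Rz_ZPi)

lemma abs_zbar_mult: "x \<in> ZPi \<Longrightarrow> y \<in> ZPi \<Longrightarrow> abs_zbar (x * y) = abs_zbar x * abs_zbar y"
  by (simp add: times_zbar.abs_eq Rz_ZPi)

lemma zetaShat_zetaU_fps: "zetaShat k = Abs_fps (\<lambda>n. abs_zbar (fps_nth (zetaU_fps k) n))"
proof -
  have "expands_ZPi (\<lambda>t. zetaU (map of_int k) 0 t) (zetaU_fps k)"
    by (rule expands_ZPi_cong[OF expands_ZPi_zetaU_fps]) (simp add: zetaU_eq_zetaU_ext)
  from expands_ZPi_unique[OF this] show ?thesis unfolding zetaShat_def by (simp add: fps_expansion_def)
qed

lemma zetaS_zetaU_fps: "zetaS k = abs_zbar (fps_nth (zetaU_fps k) 0)"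
  unfolding zetaS_def zetaU_fps_def by (simp add: zetaU_eq_zetaU_ext fps_expansion_def)

lemma zetaShat_recursion:
  assumes "j \<le> length k"
  shows "zetaShat (take j k @ (- int m) # drop j k) = nonpos_rec (\<lambda>q x. fps_const (ratZ q) * x) fps_X m j zetaShat k"
proof -
  \<comment> \<open>Coefficientwise reduction modulo pi i. The condition on \<open>ZPi\<close> is
    essential, since \<open>abs_zbar\<close> is additive and multiplicative only there.\<close>
  define R where "R = (\<lambda>(F :: unit \<Rightarrow> complex fps) g. (\<forall>n. fps_nth (F ()) n \<in> ZPi) \<and> g = Abs_fps (\<lambda>n. abs_zbar (fps_nth (F ()) n)))"
  have "R (\<lambda>i. nonpos_rec (\<lambda>q x. fps_const (of_rat q) * x) fps_X m j zetaU_fps k) (nonpos_rec (\<lambda>q x. fps_const (ratZ q) * x) fps_X m j zetaShat k)"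
  proof (rule nonpos_rec_rel[where R = R and sc = "\<lambda>i q x. fps_const (of_rat q) * x" and \<tau> = "\<lambda>i. fps_X" and G = "\<lambda>i. zetaU_fps"])
    show "R (\<lambda>i. 0) 0" by (auto simp: R_def fps_eq_iff zero_zbar_def)
    show "R (\<lambda>i. x i + y i) (x' + y')" if "R x x'" "R y y'" for x y x' y'
      using that by (auto simp: R_def fps_eq_iff abs_zbar_add)
    show "R (\<lambda>i. fps_const (of_rat q) * x i) (fps_const (ratZ q) * x')" if "R x x'" for q x x'
    proof -
      have "fps_nth (fps_const (ratZ q) * x') n = ratZ q * fps_nth x' n" for n
        by (simp add: fps_mult_nth if_distrib[of "\<lambda>y. y * _"] sum.delta cong: if_cong)
      then show ?thesis using that by (auto simp: R_def fps_eq_iff abs_zbar_mult ratZ_def)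
    qed
    show "R (\<lambda>i. fps_X * x i) (fps_X * x')" if "R x x'" for x x'
    proof -
      have "fps_nth (fps_X * x') n = (if n = 0 then 0 else fps_nth x' (n - 1))" for n
      proof -
        have "fps_nth (fps_X * x') n = (\<Sum>i=0..n. if i = 1 then fps_nth x' (n - 1) else 0)"
          unfolding fps_mult_nth by (intro sum.cong) (auto simp: fps_X_def)
        then show ?thesis by (simp add: sum.delta)
      qed
      then show ?thesis using that by (auto simp: R_def fps_eq_iff zero_zbar_def)
    qed
    show "R (\<lambda>i. zetaU_fps k') (zetaShat k')" for k' by (auto simp: R_def zetaShat_zetaU_fps zetaU_fps_ZPi)
  qed
  then show ?thesis unfolding R_def zetaShat_zetaU_fps[of "_ @ _"] zetaU_fps_recursion[OF assms] by simp
qed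

lemma zetaS_recursion:
  assumes "j \<le> length k"
  shows "zetaS (take j k @ (- int m) # drop j k) = nonpos_rec (\<lambda>q x. ratZ q * x) 0 m j zetaS k"
proof -
  define R where "R = (\<lambda>(F :: unit \<Rightarrow> complex fps) z. (\<forall>n. fps_nth (F ()) n \<in> ZPi) \<and> z = abs_zbar (fps_nth (F ()) 0))"
  have "R (\<lambda>i. nonpos_rec (\<lambda>q x. fps_const (of_rat q) * x) fps_X m j zetaU_fps k) (nonpos_rec (\<lambda>q x. ratZ q * x) 0 m j zetaS k)"
  proof (rule nonpos_rec_rel[where R = R and sc = "\<lambda>i q x. fps_const (of_rat q) * x" and \<tau> = "\<lambda>i. fps_X" and G = "\<lambda>i. zetaU_fps"])
    show "R (\<lambda>i. 0) 0" by (auto simp: R_def zero_zbar_def)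
    show "R (\<lambda>i. x i + y i) (x' + y')" if "R x x'" "R y y'" for x y x' y'
      using that by (auto simp: R_def abs_zbar_add)
    show "R (\<lambda>i. fps_const (of_rat q) * x i) (ratZ q * x')" if "R x x'" for q x x'
      using that by (auto simp: R_def abs_zbar_mult ratZ_def)
    \<comment> \<open>Only the constant coefficient is kept here, so multiplication by
      \<open>fps_X\<close> becomes multiplication by 0.\<close>
    show "R (\<lambda>i. fps_X * x i) (0 * x')" if "R x x'" for x x'
      using that unfolding mult_zero_left by (auto simp: R_def zero_zbar_def)
    show "R (\<lambda>i. zetaU_fps k') (zetaS k')" for k' by (auto simp: R_def zetaS_zetaU_fps zetaU_fps_ZPi)
  qed
  then show ?thesis unfolding R_def zetaS_zetaU_fps[of "_ @ _"] zetaU_fps_recursion[OF assms] by simp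
qed

section \<open>The recursion for truncated sums\<close>

lemma csf_cong: "list_all2 (\<lambda>\<phi> \<psi>. \<forall>n\<ge>1. \<phi> n = \<psi> n) u v \<Longrightarrow> csf N u = csf N v"
proof (induction arbitrary: N rule: list_all2_induct)
  case (Cons \<phi> u \<psi> v)
  then show ?case unfolding chain_sum_unfold by (intro sum.cong) auto
qed simp

lemma csf_cong_entry:
  assumes "\<And>n. n \<ge> 1 \<Longrightarrow> \<phi> n = \<psi> n" shows "csf N (A @ \<phi> # B) = csf N (A @ \<psi> # B)"
  by (rule csf_cong) (auto simp: assms list_all2_append list.rel_refl)

definition pow_list :: "int list \<Rightarrow> (nat \<Rightarrow> rat) list" where
  "pow_list k = map (\<lambda>k n. of_nat n powi (- k)) (rev k)"

lemma pow_list_simps: "pow_list [] = []" "pow_list (c # b) = pow_list b @ [\<lambda>n. of_nat n powi (- c)]" "pow_list (a @ b) = pow_list b @ pow_list a"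
  by (auto simp: pow_list_def)

lemma zeta_p_pow_list: "p \<ge> 1 \<Longrightarrow> zeta_p p k = csf (p - 1) (pow_list k)"
  unfolding zeta_p_def pow_list_def using sum_incr_tuples[of "\<lambda>n k. of_nat n powi (- k)" k "p - 1"]
  by (simp add: chain_sum_csf[of "\<lambda>n k. of_nat n powi (- k)"])

definition faul_rat :: "nat \<Rightarrow> nat \<Rightarrow> rat" where
  "faul_rat m n = (\<Sum>e\<le>faul_deg m. faul_coeff m e * of_nat n ^ e)"

lemma faul_rat_props: "of_nat n ^ m = faul_rat m (Suc n) - faul_rat m n" "faul_rat m (Suc n) = (\<Sum>e\<le>faul_deg m. faul_shift_coeff m e * of_nat n ^ e)"
proof -
  have 1: "(of_rat (faul_rat m n) :: complex) = poly (faulhaber m) (of_nat n)" for n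
    unfolding faul_rat_def faulhaber_faul_coeff by (simp add: of_rat_sum of_rat_mult of_rat_power)
  have "(of_rat (faul_rat m (Suc n) - faul_rat m n) :: complex) = poly (faulhaber m) (of_nat n + 1) - poly (faulhaber m) (of_nat n)"
    unfolding of_rat_diff 1 by (simp add: add.commute)
  also have "\<dots> = of_rat (of_nat n ^ m)" unfolding faulhaber_diff by (simp add: of_rat_power)
  finally show "of_nat n ^ m = faul_rat m (Suc n) - faul_rat m n" by (simp only: of_rat_eq_iff)
  have "(of_rat (faul_rat m (Suc n)) :: complex) = poly (faulhaber m) (of_nat n + 1)"
    unfolding 1 by (simp add: add.commute)
  also have "\<dots> = of_rat (\<Sum>e\<le>faul_deg m. faul_shift_coeff m e * of_nat n ^ e)"
    unfolding faulhaber_faul_shift_coeff by (simp add: of_rat_sum of_rat_mult of_rat_power)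
  finally show "faul_rat m (Suc n) = (\<Sum>e\<le>faul_deg m. faul_shift_coeff m e * of_nat n ^ e)" by (simp only: of_rat_eq_iff)
qed

text \<open>The variables run through 1, ..., p - 1 without a gap, so \<open>csf_telescope\<close>
  with N = p - 1 gives the recursion exactly; if the removed entry is the last of the index, the
  upper limit is Q (N + 1) = Q p.\<close>

lemma zeta_p_recursion:
  assumes p: "p \<ge> 1" and j: "j \<le> length k"
  shows "zeta_p p (take j k @ (- int m) # drop j k) = nonpos_rec (*) (of_nat p) m j (zeta_p p) k"
proof -
  define N where "N = p - 1"
  define Q where "Q = faul_rat m"
  have Q: "of_nat n ^ m = Q (Suc n) - Q n" "Q (Suc n) = (\<Sum>e\<le>faul_deg m. faul_shift_coeff m e * of_nat n ^ e)" for n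
    unfolding Q_def by (rule faul_rat_props)+
  let ?a = "take j k" and ?b = "drop j k"
  have pN: "Suc N = p" using p unfolding N_def by simp
  have z: "zeta_p p k = csf N (pow_list k)" for k using zeta_p_pow_list[OF p] unfolding N_def .
  have pw: "((*) t ^^ e) x = t ^ e * x" for e and t x :: rat by (induction e) (auto simp: mult.assoc)
  \<comment> \<open>The restriction n \<ge> 1 matters, since the exponent may be negative;
    \<open>csf_cong_entry\<close> compares entries at such n only.\<close>
  have shift: "of_nat n powi (- c) * (of_nat n) ^ e = (of_nat n :: rat) powi (int e - c)" if "n \<ge> 1" for n e c
    using that power_int_add[of "of_nat n :: rat" "- c" "int e"] by (simp add: power_int_def)
  have "zeta_p p (?a @ (- int m) # ?b) = csf N (pow_list ?b @ (\<lambda>n. of_nat n ^ m) # pow_list ?a)"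
    unfolding z by (simp add: pow_list_simps)
  also have "\<dots> = mergeL N (pow_list ?b) Q (pow_list ?a) - mergeR N (pow_list ?b) Q (pow_list ?a)"
    by (rule csf_telescope) (rule Q(1))
  also have "mergeL N (pow_list ?b) Q (pow_list ?a) = (if j = length k then \<Sum>e\<le>faul_deg m. faul_coeff m e * (of_nat p ^ e * zeta_p p k)
     else \<Sum>e\<le>faul_deg m. faul_coeff m e * zeta_p p (k[j := k ! j - int e]))"
  proof (cases "j = length k")
    case True
    then show ?thesis unfolding z by (simp add: mergeL_def pow_list_simps pN Q_def faul_rat_def sum_distrib_right mult.assoc)
  next
    case False
    then have b: "?b = k ! j # drop (Suc j) k" using j by (simp add: Cons_nth_drop_Suc)
    have "mergeL N (pow_list ?b) Q (pow_list ?a) = csf N (pow_list (drop (Suc j) k) @ (\<lambda>n. of_nat n powi (- (k ! j)) * Q n) # pow_list ?a)"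
      unfolding b by (simp add: mergeL_def pow_list_simps)
    also have "\<dots> = csf N (pow_list (drop (Suc j) k) @ (\<lambda>n. \<Sum>e\<le>faul_deg m. faul_coeff m e * of_nat n powi (- (k ! j - int e))) # pow_list ?a)"
      by (rule csf_cong_entry) (simp add: Q_def faul_rat_def sum_distrib_left shift[symmetric] mult_ac)
    also have "\<dots> = (\<Sum>e\<le>faul_deg m. faul_coeff m e * zeta_p p (k[j := k ! j - int e]))"
      using False j by (subst csf_linear) (auto simp: z upd_conv_take_nth_drop pow_list_simps)
    finally show ?thesis using False by simp
  qed
  also have "mergeR N (pow_list ?b) Q (pow_list ?a) = (if j = 0 then faul_shift_coeff m 0 * zeta_p p k
     else \<Sum>e\<le>faul_deg m. faul_shift_coeff m e * zeta_p p (k[j - 1 := k ! (j - 1) - int e]))"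
  proof (cases "j = 0")
    case True
    have "Q 1 = faul_shift_coeff m 0" using Q(2)[of 0] by (simp add: power_0_left sum.delta if_distrib cong: if_cong)
    then show ?thesis using True unfolding z by (simp add: mergeR_def pow_list_simps)
  next
    case False
    then obtain i where i: "j = Suc i" by (cases j) auto
    have a: "?a = take i k @ [k ! i]" using j unfolding i by (simp add: take_Suc_conv_app_nth)
    have "mergeR N (pow_list ?b) Q (pow_list ?a) = csf N (pow_list ?b @ (\<lambda>n. of_nat n powi (- (k ! i)) * Q (Suc n)) # pow_list (take i k))"
      unfolding a by (simp add: mergeR_def pow_list_simps)
    also have "\<dots> = csf N (pow_list ?b @ (\<lambda>n. \<Sum>e\<le>faul_deg m. faul_shift_coeff m e * of_nat n powi (- (k ! i - int e))) # pow_list (take i k))"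
      by (rule csf_cong_entry) (simp add: Q(2) sum_distrib_left shift[symmetric] mult_ac)
    also have "\<dots> = (\<Sum>e\<le>faul_deg m. faul_shift_coeff m e * zeta_p p (k[i := k ! i - int e]))"
      using j unfolding i by (subst csf_linear) (auto simp: z upd_conv_take_nth_drop pow_list_simps)
    finally show ?thesis using False i by simp
  qed
  finally show ?thesis unfolding nonpos_rec_def pw by (simp add: sum_negf)
qed

text \<open>The rationals that can be reduced modulo M. Fractions need not be reduced, which makes
  sums and products immediate; the clause b \<noteq> 0 excludes the denominator 0, which is coprime
  to the modulus p^0 = 1.\<close>

definition zint :: "int \<Rightarrow> rat set" where
  "zint M = {of_int a / of_int b | a b. coprime b M \<and> b \<noteq> 0}"

lemma zintI: "coprime b M \<Longrightarrow> b \<noteq> 0 \<Longrightarrow> x = of_int a / of_int b \<Longrightarrow> x \<in> zint M"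
  unfolding zint_def by blast

lemma zintE:
  assumes "x \<in> zint M"
  obtains a b where "coprime b M" "b \<noteq> 0" "x = of_int a / of_int b"
  using assms unfolding zint_def by blast

lemma zint_int: "of_int a \<in> zint M"
  by (rule zintI[of 1]) auto

lemma zint_add: assumes "x \<in> zint M" "y \<in> zint M" shows "x + y \<in> zint M"
proof -
  obtain a b where ab: "coprime b M" "b \<noteq> 0" "x = of_int a / of_int b" using assms(1) by (rule zintE)
  obtain c d where cd: "coprime d M" "d \<noteq> 0" "y = of_int c / of_int d" using assms(2) by (rule zintE)
  show ?thesis using ab cd by (intro zintI[of "b * d" _ _ "a * d + c * b"]) (auto simp: add_frac_eq)
qed

lemma zint_mult: assumes "x \<in> zint M" "y \<in> zint M" shows "x * y \<in> zint M"
proof -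
  obtain a b where ab: "coprime b M" "b \<noteq> 0" "x = of_int a / of_int b" using assms(1) by (rule zintE)
  obtain c d where cd: "coprime d M" "d \<noteq> 0" "y = of_int c / of_int d" using assms(2) by (rule zintE)
  show ?thesis using ab cd by (intro zintI[of "b * d" _ _ "a * c"]) auto
qed

lemma zint_sum: "(\<And>i. i \<in> A \<Longrightarrow> f i \<in> zint M) \<Longrightarrow> sum f A \<in> zint M"
  using zint_int[of 0 M] by (induction A rule: infinite_finite_induct) (auto intro: zint_add)

lemma zint_prod: "(\<And>i. i \<in> A \<Longrightarrow> f i \<in> zint M) \<Longrightarrow> prod f A \<in> zint M"
  using zint_int[of 1 M] by (induction A rule: infinite_finite_induct) (auto intro: zint_mult)

lemma zint_power: "x \<in> zint M \<Longrightarrow> x \<in> zint (M ^ n)"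
  by (elim zintE) (rule zintI, auto)

lemma zeta_p_zint: assumes "prime p" shows "zeta_p p k \<in> zint (int p)"
  unfolding zeta_p_def
proof (intro zint_sum zint_prod)
  fix ns i assume ns: "ns \<in> incr_tuples (length k) p" and i: "i \<in> {..<length k}"
  then have n: "0 < ns ! i" "ns ! i < p" unfolding incr_tuples_def by auto
  have "\<not> p dvd ns ! i" using n by (auto dest: dvd_imp_le)
  then have cp: "coprime (int (ns ! i)) (int p)"
    using assms by (simp add: coprime_commute prime_imp_coprime)
  show "of_nat (ns ! i) powi (- (k ! i)) \<in> zint (int p)"
  proof (cases "k ! i \<le> 0")
    case True
    then have "of_nat (ns ! i) powi (- (k ! i)) = (of_int (int (ns ! i) ^ nat (- (k ! i))) :: rat)"
      by (simp add: power_int_def)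
    then show ?thesis using zint_int by metis
  next
    case False
    then have "of_nat (ns ! i) powi (- (k ! i)) = (of_int 1 / of_int (int (ns ! i) ^ nat (k ! i)) :: rat)"
      by (simp add: power_int_def power_inverse divide_inverse)
    then show ?thesis using cp n by (intro zintI[of "int (ns ! i) ^ nat (k ! i)" _ _ 1]) auto
  qed
qed

text \<open>\<open>ratmod\<close> refers to the reduced fraction, whose denominator divides b and is
  therefore also invertible modulo M. This frees later computations from reduced fractions.\<close>

lemma ratmod_cong:
  assumes "coprime b M" "b \<noteq> 0"
  shows "[b * ratmod (of_int a / of_int b) M = a] (mod M)"
proof -
  obtain u v where uv: "quotient_of (of_int a / of_int b) = (u, v)" by fastforce
  have v: "v > 0" "coprime u v" "of_int a / of_int b = (of_int u / of_int v :: rat)"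
    using quotient_of_denom_pos[OF uv] quotient_of_coprime[OF uv] quotient_of_div[OF uv] by auto
  have "(of_int (a * v) :: rat) = of_int (u * b)" using v assms by (simp add: field_simps)
  then have eq: "a * v = u * b" by (simp only: of_int_eq_iff)
  then have "v dvd u * b" by (metis dvd_triv_right)
  then have "v dvd b" using v(2) by (simp add: coprime_commute coprime_dvd_mult_right_iff)
  then have cv: "coprime v M" using assms(1) by (metis coprime_divisors dvd_refl)
  obtain w where w: "[v * w = 1] (mod M)" using cong_solve_coprime_int[OF cv] by blast
  have "[v * (w * u) = 1 * u] (mod M)" using cong_mult[OF w cong_refl[of u]] by (simp add: mult.assoc)
  then have "[v * ratmod (of_int a / of_int b) M = u] (mod M)" (is "[v * ?r = u] (mod M)")
    unfolding ratmod_def uv fst_conv snd_conv by (intro someI[of "\<lambda>r. [v * r = u] (mod M)" "w * u"]) simp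
  then have "[b * (v * ?r) = b * u] (mod M)" by (rule cong_mult[OF cong_refl])
  then have "[v * (b * ?r) = v * a] (mod M)" using eq by (simp add: mult_ac)
  then show ?thesis using cv by (simp add: cong_mult_lcancel)
qed

lemma ratmod_unique:
  assumes "coprime b M" "b \<noteq> 0" "[b * r = a] (mod M)"
  shows "[ratmod (of_int a / of_int b) M = r] (mod M)"
proof -
  have "[b * ratmod (of_int a / of_int b) M = b * r] (mod M)"
    using ratmod_cong[OF assms(1,2)] assms(3) by (metis cong_sym cong_trans)
  then show ?thesis using assms(1) by (simp add: cong_mult_lcancel)
qed

lemma ratmod_add: assumes "x \<in> zint M" "y \<in> zint M" shows "[ratmod (x + y) M = ratmod x M + ratmod y M] (mod M)"
proof -
  obtain a b where ab: "coprime b M" "b \<noteq> 0" "x = of_int a / of_int b" using assms(1) by (rule zintE)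
  obtain c d where cd: "coprime d M" "d \<noteq> 0" "y = of_int c / of_int d" using assms(2) by (rule zintE)
  have "[d * (b * ratmod x M) + b * (d * ratmod y M) = d * a + b * c] (mod M)"
    using ratmod_cong[OF ab(1,2)] ratmod_cong[OF cd(1,2)] unfolding ab(3) cd(3) by (intro cong_add cong_mult) auto
  then have "[(b * d) * (ratmod x M + ratmod y M) = a * d + c * b] (mod M)" by (simp add: algebra_simps)
  moreover have "x + y = of_int (a * d + c * b) / of_int (b * d)" using ab cd by (simp add: add_frac_eq)
  ultimately show ?thesis using ab cd by (metis ratmod_unique coprime_mult_left_iff mult_eq_0_iff)
qed

lemma ratmod_mult: assumes "x \<in> zint M" "y \<in> zint M" shows "[ratmod (x * y) M = ratmod x M * ratmod y M] (mod M)"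
proof -
  obtain a b where ab: "coprime b M" "b \<noteq> 0" "x = of_int a / of_int b" using assms(1) by (rule zintE)
  obtain c d where cd: "coprime d M" "d \<noteq> 0" "y = of_int c / of_int d" using assms(2) by (rule zintE)
  have "[(b * ratmod x M) * (d * ratmod y M) = a * c] (mod M)"
    using ratmod_cong[OF ab(1,2)] ratmod_cong[OF cd(1,2)] unfolding ab(3) cd(3) by (intro cong_mult) auto
  then have "[(b * d) * (ratmod x M * ratmod y M) = a * c] (mod M)" by (simp add: algebra_simps)
  moreover have "x * y = of_int (a * c) / of_int (b * d)" using ab cd by simp
  ultimately show ?thesis using ab cd by (metis ratmod_unique coprime_mult_left_iff mult_eq_0_iff)
qed

lemma ratmod_int: "[ratmod (of_int a) M = a] (mod M)"
  using ratmod_unique[of 1 M a a] by simp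

text \<open>A solution of b r = a modulo M also solves it modulo L. With powers of p this is the
  compatibility of the levels required by \<open>Ahat\<close>.\<close>

lemma ratmod_cong_dvd: assumes "x \<in> zint M" "L dvd M" shows "[ratmod x M = ratmod x L] (mod L)"
proof -
  obtain a b where ab: "coprime b M" "b \<noteq> 0" "x = of_int a / of_int b" using assms(1) by (rule zintE)
  have "[b * ratmod x M = a] (mod L)" using ratmod_cong[OF ab(1,2)] assms(2) unfolding ab(3) by (rule cong_dvd_modulus)
  moreover have "coprime b L" using ab(1) assms(2) by (metis coprime_divisors dvd_refl)
  ultimately show ?thesis using ratmod_unique[of b L _ a] ab by (metis cong_sym)
qed

text \<open>Integrality is asked for almost all primes only: a constant family q fails at the prime
  divisors of its denominator.\<close>

definition zfam :: "(nat \<Rightarrow> rat) set" where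
  "zfam = {x. \<forall>\<^sub>F p in sequentially. prime p \<longrightarrow> x p \<in> zint (int p)}"

lemma zfam_const: "(\<lambda>p. q) \<in> zfam"
proof -
  obtain a b where ab: "quotient_of q = (a, b)" by fastforce
  have b: "b > 0" "q = of_int a / of_int b" using quotient_of_denom_pos[OF ab] quotient_of_div[OF ab] by auto
  have "q \<in> zint (int p)" if "prime p" "p \<ge> Suc (nat b)" for p
  proof -
    have "\<not> int p dvd b" using that b by (auto dest!: zdvd_imp_le)
    then have "coprime b (int p)" using that prime_imp_coprime[of "int p" b] by (simp add: coprime_commute)
    then show ?thesis using b by (intro zintI[of b _ _ a]) auto
  qed
  then show ?thesis unfolding zfam_def eventually_sequentially by blast
qed

lemma zfam_zeta: "(\<lambda>p. zeta_p p k) \<in> zfam"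
  unfolding zfam_def by (simp add: zeta_p_zint)

lemma zfam_of_nat: "(\<lambda>p. of_nat p) \<in> zfam"
  unfolding zfam_def using zint_int[of "int _"] by (auto intro!: always_eventually)

lemma zfam_add: "x \<in> zfam \<Longrightarrow> y \<in> zfam \<Longrightarrow> (\<lambda>p. x p + y p) \<in> zfam"
  unfolding zfam_def mem_Collect_eq by (erule (1) eventually_elim2) (auto intro: zint_add)

lemma zfam_mult: "x \<in> zfam \<Longrightarrow> y \<in> zfam \<Longrightarrow> (\<lambda>p. x p * y p) \<in> zfam"
  unfolding zfam_def mem_Collect_eq by (erule (1) eventually_elim2) (auto intro: zint_mult)

definition famA :: "(nat \<Rightarrow> rat) \<Rightarrow> ringA" where
  "famA x = abs_ringA (\<lambda>p. ratmod (x p) (int p))"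

definition famAh :: "(nat \<Rightarrow> rat) \<Rightarrow> ringAh" where
  "famAh x = abs_ringAh (\<lambda>n p. ratmod (x p) (int p ^ n))"

lemma famA_add: assumes "x \<in> zfam" "y \<in> zfam" shows "famA (\<lambda>p. x p + y p) = famA x + famA y"
  unfolding famA_def plus_ringA.abs_eq ringA.abs_eq_iff eqA_def
  by (rule eventually_elim2[OF assms[unfolded zfam_def mem_Collect_eq]]) (auto intro: ratmod_add)

lemma famA_mult: assumes "x \<in> zfam" "y \<in> zfam" shows "famA (\<lambda>p. x p * y p) = famA x * famA y"
  unfolding famA_def times_ringA.abs_eq ringA.abs_eq_iff eqA_def
  by (rule eventually_elim2[OF assms[unfolded zfam_def mem_Collect_eq]]) (auto intro: ratmod_mult)

text \<open>Modulo p the upper boundary p is zero, which explains the choice \<tau> = 0 in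
  \<open>zetaA_recursion\<close>; it corresponds to taking constant terms on the other side.\<close>

lemma famA_prime: "famA (\<lambda>p. of_nat p) = 0"
proof -
  have "[ratmod (of_nat p) (int p) = 0] (mod int p)" for p
    using ratmod_int[of "int p" "int p"] by (simp add: cong_def)
  then show ?thesis unfolding famA_def zero_ringA_def ringA.abs_eq_iff eqA_def by simp
qed

lemma famAh_add: assumes "x \<in> zfam" "y \<in> zfam" shows "famAh (\<lambda>p. x p + y p) = famAh x + famAh y"
  unfolding famAh_def plus_ringAh.abs_eq ringAh.abs_eq_iff eqAh_def
  by (intro allI) (rule eventually_elim2[OF assms[unfolded zfam_def mem_Collect_eq]], auto intro: ratmod_add zint_power)

lemma famAh_mult: assumes "x \<in> zfam" "y \<in> zfam" shows "famAh (\<lambda>p. x p * y p) = famAh x * famAh y"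
  unfolding famAh_def times_ringAh.abs_eq ringAh.abs_eq_iff eqAh_def
  by (intro allI) (rule eventually_elim2[OF assms[unfolded zfam_def mem_Collect_eq]], auto intro: ratmod_mult zint_power)

lemma famAh_prime: "famAh (\<lambda>p. of_nat p) = bp"
  unfolding famAh_def bp_def ringAh.abs_eq_iff eqAh_def using ratmod_int[of "int _"] by simp

lemma famA_zero: "famA (\<lambda>p. 0) = 0" and famAh_zero: "famAh (\<lambda>p. 0) = 0"
  using famA_add[OF zfam_const[of 0] zfam_const[of 0]] famAh_add[OF zfam_const[of 0] zfam_const[of 0]] by auto

lemma famAh_Ahat: assumes "x \<in> zfam" shows "famAh x \<in> Ahat"
proof -
  have "compatible (\<lambda>n p. ratmod (x p) (int p ^ n))" unfolding compatible_def
  proof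
    fix n
    show "\<forall>\<^sub>F p in sequentially. prime p \<longrightarrow> [ratmod (x p) (int p ^ Suc n) = ratmod (x p) (int p ^ n)] (mod int p ^ n)"
      using assms unfolding zfam_def mem_Collect_eq
      by (elim eventually_mono) (auto intro!: ratmod_cong_dvd zint_power simp del: power_Suc simp: le_imp_power_dvd)
  qed
  then show ?thesis unfolding Ahat_def famAh_def by blast
qed

lemma zetaA_recursion:
  assumes "j \<le> length k"
  shows "zetaA (take j k @ (- int m) # drop j k) = nonpos_rec (\<lambda>q x. ratA q * x) 0 m j zetaA k"
proof -
  define R where "R = (\<lambda>x X. x \<in> zfam \<and> X = famA x)"
  have "R (\<lambda>p. nonpos_rec (*) (of_nat p) m j (zeta_p p) k) (nonpos_rec (\<lambda>q x. ratA q * x) 0 m j zetaA k)"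
  proof (rule nonpos_rec_rel[where R = R])
    show "R (\<lambda>i. q * x i) (ratA q * x')" if "R x x'" for q x x'
      using that zfam_mult[OF zfam_const] famA_mult[OF zfam_const] by (simp add: R_def ratA_def famA_def)
    show "R (\<lambda>i. of_nat i * x i) (0 * x')" if "R x x'" for x x'
      using that zfam_mult[OF zfam_of_nat] famA_mult[OF zfam_of_nat] by (simp add: R_def famA_prime)
    show "R (\<lambda>i. zeta_p i k') (zetaA k')" for k' using zfam_zeta by (simp add: R_def zetaA_def famA_def)
  qed (auto simp: R_def zfam_const famA_zero zfam_add famA_add)
  then have "nonpos_rec (\<lambda>q x. ratA q * x) 0 m j zetaA k = famA (\<lambda>p. nonpos_rec (*) (of_nat p) m j (zeta_p p) k)" unfolding R_def by blast
  \<comment> \<open>The recursion holds for every p \<ge> 1, in particular for all large primes,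
    which is all that equality in \<open>ringA\<close> requires.\<close>
  also have "\<dots> = zetaA (take j k @ (- int m) # drop j k)"
    unfolding famA_def zetaA_def ringA.abs_eq_iff eqA_def eventually_sequentially
    using zeta_p_recursion[OF _ assms] by (intro exI[of _ 1]) auto
  finally show ?thesis by simp
qed

lemma zetaAh_recursion:
  assumes "j \<le> length k"
  shows "zetaAh (take j k @ (- int m) # drop j k) = nonpos_rec (\<lambda>q x. ratAh q * x) bp m j zetaAh k"
proof -
  define R where "R = (\<lambda>x X. x \<in> zfam \<and> X = famAh x)"
  have "R (\<lambda>p. nonpos_rec (*) (of_nat p) m j (zeta_p p) k) (nonpos_rec (\<lambda>q x. ratAh q * x) bp m j zetaAh k)"
  proof (rule nonpos_rec_rel[where R = R])
    show "R (\<lambda>i. q * x i) (ratAh q * x')" if "R x x'" for q x x'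
      using that zfam_mult[OF zfam_const] famAh_mult[OF zfam_const] by (simp add: R_def ratAh_def famAh_def)
    show "R (\<lambda>i. of_nat i * x i) (bp * x')" if "R x x'" for x x'
      using that zfam_mult[OF zfam_of_nat] famAh_mult[OF zfam_of_nat] by (simp add: R_def famAh_prime)
    show "R (\<lambda>i. zeta_p i k') (zetaAh k')" for k' using zfam_zeta by (simp add: R_def zetaAh_def famAh_def)
  qed (auto simp: R_def zfam_const famAh_zero zfam_add famAh_add)
  then have "nonpos_rec (\<lambda>q x. ratAh q * x) bp m j zetaAh k = famAh (\<lambda>p. nonpos_rec (*) (of_nat p) m j (zeta_p p) k)" unfolding R_def by blast
  also have "\<dots> = zetaAh (take j k @ (- int m) # drop j k)"
    unfolding famAh_def zetaAh_def ringAh.abs_eq_iff eqAh_def eventually_sequentially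
    using zeta_p_recursion[OF _ assms] by (intro allI exI[of _ 1]) auto
  finally show ?thesis by simp
qed

section \<open>The completed algebra and the theorem\<close>

lemma compatible_closed:
  assumes "compatible x" "compatible y"
  shows "compatible (\<lambda>n p. x n p + y n p)" "compatible (\<lambda>n p. x n p * y n p)"
proof -
  have ev: "\<forall>\<^sub>F p in sequentially. prime p \<longrightarrow> [x (Suc n) p = x n p] (mod int p ^ n)"
    "\<forall>\<^sub>F p in sequentially. prime p \<longrightarrow> [y (Suc n) p = y n p] (mod int p ^ n)" for n
    using assms unfolding compatible_def by blast+
  show "compatible (\<lambda>n p. x n p + y n p)" unfolding compatible_def
    by (intro allI, rule eventually_elim2[OF ev]) (auto intro: cong_add)
  show "compatible (\<lambda>n p. x n p * y n p)" unfolding compatible_def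
    by (intro allI, rule eventually_elim2[OF ev]) (auto intro: cong_mult)
qed

lemma AhatE:
  assumes "x \<in> Ahat" obtains f where "compatible f" "x = abs_ringAh f"
  using assms unfolding Ahat_def by blast

lemma AhatI: "compatible f \<Longrightarrow> abs_ringAh f \<in> Ahat"
  unfolding Ahat_def by blast

lemma Ahat_add: "x \<in> Ahat \<Longrightarrow> y \<in> Ahat \<Longrightarrow> x + y \<in> Ahat"
  by (elim AhatE) (simp add: plus_ringAh.abs_eq AhatI compatible_closed)

lemma Ahat_mult: "x \<in> Ahat \<Longrightarrow> y \<in> Ahat \<Longrightarrow> x * y \<in> Ahat"
  by (elim AhatE) (simp add: times_ringAh.abs_eq AhatI compatible_closed)

lemma Ahat_0: "0 \<in> Ahat" using famAh_Ahat[OF zfam_const[of 0]] famAh_zero by simp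

lemma Ahat_bp: "bp \<in> Ahat" using famAh_Ahat[OF zfam_of_nat] famAh_prime by simp

lemma Ahat_bp_power: "x \<in> Ahat \<Longrightarrow> bp ^ N * x \<in> Ahat"
proof (induction N)
  case (Suc N)
  then show ?case using Ahat_mult[OF Ahat_bp, of "bp ^ N * x"] by (simp add: mult.assoc)
qed simp

lemma Ahat_rat: "ratAh q \<in> Ahat" using famAh_Ahat[OF zfam_const[of q]] by (simp add: ratAh_def famAh_def)

lemma Ahat_zeta: "zetaAh k \<in> Ahat" using famAh_Ahat[OF zfam_zeta[of k]] by (simp add: zetaAh_def famAh_def)

section \<open>The closed subalgebra as the elements approximable modulo every power of p\<close>

abbreviation QAh :: "ringAh set" where
  "QAh \<equiv> Qalg ratAh ({bp} \<union> {zetaAh k | k. positive_index k})"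

lemma QAh_Ahat: "x \<in> QAh \<Longrightarrow> x \<in> Ahat"
  by (induction rule: Qalg.induct) (auto intro: Ahat_add Ahat_mult Ahat_rat Ahat_bp Ahat_zeta)

text \<open>The generating sets x + p^N \<open>Ahat\<close> are cosets, so each may be recentred at
  any of its points; for an intersection the exponent M + N serves, since p^(M+N)
  \<open>Ahat\<close> lies in both ideals.\<close>

lemma padic_nbhd:
  assumes "openin padic_top U" "x \<in> U"
  shows "\<exists>N. \<forall>z\<in>Ahat. x + bp ^ N * z \<in> U"
proof -
  have "generate_topology_on {{x + bp ^ N * z | z. z \<in> Ahat} | x N. x \<in> Ahat} U"
    using assms(1) unfolding padic_top_def openin_topology_generated_by_iff .
  then show ?thesis using assms(2)
  proof (induction arbitrary: x)
    case (Int U V)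
    obtain M N where M: "\<forall>z\<in>Ahat. x + bp ^ M * z \<in> U" and N: "\<forall>z\<in>Ahat. x + bp ^ N * z \<in> V"
      using Int by blast
    have "x + bp ^ (M + N) * z \<in> U \<inter> V" if "z \<in> Ahat" for z
    proof -
      have "bp ^ (M + N) * z = bp ^ M * (bp ^ N * z)" "bp ^ (M + N) * z = bp ^ N * (bp ^ M * z)"
        by (simp_all add: power_add mult_ac)
      then show ?thesis using M N Ahat_bp_power[OF that] by (metis IntI)
    qed
    then show ?case by blast
  next
    case (UN K)
    then obtain k where k: "k \<in> K" "x \<in> k" by blast
    then show ?case using UN.IH[OF k] by blast
  next
    case (Basis U)
    then obtain y N where U: "U = {y + bp ^ N * z | z. z \<in> Ahat}" by blast
    then obtain w where w: "x = y + bp ^ N * w" "w \<in> Ahat" using Basis by blast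
    have "x + bp ^ N * z \<in> U" if "z \<in> Ahat" for z
    proof -
      have "x + bp ^ N * z = y + bp ^ N * (w + z)" using w by (simp add: algebra_simps)
      then show ?thesis unfolding U using Ahat_add[OF w(2) that] by blast
    qed
    then show ?case by blast
  qed simp
qed

text \<open>The cosets of p^N \<open>Ahat\<close> around x are open and contained in the
  neighbourhoods of x at both ends of the argument, so closure points are those met by
  \<open>QAh\<close> in every such coset. All closure properties of \<open>ZAh\<close> are then
  computations with cosets.\<close>

lemma ZAh_iff: "x \<in> ZAh \<longleftrightarrow> x \<in> Ahat \<and> (\<forall>N. \<exists>z\<in>Ahat. x + bp ^ N * z \<in> QAh)"
proof -
  let ?B = "\<lambda>x N. {x + bp ^ N * z | z. z \<in> Ahat}"
  have op: "openin padic_top (?B x N)" if "x \<in> Ahat" for x N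
    unfolding padic_top_def openin_topology_generated_by_iff using that by (intro generate_topology_on.Basis) blast
  have self: "x \<in> ?B x N" for x N using Ahat_0 by (intro CollectI exI[of _ 0]) simp
  have top: "topspace padic_top = Ahat"
  proof
    show "topspace padic_top \<subseteq> Ahat"
      unfolding padic_top_def topology_generated_by_topspace by (auto intro: Ahat_add Ahat_bp_power)
    show "Ahat \<subseteq> topspace padic_top"
    proof
      fix x assume "x \<in> Ahat"
      then show "x \<in> topspace padic_top" using openin_subset[OF op[of x 0]] self[of x 0] by blast
    qed
  qed
  show ?thesis
  proof
    assume x: "x \<in> ZAh"
    then have xA: "x \<in> Ahat" unfolding ZAh_def in_closure_of top by blast
    have cl: "\<forall>T. x \<in> T \<and> openin padic_top T \<longrightarrow> (\<exists>y. y \<in> QAh \<and> y \<in> T)"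
      using x unfolding ZAh_def in_closure_of by (rule conjunct2)
    have "\<exists>z\<in>Ahat. x + bp ^ N * z \<in> QAh" for N
    proof -
      obtain y where y: "y \<in> QAh" "y \<in> ?B x N" using cl[rule_format, OF conjI[OF self[of x N] op[OF xA, of N]]] by (elim exE conjE)
      from y(2) obtain z where "y = x + bp ^ N * z" "z \<in> Ahat" unfolding mem_Collect_eq by (elim exE conjE)
      with y(1) show ?thesis by (intro bexI[of _ z]) simp_all
    qed
    then show "x \<in> Ahat \<and> (\<forall>N. \<exists>z\<in>Ahat. x + bp ^ N * z \<in> QAh)" using xA by blast
  next
    assume x: "x \<in> Ahat \<and> (\<forall>N. \<exists>z\<in>Ahat. x + bp ^ N * z \<in> QAh)"
    have nb: "\<exists>y. y \<in> QAh \<and> y \<in> U" if U: "x \<in> U \<and> openin padic_top U" for U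
    proof -
      obtain N where N: "\<forall>z\<in>Ahat. x + bp ^ N * z \<in> U" using padic_nbhd[of U x] U by (elim conjE) (rule exE)
      obtain z where "z \<in> Ahat" "x + bp ^ N * z \<in> QAh" using conjunct2[OF x, rule_format, of N] by (elim bexE)
      then show ?thesis using N by (intro exI[of _ "x + bp ^ N * z"]) simp
    qed
    show "x \<in> ZAh" unfolding ZAh_def in_closure_of top using conjunct1[OF x] nb by (intro conjI allI impI)
  qed
qed

lemma ZAhD: "x \<in> ZAh \<Longrightarrow> x \<in> Ahat"
  unfolding ZAh_iff by (rule conjunct1)

lemma ZAhE:
  assumes "x \<in> ZAh"
  obtains z where "z \<in> Ahat" "x + bp ^ N * z \<in> QAh"
  using assms unfolding ZAh_iff by (elim conjE allE[of _ N] bexE) (rule that)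

lemma ZAhI: "x \<in> Ahat \<Longrightarrow> (\<And>N. \<exists>z\<in>Ahat. x + bp ^ N * z \<in> QAh) \<Longrightarrow> x \<in> ZAh"
  unfolding ZAh_iff by (intro conjI allI)

lemma QAh_ZAh:
  assumes "x \<in> QAh" shows "x \<in> ZAh"
proof (rule ZAhI[OF QAh_Ahat[OF assms]])
  show "\<exists>z\<in>Ahat. x + bp ^ N * z \<in> QAh" for N
    using assms Ahat_0 by (intro bexI[of _ 0]) simp_all
qed

lemma ZAh_add: assumes "x \<in> ZAh" "y \<in> ZAh" shows "x + y \<in> ZAh"
proof (rule ZAhI)
  show "x + y \<in> Ahat" using assms by (intro Ahat_add ZAhD)
  fix N
  obtain z where z: "z \<in> Ahat" "x + bp ^ N * z \<in> QAh" using ZAhE[OF assms(1)] .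
  obtain w where w: "w \<in> Ahat" "y + bp ^ N * w \<in> QAh" using ZAhE[OF assms(2)] .
  have "(x + y) + bp ^ N * (z + w) = (x + bp ^ N * z) + (y + bp ^ N * w)" by (simp add: algebra_simps)
  then have "(x + y) + bp ^ N * (z + w) \<in> QAh" using Qalg.add[OF z(2) w(2)] by (simp only:)
  then show "\<exists>z\<in>Ahat. x + y + bp ^ N * z \<in> QAh" using Ahat_add[OF z(1) w(1)] by (rule bexI)
qed

lemma ZAh_mult: assumes "x \<in> ZAh" "y \<in> ZAh" shows "x * y \<in> ZAh"
proof (rule ZAhI)
  show "x * y \<in> Ahat" using assms by (intro Ahat_mult ZAhD)
  fix N
  obtain z where z: "z \<in> Ahat" "x + bp ^ N * z \<in> QAh" using ZAhE[OF assms(1)] .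
  obtain w where w: "w \<in> Ahat" "y + bp ^ N * w \<in> QAh" using ZAhE[OF assms(2)] .
  \<comment> \<open>The part divisible by p^N in the product of the two approximations; it stays in
    \<open>Ahat\<close>, so the product approximates x * y to the same precision.\<close>
  let ?v = "x * w + z * y + bp ^ N * (z * w)"
  have "(x * y) + bp ^ N * ?v = (x + bp ^ N * z) * (y + bp ^ N * w)" by (simp add: algebra_simps)
  then have "(x * y) + bp ^ N * ?v \<in> QAh" using Qalg.mult[OF z(2) w(2)] by (simp only:)
  moreover have "?v \<in> Ahat" using z(1) w(1) assms[THEN ZAhD] by (intro Ahat_add Ahat_mult Ahat_bp_power)
  ultimately show "\<exists>z\<in>Ahat. x * y + bp ^ N * z \<in> QAh" by (rule bexI)
qed

lemma ZAh_rat: "ratAh q \<in> ZAh" by (intro QAh_ZAh Qalg.rat)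

lemma ZAh_bp: "bp \<in> ZAh" by (intro QAh_ZAh Qalg.gen) simp

lemma ZAh_0: "0 \<in> ZAh"
  using ZAh_rat[of 0] famAh_zero by (simp add: ratAh_def famAh_def)

lemma ZA_0: "0 \<in> ZA"
  using Qalg.rat[of ratA 0] famA_zero unfolding ZA_def by (simp add: ratA_def famA_def)

text \<open>The graph of \<phi> over \<open>ZA\<close> is compatible with the operations in
  \<open>nonpos_rec\<close>. The recursions for \<open>zetaA\<close> and \<open>zetaS\<close>
  therefore carry both membership and equality from shorter indices, with arbitrary entries, to
  longer ones.\<close>

theorem zetaA_general:
  assumes add: "\<And>x y. x \<in> ZA \<Longrightarrow> y \<in> ZA \<Longrightarrow> \<phi> (x + y) = \<phi> x + \<phi> y"
    and sc: "\<And>q x. x \<in> ZA \<Longrightarrow> \<phi> (ratA q * x) = ratZ q * \<phi> x"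
    and pos: "\<And>k. positive_index k \<Longrightarrow> \<phi> (zetaA k) = zetaS k"
  shows "zetaA k \<in> ZA \<and> \<phi> (zetaA k) = zetaS k"
proof (induction "length k" arbitrary: k rule: less_induct)
  case less
  show ?case
  proof (cases "positive_index k")
    case True
    then show ?thesis unfolding ZA_def using pos by (auto intro: Qalg.gen)
  next
    case False
    obtain j m k' where k: "k = take j k' @ (- int m) # drop j k'" "j \<le> length k'" "length k = Suc (length k')"
      using nonpositive_split[OF False] by blast
    define R where "R = (\<lambda>x y. x () \<in> ZA \<and> y = \<phi> (x ()))"
    have \<phi>0: "\<phi> 0 = 0" using add[OF ZA_0 ZA_0] by simp
    have "R (\<lambda>i::unit. nonpos_rec (\<lambda>q x. ratA q * x) 0 m j zetaA k') (nonpos_rec (\<lambda>q x. ratZ q * x) 0 m j zetaS k')"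
    proof (rule nonpos_rec_rel[where R = R and sc = "\<lambda>i q x. ratA q * x" and \<tau> = "\<lambda>i. 0" and G = "\<lambda>i. zetaA"])
      show "R (\<lambda>i. zetaA u) (zetaS u)" if "length u = length k'" for u
        using less[of u] that k(3) by (simp add: R_def)
      show "R (\<lambda>i. ratA q * x i) (ratZ q * x')" if "R x x'" for q x x'
        using that sc unfolding R_def ZA_def by (auto intro: Qalg.mult Qalg.rat)
      show "R (\<lambda>i. x i + y i) (x' + y')" if "R x x'" "R y y'" for x x' y y'
        using that add unfolding R_def ZA_def by (auto intro: Qalg.add)
    qed (auto simp: R_def ZA_0 \<phi>0)
    then show ?thesis unfolding R_def zetaA_recursion[OF k(2), of m, folded k(1)] zetaS_recursion[OF k(2), of m, folded k(1)] by simp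
  qed
qed

text \<open>As for \<open>zetaA\<close>, but \<tau> is now \<open>bp\<close> on one side and
  \<open>fps_X\<close> on the other; multiplicativity together with \<psi>(bp) = t makes the graph
  of \<psi> compatible with this operation, and \<open>ZAh_mult\<close> keeps it inside
  \<open>ZAh\<close>.\<close>

theorem zetaAh_general:
  assumes add: "\<And>x y. x \<in> ZAh \<Longrightarrow> y \<in> ZAh \<Longrightarrow> \<psi> (x + y) = \<psi> x + \<psi> y"
    and mult: "\<And>x y. x \<in> ZAh \<Longrightarrow> y \<in> ZAh \<Longrightarrow> \<psi> (x * y) = \<psi> x * \<psi> y"
    and sc: "\<And>q x. x \<in> ZAh \<Longrightarrow> \<psi> (ratAh q * x) = fps_const (ratZ q) * \<psi> x"
    and bp: "\<psi> bp = fps_X"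
    and pos: "\<And>k. positive_index k \<Longrightarrow> \<psi> (zetaAh k) = zetaShat k"
  shows "zetaAh k \<in> ZAh \<and> \<psi> (zetaAh k) = zetaShat k"
proof (induction "length k" arbitrary: k rule: less_induct)
  case less
  show ?case
  proof (cases "positive_index k")
    case True
    then have "zetaAh k \<in> QAh" by (intro Qalg.gen) auto
    then show ?thesis using pos[OF True] QAh_ZAh by blast
  next
    case False
    obtain j m k' where k: "k = take j k' @ (- int m) # drop j k'" "j \<le> length k'" "length k = Suc (length k')"
      using nonpositive_split[OF False] by blast
    define R where "R = (\<lambda>x y. x () \<in> ZAh \<and> y = \<psi> (x ()))"
    have \<psi>0: "\<psi> 0 = 0" using add[OF ZAh_0 ZAh_0] by simp
    have "R (\<lambda>i::unit. nonpos_rec (\<lambda>q x. ratAh q * x) bp m j zetaAh k') (nonpos_rec (\<lambda>q x. fps_const (ratZ q) * x) fps_X m j zetaShat k')"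
    proof (rule nonpos_rec_rel[where R = R and sc = "\<lambda>i q x. ratAh q * x" and \<tau> = "\<lambda>i. bp" and G = "\<lambda>i. zetaAh"])
      show "R (\<lambda>i. zetaAh u) (zetaShat u)" if "length u = length k'" for u
        using less[of u] that k(3) by (simp add: R_def)
      show "R (\<lambda>i. ratAh q * x i) (fps_const (ratZ q) * x')" if "R x x'" for q x x'
        using that sc unfolding R_def by (auto intro: ZAh_mult ZAh_rat)
      show "R (\<lambda>i. bp * x i) (fps_X * x')" if "R x x'" for x x'
        using that mult[OF ZAh_bp] bp unfolding R_def by (auto intro: ZAh_mult ZAh_bp)
      show "R (\<lambda>i. x i + y i) (x' + y')" if "R x x'" "R y y'" for x x' y y'
        using that add unfolding R_def by (auto intro: ZAh_add)
    qed (auto simp: R_def ZAh_0 \<psi>0)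
    then show ?thesis unfolding R_def zetaAh_recursion[OF k(2), of m, folded k(1)] zetaShat_recursion[OF k(2), of m, folded k(1)] by simp
  qed
qed

theorem theorem4p4:
  shows "(\<forall>\<phi> :: ringA \<Rightarrow> zbar.
            (bij_betw \<phi> ZA UNIV \<and>
             (\<forall>x\<in>ZA. \<forall>y\<in>ZA. \<phi> (x + y) = \<phi> x + \<phi> y \<and> \<phi> (x * y) = \<phi> x * \<phi> y) \<and>
             (\<forall>q. \<forall>x\<in>ZA. \<phi> (ratA q * x) = ratZ q * \<phi> x) \<and>
             \<phi> 1 = 1 \<and>
             (\<forall>k. positive_index k \<longrightarrow> \<phi> (zetaA k) = zetaS k))
            \<longrightarrow> (\<forall>k :: int list. zetaA k \<in> ZA \<and> \<phi> (zetaA k) = zetaS k))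
       \<and>
         (\<forall>\<psi> :: ringAh \<Rightarrow> zbar fps.
            (bij_betw \<psi> ZAh UNIV \<and>
             homeomorphic_map (subtopology padic_top ZAh) tadic_top \<psi> \<and>
             (\<forall>x\<in>ZAh. \<forall>y\<in>ZAh. \<psi> (x + y) = \<psi> x + \<psi> y \<and> \<psi> (x * y) = \<psi> x * \<psi> y) \<and>
             (\<forall>q. \<forall>x\<in>ZAh. \<psi> (ratAh q * x) = fps_const (ratZ q) * \<psi> x) \<and>
             \<psi> 1 = 1 \<and>
             \<psi> bp = fps_X \<and>
             (\<forall>k. positive_index k \<longrightarrow> \<psi> (zetaAh k) = zetaShat k))
            \<longrightarrow> (\<forall>k :: int list. zetaAh k \<in> ZAh \<and> \<psi> (zetaAh k) = zetaShat k))"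
proof (intro conjI allI impI)
  fix \<phi> :: "ringA \<Rightarrow> zbar" and k
  assume h: "bij_betw \<phi> ZA UNIV \<and>
             (\<forall>x\<in>ZA. \<forall>y\<in>ZA. \<phi> (x + y) = \<phi> x + \<phi> y \<and> \<phi> (x * y) = \<phi> x * \<phi> y) \<and>
             (\<forall>q. \<forall>x\<in>ZA. \<phi> (ratA q * x) = ratZ q * \<phi> x) \<and>
             \<phi> 1 = 1 \<and>
             (\<forall>k. positive_index k \<longrightarrow> \<phi> (zetaA k) = zetaS k)"
  have "zetaA k \<in> ZA \<and> \<phi> (zetaA k) = zetaS k" by (rule zetaA_general) (use h in blast)+
  then show "zetaA k \<in> ZA" "\<phi> (zetaA k) = zetaS k" by blast+
next
  fix \<psi> :: "ringAh \<Rightarrow> zbar fps" and k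
  assume h: "bij_betw \<psi> ZAh UNIV \<and>
             homeomorphic_map (subtopology padic_top ZAh) tadic_top \<psi> \<and>
             (\<forall>x\<in>ZAh. \<forall>y\<in>ZAh. \<psi> (x + y) = \<psi> x + \<psi> y \<and> \<psi> (x * y) = \<psi> x * \<psi> y) \<and>
             (\<forall>q. \<forall>x\<in>ZAh. \<psi> (ratAh q * x) = fps_const (ratZ q) * \<psi> x) \<and>
             \<psi> 1 = 1 \<and>
             \<psi> bp = fps_X \<and>
             (\<forall>k. positive_index k \<longrightarrow> \<psi> (zetaAh k) = zetaShat k)"
  have "zetaAh k \<in> ZAh \<and> \<psi> (zetaAh k) = zetaShat k" by (rule zetaAh_general) (use h in blast)+
  then show "zetaAh k \<in> ZAh" "\<psi> (zetaAh k) = zetaShat k" by blast+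
qed

end
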